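(* Let $X, X'$ be two nonsingular varieties in $\mathbb{P}^{n+2}$ ($n>4$), each of them defined as an intersection of two quadric hypersurfaces. Let $\widetilde{\mu}^X: X^{\rm reg} \to \widetilde{\mathcal{M}}_n^{\rm PQ}$ and $\widetilde{\mu}^{X'}: (X')^{\rm reg} \to \widetilde{\mathcal{M}}_n^{\rm PQ}$ be their refined moduli maps of second fundamental forms. Suppose there exists a biholomorphic map $f:M \to M'$ between connected Euclidean open subsets $M \subset X^{\rm reg}$ and $M' \subset (X')^{\rm reg}$ such that $\widetilde{\mu}^X|_M = \widetilde{\mu}^{X'}|_{M'} \circ f$. Then $f$ comes from a projective automorphism of $\mathbb{P}^{n+2}$ (i.e. $f$ is the restriction to $M$ of a projective automorphism of $\mathbb{P}^{n+2}$).
   Context: Everything is over $\mathbb{C}$. Let $W$ be a complex vector space of dimension $n\ge 3$. A pencil of quadrics on $W$ is a line $\Phi$ in $\mathbb{P}(\mathrm{Sym}^2(W^* ))$. A quadratic form is degenerate if its symmetric bilinear form has nontrivial kernel; let $D\subset\mathbb{P}(\mathrm{Sym}^2(W^* ))$ be the hypersurface (of degree $n$) of degenerate forms. A pencil $\Phi$ is nonsingular if its general elements are nondegenerate and $\Phi$ meets $D$ in $n$ distinct points. $\mathrm{PGL}(W)$ acts on pencils by pull-back, and $\mathcal{M}^{\rm PQ}_n$ is the orbit space of nonsingular pencils modulo $\mathrm{PGL}(W)$ (a Zariski open subset of the GIT quotient; independent of the choice of $W$). The refined moduli space $\widetilde{\mathcal{M}}^{\rm PQ}_n$ is the orbit space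 of pairs $(\Phi,P)$, with $\Phi$ a nonsingular pencil on $W$ and $P\in\mathrm{Gr}(3,W)$ a three-dimensional vector subspace, modulo the action $T\cdot(\Phi,P)=(T^*(\Phi),T^{-1}(P))$ of $\mathrm{PGL}(W)$; it is likewise independent of $W$. Let $X\subset\mathbb{P}^{n+2}=\mathbb{P}(V)$ be a nonsingular intersection of two quadric hypersurfaces (so $\dim X=n$), with pencil $\Phi_X$ of quadratic forms vanishing on $X$. One can choose linearly independent nondegenerate forms $\varphi_1,\varphi_2$ spanning $\Phi_X$ and a basis $\mathbf e_1,\dots,\mathbf e_{n+3}$ of $V$ with $\varphi_1(\sum z_i\mathbf e_i)=\sum\lambda_iz_i^2$, $\varphi_2(\sum z_i\mathbf e_i)=\sum z_i^2$, where $\lambda_1,\dots,\lambda_{n+3}$ are distinct nonzero complex numbers; fix such a choice. For $x\in X$ let $\widehat{x}\subset V$ be its line, $x^\perp\subset V$ the set of vectors orthogonal to $\widehat{x}$ for the bilinear forms of both $\varphi_1,\varphi_2$, and $W_x$ a complement of $\widehat{x}$ in $x^\perp$, identified with $T_x(X)$. The second fundamental form $II_{X,x}$ is the linear system of quadrics on $T_x(X)$ generated by $\varphi_1|_{W_x},\varphi_2|_{W_x}$. Let $X^o\subset X$ be the Zariski open subset where $II_{X,x}$ is a nonsingular pencil; the moduli map is $\mu^X:X^o\to\mathcal{M}^{\rm PQ}_n$, $x\mapsto[II_{X,x}]$. $X^{\rm reg}\subset X$ is the set of regular points, i.e. points $x=[x_1:\cdots:x_{n+3}]$ such that: (i) all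 $x_i\ne0$; (ii) $II_{X,x}$ is a nonsingular pencil; (iii) the identity is the only projective automorphism of $II_{X,x}\cong\mathbb{P}^1$ preserving its set of $n$ degenerate elements; (iv) the quadratic forms induced by $\varphi_1,\varphi_2$ on $T_x(X)$ are nondegenerate. For $x\in X^{\rm reg}$, $\mathcal{P}_x:=\mathrm{Ker}(\mathrm{d}_x\mu^X)\subset T_x(X)$ is a three-dimensional subspace. The refined moduli map $\widetilde{\mu}^X:X^{\rm reg}\to\widetilde{\mathcal{M}}^{\rm PQ}_n$ sends $x$ to the class of the pair $(II_{X,x},\mathcal{P}_x)$ (taking $W=T_x(X)$). The same definitions apply to $X'$. *)

theory Defs
  imports "HOL-Analysis.Analysis"
begin

section \<open>Projective space and holomorphic maps between its subsets\<close>

text \<open>A point of the projective space of \<open>complex ^ 'k\<close> is a one-dimensional linear subspace.\<close>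

definition proj_space :: "(complex ^ 'k) set set" where
  "proj_space = {vec.span {z} | z. z \<noteq> 0}"

text \<open>The Euclidean topology: the quotient topology from the nonzero vectors.\<close>

definition proj_topology :: "(complex ^ 'k) set topology" where
  "proj_topology = topology (\<lambda>U. U \<subseteq> proj_space \<and> open {z. z \<noteq> 0 \<and> vec.span {z} \<in> U})"

lemma openin_proj_topology:
  fixes U :: "(complex ^ 'k) set set"
  shows "openin proj_topology U \<longleftrightarrow> U \<subseteq> proj_space \<and> open {z. z \<noteq> 0 \<and> vec.span {z} \<in> U}"
proof -
  have "istopology (\<lambda>U :: (complex ^ 'k) set set.
          U \<subseteq> proj_space \<and> open {z. z \<noteq> 0 \<and> vec.span {z} \<in> U})"
    unfolding istopology_def
  proof (intro conjI allI impI)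
    fix S T :: "(complex ^ 'k) set set"
    assume S: "S \<subseteq> proj_space \<and> open {z. z \<noteq> 0 \<and> vec.span {z} \<in> S}"
      and T: "T \<subseteq> proj_space \<and> open {z. z \<noteq> 0 \<and> vec.span {z} \<in> T}"
    have eq: "{z. z \<noteq> 0 \<and> vec.span {z} \<in> S \<inter> T}
        = {z. z \<noteq> 0 \<and> vec.span {z} \<in> S} \<inter> {z. z \<noteq> 0 \<and> vec.span {z} \<in> T}"
      by blast
    show "S \<inter> T \<subseteq> proj_space" using S by blast
    show "open {z. z \<noteq> 0 \<and> vec.span {z} \<in> S \<inter> T}"
      unfolding eq using S T by (intro open_Int) simp_all
  next
    fix K :: "(complex ^ 'k) set set set"
    assume K: "\<forall>U\<in>K. U \<subseteq> proj_space \<and> open {z. z \<noteq> 0 \<and> vec.span {z} \<in> U}"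
    have eq: "{z. z \<noteq> 0 \<and> vec.span {z} \<in> \<Union>K} = (\<Union>U\<in>K. {z. z \<noteq> 0 \<and> vec.span {z} \<in> U})"
      by blast
    show "\<Union>K \<subseteq> proj_space" using K by blast
    show "open {z. z \<noteq> 0 \<and> vec.span {z} \<in> \<Union>K}"
      unfolding eq using K by (intro open_UN) simp
  qed
  then show ?thesis
    by (simp add: proj_topology_def topology_inverse')
qed

text \<open>A map on a subset \<open>M\<close> of projective space is holomorphic if it locally lifts to the
  restriction of a holomorphic, nowhere vanishing map between open sets of vectors; a complex
  derivative is a real derivative given by a complex (Jacobian) matrix.\<close>

definition proj_holomorphic_on ::
    "((complex ^ 'k) set \<Rightarrow> (complex ^ 'm) set) \<Rightarrow> (complex ^ 'k) set set \<Rightarrow> bool" where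
  "proj_holomorphic_on f M \<longleftrightarrow>
     (\<forall>p\<in>M. \<forall>z\<in>p - {0}. \<exists>N F. open N \<and> z \<in> N \<and>
        (\<forall>u\<in>N. (\<exists>J. (F has_derivative (*v) J) (at u)) \<and> F u \<noteq> 0 \<and>
                (u \<noteq> 0 \<and> vec.span {u} \<in> M \<longrightarrow> f (vec.span {u}) = vec.span {F u})))"

definition biholomorphic ::
    "((complex ^ 'k) set \<Rightarrow> (complex ^ 'm) set) \<Rightarrow> (complex ^ 'k) set set \<Rightarrow>
     (complex ^ 'm) set set \<Rightarrow> bool" where
  "biholomorphic f M M' \<longleftrightarrow>
     bij_betw f M M' \<and> proj_holomorphic_on f M \<and> proj_holomorphic_on (inv_into M f) M'"

section \<open>Quadratic forms and pencils\<close>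

text \<open>The matrix need not be symmetric: \<open>quad_form A\<close> depends only on its symmetric part.\<close>

definition quad_form :: "complex ^ 'n ^ 'n \<Rightarrow> complex ^ 'n \<Rightarrow> complex" where
  "quad_form A v = (\<Sum>i\<in>UNIV. \<Sum>j\<in>UNIV. A $ i $ j * v $ i * v $ j)"

definition quadratic_form :: "(complex ^ 'n \<Rightarrow> complex) \<Rightarrow> bool" where
  "quadratic_form q \<longleftrightarrow> (\<exists>A. q = quad_form A)"

definition polar :: "(complex ^ 'n \<Rightarrow> complex) \<Rightarrow> complex ^ 'n \<Rightarrow> complex ^ 'n \<Rightarrow> complex" where
  "polar q u v = (q (u + v) - q u - q v) / 2"

definition degenerate :: "(complex ^ 'n \<Rightarrow> complex) \<Rightarrow> bool" where
  "degenerate q \<longleftrightarrow> (\<exists>u. u \<noteq> 0 \<and> (\<forall>v. polar q u v = 0))"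

definition forms_span ::
    "(complex ^ 'n \<Rightarrow> complex) \<Rightarrow> (complex ^ 'n \<Rightarrow> complex) \<Rightarrow> (complex ^ 'n \<Rightarrow> complex) set" where
  "forms_span q r = {(\<lambda>v. s * q v + t * r v) | s t. True}"

definition forms_independent ::
    "(complex ^ 'n \<Rightarrow> complex) \<Rightarrow> (complex ^ 'n \<Rightarrow> complex) \<Rightarrow> bool" where
  "forms_independent q r \<longleftrightarrow> (\<forall>s t. (\<forall>v. s * q v + t * r v = 0) \<longrightarrow> s = 0 \<and> t = 0)"

text \<open>A pencil, i.e. a line in the projective space of quadratic forms, is represented by the
  corresponding two-dimensional space of forms; its elements (points of the line) by the
  one-dimensional spaces \<open>form_line q\<close>.\<close>

definition pencil :: "(complex ^ 'n \<Rightarrow> complex) set \<Rightarrow> bool" where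
  "pencil \<Phi> \<longleftrightarrow> (\<exists>q r. quadratic_form q \<and> quadratic_form r \<and> forms_independent q r \<and>
                        \<Phi> = forms_span q r)"

definition form_line :: "(complex ^ 'n \<Rightarrow> complex) \<Rightarrow> (complex ^ 'n \<Rightarrow> complex) set" where
  "form_line q = {(\<lambda>v. c * q v) | c. True}"

definition pencil_elements ::
    "(complex ^ 'n \<Rightarrow> complex) set \<Rightarrow> (complex ^ 'n \<Rightarrow> complex) set set" where
  "pencil_elements \<Phi> = {form_line q | q. q \<in> \<Phi> \<and> q \<noteq> (\<lambda>v. 0)}"

definition degenerate_elements ::
    "(complex ^ 'n \<Rightarrow> complex) set \<Rightarrow> (complex ^ 'n \<Rightarrow> complex) set set" where
  "degenerate_elements \<Phi> = {form_line q | q. q \<in> \<Phi> \<and> q \<noteq> (\<lambda>v. 0) \<and> degenerate q}"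

text \<open>Degeneracy is a Zariski closed condition on the elements of a pencil, so its general
  elements are nondegenerate iff one of them is.\<close>

definition nonsingular_pencil :: "(complex ^ 'n \<Rightarrow> complex) set \<Rightarrow> bool" where
  "nonsingular_pencil \<Phi> \<longleftrightarrow> pencil \<Phi> \<and> (\<exists>q\<in>\<Phi>. \<not> degenerate q) \<and>
     card (degenerate_elements \<Phi>) = CARD('n)"

definition pullback ::
    "complex ^ 'm ^ 'n \<Rightarrow> (complex ^ 'n \<Rightarrow> complex) set \<Rightarrow> (complex ^ 'm \<Rightarrow> complex) set" where
  "pullback T \<Phi> = (\<lambda>q v. q (T *v v)) ` \<Phi>"

definition no_pencil_automorphisms :: "(complex ^ 'n \<Rightarrow> complex) set \<Rightarrow> bool" where
  "no_pencil_automorphisms \<Phi> \<longleftrightarrow>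
     (\<forall>L. bij_betw L \<Phi> \<Phi> \<and>
          (\<forall>q\<in>\<Phi>. \<forall>r\<in>\<Phi>. \<forall>s t. L (\<lambda>v. s * q v + t * r v) = (\<lambda>v. s * L q v + t * L r v)) \<and>
          (\<lambda>l. L ` l) ` degenerate_elements \<Phi> = degenerate_elements \<Phi>
        \<longrightarrow> (\<forall>l\<in>pencil_elements \<Phi>. L ` l = l))"

section \<open>The moduli spaces\<close>

definition pencil_rel ::
    "((complex ^ 'n \<Rightarrow> complex) set \<times> (complex ^ 'n \<Rightarrow> complex) set) set" where
  "pencil_rel = {(\<Phi>, \<Psi>). nonsingular_pencil \<Phi> \<and> nonsingular_pencil \<Psi> \<and>
                         (\<exists>T. invertible T \<and> \<Psi> = pullback T \<Phi>)}"

definition moduli_PQ :: "(complex ^ 'n \<Rightarrow> complex) set set set" where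
  "moduli_PQ = {\<Phi>. nonsingular_pencil \<Phi>} // pencil_rel"

definition pencil_class ::
    "(complex ^ 'n \<Rightarrow> complex) set \<Rightarrow> (complex ^ 'n \<Rightarrow> complex) set set" where
  "pencil_class \<Phi> = pencil_rel `` {\<Phi>}"

definition refined_pairs ::
    "((complex ^ 'n \<Rightarrow> complex) set \<times> (complex ^ 'n) set) set" where
  "refined_pairs = {(\<Phi>, P). nonsingular_pencil \<Phi> \<and> vec.subspace P \<and> vec.dim P = 3}"

definition refined_rel ::
    "(((complex ^ 'n \<Rightarrow> complex) set \<times> (complex ^ 'n) set) \<times>
      ((complex ^ 'n \<Rightarrow> complex) set \<times> (complex ^ 'n) set)) set" where
  "refined_rel = {((\<Phi>, P), (\<Psi>, Q)). (\<Phi>, P) \<in> refined_pairs \<and> (\<Psi>, Q) \<in> refined_pairs \<and>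
     (\<exists>T. invertible T \<and> \<Psi> = pullback T \<Phi> \<and> Q = (*v) T -` P)}"

definition refined_moduli_PQ ::
    "((complex ^ 'n \<Rightarrow> complex) set \<times> (complex ^ 'n) set) set set" where
  "refined_moduli_PQ = refined_pairs // refined_rel"

text \<open>The complex structure of the quotient \<open>moduli_PQ\<close>: a function \<open>g\<close> on orbits is holomorphic
  near \<open>m\<close> if its pull-back to the pairs of forms (given by matrices) spanning a pencil whose class
  lies in a suitable neighbourhood of \<open>m\<close> is holomorphic. (The pull-back is automatically
  invariant.) Complex differentiability is expressed by the partial derivatives \<open>J\<close>, \<open>K\<close>
  with respect to the entries of the two matrices.\<close>

definition moduli_holomorphic_near ::
    "((complex ^ 'n \<Rightarrow> complex) set set \<Rightarrow> complex) \<Rightarrow> (complex ^ 'n \<Rightarrow> complex) set set \<Rightarrow> bool" where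
  "moduli_holomorphic_near g m \<longleftrightarrow>
     (\<exists>U S. U \<subseteq> moduli_PQ \<and> m \<in> U \<and>
        S = {(A, B). pencil_class (forms_span (quad_form A) (quad_form B)) \<in> U} \<and> open S \<and>
        (\<forall>x\<in>S. \<exists>J K.
           ((\<lambda>(A, B). g (pencil_class (forms_span (quad_form A) (quad_form B)))) has_derivative
            (\<lambda>(A, B). \<Sum>i\<in>UNIV. \<Sum>j\<in>UNIV. J $ i $ j * A $ i $ j + K $ i $ j * B $ i $ j)) (at x)))"

section \<open>Intersections of two quadrics\<close>

text \<open>Nonsingular of codimension two: the differentials of the two equations are independent
  at every point.\<close>

definition nonsingular_two_quadrics :: "(complex ^ 'k) set set \<Rightarrow> bool" where
  "nonsingular_two_quadrics X \<longleftrightarrow>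
     (\<exists>q r. quadratic_form q \<and> quadratic_form r \<and>
        X = {p \<in> proj_space. \<forall>z\<in>p. q z = 0 \<and> r z = 0} \<and>
        (\<forall>p\<in>X. \<forall>z\<in>p - {0}. \<forall>s t.
           (\<forall>v. s * polar q z v + t * polar r z v = 0) \<longrightarrow> s = 0 \<and> t = 0))"

definition vanishing_forms :: "(complex ^ 'k) set set \<Rightarrow> (complex ^ 'k \<Rightarrow> complex) set" where
  "vanishing_forms X = {q. quadratic_form q \<and> (\<forall>p\<in>X. \<forall>z\<in>p. q z = 0)}"

text \<open>The choice, for \<open>X\<close>, of nondegenerate generators of its pencil and of a basis of the
  ambient vector space in which both are diagonal.\<close>

definition diagonalization ::
    "(complex ^ 'k) set set \<Rightarrow> (complex ^ 'k \<Rightarrow> complex) \<Rightarrow> (complex ^ 'k \<Rightarrow> complex) \<Rightarrow>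
     ('k \<Rightarrow> complex) \<Rightarrow> ('k \<Rightarrow> complex ^ 'k) \<Rightarrow> bool" where
  "diagonalization X \<phi>\<^sub>1 \<phi>\<^sub>2 lam e \<longleftrightarrow>
     quadratic_form \<phi>\<^sub>1 \<and> quadratic_form \<phi>\<^sub>2 \<and> forms_independent \<phi>\<^sub>1 \<phi>\<^sub>2 \<and>
     \<not> degenerate \<phi>\<^sub>1 \<and> \<not> degenerate \<phi>\<^sub>2 \<and> vanishing_forms X = forms_span \<phi>\<^sub>1 \<phi>\<^sub>2 \<and>
     inj e \<and> vec.independent (range e) \<and> vec.span (range e) = UNIV \<and>
     inj lam \<and> (\<forall>i. lam i \<noteq> 0) \<and>
     (\<forall>z. \<phi>\<^sub>1 (\<Sum>i\<in>UNIV. z i *s e i) = (\<Sum>i\<in>UNIV. lam i * (z i)\<^sup>2)) \<and>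
     (\<forall>z. \<phi>\<^sub>2 (\<Sum>i\<in>UNIV. z i *s e i) = (\<Sum>i\<in>UNIV. (z i)\<^sup>2))"

definition perp :: "(complex ^ 'k) set set \<Rightarrow> (complex ^ 'k) set \<Rightarrow> (complex ^ 'k) set" where
  "perp X p = {v. \<forall>q\<in>vanishing_forms X. \<forall>u\<in>p. polar q u v = 0}"

text \<open>From here on \<open>X\<close> lies in the projective space of \<open>complex ^ ('n + 3)\<close>, of dimension
  \<open>CARD('n) + 2\<close>. A complement of the line \<open>p\<close> in \<open>perp X p\<close> is handled through a linear
  isomorphism from \<open>complex ^ 'n\<close> onto it; the orbits below do not depend on that choice.\<close>

definition tangent_frame ::
    "(complex ^ ('n::finite + 3)) set set \<Rightarrow> (complex ^ ('n + 3)) set \<Rightarrow>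
     complex ^ 'n ^ ('n + 3) \<Rightarrow> bool" where
  "tangent_frame X p T \<longleftrightarrow> inj ((*v) T) \<and> range ((*v) T) \<inter> p = {0} \<and>
     {w + u | w u. w \<in> range ((*v) T) \<and> u \<in> p} = perp X p"

definition frame_at ::
    "(complex ^ ('n::finite + 3)) set set \<Rightarrow> (complex ^ ('n + 3)) set \<Rightarrow>
     complex ^ 'n ^ ('n + 3)" where
  "frame_at X p = (SOME T. tangent_frame X p T)"

definition second_fundamental_form ::
    "(complex ^ ('n::finite + 3)) set set \<Rightarrow> (complex ^ ('n + 3)) set \<Rightarrow>
     (complex ^ 'n \<Rightarrow> complex) set" where
  "second_fundamental_form X p = pullback (frame_at X p) (vanishing_forms X)"

definition moduli_map ::
    "(complex ^ ('n::finite + 3)) set set \<Rightarrow> (complex ^ ('n + 3)) set \<Rightarrow>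
     (complex ^ 'n \<Rightarrow> complex) set set" where
  "moduli_map X p = pencil_class (second_fundamental_form X p)"

text \<open>The kernel of the differential of the moduli map at \<open>p\<close>, as the subspace of
  \<open>perp X p\<close> (the tangent space at \<open>z\<close> of the affine cone over \<open>X\<close>, for each nonzero \<open>z\<close> in \<open>p\<close>)
  that contains \<open>p\<close> and corresponds to it modulo \<open>p\<close>. A tangent vector lies in the kernel
  iff it annihilates the pull-back of each holomorphic function near the image point. Here
  \<open>D\<close> is determined by the function on the tangent space of the cone only.\<close>

definition moduli_kernel ::
    "(complex ^ ('n::finite + 3)) set set \<Rightarrow> (complex ^ ('n + 3)) set \<Rightarrow>
     (complex ^ ('n + 3)) set" where
  "moduli_kernel X p =
     {v \<in> perp X p. \<forall>z\<in>p - {0}. \<forall>g. moduli_holomorphic_near g (moduli_map X p) \<longrightarrow>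
        (\<exists>D. ((\<lambda>u. g (moduli_map X (vec.span {u}))) has_derivative D)
               (at z within {u. u \<noteq> 0 \<and> vec.span {u} \<in> X}) \<and> D v = 0)}"

definition tangent_kernel ::
    "(complex ^ ('n::finite + 3)) set set \<Rightarrow> (complex ^ ('n + 3)) set \<Rightarrow> (complex ^ 'n) set" where
  "tangent_kernel X p = (*v) (frame_at X p) -` moduli_kernel X p"

definition refined_moduli_map ::
    "(complex ^ ('n::finite + 3)) set set \<Rightarrow> (complex ^ ('n + 3)) set \<Rightarrow>
     ((complex ^ 'n \<Rightarrow> complex) set \<times> (complex ^ 'n) set) set" where
  "refined_moduli_map X p = refined_rel `` {(second_fundamental_form X p, tangent_kernel X p)}"

definition regular_points ::
    "(complex ^ ('n::finite + 3)) set set \<Rightarrow>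
     (complex ^ ('n + 3) \<Rightarrow> complex) \<Rightarrow> (complex ^ ('n + 3) \<Rightarrow> complex) \<Rightarrow>
     ('n + 3 \<Rightarrow> complex ^ ('n + 3)) \<Rightarrow> (complex ^ ('n + 3)) set set" where
  "regular_points X \<phi>\<^sub>1 \<phi>\<^sub>2 e =
     {p \<in> X.
        (\<forall>x. (\<Sum>i\<in>UNIV. x i *s e i) \<in> p - {0} \<longrightarrow> (\<forall>i. x i \<noteq> 0)) \<and>
        nonsingular_pencil (second_fundamental_form X p) \<and>
        no_pencil_automorphisms (second_fundamental_form X p) \<and>
        \<not> degenerate (\<lambda>w. \<phi>\<^sub>1 (frame_at X p *v w)) \<and>
        \<not> degenerate (\<lambda>w. \<phi>\<^sub>2 (frame_at X p *v w))}"

end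

theory Submission
  imports Defs
begin

text \<open>
  In coordinates \<open>x\<close> with respect to the eigenbasis of \<open>X\<close>, a point of \<open>X\<close> with nonzero coordinates
  is encoded by the rational function \<open>R(s) = \<Sum>\<^sub>i x\<^sub>i\<^sup>2 / (\<lambda>\<^sub>i - s)\<close> (\<open>resolvent\<close>). The two equations of
  \<open>X\<close> say that its numerator has degree at most \<open>n\<close>, and at a regular point
  it has \<open>n\<close> distinct zeros, so \<open>R(s) = c \<Prod>\<^sub>k (t\<^sub>k - s) / \<Prod>\<^sub>i (\<lambda>\<^sub>i - s)\<close>. The vectors
  \<open>w\<^sub>k = (x\<^sub>i / (\<lambda>\<^sub>i - t\<^sub>k))\<^sub>i\<close> form a basis of the tangent space that diagonalizes the second fundamental
  form, with \<open>\<phi>\<^sub>2(w\<^sub>k) = R'(t\<^sub>k)\<close> and \<open>\<phi>\<^sub>1(w\<^sub>k) = t\<^sub>k R'(t\<^sub>k)\<close>; its degenerate elements are therefore the roots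
  \<open>t\<^sub>k\<close>, and its class is the set of roots up to Moebius transformations. Conversely the roots
  determine the point up to the signs of its coordinates, so they are local coordinates on \<open>X\<close>
  (\<open>root_chart\<close>).

  The tangent vector \<open>\<Sum>\<^sub>k a\<^sub>k w\<^sub>k\<close> moves the root \<open>t\<^sub>k\<close> with velocity \<open>-2 a\<^sub>k\<close>. It lies in the kernel of the
  differential of the moduli map iff this motion is infinitesimally Moebius, that is,
  \<open>a\<^sub>k = p(t\<^sub>k)\<close> for a polynomial \<open>p\<close> of degree at most two (\<open>moduli_kernel_eq\<close>): functions on the moduli
  space are constant along Moebius orbits, and the cross ratios of the roots, which are functions
  on the moduli space because a regular pencil has no automorphisms, detect all other motions.

  Suppose that two regular points have the same refined class. Then a Moebius map
  \<open>s \<mapsto> (a s + b) / (g s + d)\<close> carries the roots to the roots, and a linear map carries \<open>w\<^sub>k\<close> to a multiple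
  of the corresponding \<open>w'\<close>. It also respects the spaces of quadratic polynomials; since \<open>n > 4\<close>
  this pins down the multiples up to a common factor (\<open>refined_pencil_match\<close>), and comparing the
  values of \<open>R'\<close> yields
  \<open>\<Prod>\<^sub>i (\<lambda>\<^sub>i - s) = K \<Prod>\<^sub>i (\<lambda>\<^sub>i' (g s + d) - (a s + b))\<close> at every root \<open>s = t\<^sub>k\<close> (\<open>refined_match\<close>).
  Once \<open>K\<close> is absorbed into the Moebius map, the differences of both sides form a family of
  polynomials in \<open>s\<close> with four complex parameters, so the \<open>n\<close>-tuples of common zeros of a nonzero member
  form a null set, as \<open>n > 4\<close> (\<open>common_roots_negligible\<close>). For almost all points the identity therefore holds for all \<open>s\<close>: the
  Moebius map carries \<open>\<lambda>\<close> to \<open>\<lambda>'\<close>, and \<open>x'\<^bsub>\<sigma> i\<^esub>\<^sup>2 = C (g \<lambda>\<^sub>i + d) x\<^sub>i\<^sup>2\<close>. So \<open>f\<close> is given there by one of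
  finitely many projective maps, each a permutation of the coordinates with fixed multipliers
  (\<open>node_maps\<close>).

  By continuity every point of \<open>M\<close> lies in one of the closed sets on which \<open>f\<close> agrees with one of
  these maps. Two of the maps that agree at a regular point are equal, since their
  Moebius maps differ by one that permutes the roots and hence fixes them (\<open>node_maps_rigid\<close>). The
  closed sets thus form a finite partition of the connected set \<open>M\<close>, so only one of them is nonempty.
\<close>

section \<open>Interpolation and resolvents\<close>

lemma poly_eq_if_agree:
  fixes p q :: "'a::idom poly"
  assumes "inj_on t A" "degree p < card A" "degree q < card A"
    and "\<And>k. k \<in> A \<Longrightarrow> poly p (t k) = poly q (t k)"
  shows "p = q"
  using assms by (intro poly_eqI_degree[of "t ` A"]) (auto simp: card_image)

definition node_poly :: "('i \<Rightarrow> 'a::field) \<Rightarrow> 'i set \<Rightarrow> 'a poly" where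
  "node_poly lam A = (\<Prod>j\<in>A. [:lam j, -1:])"

lemma poly_node_poly: "poly (node_poly lam A) s = (\<Prod>j\<in>A. (lam j - s))"
  by (simp add: node_poly_def poly_prod)

lemma degree_node_poly: "degree (node_poly lam A) = card A"
  by (simp add: node_poly_def degree_prod_sum_eq)

lemma lead_coeff_node_poly: "lead_coeff (node_poly lam A) = (-1) ^ card A"
  by (simp add: node_poly_def lead_coeff_prod)

lemma lagrange_interpolation:
  fixes lam :: "'k::finite \<Rightarrow> 'a::field"
  assumes "inj lam" and "degree Q < CARD('k)"
  shows "Q = (\<Sum>i\<in>UNIV. smult (poly Q (lam i) / (\<Prod>j\<in>UNIV-{i}. (lam j - lam i)))
                                 (node_poly lam (UNIV - {i})))"
proof (rule poly_eq_if_agree[OF assms(1), of _ _])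
  show "degree (\<Sum>i\<in>UNIV. smult (poly Q (lam i) / (\<Prod>j\<in>UNIV-{i}. (lam j - lam i)))
                                 (node_poly lam (UNIV - {i}))) < card (UNIV :: 'k set)"
    by (intro degree_sum_less order_le_less_trans[OF degree_smult_le])
       (auto simp: degree_node_poly card_Diff_singleton)
next
  fix k :: 'k
  have off: "poly (node_poly lam (UNIV - {i})) (lam k) = 0" if "i \<noteq> k" for i
    using that by (auto simp: poly_node_poly)
  have on: "poly (node_poly lam (UNIV - {k})) (lam k) = (\<Prod>j\<in>UNIV-{k}. (lam j - lam k))"
    by (simp add: poly_node_poly)
  have nz: "(\<Prod>j\<in>UNIV-{k}. (lam j - lam k)) \<noteq> 0"
    using assms(1) by (auto simp: inj_eq)
  show "poly Q (lam k) = poly (\<Sum>i\<in>UNIV. smult (poly Q (lam i) / (\<Prod>j\<in>UNIV-{i}. (lam j - lam i)))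
                                 (node_poly lam (UNIV - {i}))) (lam k)"
    unfolding poly_sum poly_smult
    by (subst sum.remove[of _ k]) (auto simp: off on nz)
qed (use assms in auto)

text \<open>The sum is, up to sign, the coefficient of degree \<open>CARD('k) - 1\<close> of the interpolating polynomial.\<close>

lemma lagrange_sum_zero:
  fixes lam :: "'k::finite \<Rightarrow> 'a::field"
  assumes "inj lam" and "degree Q + 1 < CARD('k)"
  shows "(\<Sum>i\<in>UNIV. poly Q (lam i) / (\<Prod>j\<in>UNIV-{i}. (lam j - lam i))) = 0"
proof -
  let ?N = "CARD('k) - 1"
  have co: "coeff (node_poly lam (UNIV - {i})) ?N = (-1) ^ ?N" for i
    using lead_coeff_node_poly[of lam "UNIV - {i}"] by (simp add: degree_node_poly card_Diff_singleton)
  have "0 = coeff Q ?N" using assms(2) by (intro coeff_eq_0[symmetric]) simp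
  also have "\<dots> = (\<Sum>i\<in>UNIV. poly Q (lam i) / (\<Prod>j\<in>UNIV-{i}. (lam j - lam i)) * (-1) ^ ?N)"
  proof -
    have "degree Q < CARD('k)" using assms(2) by simp
    from arg_cong[OF lagrange_interpolation[OF assms(1) this], of "\<lambda>p. coeff p ?N"]
    show ?thesis by (simp only: coeff_sum coeff_smult co)
  qed
  also have "\<dots> = (\<Sum>i\<in>UNIV. poly Q (lam i) / (\<Prod>j\<in>UNIV-{i}. (lam j - lam i))) * (-1) ^ ?N"
    by (simp add: sum_distrib_right)
  finally show ?thesis by simp
qed

lemma prod_remove_univ: "f k * (\<Prod>j\<in>UNIV-{k}. f j) = (\<Prod>j\<in>UNIV. f j)" for k :: "'k::finite"
  by (simp add: prod.remove[of _ k])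

lemma lagrange_partial_fractions:
  fixes lam :: "'k::finite \<Rightarrow> 'a::field"
  assumes "inj lam" and "degree Q < CARD('k)" and s: "\<And>i. s \<noteq> lam i"
  shows "(\<Sum>i\<in>UNIV. poly Q (lam i) / ((\<Prod>j\<in>UNIV-{i}. (lam j - lam i)) * (lam i - s)))
         = poly Q s / (\<Prod>i\<in>UNIV. (lam i - s))"
proof -
  let ?L = "\<Prod>i\<in>UNIV. (lam i - s)"
  have L: "?L \<noteq> 0" using s[symmetric] by auto
  have rem: "(\<Prod>j\<in>UNIV-{i}. (lam j - s)) = ?L / (lam i - s)" for i
  proof -
    have "lam i - s \<noteq> 0" using s[of i] by auto
    then show ?thesis using prod_remove_univ[of "\<lambda>j. lam j - s" i] by (simp add: field_simps)
  qed
  have "poly Q s = (\<Sum>i\<in>UNIV. poly Q (lam i) / (\<Prod>j\<in>UNIV-{i}. (lam j - lam i)) *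
                       (?L / (lam i - s)))"
    using arg_cong[OF lagrange_interpolation[OF assms(1,2)], of "\<lambda>p. poly p s"]
    by (simp only: poly_sum poly_smult poly_node_poly rem)
  also have "\<dots> = (\<Sum>i\<in>UNIV. poly Q (lam i) / ((\<Prod>j\<in>UNIV-{i}. (lam j - lam i)) * (lam i - s))) * ?L"
    by (simp add: sum_distrib_right)
  finally show ?thesis using L by (simp add: field_simps)
qed

text \<open>On a point \<open>x\<close> of both diagonal quadrics this is a rational function with numerator of degree
  at least three less than the denominator; its zeros turn out to be the degenerate elements of the second
  fundamental form.\<close>

definition resolvent :: "('k::finite \<Rightarrow> complex) \<Rightarrow> ('k \<Rightarrow> complex) \<Rightarrow> complex \<Rightarrow> complex" where
  "resolvent lam x s = (\<Sum>i\<in>UNIV. (x i)\<^sup>2 / (lam i - s))"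

definition resolvent_deriv :: "('k::finite \<Rightarrow> complex) \<Rightarrow> ('k \<Rightarrow> complex) \<Rightarrow> complex \<Rightarrow> complex" where
  "resolvent_deriv lam x s = (\<Sum>i\<in>UNIV. (x i)\<^sup>2 / (lam i - s)\<^sup>2)"

text \<open>The sum interpolates the values \<open>y\<^sub>i\<close>, weighted by the node products. By the two
  vanishing moments its product with \<open>s\<^sup>2\<close> interpolates \<open>(lam i)\<^sup>2 * y i\<close> in the same way, without reduction modulo
  the node polynomial, which leaves room for degree \<open>CARD('k) - 3\<close> only.\<close>

lemma two_moments_interpolant:
  fixes lam :: "'k::finite \<Rightarrow> 'a::{field,ring_char_0}"
  assumes lam: "inj lam" and k: "CARD('k) \<ge> 3"
    and s0: "(\<Sum>i\<in>UNIV. y i) = 0" and s1: "(\<Sum>i\<in>UNIV. lam i * y i) = 0"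
  obtains H where "degree H + 3 \<le> CARD('k)"
    "\<And>s. poly H s = (\<Sum>i\<in>UNIV. y i * (\<Prod>j\<in>UNIV-{i}. (lam j - s)))"
    "\<And>i. poly H (lam i) = y i * (\<Prod>j\<in>UNIV-{i}. (lam j - lam i))"
proof -
  let ?B = "\<lambda>i. node_poly lam (UNIV - {i})"
  define F where "F = (\<Sum>i\<in>UNIV. smult (y i) (?B i))"
  have off: "poly (?B i) (lam k) = 0" if "i \<noteq> k" for i k
    using that by (auto simp: poly_node_poly)
  have lamF: "poly F (lam i) = y i * (\<Prod>j\<in>UNIV-{i}. (lam j - lam i))" for i
    unfolding F_def poly_sum poly_smult
    by (subst sum.remove[of _ i]) (auto simp: off poly_node_poly[of _ "UNIV - {i}"])
  have "[:0,0,1:] * F = (\<Sum>i\<in>UNIV. smult ((lam i)\<^sup>2 * y i) (?B i))" (is "_ = ?H")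
  proof -
    have "poly ([:0,0,1:] * F) s = poly ?H s" for s
    proof -
      \<comment> \<open>\<open>lam\<^sup>2 - s\<^sup>2\<close> contains the factor \<open>lam - s\<close>; what is left involves the two moments only.\<close>
      have "poly ?H s - poly ([:0,0,1:] * F) s
          = (\<Sum>i\<in>UNIV. y i * (lam i + s) * ((lam i - s) * (\<Prod>j\<in>UNIV-{i}. (lam j - s))))"
        by (simp add: F_def poly_sum poly_node_poly sum_distrib_left flip: sum_subtractf)
           (simp add: algebra_simps power2_eq_square)
      also have "\<dots> = (\<Sum>i\<in>UNIV. y i * (lam i + s) * (\<Prod>j\<in>UNIV. (lam j - s)))"
        by (simp only: prod_remove_univ[of "\<lambda>j. lam j - s"])
      also have "\<dots> = ((\<Sum>i\<in>UNIV. lam i * y i) + s * (\<Sum>i\<in>UNIV. y i)) * (\<Prod>j\<in>UNIV. (lam j - s))"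
        by (simp add: sum_distrib_left sum_distrib_right sum.distrib algebra_simps)
      finally show ?thesis using s0 s1 by simp
    qed
    then have "poly ([:0,0,1:] * F) = poly ?H" by (rule ext)
    then show ?thesis by (simp only: poly_eq_poly_eq_iff)
  qed
  moreover have "degree ?H < CARD('k)"
    by (intro degree_sum_less order_le_less_trans[OF degree_smult_le])
       (auto simp: degree_node_poly card_Diff_singleton)
  moreover have "degree ([:0,0,1:] * F) = 2 + degree F" if "F \<noteq> 0"
    by (subst degree_mult_eq) (use that in auto)
  ultimately have dF: "degree F + 3 \<le> CARD('k)" using k by (cases "F = 0") auto
  show ?thesis
    by (rule that[of F]) (use dF lamF in \<open>auto simp: F_def poly_sum poly_node_poly\<close>)
qed

text \<open>The numerator of the resolvent has degree at most \<open>CARD('n)\<close>, so its \<open>CARD('n)\<close> roots determine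
  it up to a factor; the squares \<open>(x i)\<^sup>2\<close> are its residues.\<close>

lemma resolvent_roots:
  fixes lam :: "'k::finite \<Rightarrow> complex" and t :: "'n::finite \<Rightarrow> complex"
  assumes lam: "inj lam" and t: "inj t" and card: "CARD('k) = CARD('n) + 3"
    and s0: "(\<Sum>i\<in>UNIV. (x i)\<^sup>2) = 0" and s1: "(\<Sum>i\<in>UNIV. lam i * (x i)\<^sup>2) = 0"
    and x: "\<And>i. x i \<noteq> 0" and tl: "\<And>k i. t k \<noteq> lam i" and root: "\<And>k. resolvent lam x (t k) = 0"
  obtains c where "c \<noteq> 0"
    "\<And>i. (x i)\<^sup>2 * (\<Prod>j\<in>UNIV-{i}. (lam j - lam i)) = c * (\<Prod>k\<in>UNIV. (t k - lam i))"
proof -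
  have "CARD('k) \<ge> 3" using card by simp
  then obtain F where dF3: "degree F + 3 \<le> CARD('k)"
    and Fs: "\<And>s. poly F s = (\<Sum>i\<in>UNIV. (x i)\<^sup>2 * (\<Prod>j\<in>UNIV-{i}. (lam j - s)))"
    and lamF: "\<And>i. poly F (lam i) = (x i)\<^sup>2 * (\<Prod>j\<in>UNIV-{i}. (lam j - lam i))"
    by (rule two_moments_interpolant[OF lam _ s0 s1]) (rule that; assumption)
  have dF: "degree F \<le> CARD('n)" using dF3 card by simp
  have nzi: "(\<Prod>j\<in>UNIV-{i}. (lam j - lam i)) \<noteq> 0" for i
    using lam by (auto simp: inj_eq)
  have F0: "F \<noteq> 0" using lamF x nzi by (metis mult_eq_0_iff poly_0 power2_eq_square)
  have Fr: "poly F (t k) = 0" for k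
  proof -
    have "poly F (t k) = (\<Sum>i\<in>UNIV. (x i)\<^sup>2 / (lam i - t k) * (\<Prod>j\<in>UNIV. (lam j - t k)))"
      unfolding Fs
    proof (rule sum.cong[OF refl])
      fix i
      have "lam i - t k \<noteq> 0" using tl[of k i] by auto
      then show "(x i)\<^sup>2 * (\<Prod>j\<in>UNIV-{i}. (lam j - t k)) =
            (x i)\<^sup>2 / (lam i - t k) * (\<Prod>j\<in>UNIV. (lam j - t k))"
        using prod_remove_univ[of "\<lambda>j. lam j - t k" i, symmetric] by simp
    qed
    also have "\<dots> = 0" unfolding sum_distrib_right[symmetric] using root[of k] by (simp add: resolvent_def)
    finally show ?thesis .
  qed
  define T where "T = node_poly t (UNIV :: 'n set)"
  obtain i0 :: 'k where True by simp
  define c where "c = poly F (lam i0) / poly T (lam i0)"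
  have Tl: "poly T (lam i) = (\<Prod>k\<in>UNIV. (t k - lam i))" for i
    by (simp add: T_def poly_node_poly)
  have Tnz: "poly T (lam i) \<noteq> 0" for i using tl by (auto simp: Tl)
  have dT: "degree T = CARD('n)" by (simp add: T_def degree_node_poly)
  let ?A = "insert (lam i0) (range t)"
  have cA: "card ?A = CARD('n) + 1"
    using tl[symmetric] t by (subst card_insert_disjoint) (auto simp: card_image)
  have FT: "F = smult c T"
  proof (rule poly_eq_if_agree[where t = id and A = ?A])
    show "degree F < card ?A" "degree (smult c T) < card ?A"
      using dF dT degree_smult_le[of c T] unfolding cA by linarith+
    fix k assume "k \<in> ?A"
    moreover have "poly T (t m) = 0" for m by (auto simp: T_def poly_node_poly)
    ultimately show "poly F (id k) = poly (smult c T) (id k)"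
      using Fr Tnz[of i0] by (auto simp: c_def)
  qed auto
  show ?thesis
  proof (rule that)
    show "c \<noteq> 0" using FT F0 by auto
    show "(x i)\<^sup>2 * (\<Prod>j\<in>UNIV-{i}. (lam j - lam i)) = c * (\<Prod>k\<in>UNIV. (t k - lam i))" for i
      unfolding lamF[symmetric] FT poly_smult Tl ..
  qed
qed

text \<open>Converse: prescribing the roots, and the residues accordingly, gives a point of both quadrics. The last
  identity relates the derivative at a root to the discriminant of the roots.\<close>

lemma resolvent_of_roots:
  fixes lam :: "'k::finite \<Rightarrow> complex" and t :: "'n::finite \<Rightarrow> complex"
  assumes lam: "inj lam" and card: "CARD('k) = CARD('n) + 3" and tl: "\<And>k i. t k \<noteq> lam i"
    and rep: "\<And>i. (x i)\<^sup>2 * (\<Prod>j\<in>UNIV-{i}. (lam j - lam i)) = c * (\<Prod>k\<in>UNIV. (t k - lam i))"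
  shows "(\<Sum>i\<in>UNIV. (x i)\<^sup>2) = 0" and "(\<Sum>i\<in>UNIV. lam i * (x i)\<^sup>2) = 0"
    and "\<And>s. (\<And>i. s \<noteq> lam i) \<Longrightarrow>
           resolvent lam x s * (\<Prod>i\<in>UNIV. (lam i - s)) = c * (\<Prod>k\<in>UNIV. (t k - s))"
    and "\<And>k. resolvent lam x (t k) = 0"
    and "\<And>k. resolvent_deriv lam x (t k) * (\<Prod>i\<in>UNIV. (lam i - t k))
             = - c * (\<Prod>j\<in>UNIV-{k}. (t j - t k))"
proof -
  have nzi: "(\<Prod>j\<in>UNIV-{i}. (lam j - lam i)) \<noteq> 0" for i
    using lam by (auto simp: inj_eq)
  define T where "T A = smult c (node_poly t A)" for A :: "'n set"
  have pT: "poly (T A) s = c * (\<Prod>k\<in>A. (t k - s))" for s A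
    by (simp add: T_def poly_node_poly)
  have dT: "degree (T A) \<le> card A" for A
    unfolding T_def using degree_smult_le[of c "node_poly t A"] by (simp add: degree_node_poly)
  have dU: "degree (T UNIV) \<le> CARD('n)" using dT[of UNIV] by simp
  have sq: "(x i)\<^sup>2 = poly (T UNIV) (lam i) / (\<Prod>j\<in>UNIV-{i}. (lam j - lam i))" for i
    using rep[of i] nzi[of i] by (simp add: pT field_simps)
  show "(\<Sum>i\<in>UNIV. (x i)\<^sup>2) = 0"
    unfolding sq using dU card by (intro lagrange_sum_zero lam) simp
  have "degree (pCons 0 (T UNIV)) \<le> CARD('n) + 1" using dU by (simp add: degree_pCons_eq_if)
  then have "(\<Sum>i\<in>UNIV. poly (pCons 0 (T UNIV)) (lam i) / (\<Prod>j\<in>UNIV-{i}. (lam j - lam i))) = 0"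
    using card by (intro lagrange_sum_zero lam) simp
  then show "(\<Sum>i\<in>UNIV. lam i * (x i)\<^sup>2) = 0" by (simp add: sq)
  show res: "resolvent lam x s * (\<Prod>i\<in>UNIV. (lam i - s)) = c * (\<Prod>k\<in>UNIV. (t k - s))"
    if s: "\<And>i. s \<noteq> lam i" for s
  proof -
    have "resolvent lam x s = poly (T UNIV) s / (\<Prod>i\<in>UNIV. (lam i - s))"
      unfolding resolvent_def sq divide_divide_eq_left
      using dU card by (intro lagrange_partial_fractions lam s) simp
    moreover have "(\<Prod>i\<in>UNIV. (lam i - s)) \<noteq> 0" using s[symmetric] by auto
    ultimately show ?thesis by (simp add: pT)
  qed
  have Lnz: "(\<Prod>i\<in>UNIV. (lam i - t k)) \<noteq> 0" for k using tl[symmetric] by auto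
  show "resolvent lam x (t k) = 0" for k
  proof -
    have "(\<Prod>j\<in>UNIV. (t j - t k)) = 0" by auto
    then show ?thesis using res[OF tl, of k] Lnz[of k] by (metis mult_eq_0_iff)
  qed
  show "resolvent_deriv lam x (t k) * (\<Prod>i\<in>UNIV. (lam i - t k))
             = - c * (\<Prod>j\<in>UNIV-{k}. (t j - t k))" for k
  proof -
    have "(x i)\<^sup>2 / (lam i - t k)\<^sup>2 =
        - (poly (T (UNIV - {k})) (lam i) / ((\<Prod>j\<in>UNIV-{i}. (lam j - lam i)) * (lam i - t k)))" for i
    proof -
      have "lam i - t k \<noteq> 0" using tl[of k i] by auto
      moreover have T': "poly (T UNIV) (lam i) = - (lam i - t k) * poly (T (UNIV - {k})) (lam i)"
        unfolding pT prod_remove_univ[of "\<lambda>j. t j - lam i" k, symmetric] by (simp add: algebra_simps)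
      ultimately show ?thesis
        unfolding sq T' using nzi[of i]
        by (simp add: divide_simps power2_eq_square) (simp add: algebra_simps)
    qed
    then have "resolvent_deriv lam x (t k) = - (\<Sum>i\<in>UNIV.
        poly (T (UNIV - {k})) (lam i) / ((\<Prod>j\<in>UNIV-{i}. (lam j - lam i)) * (lam i - t k)))"
      by (simp add: resolvent_deriv_def sum_negf)
    also have "\<dots> = - (poly (T (UNIV - {k})) (t k) / (\<Prod>i\<in>UNIV. (lam i - t k)))"
    proof -
      have "degree (T (UNIV - {k})) < CARD('k)"
        using dT[of "UNIV - {k}"] card by (simp add: card_Diff_singleton)
      then show ?thesis by (subst lagrange_partial_fractions[OF lam _ tl]) auto
    qed
    finally show ?thesis using Lnz[of k] by (simp add: pT)
  qed
qed

text \<open>Let \<open>P\<close> be the quadratic polynomial that \<open>M\<close> produces from \<open>1\<close>. Then \<open>M\<close> turns \<open>s\<^sup>2\<close> into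
  \<open>s\<^sup>2 P\<close>, of degree at most four, which coincides on five points with a quadratic polynomial; so
  \<open>P\<close> is constant.\<close>

lemma quadratic_multiplier_constant:
  fixes t :: "'n::finite \<Rightarrow> 'a::field"
  assumes t: "inj t" and n: "CARD('n) > 4"
    and M: "\<And>q. degree q \<le> 2 \<Longrightarrow> \<exists>q'. degree q' \<le> 2 \<and> (\<forall>k. M k * poly q (t k) = poly q' (t k))"
  shows "\<exists>c. \<forall>k. M k = c"
proof -
  obtain P where P: "degree P \<le> 2" "\<And>k. M k = poly P (t k)"
    using M[of 1] by auto
  obtain R where R: "degree R \<le> 2" "\<And>k. M k * (t k)\<^sup>2 = poly R (t k)"
    using M[of "[:0,0,1:]"] by (auto simp: power2_eq_square)
  have dP: "degree (P * [:0,0,1:]) \<le> degree P + 2"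
    using degree_mult_le[of P "[:0,0,1:]"] by simp
  have "P * [:0,0,1:] = R"
  proof (rule poly_eq_if_agree[OF t])
    show "degree (P * [:0,0,1:]) < CARD('n)" "degree R < CARD('n)"
      using dP P(1) R(1) n by simp_all
    show "poly (P * [:0,0,1:]) (t k) = poly R (t k)" for k
      using R(2)[of k] P(2)[of k] by (simp add: power2_eq_square mult_ac)
  qed
  then have "degree P = 0"
    using R(1) degree_mult_eq[of P "[:0,0,1:]"] by (cases "P = 0") auto
  then show ?thesis using P(2) by (metis degree_eq_zeroE poly_pCons poly_0 mult_zero_right add.right_neutral)
qed

section \<open>Moebius maps between nodes and between roots\<close>

text \<open>A Moebius map \<open>u \<mapsto> (a u + b) / (g u + d)\<close> is written without denominators, as
  \<open>u' (g u + d) = a u + b\<close>.\<close>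

lemma moebius_diff:
  fixes u v :: "'a::field"
  assumes "u' * (g * u + d) = a * u + b" and "v' * (g * v + d) = a * v + b"
  shows "(u' - v') * ((g * u + d) * (g * v + d)) = (a * d - b * g) * (u - v)"
proof -
  have "(u' - v') * ((g * u + d) * (g * v + d))
      = (u' * (g * u + d)) * (g * v + d) - (v' * (g * v + d)) * (g * u + d)"
    by (simp add: algebra_simps)
  then show ?thesis unfolding assms by (simp add: algebra_simps)
qed

lemma moebius_denominator_nz:
  fixes u :: "'a::field"
  assumes "u' * (g * u + d) = a * u + b" and "a * d - b * g \<noteq> 0"
  shows "g * u + d \<noteq> 0"
proof
  assume z: "g * u + d = 0"
  then have "a * u + b = 0" using assms(1) by simp
  then have "a * (g * u + d) - g * (a * u + b) = 0" and "d * (a * u + b) - b * (g * u + d) = 0"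
    using z by simp_all
  then have "a * d - b * g = 0" by (simp add: algebra_simps)
  then show False using assms(2) by simp
qed

lemma prod_diff_moebius:
  fixes u u' :: "'i::finite \<Rightarrow> 'a::field"
  assumes "bij \<sigma>" and "\<And>i. u' (\<sigma> i) * (g * u i + d) = a * u i + b"
  shows "(\<Prod>j\<in>UNIV-{\<sigma> i}. (u' j - u' (\<sigma> i))) *
            ((g * u i + d) ^ (CARD('i) - 1) * (\<Prod>j\<in>UNIV-{i}. (g * u j + d)))
         = (a * d - b * g) ^ (CARD('i) - 1) * (\<Prod>j\<in>UNIV-{i}. (u j - u i))"
proof -
  have "bij_betw \<sigma> (UNIV - {i}) (UNIV - {\<sigma> i})"
    using assms(1) by (auto simp: bij_betw_def bij_def inj_on_def surj_def) (metis image_eqI Diff_iff UNIV_I singletonD)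
  then have "(\<Prod>j\<in>UNIV-{\<sigma> i}. (u' j - u' (\<sigma> i))) = (\<Prod>j\<in>UNIV-{i}. (u' (\<sigma> j) - u' (\<sigma> i)))"
    by (simp add: prod.reindex_bij_betw[symmetric])
  moreover have "(\<Prod>j\<in>UNIV-{i}. (u' (\<sigma> j) - u' (\<sigma> i))) *
            (\<Prod>j\<in>UNIV-{i}. ((g * u j + d) * (g * u i + d)))
         = (\<Prod>j\<in>UNIV-{i}. ((a * d - b * g) * (u j - u i)))"
    unfolding prod.distrib[symmetric] by (intro prod.cong refl moebius_diff assms)
  ultimately show ?thesis
    by (simp add: prod.distrib card_Diff_singleton mult_ac)
qed

text \<open>The power of the denominator \<open>g * t k + d\<close> is \<open>CARD('n) + 3\<close> for the product over the nodes and
  \<open>CARD('n) - 2\<close> for the product over the other roots; the difference is the exponent five of the map of refined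
  pairs.\<close>

lemma discriminants_match:
  fixes lam lam' :: "'k::finite \<Rightarrow> complex" and t t' :: "'n::finite \<Rightarrow> complex"
  assumes card: "CARD('k) = CARD('n) + 3" and n: "CARD('n) \<ge> 2"
    and t: "inj t" and tl: "\<And>k i. t k \<noteq> lam i"
    and pi: "bij \<pi>" and h: "\<And>k. t' (\<pi> k) * (g * t k + d) = a * t k + b"
    and det: "a * d - b * g \<noteq> 0"
    and D: "\<And>k. D k * (\<Prod>i\<in>UNIV. (lam i - t k)) = - c * (\<Prod>j\<in>UNIV-{k}. (t j - t k))"
    and D': "\<And>k. D' k * (\<Prod>i\<in>UNIV. (lam' i - t' k)) = - c' * (\<Prod>j\<in>UNIV-{k}. (t' j - t' k))"
    and c: "c \<noteq> 0" "c' \<noteq> 0"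
    and \<kappa>: "\<kappa> \<noteq> 0" "\<And>k. D' (\<pi> k) = \<kappa> * (g * t k + d) ^ 5 * D k"
  obtains K where "K \<noteq> 0"
    "\<And>k. (\<Prod>i\<in>UNIV. (lam i - t k)) = K * (\<Prod>i\<in>UNIV. (lam' i * (g * t k + d) - (a * t k + b)))"
proof -
  let ?w = "\<lambda>k. g * t k + d" and ?E = "a * d - b * g"
  define W where "W = (\<Prod>k\<in>UNIV. ?w k)"
  have w: "?w k \<noteq> 0" for k by (rule moebius_denominator_nz[OF h det])
  then have W: "W \<noteq> 0" by (simp add: W_def)
  obtain m where m: "CARD('n) = m + 2" using n by (metis add.commute le_Suc_ex)
  define K where "K = \<kappa> * c * W / (c' * ?E ^ (m + 1))"
  show ?thesis
  proof (rule that)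
    show "K \<noteq> 0" using c \<kappa>(1) W det by (simp add: K_def)
    fix k
    define A where "A = (\<Prod>i\<in>UNIV. (lam i - t k))"
    define B where "B = (\<Prod>i\<in>UNIV. (lam' i * ?w k - (a * t k + b)))"
    define P where "P = (\<Prod>j\<in>UNIV-{k}. (t j - t k))"
    define P' where "P' = (\<Prod>j\<in>UNIV-{\<pi> k}. (t' j - t' (\<pi> k)))"
    define V where "V = (\<Prod>j\<in>UNIV-{k}. ?w j)"
    define y where "y = ?w k"
    have y: "y \<noteq> 0" using w by (simp add: y_def)
    have P: "P \<noteq> 0" using t by (auto simp: P_def inj_eq)
    have V: "V \<noteq> 0" using w by (simp add: V_def)
    have WV: "W = y * V" unfolding W_def V_def y_def by (rule prod_remove_univ[symmetric])
    have "B = (\<Prod>i\<in>UNIV. (lam' i - t' (\<pi> k)) * ?w k)"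
      unfolding B_def by (simp add: left_diff_distrib h)
    then have B: "B = (\<Prod>i\<in>UNIV. (lam' i - t' (\<pi> k))) * y ^ (m + 5)"
      using card m by (simp add: prod.distrib y_def add.commute)
    have e1: "P' * (y ^ (m + 1) * V) = ?E ^ (m + 1) * P"
      using prod_diff_moebius[where u = t and u' = t', OF pi h, of k] unfolding P_def P'_def V_def y_def m by simp
    have e2: "D' (\<pi> k) * B = - c' * P' * y ^ (m + 5)"
      using D'[of "\<pi> k"] unfolding B P'_def by (simp flip: mult.assoc)
    have e3: "D k * A = - c * P" using D[of k] unfolding A_def P_def .
    have A: "A \<noteq> 0" using tl[symmetric] by (simp add: A_def)
    have "\<kappa> * y ^ 5 * D k * B * V * A = (D' (\<pi> k) * B) * V * A"
      by (simp add: \<kappa>(2) y_def)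
    also have "\<dots> = - c' * (P' * (y ^ (m + 1) * V)) * y ^ 4 * A"
      unfolding e2 by (simp add: power_add algebra_simps eval_nat_numeral)
    also have "\<dots> = - c' * ?E ^ (m + 1) * P * y ^ 4 * A" unfolding e1 by simp
    finally have "\<kappa> * y ^ 5 * B * V * (D k * A) = - c' * ?E ^ (m + 1) * P * y ^ 4 * A"
      by (simp add: mult_ac)
    then have "P * y ^ 4 * (\<kappa> * c * (y * V) * B) = P * y ^ 4 * (c' * ?E ^ (m + 1) * A)"
      unfolding e3 by (simp add: algebra_simps eval_nat_numeral)
    then have "\<kappa> * c * (y * V) * B = c' * ?E ^ (m + 1) * A"
      using P y by simp
    then have "A = K * B" using c det by (simp add: K_def WV field_simps)
    then show "(\<Prod>i\<in>UNIV. (lam i - t k)) = K * (\<Prod>i\<in>UNIV. (lam' i * ?w k - (a * t k + b)))"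
      unfolding A_def B_def .
  qed
qed

lemma nodes_match:
  fixes lam lam' :: "'k::finite \<Rightarrow> 'a::field"
  assumes lam: "inj lam" and det: "a * d - b * g \<noteq> 0"
    and id: "\<And>s. (\<Prod>i\<in>UNIV. (lam i - s)) = (\<Prod>i\<in>UNIV. (lam' i * (g * s + d) - (a * s + b)))"
  obtains \<sigma> where "bij \<sigma>" "\<And>i. lam' (\<sigma> i) * (g * lam i + d) = a * lam i + b"
proof -
  have "\<exists>j. lam' j * (g * lam i + d) = a * lam i + b" for i
  proof -
    have "(\<Prod>j\<in>UNIV. (lam j - lam i)) = 0" by auto
    then show ?thesis unfolding id by auto
  qed
  then obtain \<sigma> where \<sigma>: "\<And>i. lam' (\<sigma> i) * (g * lam i + d) = a * lam i + b" by metis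
  have "inj \<sigma>"
  proof (rule injI)
    fix i j assume "\<sigma> i = \<sigma> j"
    then have "(a * d - b * g) * (lam i - lam j) = 0"
      using moebius_diff[OF \<sigma>[of i] \<sigma>[of j]] by simp
    then show "i = j" using det lam by (simp add: inj_eq)
  qed
  then show ?thesis using \<sigma> by (intro that) (auto simp: bij_def finite_UNIV_inj_surj)
qed

text \<open>Both squares are quotients of a product over the roots by a product over the nodes, and the
  Moebius map changes each factor by \<open>moebius_diff\<close>. Apart from constants, the product over the nodes contributes one
  power of the denominator at the \<open>i\<close>-th node more than the product over the roots.\<close>

lemma squares_match:
  fixes lam lam' :: "'k::finite \<Rightarrow> complex" and t t' :: "'n::finite \<Rightarrow> complex"
  assumes card: "CARD('k) = CARD('n) + 3" and lam: "inj lam"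
    and pi: "bij \<pi>" and h: "\<And>k. t' (\<pi> k) * (g * t k + d) = a * t k + b"
    and sig: "bij \<sigma>" and hl: "\<And>i. lam' (\<sigma> i) * (g * lam i + d) = a * lam i + b"
    and det: "a * d - b * g \<noteq> 0"
    and x: "\<And>i. (x i)\<^sup>2 * (\<Prod>j\<in>UNIV-{i}. (lam j - lam i)) = c * (\<Prod>k\<in>UNIV. (t k - lam i))"
    and x': "\<And>i. (x' i)\<^sup>2 * (\<Prod>j\<in>UNIV-{i}. (lam' j - lam' i)) = c' * (\<Prod>k\<in>UNIV. (t' k - lam' i))"
    and c: "c \<noteq> 0" "c' \<noteq> 0"
  obtains C where "C \<noteq> 0" "\<And>i. (x' (\<sigma> i))\<^sup>2 = C * (g * lam i + d) * (x i)\<^sup>2"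
proof -
  let ?w = "\<lambda>k. g * t k + d" and ?v = "\<lambda>i. g * lam i + d" and ?E = "a * d - b * g"
  have w: "?w k \<noteq> 0" for k by (rule moebius_denominator_nz[OF h det])
  have v: "?v i \<noteq> 0" for i by (rule moebius_denominator_nz[OF hl det])
  define W where "W = (\<Prod>k\<in>UNIV. ?w k)"
  define V where "V = (\<Prod>i\<in>UNIV. ?v i)"
  have WV: "W \<noteq> 0" "V \<noteq> 0" using w v by (simp_all add: W_def V_def)
  define m where "m = CARD('n)"
  define C where "C = c' * V / (c * W * ?E ^ 2)"
  show ?thesis
  proof (rule that)
    show "C \<noteq> 0" using c WV det by (simp add: C_def)
    fix i
    define y where "y = ?v i"
    define U where "U = (\<Prod>j\<in>UNIV-{i}. ?v j)"
    define P where "P = (\<Prod>j\<in>UNIV-{i}. (lam j - lam i))"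
    define P' where "P' = (\<Prod>j\<in>UNIV-{\<sigma> i}. (lam' j - lam' (\<sigma> i)))"
    define T where "T = (\<Prod>k\<in>UNIV. (t k - lam i))"
    define T' where "T' = (\<Prod>k\<in>UNIV. (t' k - lam' (\<sigma> i)))"
    have y: "y \<noteq> 0" using v by (simp add: y_def)
    have VU: "V = y * U" unfolding V_def U_def y_def by (rule prod_remove_univ[symmetric])
    have U: "U \<noteq> 0" using v by (simp add: U_def)
    have P: "P \<noteq> 0" using lam by (auto simp: P_def inj_eq)
    have e1: "P' * (y ^ (m + 2) * U) = ?E ^ (m + 2) * P"
      using prod_diff_moebius[where u = lam and u' = lam', OF sig hl, of i] unfolding P_def P'_def U_def y_def m_def card by simp
    have "T' = (\<Prod>k\<in>UNIV. (t' (\<pi> k) - lam' (\<sigma> i)))"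
      unfolding T'_def using prod.reindex_bij_betw[OF pi, of "\<lambda>k. t' k - lam' (\<sigma> i)"] by simp
    moreover have "(\<Prod>k\<in>UNIV. (t' (\<pi> k) - lam' (\<sigma> i))) * (\<Prod>k\<in>UNIV. (?w k * ?v i))
        = (\<Prod>k\<in>UNIV. (?E * (t k - lam i)))"
      unfolding prod.distrib[symmetric] by (intro prod.cong refl moebius_diff h hl)
    ultimately have e2: "T' * (W * y ^ m) = ?E ^ m * T"
      by (simp add: prod.distrib W_def y_def m_def T_def)
    have P': "P' \<noteq> 0" using e1 P det by auto
    have e3: "(x i)\<^sup>2 * P = c * T" using x[of i] by (simp add: P_def T_def)
    have e4: "(x' (\<sigma> i))\<^sup>2 * P' = c' * T'" using x'[of "\<sigma> i"] by (simp add: P'_def T'_def)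
    have "(x' (\<sigma> i))\<^sup>2 * (?E ^ (m + 2) * P) * (c * W) = ((x' (\<sigma> i))\<^sup>2 * P') * (y ^ (m + 2) * U) * (c * W)"
      unfolding e1[symmetric] by (simp add: mult_ac)
    also have "\<dots> = c * c' * (T' * (W * y ^ m)) * y ^ 2 * U"
      unfolding e4 by (simp add: power_add power2_eq_square mult_ac)
    also have "\<dots> = c' * ?E ^ m * (c * T) * y ^ 2 * U"
      unfolding e2 by (simp add: mult_ac)
    also have "\<dots> = c' * ?E ^ m * P * (x i)\<^sup>2 * y * V"
      unfolding e3[symmetric] VU by (simp add: mult_ac power2_eq_square)
    finally have "(?E ^ m * P) * ((x' (\<sigma> i))\<^sup>2 * (c * W * ?E ^ 2)) = (?E ^ m * P) * (c' * V * y * (x i)\<^sup>2)"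
      by (simp add: power_add power2_eq_square mult_ac)
    then have "(x' (\<sigma> i))\<^sup>2 * (c * W * ?E ^ 2) = c' * V * y * (x i)\<^sup>2"
      using P det by simp
    then show "(x' (\<sigma> i))\<^sup>2 = C * ?v i * (x i)\<^sup>2"
      unfolding y_def[symmetric] using c WV det by (simp add: C_def field_simps)
  qed
qed

text \<open>The products over the roots, as polynomials in the node \<open>s = lam i\<close>, agree at more nodes than
  their degree, so they agree identically and have the same zeros.\<close>

lemma roots_match:
  fixes lam lam' :: "'k::finite \<Rightarrow> complex" and t t' :: "'n::finite \<Rightarrow> complex"
  assumes card: "CARD('k) = CARD('n) + 3" and lam: "inj lam"
    and sig: "bij \<sigma>" and hl: "\<And>i. lam' (\<sigma> i) * (g * lam i + d) = a * lam i + b"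
    and det: "a * d - b * g \<noteq> 0"
    and x: "\<And>i. (x i)\<^sup>2 * (\<Prod>j\<in>UNIV-{i}. (lam j - lam i)) = c * (\<Prod>k\<in>UNIV. (t k - lam i))"
    and x': "\<And>i. (x' i)\<^sup>2 * (\<Prod>j\<in>UNIV-{i}. (lam' j - lam' i)) = c' * (\<Prod>k\<in>UNIV. (t' k - lam' i))"
    and c: "c \<noteq> 0" "c' \<noteq> 0"
    and C: "\<And>i. (x' (\<sigma> i))\<^sup>2 = C * (g * lam i + d) * (x i)\<^sup>2"
    and t: "inj t"
  obtains \<pi> where "bij \<pi>" "\<And>k. t' (\<pi> k) * (g * t k + d) = a * t k + b"
proof -
  let ?v = "\<lambda>i. g * lam i + d" and ?E = "a * d - b * g"
  have v: "?v i \<noteq> 0" for i by (rule moebius_denominator_nz[OF hl det])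
  define V where "V = (\<Prod>i\<in>UNIV. ?v i)"
  have V: "V \<noteq> 0" using v by (simp add: V_def)
  define m where "m = CARD('n)"
  define K where "K = C * ?E ^ (m + 2) * c / (V * c')"
  define Q where "Q = (\<Prod>k\<in>UNIV. [:t' k * d - b, t' k * g - a:])"
  define R where "R = smult K (node_poly t UNIV)"
  have Q: "poly Q s = (\<Prod>k\<in>UNIV. (t' k * (g * s + d) - (a * s + b)))" for s
    by (simp add: Q_def poly_prod algebra_simps)
  have R: "poly R s = K * (\<Prod>k\<in>UNIV. (t k - s))" for s
    by (simp add: R_def poly_node_poly)
  have "Q = R"
  proof (rule poly_eq_if_agree[OF lam])
    have "degree Q \<le> (\<Sum>k\<in>(UNIV::'n set). 1)"
      unfolding Q_def by (rule order_trans[OF degree_prod_sum_le[OF finite] sum_mono]) simp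
    then show "degree Q < CARD('k)" using card by simp
    show "degree R < CARD('k)"
      using card degree_smult_le[of K "node_poly t UNIV"] by (simp add: R_def degree_node_poly)
    fix i
    define y where "y = ?v i"
    define U where "U = (\<Prod>j\<in>UNIV-{i}. ?v j)"
    define P where "P = (\<Prod>j\<in>UNIV-{i}. (lam j - lam i))"
    define P' where "P' = (\<Prod>j\<in>UNIV-{\<sigma> i}. (lam' j - lam' (\<sigma> i)))"
    define T where "T = (\<Prod>k\<in>UNIV. (t k - lam i))"
    define T' where "T' = (\<Prod>k\<in>UNIV. (t' k - lam' (\<sigma> i)))"
    have y: "y \<noteq> 0" using v by (simp add: y_def)
    have VU: "V = y * U" unfolding V_def U_def y_def by (rule prod_remove_univ[symmetric])
    have e1: "P' * (y ^ (m + 2) * U) = ?E ^ (m + 2) * P"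
      using prod_diff_moebius[where u = lam and u' = lam', OF sig hl, of i] unfolding P_def P'_def U_def y_def m_def card by simp
    have e3: "(x i)\<^sup>2 * P = c * T" using x[of i] by (simp add: P_def T_def)
    have e4: "(x' (\<sigma> i))\<^sup>2 * P' = c' * T'" using x'[of "\<sigma> i"] by (simp add: P'_def T'_def)
    have Qi: "poly Q (lam i) = T' * y ^ m"
    proof -
      have "poly Q (lam i) = (\<Prod>k\<in>UNIV. (t' k - lam' (\<sigma> i)) * y)"
        unfolding Q y_def by (simp add: left_diff_distrib hl)
      then show ?thesis by (simp add: prod.distrib T'_def m_def)
    qed
    have "c' * V * poly Q (lam i) = V * y ^ m * (c' * T')" by (simp add: Qi mult_ac)
    also have "\<dots> = C * y ^ (m + 2) * U * P' * (x i)\<^sup>2"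
      unfolding e4[symmetric] C y_def[symmetric] VU by (simp add: power_add power2_eq_square mult_ac)
    also have "\<dots> = C * (P' * (y ^ (m + 2) * U)) * (x i)\<^sup>2" by (simp add: mult_ac)
    also have "\<dots> = C * ?E ^ (m + 2) * (c * T)" unfolding e1 e3[symmetric] by (simp add: mult_ac)
    finally show "poly Q (lam i) = poly R (lam i)"
      unfolding R T_def[symmetric] using V c by (simp add: K_def field_simps)
  qed
  have "\<exists>m. t' m * (g * t k + d) = a * t k + b" for k
  proof -
    have "(\<Prod>j\<in>UNIV. (t j - t k)) = 0" by auto
    then have "poly Q (t k) = 0" unfolding \<open>Q = R\<close> R by (metis mult_zero_right)
    then show ?thesis unfolding Q by auto
  qed
  then obtain \<pi> where \<pi>: "\<And>k. t' (\<pi> k) * (g * t k + d) = a * t k + b" by metis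
  have "inj \<pi>"
  proof (rule injI)
    fix i j assume "\<pi> i = \<pi> j"
    then have "?E * (t i - t j) = 0"
      using moebius_diff[OF \<pi>[of i] \<pi>[of j]] by simp
    then show "i = j" using det t by (simp add: inj_eq)
  qed
  then show ?thesis using \<pi> by (intro that) (auto simp: bij_def finite_UNIV_inj_surj)
qed

section \<open>Common roots in families of polynomials\<close>

definition lipschitz_near :: "('a::metric_space \<Rightarrow> 'b::metric_space) \<Rightarrow> 'a \<Rightarrow> bool" where
  "lipschitz_near f x \<longleftrightarrow> (\<exists>e>0. \<exists>B\<ge>0. \<forall>y\<in>ball x e. \<forall>z\<in>ball x e. dist (f y) (f z) \<le> B * dist y z)"

text \<open>Lipschitz continuity is what is used of the smooth dependence of roots on parameters: it
  suffices for null sets and passes to subsets of the parameter space.\<close>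

definition locally_lipschitz :: "('a::metric_space \<Rightarrow> 'b::metric_space) \<Rightarrow> bool" where
  "locally_lipschitz f \<longleftrightarrow> (\<forall>x. lipschitz_near f x)"

lemma lipschitz_nearI:
  assumes "e > 0" "B \<ge> 0"
    and "\<And>y z. y \<in> ball x e \<Longrightarrow> z \<in> ball x e \<Longrightarrow> dist (f y) (f z) \<le> B * dist y z"
  shows "lipschitz_near f x"
  using assms unfolding lipschitz_near_def by blast

lemma locally_lipschitzD:
  assumes "locally_lipschitz f"
  obtains e B where "e > 0" "B \<ge> 0" "\<And>y z. y \<in> ball x e \<Longrightarrow> z \<in> ball x e \<Longrightarrow> dist (f y) (f z) \<le> B * dist y z"
  using assms unfolding locally_lipschitz_def lipschitz_near_def by meson

lemma locally_lipschitz_const: "locally_lipschitz (\<lambda>x. c)"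
  by (auto simp: locally_lipschitz_def intro!: lipschitz_nearI[of 1 0])

lemma locally_lipschitz_linear:
  assumes "bounded_linear f" shows "locally_lipschitz f"
  unfolding locally_lipschitz_def
proof
  fix x
  interpret bounded_linear f by fact
  obtain K where "K \<ge> 0" "\<And>x. norm (f x) \<le> norm x * K" using nonneg_bounded by blast
  then show "lipschitz_near f x"
    by (intro lipschitz_nearI[of 1 K]) (auto simp: dist_norm mult.commute simp flip: diff)
qed

lemma locally_lipschitz_add:
  fixes f g :: "'a::metric_space \<Rightarrow> 'b::real_normed_vector"
  assumes "locally_lipschitz f" "locally_lipschitz g"
  shows "locally_lipschitz (\<lambda>x. f x + g x)"
  unfolding locally_lipschitz_def
proof
  fix x
  obtain e B where f: "e > 0" "B \<ge> 0" "\<And>y z. y \<in> ball x e \<Longrightarrow> z \<in> ball x e \<Longrightarrow> dist (f y) (f z) \<le> B * dist y z"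
    using locally_lipschitzD[OF assms(1)] by metis
  obtain e' B' where g: "e' > 0" "B' \<ge> 0" "\<And>y z. y \<in> ball x e' \<Longrightarrow> z \<in> ball x e' \<Longrightarrow> dist (g y) (g z) \<le> B' * dist y z"
    using locally_lipschitzD[OF assms(2)] by metis
  show "lipschitz_near (\<lambda>x. f x + g x) x"
  proof (rule lipschitz_nearI[of "min e e'" "B + B'"])
    fix y z assume "y \<in> ball x (min e e')" "z \<in> ball x (min e e')"
    then have "dist (f y) (f z) \<le> B * dist y z" "dist (g y) (g z) \<le> B' * dist y z"
      by (auto intro!: f g)
    moreover have "dist (f y + g y) (f z + g z) \<le> dist (f y) (f z) + dist (g y) (g z)"
      by (rule dist_triangle_add)
    ultimately show "dist (f y + g y) (f z + g z) \<le> (B + B') * dist y z"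
      by (simp add: distrib_right)
  qed (use f g in auto)
qed

lemma locally_lipschitz_mult:
  fixes f g :: "'a::metric_space \<Rightarrow> 'b::real_normed_algebra"
  assumes "locally_lipschitz f" "locally_lipschitz g"
  shows "locally_lipschitz (\<lambda>x. f x * g x)"
  unfolding locally_lipschitz_def
proof
  fix x
  obtain e B where f: "e > 0" "B \<ge> 0" "\<And>y z. y \<in> ball x e \<Longrightarrow> z \<in> ball x e \<Longrightarrow> dist (f y) (f z) \<le> B * dist y z"
    using locally_lipschitzD[OF assms(1)] by metis
  obtain e' B' where g: "e' > 0" "B' \<ge> 0" "\<And>y z. y \<in> ball x e' \<Longrightarrow> z \<in> ball x e' \<Longrightarrow> dist (g y) (g z) \<le> B' * dist y z"
    using locally_lipschitzD[OF assms(2)] by metis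
  define F where "F = norm (f x) + B"
  define G where "G = norm (g x) + B'"
  have FG: "F \<ge> 0" "G \<ge> 0" using f(2) g(2) by (auto simp: F_def G_def)
  let ?e = "min 1 (min e e')"
  have bf: "norm (f y) \<le> F" if "y \<in> ball x ?e" for y
  proof -
    have "dist (f y) (f x) \<le> B * dist y x" using that f(1) by (intro f) auto
    also have "\<dots> \<le> B * 1" using that f(2) by (intro mult_left_mono) (auto simp: dist_commute)
    finally show ?thesis using norm_triangle_sub[of "f y" "f x"] by (simp add: F_def dist_norm)
  qed
  have bg: "norm (g y) \<le> G" if "y \<in> ball x ?e" for y
  proof -
    have "dist (g y) (g x) \<le> B' * dist y x" using that g(1) by (intro g) auto
    also have "\<dots> \<le> B' * 1" using that g(2) by (intro mult_left_mono) (auto simp: dist_commute)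
    finally show ?thesis using norm_triangle_sub[of "g y" "g x"] by (simp add: G_def dist_norm)
  qed
  show "lipschitz_near (\<lambda>x. f x * g x) x"
  proof (rule lipschitz_nearI[of ?e "F * B' + B * G"])
    fix y z assume yz: "y \<in> ball x ?e" "z \<in> ball x ?e"
    then have d: "norm (f y - f z) \<le> B * dist y z" "norm (g y - g z) \<le> B' * dist y z"
      unfolding dist_norm[symmetric] by (auto intro!: f g)
    have "f y * g y - f z * g z = f y * (g y - g z) + (f y - f z) * g z" by (simp add: algebra_simps)
    then have "dist (f y * g y) (f z * g z) \<le> norm (f y * (g y - g z)) + norm ((f y - f z) * g z)"
      unfolding dist_norm by (simp add: norm_triangle_ineq)
    also have "\<dots> \<le> norm (f y) * norm (g y - g z) + norm (f y - f z) * norm (g z)"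
      by (intro add_mono norm_mult_ineq)
    also have "\<dots> \<le> F * (B' * dist y z) + (B * dist y z) * G"
      by (intro add_mono mult_mono bf bg yz d) (use FG f(2) g(2) in auto)
    finally show "dist (f y * g y) (f z * g z) \<le> (F * B' + B * G) * dist y z"
      by (simp add: algebra_simps)
  qed (use f g FG in auto)
qed

lemma locally_lipschitz_sum:
  fixes f :: "'i \<Rightarrow> 'a::metric_space \<Rightarrow> 'b::real_normed_vector"
  assumes "\<And>i. i \<in> A \<Longrightarrow> locally_lipschitz (f i)"
  shows "locally_lipschitz (\<lambda>x. \<Sum>i\<in>A. f i x)"
  using assms
  by (induction A rule: infinite_finite_induct) (auto intro: locally_lipschitz_const locally_lipschitz_add)

definition lipschitz_poly_family :: "nat \<Rightarrow> ('a::metric_space \<Rightarrow> complex poly) \<Rightarrow> bool" where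
  "lipschitz_poly_family m P \<longleftrightarrow>
     (\<forall>h. degree (P h) \<le> m) \<and> (\<forall>i. locally_lipschitz (\<lambda>h. coeff (P h) i))"

lemma lipschitz_poly_family_pderiv:
  assumes "lipschitz_poly_family m P" shows "lipschitz_poly_family m (\<lambda>h. pderiv (P h))"
  unfolding lipschitz_poly_family_def coeff_pderiv
proof (intro conjI allI)
  show "degree (pderiv (P h)) \<le> m" for h
    using assms by (simp add: lipschitz_poly_family_def degree_pderiv le_diff_conv le_SucI)
  show "locally_lipschitz (\<lambda>h. of_nat (Suc i) * coeff (P h) (Suc i))" for i
    by (intro locally_lipschitz_mult locally_lipschitz_const)
       (use assms in \<open>auto simp: lipschitz_poly_family_def\<close>)
qed

lemma lipschitz_poly_family_higher_pderiv:
  assumes "lipschitz_poly_family m P" shows "lipschitz_poly_family m (\<lambda>h. (pderiv ^^ j) (P h))"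
  by (induction j) (use assms lipschitz_poly_family_pderiv in auto)

lemma lipschitz_poly_family_mult:
  assumes "lipschitz_poly_family m P" "lipschitz_poly_family n Q"
  shows "lipschitz_poly_family (m + n) (\<lambda>h. P h * Q h)"
  unfolding lipschitz_poly_family_def coeff_mult
proof (intro conjI allI)
  show "degree (P h * Q h) \<le> m + n" for h
    using assms unfolding lipschitz_poly_family_def
    by (intro order_trans[OF degree_mult_le] add_mono) auto
  show "locally_lipschitz (\<lambda>h. \<Sum>j\<le>i. coeff (P h) j * coeff (Q h) (i - j))" for i
    by (intro locally_lipschitz_sum locally_lipschitz_mult)
       (use assms in \<open>auto simp: lipschitz_poly_family_def\<close>)
qed

lemma lipschitz_poly_family_prod:
  assumes "\<And>i. i \<in> A \<Longrightarrow> lipschitz_poly_family 1 (P i)" "finite A"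
  shows "lipschitz_poly_family (card A) (\<lambda>h. \<Prod>i\<in>A. P i h)"
  using assms(2,1)
proof (induction A rule: finite_induct)
  case empty
  then show ?case by (simp add: lipschitz_poly_family_def locally_lipschitz_const)
next
  case (insert i A)
  then show ?case using lipschitz_poly_family_mult[of 1 "P i" "card A"] by simp
qed

lemma poly_eq_sum: "degree p \<le> m \<Longrightarrow> poly p x = (\<Sum>i\<le>m. coeff p i * x ^ i)"
  for x :: "'a::comm_semiring_1"
  unfolding poly_altdef by (rule sum.mono_neutral_left) (auto simp: coeff_eq_0)

lemma lipschitz_poly_family_eval:
  assumes P: "lipschitz_poly_family m P"
  obtains e B where "e > 0" "B \<ge> 0"
    "\<And>h h' s. h \<in> ball h0 e \<Longrightarrow> h' \<in> ball h0 e \<Longrightarrow> s \<in> ball t0 1 \<Longrightarrow>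
       norm (poly (P h) s - poly (P h') s) \<le> B * dist h h'"
proof -
  have "\<exists>e>0. \<exists>B\<ge>0. \<forall>h\<in>ball h0 e. \<forall>h'\<in>ball h0 e. dist (coeff (P h) i) (coeff (P h') i) \<le> B * dist h h'" for i
    using P unfolding lipschitz_poly_family_def locally_lipschitz_def lipschitz_near_def by blast
  then obtain E B where E: "\<And>i. E i > 0" "\<And>i. B i \<ge> 0"
    and EB: "\<And>i h h'. h \<in> ball h0 (E i) \<Longrightarrow> h' \<in> ball h0 (E i) \<Longrightarrow> dist (coeff (P h) i) (coeff (P h') i) \<le> B i * dist h h'"
    by metis
  define e where "e = Min (E ` {..m})"
  define R where "R = norm t0 + 1"
  have e: "e > 0" "\<And>i. i \<le> m \<Longrightarrow> e \<le> E i" using E by (auto simp: e_def)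
  show ?thesis
  proof (rule that)
    show "e > 0" by fact
    show "0 \<le> (\<Sum>i\<le>m. B i * R ^ i)" using E by (auto intro!: sum_nonneg simp: R_def)
    fix h h' s assume h: "h \<in> ball h0 e" "h' \<in> ball h0 e" and s: "s \<in> ball t0 1"
    have "poly (P h) s - poly (P h') s = (\<Sum>i\<le>m. (coeff (P h) i - coeff (P h') i) * s ^ i)"
      using P by (simp add: poly_eq_sum[of _ m] lipschitz_poly_family_def left_diff_distrib sum_subtractf)
    also have "norm \<dots> \<le> (\<Sum>i\<le>m. (B i * dist h h') * R ^ i)"
    proof (rule sum_norm_le)
      fix i assume i: "i \<in> {..m}"
      have sR: "norm s \<le> R" using s norm_triangle_sub[of s t0] by (simp add: R_def dist_norm norm_minus_commute)
      have "dist (coeff (P h) i) (coeff (P h') i) \<le> B i * dist h h'"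
        using h e(2)[of i] i by (intro EB) auto
      then show "norm ((coeff (P h) i - coeff (P h') i) * s ^ i) \<le> (B i * dist h h') * R ^ i"
        unfolding norm_mult norm_power using sR E(2)[of i]
        by (intro mult_mono power_mono) (auto simp: dist_norm R_def)
    qed
    finally show "norm (poly (P h) s - poly (P h') s) \<le> (\<Sum>i\<le>m. B i * R ^ i) * dist h h'"
      by (simp add: sum_distrib_left sum_distrib_right mult_ac)
  qed
qed

text \<open>Near \<open>(h0, t0)\<close> the derivative is within \<open>norm r / 2\<close> of \<open>r\<close>. So the distance of the roots \<open>t\<close> and
  \<open>t'\<close> is at most \<open>2 / norm r\<close> times the value of \<open>P h\<close> at \<open>t'\<close>, which is Lipschitz in the parameter since \<open>P h'\<close> vanishes there.\<close>

lemma simple_root_lipschitz: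
  assumes P: "lipschitz_poly_family m P" and r: "poly (pderiv (P h0)) t0 \<noteq> 0"
  obtains e B where "e > 0" "B \<ge> 0"
    "\<And>h h' t t'. h \<in> ball h0 e \<Longrightarrow> h' \<in> ball h0 e \<Longrightarrow> t \<in> ball t0 e \<Longrightarrow> t' \<in> ball t0 e \<Longrightarrow>
       poly (P h) t = 0 \<Longrightarrow> poly (P h') t' = 0 \<Longrightarrow> dist t t' \<le> B * dist h h'"
proof -
  define r where "r = poly (pderiv (P h0)) t0"
  have nr: "norm r > 0" using r by (simp add: r_def)
  obtain e1 B1 where 1: "e1 > 0" "B1 \<ge> 0"
    "\<And>h h' s. h \<in> ball h0 e1 \<Longrightarrow> h' \<in> ball h0 e1 \<Longrightarrow> s \<in> ball t0 1 \<Longrightarrow>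
       norm (poly (P h) s - poly (P h') s) \<le> B1 * dist h h'"
    using lipschitz_poly_family_eval[OF P, of h0 t0] by metis
  obtain e2 B2 where 2: "e2 > 0" "B2 \<ge> 0"
    "\<And>h h' s. h \<in> ball h0 e2 \<Longrightarrow> h' \<in> ball h0 e2 \<Longrightarrow> s \<in> ball t0 1 \<Longrightarrow>
       norm (poly (pderiv (P h)) s - poly (pderiv (P h')) s) \<le> B2 * dist h h'"
    using lipschitz_poly_family_eval[OF lipschitz_poly_family_pderiv[OF P], of h0 t0] by metis
  have "continuous (at t0) (\<lambda>s. poly (pderiv (P h0)) s)" by simp
  then obtain e3 where 3: "e3 > 0" "\<And>s. dist s t0 < e3 \<Longrightarrow> dist (poly (pderiv (P h0)) s) r < norm r / 4"
    unfolding continuous_at_eps_delta r_def using nr unfolding r_def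
    by (metis divide_pos_pos zero_less_numeral)
  define e4 where "e4 = norm r / (4 * (B2 + 1))"
  have e4: "e4 > 0" "B2 * e4 \<le> norm r / 4" using nr 2(2) by (auto simp: e4_def divide_simps)
  define e where "e = min (min 1 e1) (min e2 (min e3 e4))"
  show ?thesis
  proof (rule that)
    show "e > 0" using 1 2 3 e4 by (simp add: e_def)
    show "0 \<le> B1 * 2 / norm r" using 1(2) by simp
    fix h h' t t' assume h: "h \<in> ball h0 e" "h' \<in> ball h0 e" and t: "t \<in> ball t0 e" "t' \<in> ball t0 e"
      and z: "poly (P h) t = 0" "poly (P h') t' = 0"
    have d: "norm (poly (pderiv (P h)) s - r) \<le> norm r / 2" if "s \<in> ball t0 e" for s
    proof -
      have "norm (poly (pderiv (P h)) s - poly (pderiv (P h0)) s) \<le> B2 * dist h h0"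
        using h that 2(1) by (intro 2) (auto simp: e_def)
      also have "\<dots> \<le> B2 * e4" using h 2(2) by (intro mult_left_mono) (auto simp: e_def dist_commute)
      finally have "norm (poly (pderiv (P h)) s - poly (pderiv (P h0)) s) \<le> norm r / 4" using e4 by simp
      moreover have "norm (poly (pderiv (P h0)) s - r) < norm r / 4"
        using 3(2)[of s] that by (auto simp: e_def dist_norm norm_minus_commute)
      ultimately show ?thesis
        using norm_triangle_ineq[of "poly (pderiv (P h)) s - poly (pderiv (P h0)) s" "poly (pderiv (P h0)) s - r"] by simp
    qed
    have "norm ((poly (P h) t - r * t) - (poly (P h) t' - r * t')) \<le> norm r / 2 * norm (t - t')"
    proof (rule field_differentiable_bound[of "ball t0 e" _ "\<lambda>s. poly (pderiv (P h)) s - r"])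
      show "((\<lambda>s. poly (P h) s - r * s) has_field_derivative poly (pderiv (P h)) s - r) (at s within ball t0 e)" for s
        by (auto intro!: derivative_eq_intros)
    qed (use d t in auto)
    then have "norm (poly (P h) t' - r * (t' - t)) \<le> norm r / 2 * norm (t' - t)"
      using z(1) by (simp add: algebra_simps norm_minus_commute)
    then have "norm (r * (t' - t)) - norm (poly (P h) t') \<le> norm r / 2 * norm (t' - t)"
      using norm_triangle_ineq2[of "r * (t' - t)" "poly (P h) t'"] by (simp add: norm_minus_commute)
    then have "norm r / 2 * norm (t' - t) \<le> norm (poly (P h) t')" by (simp add: norm_mult)
    also have "\<dots> \<le> B1 * dist h h'"
      using 1(3)[of h h' t'] h t z(2) by (auto simp: e_def)
    finally show "dist t t' \<le> B1 * 2 / norm r * dist h h'"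
      using nr by (simp add: dist_norm norm_minus_commute field_simps)
  qed
qed

text \<open>A Lipschitz map from a space of smaller dimension has null image. The set \<open>S\<close> is the graph
  of such a map on a subset of \<open>'a\<close>; a dummy real coordinate turns the subset into a null
  set, to which the theorem on Lipschitz images of null sets applies.\<close>

lemma lipschitz_graph_negligible:
  fixes S :: "('a::euclidean_space \<times> 'b::euclidean_space) set"
  assumes dim: "DIM('a) < DIM('b)"
    and lip: "\<And>x y. x \<in> S \<Longrightarrow> y \<in> S \<Longrightarrow> dist (snd x) (snd y) \<le> B * dist (fst x) (fst y)"
  shows "negligible (snd ` S)"
proof -
  define f :: "'a \<times> real \<Rightarrow> 'b" where "f = (\<lambda>p. SOME t. (fst p, t) \<in> S)"
  have f: "f (h, r) = t" if "(h, t) \<in> S" for h t r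
  proof -
    have "(h, f (h, r)) \<in> S" unfolding f_def by (rule someI2[of _ t]) (use that in auto)
    then show ?thesis using lip[of "(h, f (h, r))" "(h, t)"] that by simp
  qed
  \<comment> \<open>The parameters are embedded in the hyperplane where the dummy coordinate vanishes.\<close>
  have "negligible {x :: 'a \<times> real. (0, 1) \<bullet> x = 0}"
    by (rule negligible_hyperplane) (simp add: zero_prod_def)
  then have "negligible (fst ` S \<times> {0::real})" by (rule negligible_subset) (auto simp: inner_prod_def)
  then have "negligible (f ` (fst ` S \<times> {0}))"
  proof (rule negligible_locally_Lipschitz_image[rotated])
    show "DIM('a \<times> real) \<le> DIM('b)" using dim by simp
    fix x assume "x \<in> fst ` S \<times> {0::real}"
    then obtain h t where x: "x = (h, 0)" "(h, t) \<in> S" by auto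
    have lips: "norm (f y - f x) \<le> B * norm (y - x)" if yS: "y \<in> fst ` S \<times> {0}" for y
    proof -
      obtain h' t' where y: "y = (h', 0)" "(h', t') \<in> S" using yS by auto
      show ?thesis using lip[OF y(2) x(2)] unfolding x(1) y(1) f[OF x(2)] f[OF y(2)]
        by (simp add: dist_norm norm_Pair)
    qed
    show "\<exists>T B. open T \<and> x \<in> T \<and> (\<forall>y\<in>fst ` S \<times> {0} \<inter> T. norm (f y - f x) \<le> B * norm (y - x))"
    proof (rule exI, rule exI, intro conjI ballI)
      show "open (UNIV :: ('a \<times> real) set)" "x \<in> UNIV" by simp_all
      show "norm (f y - f x) \<le> B * norm (y - x)" if "y \<in> fst ` S \<times> {0} \<inter> UNIV" for y
        using that by (intro lips) simp
    qed
  qed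
  moreover have "snd ` S \<subseteq> f ` (fst ` S \<times> {0})"
  proof
    fix t assume "t \<in> snd ` S"
    then obtain h where h: "(h, t) \<in> S" by auto
    then have "(h, 0) \<in> fst ` S \<times> {0::real}" by force
    then show "t \<in> f ` (fst ` S \<times> {0})" using f[OF h] by (metis imageI)
  qed
  ultimately show ?thesis by (rule negligible_subset)
qed

text \<open>At a fixed pattern \<open>j\<close> of multiplicities each \<open>t $ k\<close> is a simple root of a derivative of \<open>G h\<close>
  and hence locally a Lipschitz function of \<open>h\<close>. So the tuples with this pattern are covered by countably
  many Lipschitz images of subsets of the smaller space of parameters.\<close>

lemma common_roots_negligible:
  fixes G :: "'a::euclidean_space \<Rightarrow> complex poly"
  assumes G: "lipschitz_poly_family m G" and dim: "DIM('a) < 2 * CARD('n::finite)"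
  shows "negligible {t :: complex ^ 'n. \<exists>h. G h \<noteq> 0 \<and> (\<forall>k. poly (G h) (t $ k) = 0)}"
proof -
  define Z :: "('n \<Rightarrow> nat) \<Rightarrow> ('a \<times> (complex ^ 'n)) set" where
    "Z j = {(h, t). \<forall>k. poly ((pderiv ^^ j k) (G h)) (t $ k) = 0 \<and>
                        poly (pderiv ((pderiv ^^ j k) (G h))) (t $ k) \<noteq> 0}" for j
  have neg: "negligible (snd ` Z j)" for j
  proof -
    have "\<exists>U. open U \<and> x \<in> U \<and> negligible (snd ` (Z j \<inter> U))" if "x \<in> Z j" for x
    proof -
      obtain h0 t0 where x: "x = (h0, t0)" by force
      have "\<exists>e>0. \<exists>B\<ge>0. \<forall>h\<in>ball h0 e. \<forall>h'\<in>ball h0 e. \<forall>t\<in>ball (t0 $ k) e. \<forall>t'\<in>ball (t0 $ k) e.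
          poly ((pderiv ^^ j k) (G h)) t = 0 \<longrightarrow> poly ((pderiv ^^ j k) (G h')) t' = 0 \<longrightarrow> dist t t' \<le> B * dist h h'" for k
      proof -
        have "poly (pderiv ((pderiv ^^ j k) (G h0))) (t0 $ k) \<noteq> 0" using that by (simp add: Z_def x)
        from simple_root_lipschitz[OF lipschitz_poly_family_higher_pderiv[OF G] this]
        show ?thesis by metis
      qed
      then obtain E B where E: "\<And>k. E k > 0" "\<And>k. B k \<ge> 0"
        and EB: "\<And>k h h' t t'. h \<in> ball h0 (E k) \<Longrightarrow> h' \<in> ball h0 (E k) \<Longrightarrow> t \<in> ball (t0 $ k) (E k) \<Longrightarrow>
          t' \<in> ball (t0 $ k) (E k) \<Longrightarrow> poly ((pderiv ^^ j k) (G h)) t = 0 \<Longrightarrow>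
          poly ((pderiv ^^ j k) (G h')) t' = 0 \<Longrightarrow> dist t t' \<le> B k * dist h h'"
        by metis
      define e where "e = Min (range E)"
      have e: "e > 0" "\<And>k. e \<le> E k" using E by (auto simp: e_def)
      let ?U = "ball h0 e \<times> ball t0 e"
      have "negligible (snd ` (Z j \<inter> ?U))"
      proof (rule lipschitz_graph_negligible[where B = "\<Sum>k\<in>UNIV. B k"])
        show "DIM('a) < DIM(complex ^ 'n)" using dim by (simp add: mult.commute)
        fix y z assume y: "y \<in> Z j \<inter> ?U" and z: "z \<in> Z j \<inter> ?U"
        have comp: "dist (t0 $ k) (s $ k) < E k" if "dist t0 s < e" for s k
          using dist_vec_nth_le[of t0 k s] e(2)[of k] that by simp
        have "dist (snd y $ k) (snd z $ k) \<le> B k * dist (fst y) (fst z)" for k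
          using y z e(2)[of k] by (intro EB) (auto simp: Z_def intro: comp)
        then have "(\<Sum>k\<in>UNIV. dist (snd y $ k) (snd z $ k)) \<le> (\<Sum>k\<in>UNIV. B k * dist (fst y) (fst z))"
          by (rule sum_mono)
        moreover have "dist (snd y) (snd z) \<le> (\<Sum>k\<in>UNIV. dist (snd y $ k) (snd z $ k))"
          unfolding dist_vec_def by (rule L2_set_le_sum) simp
        ultimately show "dist (snd y) (snd z) \<le> (\<Sum>k\<in>UNIV. B k) * dist (fst y) (fst z)"
          by (simp add: sum_distrib_right)
      qed
      then show ?thesis using e(1) x by (intro exI[of _ ?U]) (auto intro: open_Times)
    qed
    then obtain U where U: "\<And>x. x \<in> Z j \<Longrightarrow> open (U x) \<and> x \<in> U x \<and> negligible (snd ` (Z j \<inter> U x))"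
      by metis
    then obtain F where F: "F \<subseteq> U ` Z j" "countable F" "\<Union>F = \<Union>(U ` Z j)"
      using Lindelof[of "U ` Z j"] U by (metis (no_types, lifting) imageE)
    have "negligible (\<Union>((\<lambda>V. snd ` (Z j \<inter> V)) ` F))"
      using F U by (intro negligible_countable_Union) auto
    moreover have "snd ` Z j \<subseteq> \<Union>((\<lambda>V. snd ` (Z j \<inter> V)) ` F)"
    proof
      fix s assume "s \<in> snd ` Z j"
      then obtain x where x: "x \<in> Z j" "s = snd x" by auto
      then have "x \<in> \<Union>F" using U F(3) by blast
      then show "s \<in> \<Union>((\<lambda>V. snd ` (Z j \<inter> V)) ` F)" using x by auto
    qed
    ultimately show ?thesis by (rule negligible_subset)
  qed
  have "negligible (\<Union>(range (\<lambda>j. snd ` Z j)))"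
    using neg by (intro negligible_countable_Union) auto
  moreover have "{t. \<exists>h. G h \<noteq> 0 \<and> (\<forall>k. poly (G h) (t $ k) = 0)} \<subseteq> \<Union>(range (\<lambda>j. snd ` Z j))"
  proof clarify
    fix t :: "complex ^ 'n" and h assume h: "G h \<noteq> 0" "\<forall>k. poly (G h) (t $ k) = 0"
    \<comment> \<open>One less than the multiplicity of the root.\<close>
    have "\<exists>j. poly ((pderiv ^^ j) p) s = 0 \<and> poly (pderiv ((pderiv ^^ j) p)) s \<noteq> 0"
      if "p \<noteq> 0" "poly p s = 0" for p :: "complex poly" and s
    proof (rule ccontr)
      assume no: "\<not> ?thesis"
      have "poly ((pderiv ^^ j) p) s = 0" for j
        by (induction j) (use that no in auto)
      moreover have "poly ((pderiv ^^ degree p) p) s = fact (degree p) * lead_coeff p"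
      proof -
        have "degree ((pderiv ^^ degree p) p) = 0" by (simp add: degree_higher_pderiv)
        then obtain a where a: "(pderiv ^^ degree p) p = [:a:]" by (rule degree_eq_zeroE)
        have "coeff ((pderiv ^^ degree p) p) 0 = fact (degree p) * lead_coeff p"
          by (simp add: coeff_higher_pderiv pochhammer_fact)
        then show ?thesis unfolding a by simp
      qed
      ultimately show False using \<open>p \<noteq> 0\<close> by simp
    qed
    then have "\<forall>k. \<exists>j. poly ((pderiv ^^ j) (G h)) (t $ k) = 0 \<and>
                        poly (pderiv ((pderiv ^^ j) (G h))) (t $ k) \<noteq> 0"
      using h by blast
    from choice[OF this] obtain j where "(h, t) \<in> Z j" unfolding Z_def by auto
    then have "t \<in> snd ` Z j" by (metis image_eqI snd_conv)
    then show "t \<in> \<Union>(range (\<lambda>j. snd ` Z j))" by blast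
  qed
  ultimately show ?thesis by (rule negligible_subset)
qed

section \<open>Implicitly defined roots\<close>

lemma eventually_distinct:
  assumes tend: "\<And>k. ((\<lambda>p. \<tau> p k) \<longlongrightarrow> t k) F" and t: "inj (t :: 'n::finite \<Rightarrow> complex)"
  shows "\<forall>\<^sub>F p in F. \<forall>k l. k \<noteq> l \<longrightarrow> \<tau> p k \<noteq> \<tau> p l"
proof (intro eventually_all_finite)
  fix k l
  show "\<forall>\<^sub>F p in F. k \<noteq> l \<longrightarrow> \<tau> p k \<noteq> \<tau> p l"
  proof (cases "k = l")
    case False
    then have "t k - t l \<noteq> 0" using t by (auto simp: inj_eq)
    with tendsto_diff[OF tend[of k] tend[of l]] have "\<forall>\<^sub>F p in F. \<tau> p k - \<tau> p l \<noteq> 0"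
      by (rule tendsto_imp_eventually_ne)
    then show ?thesis by eventually_elim auto
  qed simp
qed

text \<open>Differentiability is assumed at one point only, so the inverse function theorem does
  not apply. By the open mapping theorem, \<open>f\<close> is open at \<open>x\<close>; choosing preimages nearest to \<open>x\<close>
  gives a right inverse that is continuous at \<open>f x\<close>, and then differentiable there.\<close>

lemma local_right_inverse:
  fixes f :: "'a::euclidean_space \<Rightarrow> 'b::euclidean_space"
  assumes S: "open S" "x \<in> S" "continuous_on S f"
    and der: "(f has_derivative f') (at x)" and lin: "bounded_linear g'"
    and inv: "f' \<circ> g' = id" "g' \<circ> f' = id"
  obtains g T where "open T" "f x \<in> T" "g (f x) = x" "\<And>y. y \<in> T \<Longrightarrow> f (g y) = y"
    "(g has_derivative g') (at (f x))"
proof -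
  obtain e where e: "e > 0" "cball x e \<subseteq> S" using S open_contains_cball by blast
  have int: "f x \<in> interior (f ` ball x d)" if "d > 0" "d \<le> e" for d
    by (rule sussmann_open_mapping[OF S(1,3,2) der lin inv(1)])
       (use that e in \<open>auto simp: interior_open subset_iff\<close>)
  define T where "T = interior (f ` ball x e)"
  define near where "near y w \<longleftrightarrow> w \<in> cball x e \<and> f w = y \<and>
      (\<forall>w'\<in>cball x e. f w' = y \<longrightarrow> dist x w \<le> dist x w')" for y w
  define g where "g y = (SOME w. near y w)" for y
  have near: "near y (g y)" if "y \<in> T" for y
  proof -
    let ?K = "cball x e \<inter> f -` {y}"
    have "y \<in> f ` ball x e" using that interior_subset unfolding T_def by blast
    then obtain w where "w \<in> ball x e" "f w = y" by blast
    then have "w \<in> ?K" by simp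
    then have "?K \<noteq> {}" by blast
    moreover have "closed ?K"
      by (intro continuous_closed_preimage continuous_on_subset[OF S(3) e(2)]) auto
    then have "compact ?K" by (metis compact_Int_closed compact_cball inf.right_idem inf_commute Int_assoc)
    ultimately obtain w where "w \<in> ?K" "\<And>w'. w' \<in> ?K \<Longrightarrow> dist x w \<le> dist x w'"
      using continuous_attains_inf[of ?K "dist x"] continuous_on_dist[OF continuous_on_const continuous_on_id]
      by blast
    then have "near y w" by (auto simp: near_def)
    then show ?thesis unfolding g_def by (rule someI)
  qed
  have fxT: "f x \<in> T" unfolding T_def using int e(1) by simp
  have gx: "g (f x) = x"
    using near[OF fxT] e(1) by (auto simp: near_def dest: bspec[of _ _ x])
  have "continuous (at (f x)) g"
    unfolding continuous_at tendsto_def gx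
  proof (intro allI impI)
    fix S' assume S': "open S'" "x \<in> S'"
    then obtain d0 where d0: "d0 > 0" "ball x d0 \<subseteq> S'" using open_contains_ball by blast
    define d where "d = min d0 e"
    have d: "d > 0" "d \<le> e" using d0 e by (auto simp: d_def)
    have "open (interior (f ` ball x d) \<inter> T)" "f x \<in> interior (f ` ball x d) \<inter> T"
      using int[OF d] fxT by (auto simp: T_def)
    then have "\<forall>\<^sub>F y in nhds (f x). y \<in> interior (f ` ball x d) \<inter> T" by (rule eventually_nhds_in_open)
    then show "\<forall>\<^sub>F y in at (f x). g y \<in> S'"
      unfolding eventually_at_filter
    proof eventually_elim
      case (elim y)
      then obtain w where w: "w \<in> ball x d" "y = f w" using interior_subset by blast
      then have "dist x (g y) \<le> dist x w"
        using near[of y] elim d by (auto simp: near_def)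
      then show ?case using w d0 by (auto simp: d_def)
    qed
  qed
  then have "(g has_derivative g') (at (f x))"
    by (rule has_derivative_inverse_basic_x[where T = T and g = g, OF der lin inv(2) _ gx _ fxT])
       (use near in \<open>auto simp: near_def T_def\<close>)
  then show ?thesis using fxT gx near by (intro that[of T g]) (auto simp: near_def T_def)
qed

text \<open>The right inverse of \<open>(u, s) \<mapsto> (u, R u s)\<close>, evaluated at \<open>(u, 0)\<close>.\<close>

lemma implicit_root:
  fixes R :: "'a::euclidean_space \<Rightarrow> complex \<Rightarrow> complex"
  assumes W: "open W" "(z, t0) \<in> W" "continuous_on W (\<lambda>p. R (fst p) (snd p))"
    and root: "R z t0 = 0"
    and der: "((\<lambda>p. R (fst p) (snd p)) has_derivative (\<lambda>p. D (fst p) + r * snd p)) (at (z, t0))"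
    and r: "r \<noteq> 0"
  obtains \<tau> N where "open N" "z \<in> N" "\<tau> z = t0" "\<And>u. u \<in> N \<Longrightarrow> R u (\<tau> u) = 0"
    "(\<tau> has_derivative (\<lambda>v. - D v / r)) (at z)"
proof -
  let ?f = "\<lambda>p. (fst p, R (fst p) (snd p))"
  let ?f' = "\<lambda>p. (fst p, D (fst p) + r * snd p)"
  let ?g' = "\<lambda>q. (fst q, (snd q - D (fst q)) / r)"
  have "bounded_linear (\<lambda>p::'a \<times> complex. D (fst p) + r * snd p)"
    using der by (rule has_derivative_bounded_linear)
  from bounded_linear_compose[OF this bounded_linear_Pair[OF bounded_linear_ident bounded_linear_zero]]
  have D: "bounded_linear D" by simp
  have der': "(?f has_derivative ?f') (at (z, t0))"
    by (intro has_derivative_Pair der) (auto intro!: derivative_eq_intros)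
  have lin: "bounded_linear ?g'"
    by (intro bounded_linear_Pair bounded_linear_fst bounded_linear_compose[OF bounded_linear_divide]
        bounded_linear_sub bounded_linear_snd bounded_linear_compose[OF D])
  obtain g T where g: "open T" "?f (z, t0) \<in> T" "g (?f (z, t0)) = (z, t0)"
      "\<And>y. y \<in> T \<Longrightarrow> ?f (g y) = y" "(g has_derivative ?g') (at (?f (z, t0)))"
    by (rule local_right_inverse[OF W(1,2) _ der' lin])
       (use r W(3) in \<open>auto simp: fun_eq_iff intro!: continuous_intros\<close>)
  define \<tau> where "\<tau> u = snd (g (u, 0))" for u
  define N where "N = (\<lambda>u. (u, 0)) -` T"
  show ?thesis
  proof (rule that)
    show "open N" unfolding N_def by (intro open_vimage g(1)) (auto intro!: continuous_intros)
    show "z \<in> N" "\<tau> z = t0" using g(2,3) root by (auto simp: N_def \<tau>_def)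
    show "R u (\<tau> u) = 0" if "u \<in> N" for u
      using g(4)[of "(u, 0)"] that by (auto simp: N_def \<tau>_def)
    have "(g has_derivative ?g') (at (z, 0))" using g(5) root by simp
    moreover have "((\<lambda>u. (u, 0::complex)) has_derivative (\<lambda>v. (v, 0))) (at z)"
      by (intro has_derivative_Pair has_derivative_ident has_derivative_const)
    ultimately have "((\<lambda>u. g (u, 0)) has_derivative (\<lambda>v. ?g' (v, 0))) (at z)"
      by (rule has_derivative_compose[rotated])
    from has_derivative_snd[OF this]
    show "(\<tau> has_derivative (\<lambda>v. - D v / r)) (at z)" by (simp add: \<tau>_def[abs_def])
  qed
qed

section \<open>Diagonalized pencils of quadratic forms\<close>

lemma vec_eqI: "(\<And>i. x $ i = y $ i) \<Longrightarrow> x = y"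
  by (simp add: vec_eq_iff)

lemma invertible_mat_1: "invertible (mat 1 :: 'a::field ^ 'n ^ 'n)"
  unfolding invertible_def by (metis matrix_mul_lid)

lemma matrix_inv:
  fixes A :: "'a::field ^ 'n ^ 'n"
  assumes "invertible A"
  shows "A ** matrix_inv A = mat 1" "matrix_inv A ** A = mat 1"
  using someI_ex[of "\<lambda>B. A ** B = mat 1 \<and> B ** A = mat 1"] assms
  unfolding invertible_def matrix_inv_def by auto

lemma invertible_matrix_inv: "invertible A \<Longrightarrow> invertible (matrix_inv A)" for A :: "'a::field ^ 'n ^ 'n"
  using matrix_inv[of A] unfolding invertible_def by metis

definition diag_form :: "('n::finite \<Rightarrow> complex) \<Rightarrow> complex ^ 'n \<Rightarrow> complex" where
  "diag_form c v = (\<Sum>k\<in>UNIV. c k * (v $ k)\<^sup>2)"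

lemma quadratic_form_diag_form_comp: "quadratic_form (\<lambda>v. diag_form c (B *v v))"
  unfolding quadratic_form_def
proof
  let ?A = "\<chi> i j. \<Sum>k\<in>UNIV. c k * B $ k $ i * B $ k $ j"
  show "(\<lambda>v. diag_form c (B *v v)) = quad_form ?A"
  proof
    fix v
    have "diag_form c (B *v v) =
        (\<Sum>k\<in>UNIV. \<Sum>i\<in>UNIV. \<Sum>j\<in>UNIV. c k * B $ k $ i * B $ k $ j * v $ i * v $ j)"
      unfolding diag_form_def matrix_vector_mult_def power2_eq_square
      by (simp add: sum_product sum_distrib_left mult_ac)
    also have "\<dots> = (\<Sum>i\<in>UNIV. \<Sum>k\<in>UNIV. \<Sum>j\<in>UNIV. c k * B $ k $ i * B $ k $ j * v $ i * v $ j)"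
      by (rule sum.swap)
    also have "\<dots> = (\<Sum>i\<in>UNIV. \<Sum>j\<in>UNIV. \<Sum>k\<in>UNIV. c k * B $ k $ i * B $ k $ j * v $ i * v $ j)"
      by (intro sum.cong refl sum.swap)
    also have "\<dots> = quad_form ?A v"
      by (simp add: quad_form_def sum_distrib_right)
    finally show "diag_form c (B *v v) = quad_form ?A v" .
  qed
qed

lemma quad_form_diagonal: "quad_form (\<chi> i j. if i = j then c i else 0) = diag_form c"
proof
  fix v :: "complex ^ 'a"
  have "(\<Sum>j\<in>UNIV. (if i = j then c i else 0) * v $ i * v $ j) = c i * (v $ i)\<^sup>2" for i
    by (subst sum.remove[of _ i]) (auto simp: power2_eq_square)
  then show "quad_form (\<chi> i j. if i = j then c i else 0) v = diag_form c v"
    by (simp add: quad_form_def diag_form_def)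
qed

lemma polar_diag_form:
  assumes "\<And>z. q (E *v z) = diag_form c z"
  shows "polar q (E *v z) (E *v w) = (\<Sum>k\<in>UNIV. c k * z $ k * w $ k)"
proof -
  have "polar q (E *v z) (E *v w) = (diag_form c (z + w) - diag_form c z - diag_form c w) / 2"
    unfolding polar_def matrix_vector_right_distrib[symmetric] assms ..
  also have "\<dots> = (\<Sum>k\<in>UNIV. 2 * (c k * z $ k * w $ k)) / 2"
    unfolding diag_form_def sum_subtractf[symmetric]
    by (intro arg_cong2[where f = "(/)"] sum.cong refl) (simp add: power2_eq_square algebra_simps)
  finally show ?thesis by (simp flip: sum_distrib_left)
qed

lemma matrix_vector_mult_sum: "A *v (\<Sum>k\<in>S. f k) = (\<Sum>k\<in>S. A *v f k)" for A :: "'a::field ^ 'n ^ 'm"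
  by (rule vec.linear_sum[OF matrix_vector_mul_linear_gen])

text \<open>The columns of \<open>E\<close> are orthogonal for both forms, the \<open>k\<close>-th one with values \<open>t k * d k\<close> and \<open>d k\<close>.\<close>

definition diagonal_pair ::
    "(complex ^ 'n \<Rightarrow> complex) \<Rightarrow> (complex ^ 'n \<Rightarrow> complex) \<Rightarrow> ('n::finite \<Rightarrow> complex) \<Rightarrow>
     complex ^ 'n ^ 'n \<Rightarrow> ('n \<Rightarrow> complex) \<Rightarrow> bool" where
  "diagonal_pair q1 q2 t E d \<longleftrightarrow> inj t \<and> (\<forall>k. d k \<noteq> 0) \<and> invertible E \<and>
     (\<forall>z. q1 (E *v z) = diag_form (\<lambda>k. t k * d k) z) \<and> (\<forall>z. q2 (E *v z) = diag_form d z)"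

lemma invertible_surj:
  fixes E :: "complex ^ 'n ^ 'n"
  assumes "invertible E" obtains z where "v = E *v z"
proof
  show "v = E *v (matrix_inv E *v v)"
    by (simp add: matrix_vector_mul_assoc matrix_inv(1)[OF assms])
qed

lemma invertible_eq_0:
  fixes E :: "complex ^ 'n ^ 'n"
  assumes "invertible E" shows "E *v z = 0 \<longleftrightarrow> z = 0"
  using assms matrix_left_invertible_ker[of E] unfolding invertible_left_inverse by auto

lemma invertible_inj:
  fixes E :: "complex ^ 'n ^ 'n"
  assumes "invertible E" shows "E *v z = E *v w \<longleftrightarrow> z = w"
  using invertible_eq_0[OF assms, of "z - w"] by (simp add: matrix_vector_mult_diff_distrib)

lemma diagonal_pair_comb:
  assumes "diagonal_pair q1 q2 t E d"
  shows "s * q1 (E *v z) + r * q2 (E *v z) = diag_form (\<lambda>k. (s * t k + r) * d k) z"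
  using assms unfolding diagonal_pair_def diag_form_def
  by (simp add: sum_distrib_left sum.distrib[symmetric] algebra_simps)

lemma diagonal_pair_polar:
  assumes "diagonal_pair q1 q2 t E d"
  shows "polar (\<lambda>v. s * q1 v + r * q2 v) (E *v z) (E *v w)
         = (\<Sum>k\<in>UNIV. (s * t k + r) * d k * z $ k * w $ k)"
  by (rule polar_diag_form[OF diagonal_pair_comb[OF assms]])

lemma sum_axis:
  fixes c :: "'n::finite \<Rightarrow> 'a::comm_semiring_1"
  shows "(\<Sum>k\<in>UNIV. c k * axis j 1 $ k) = c j"
  by (subst sum.remove[of _ j]) (auto simp: axis_def)

lemma diag_form_axis: "diag_form c (axis k 1) = c k"
  unfolding diag_form_def by (subst sum.remove[of _ k]) (auto simp: axis_def)

lemma diagonal_pair_degenerate: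
  assumes "diagonal_pair q1 q2 t E d"
  shows "degenerate (\<lambda>v. s * q1 v + r * q2 v) \<longleftrightarrow> (\<exists>k. s * t k + r = 0)"
proof
  assume "degenerate (\<lambda>v. s * q1 v + r * q2 v)"
  then obtain u where u: "u \<noteq> 0" "\<And>v. polar (\<lambda>v. s * q1 v + r * q2 v) u v = 0"
    unfolding degenerate_def by auto
  have E: "invertible E" using assms by (simp add: diagonal_pair_def)
  obtain z where z: "u = E *v z" using invertible_surj[OF E] by metis
  then obtain k where k: "z $ k \<noteq> 0" using u(1) by (metis vec_eq_iff zero_index matrix_vector_mult_0_right)
  have "(s * t k + r) * d k * z $ k = 0"
    using u(2)[of "E *v axis k 1"] unfolding z diagonal_pair_polar[OF assms] sum_axis .
  then show "\<exists>k. s * t k + r = 0" using k assms by (auto simp: diagonal_pair_def)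
next
  assume "\<exists>k. s * t k + r = 0"
  then obtain k where k: "s * t k + r = 0" by auto
  have E: "invertible E" using assms by (simp add: diagonal_pair_def)
  show "degenerate (\<lambda>v. s * q1 v + r * q2 v)"
    unfolding degenerate_def
  proof (intro exI[of _ "E *v axis k 1"] conjI allI)
    show "E *v axis k 1 \<noteq> 0" by (simp add: invertible_eq_0[OF E] axis_eq_0_iff)
    fix v
    obtain w where w: "v = E *v w" using invertible_surj[OF E] by metis
    show "polar (\<lambda>v. s * q1 v + r * q2 v) (E *v axis k 1) v = 0"
      unfolding w diagonal_pair_polar[OF assms] using k by (intro sum.neutral) (auto simp: axis_def)
  qed
qed

lemma diagonal_pair_zero:
  assumes "diagonal_pair q1 q2 t E d" and "\<And>v. s * q1 v + r * q2 v = 0"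
  shows "s * t k + r = 0"
proof -
  have "(s * t k + r) * d k = 0"
    using assms(2)[of "E *v axis k 1"] unfolding diagonal_pair_comb[OF assms(1)] diag_form_axis .
  then show ?thesis using assms(1) by (simp add: diagonal_pair_def)
qed

lemma two_indices:
  assumes "CARD('n::finite) \<ge> 2"
  obtains i j :: "'n::finite" where "i \<noteq> j"
proof -
  have "\<not> (\<forall>i j :: 'n. i = j)"
  proof
    assume "\<forall>i j :: 'n. i = j"
    then have "(UNIV :: 'n set) \<subseteq> {undefined}" by auto
    then have "CARD('n) \<le> card {undefined :: 'n}" by (intro card_mono) auto
    then show False using assms by simp
  qed
  then show ?thesis using that by auto
qed

lemma linear_zero_at_two:
  fixes s :: "'a::field"
  assumes "s * u + r = 0" "s * v + r = 0" "u \<noteq> v"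
  shows "s = 0" "r = 0"
proof -
  have "s * (u - v) = (s * u + r) - (s * v + r)" by (simp add: algebra_simps)
  then show "s = 0" using assms by simp
  then show "r = 0" using assms by simp
qed

lemma diagonal_pair_independent:
  assumes "diagonal_pair q1 q2 t (E :: complex ^ 'n ^ 'n) d" and "CARD('n) \<ge> 2"
  shows "forms_independent q1 q2"
  unfolding forms_independent_def
proof (intro allI impI)
  fix s r assume z: "\<forall>v. s * q1 v + r * q2 v = 0"
  obtain i j :: 'n where "i \<noteq> j" using two_indices[OF assms(2)] .
  moreover have "inj t" using assms(1) by (simp add: diagonal_pair_def)
  ultimately have "t i \<noteq> t j" by (simp add: inj_eq)
  then show "s = 0 \<and> r = 0"
    using linear_zero_at_two[of s "t i" r "t j"] diagonal_pair_zero[OF assms(1)] z by metis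
qed

lemma diagonal_pair_quadratic:
  assumes "diagonal_pair q1 q2 t E d"
  shows "quadratic_form q1" "quadratic_form q2"
proof -
  have E: "invertible E" using assms by (simp add: diagonal_pair_def)
  have v: "v = E *v (matrix_inv E *v v)" for v
    by (simp add: matrix_vector_mul_assoc matrix_inv(1)[OF E])
  have "q1 = (\<lambda>v. diag_form (\<lambda>k. t k * d k) (matrix_inv E *v v))"
    using assms v unfolding diagonal_pair_def by (metis (no_types, lifting) ext)
  then show "quadratic_form q1" by (metis quadratic_form_diag_form_comp)
  have "q2 = (\<lambda>v. diag_form d (matrix_inv E *v v))"
    using assms v unfolding diagonal_pair_def by (metis (no_types, lifting) ext)
  then show "quadratic_form q2" by (metis quadratic_form_diag_form_comp)
qed

lemma forms_independent_inject:
  assumes "forms_independent q r"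
    and "(\<lambda>v. s * q v + t * r v) = (\<lambda>v. s' * q v + t' * r v)"
  shows "s = s'" "t = t'"
proof -
  have "(s - s') * q v + (t - t') * r v = 0" for v
    using fun_cong[OF assms(2), of v] by (simp add: algebra_simps)
  then show "s = s'" "t = t'" using assms(1) unfolding forms_independent_def by (metis eq_iff_diff_eq_0)+
qed

lemma form_line_eqD: "form_line q = form_line r \<Longrightarrow> \<exists>c. q = (\<lambda>v. c * r v)"
proof -
  assume "form_line q = form_line r"
  moreover have "q \<in> form_line q" unfolding form_line_def by (auto intro: exI[of _ 1])
  ultimately show ?thesis unfolding form_line_def by auto
qed

lemma form_line_scale: "c \<noteq> 0 \<Longrightarrow> form_line (\<lambda>v. c * q v) = form_line q"
  unfolding form_line_def
proof (intro set_eqI iffI; clarify)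
  show "\<exists>ca. (\<lambda>v. a * (c * q v)) = (\<lambda>v. ca * q v) \<and> True" for a
    by (intro exI[of _ "a * c"]) (auto simp: mult_ac)
  show "\<exists>ca. (\<lambda>v. a * q v) = (\<lambda>v. ca * (c * q v)) \<and> True" if "c \<noteq> 0" for a
    using that by (intro exI[of _ "a / c"]) auto
qed

lemma diagonal_pair_degenerate_elements:
  assumes dp: "diagonal_pair q1 q2 t (E :: complex ^ 'n ^ 'n) d" and n: "CARD('n) \<ge> 2"
  shows "degenerate_elements (forms_span q1 q2) = (\<lambda>k. form_line (\<lambda>v. q1 v - t k * q2 v)) ` UNIV"
    and "inj (\<lambda>k. form_line (\<lambda>v. q1 v - t k * q2 v))"
proof -
  note ind = diagonal_pair_independent[OF dp n]
  have t: "inj t" using dp by (simp add: diagonal_pair_def)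
  have el: "(\<lambda>v. q1 v - t k * q2 v) = (\<lambda>v. 1 * q1 v + (- t k) * q2 v)" for k by simp
  have nz: "(\<lambda>v. q1 v - t k * q2 v) \<noteq> (\<lambda>v. 0)" for k
  proof
    assume "(\<lambda>v. q1 v - t k * q2 v) = (\<lambda>v. 0)"
    then have "(\<lambda>v. 1 * q1 v + (- t k) * q2 v) = (\<lambda>v. 0 * q1 v + 0 * q2 v)" by simp
    from forms_independent_inject(1)[OF ind this] show False by simp
  qed
  show "degenerate_elements (forms_span q1 q2) = (\<lambda>k. form_line (\<lambda>v. q1 v - t k * q2 v)) ` UNIV"
  proof (intro set_eqI iffI)
    fix l assume "l \<in> degenerate_elements (forms_span q1 q2)"
    then obtain q where q: "l = form_line q" "q \<in> forms_span q1 q2" "q \<noteq> (\<lambda>v. 0)" "degenerate q"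
      unfolding degenerate_elements_def by auto
    then obtain s r where sr: "q = (\<lambda>v. s * q1 v + r * q2 v)" unfolding forms_span_def by auto
    then obtain k where k: "s * t k + r = 0" using q(4) diagonal_pair_degenerate[OF dp] by auto
    then have r: "r = - s * t k" by (simp add: add_eq_0_iff)
    have "s \<noteq> 0" using q(3) sr r by auto
    moreover have "q = (\<lambda>v. s * (q1 v - t k * q2 v))" unfolding sr r by (auto simp: algebra_simps)
    ultimately show "l \<in> (\<lambda>k. form_line (\<lambda>v. q1 v - t k * q2 v)) ` UNIV"
      using q(1) form_line_scale[of s "\<lambda>v. q1 v - t k * q2 v"] by auto
  next
    fix l assume "l \<in> (\<lambda>k. form_line (\<lambda>v. q1 v - t k * q2 v)) ` UNIV"
    then obtain k where l: "l = form_line (\<lambda>v. q1 v - t k * q2 v)" by auto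
    have "degenerate (\<lambda>v. q1 v - t k * q2 v)" unfolding el diagonal_pair_degenerate[OF dp] by auto
    moreover have "(\<lambda>v. q1 v - t k * q2 v) \<in> forms_span q1 q2"
      unfolding el forms_span_def by blast
    ultimately show "l \<in> degenerate_elements (forms_span q1 q2)"
      unfolding degenerate_elements_def l using nz by blast
  qed
  show "inj (\<lambda>k. form_line (\<lambda>v. q1 v - t k * q2 v))"
  proof (rule injI)
    fix k j assume "form_line (\<lambda>v. q1 v - t k * q2 v) = form_line (\<lambda>v. q1 v - t j * q2 v)"
    from form_line_eqD[OF this]
    obtain c where c: "(\<lambda>v. q1 v - t k * q2 v) = (\<lambda>v. c * (q1 v - t j * q2 v))" by blast
    have "(\<lambda>v. 1 * q1 v + (- t k) * q2 v) = (\<lambda>v. c * q1 v + (- c * t j) * q2 v)"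
    proof
      fix v
      show "1 * q1 v + (- t k) * q2 v = c * q1 v + (- c * t j) * q2 v"
        using fun_cong[OF c, of v] by (simp add: algebra_simps)
    qed
    from forms_independent_inject[OF ind this] show "k = j" using t by (simp add: inj_eq)
  qed
qed

text \<open>The degenerate elements are \<open>q1 - t k * q2\<close>, one for each \<open>k\<close>.\<close>

lemma diagonal_pair_nonsingular:
  assumes dp: "diagonal_pair q1 q2 t (E :: complex ^ 'n ^ 'n) d" and n: "CARD('n) \<ge> 2"
  shows "nonsingular_pencil (forms_span q1 q2)"
  unfolding nonsingular_pencil_def
proof (intro conjI)
  show "pencil (forms_span q1 q2)"
    unfolding pencil_def using diagonal_pair_quadratic[OF dp] diagonal_pair_independent[OF dp n] by blast
  have "\<not> degenerate (\<lambda>v. 0 * q1 v + 1 * q2 v)" unfolding diagonal_pair_degenerate[OF dp] by simp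
  moreover have "(\<lambda>v. 0 * q1 v + 1 * q2 v) \<in> forms_span q1 q2" unfolding forms_span_def by blast
  ultimately show "\<exists>q\<in>forms_span q1 q2. \<not> degenerate q" by blast
  show "card (degenerate_elements (forms_span q1 q2)) = CARD('n)"
    unfolding diagonal_pair_degenerate_elements(1)[OF dp n]
    by (rule card_image[OF diagonal_pair_degenerate_elements(2)[OF dp n]])
qed

section \<open>Classes of pencils\<close>

lemma pullback_forms_span:
  "pullback T (forms_span q r) = forms_span (\<lambda>v. q (T *v v)) (\<lambda>v. r (T *v v))"
proof (intro set_eqI iffI)
  fix f assume "f \<in> pullback T (forms_span q r)"
  then show "f \<in> forms_span (\<lambda>v. q (T *v v)) (\<lambda>v. r (T *v v))"
    unfolding pullback_def forms_span_def by auto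
next
  fix f assume "f \<in> forms_span (\<lambda>v. q (T *v v)) (\<lambda>v. r (T *v v))"
  then obtain s t where f: "f = (\<lambda>v. s * q (T *v v) + t * r (T *v v))" unfolding forms_span_def by auto
  have "(\<lambda>v. s * q v + t * r v) \<in> forms_span q r" unfolding forms_span_def by blast
  then show "f \<in> pullback T (forms_span q r)" unfolding pullback_def f by (rule rev_image_eqI) simp
qed

lemma pullback_pullback: "pullback S (pullback T \<Phi>) = pullback (T ** S) \<Phi>"
  unfolding pullback_def image_image by (simp add: matrix_vector_mul_assoc)

lemma pullback_mat_1: "pullback (mat 1) \<Phi> = \<Phi>"
  unfolding pullback_def by simp

lemma equiv_pencil_rel: "equiv {\<Phi> :: (complex ^ 'n \<Rightarrow> complex) set. nonsingular_pencil \<Phi>} pencil_rel"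
proof (rule equivI)
  let ?r = "pencil_rel :: ((complex ^ 'n \<Rightarrow> complex) set \<times> (complex ^ 'n \<Rightarrow> complex) set) set"
  show "?r \<subseteq> {\<Phi>. nonsingular_pencil \<Phi>} \<times> {\<Phi>. nonsingular_pencil \<Phi>}"
    by (auto simp: pencil_rel_def)
  show "refl_on {\<Phi>. nonsingular_pencil \<Phi>} ?r"
    by (rule refl_onI) (auto simp: pencil_rel_def pullback_mat_1 intro!: exI[of _ "mat 1"] invertible_mat_1)
  show "sym ?r"
  proof (rule symI)
    fix \<Phi> \<Psi> :: "(complex ^ 'n \<Rightarrow> complex) set" assume "(\<Phi>, \<Psi>) \<in> pencil_rel"
    then obtain T where T: "nonsingular_pencil \<Phi>" "nonsingular_pencil \<Psi>" "invertible T" "\<Psi> = pullback T \<Phi>"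
      by (auto simp: pencil_rel_def)
    then have "\<Phi> = pullback (matrix_inv T) \<Psi>"
      by (simp add: pullback_pullback matrix_inv pullback_mat_1)
    moreover have "invertible (matrix_inv T)"
      using T(3) by (rule invertible_matrix_inv)
    ultimately show "(\<Psi>, \<Phi>) \<in> pencil_rel" using T by (auto simp: pencil_rel_def)
  qed
  show "trans ?r"
  proof (rule transI)
    fix \<Phi> \<Psi> \<Theta> :: "(complex ^ 'n \<Rightarrow> complex) set"
    assume "(\<Phi>, \<Psi>) \<in> pencil_rel" "(\<Psi>, \<Theta>) \<in> pencil_rel"
    then obtain T S where T: "invertible T" "\<Psi> = pullback T \<Phi>" and S: "invertible S" "\<Theta> = pullback S \<Psi>"
      and ns: "nonsingular_pencil \<Phi>" "nonsingular_pencil \<Theta>"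
      unfolding pencil_rel_def by blast
    have "\<Theta> = pullback (T ** S) \<Phi>" unfolding S(2) T(2) pullback_pullback ..
    then show "(\<Phi>, \<Theta>) \<in> pencil_rel"
      using ns invertible_mult[OF T(1) S(1)] unfolding pencil_rel_def by blast
  qed
qed

lemma pencil_class_eq_iff:
  assumes "nonsingular_pencil \<Psi>"
  shows "pencil_class \<Phi> = pencil_class \<Psi> \<longleftrightarrow> (\<Phi>, \<Psi>) \<in> pencil_rel"
proof
  assume "pencil_class \<Phi> = pencil_class \<Psi>"
  moreover have "\<Psi> \<in> pencil_class \<Psi>"
    using equiv_class_self[OF equiv_pencil_rel] assms by (simp add: pencil_class_def)
  ultimately have "\<Psi> \<in> pencil_class \<Phi>" by simp
  then show "(\<Phi>, \<Psi>) \<in> pencil_rel" by (simp add: pencil_class_def)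
next
  assume "(\<Phi>, \<Psi>) \<in> pencil_rel"
  then show "pencil_class \<Phi> = pencil_class \<Psi>"
    unfolding pencil_class_def by (rule equiv_class_eq[OF equiv_pencil_rel])
qed

text \<open>Up to equivalence, every nonsingular pencil is of this form.\<close>

definition model_pencil :: "('n::finite \<Rightarrow> complex) \<Rightarrow> (complex ^ 'n \<Rightarrow> complex) set" where
  "model_pencil t = forms_span (diag_form t) (diag_form (\<lambda>_. 1))"

lemma model_diagonal_pair: "inj t \<Longrightarrow> diagonal_pair (diag_form t) (diag_form (\<lambda>_. 1)) t (mat 1) (\<lambda>_. 1)"
  by (simp add: diagonal_pair_def invertible_mat_1)

lemma diagonal_matrix_mult: "(\<chi> i j. if i = j then c i else 0) *v v = (\<chi> i. c i * v $ i)"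
  for v :: "'a::comm_ring_1 ^ 'n::finite"
proof (rule vec_eqI)
  fix i
  show "((\<chi> i j. if i = j then c i else 0) *v v) $ i = (\<chi> i. c i * v $ i) $ i"
    unfolding matrix_vector_mult_def by (simp, subst sum.remove[of _ i]) auto
qed

lemma invertible_diagonal:
  fixes c :: "'n::finite \<Rightarrow> 'a::field"
  assumes "\<And>i. c i \<noteq> 0" shows "invertible (\<chi> i j. if i = j then c i else 0)"
  unfolding invertible_left_inverse matrix_left_invertible_ker diagonal_matrix_mult
  using assms by (auto simp: vec_eq_iff)

lemma diagonal_pair_class:
  assumes dp: "diagonal_pair q1 q2 t (E :: complex ^ 'n ^ 'n) d" and n: "CARD('n) \<ge> 2"
  shows "pencil_class (forms_span q1 q2) = pencil_class (model_pencil t)"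
proof -
  have t: "inj t" and d: "\<And>k. d k \<noteq> 0" and E: "invertible E"
    and q: "\<And>z. q1 (E *v z) = diag_form (\<lambda>k. t k * d k) z" "\<And>z. q2 (E *v z) = diag_form d z"
    using dp by (auto simp: diagonal_pair_def)
  define S :: "complex ^ 'n ^ 'n" where "S = (\<chi> i j. if i = j then 1 / csqrt (d i) else 0)"
  have S: "invertible S" unfolding S_def using d by (intro invertible_diagonal) simp
  have Sc: "diag_form c (S *v v) = diag_form (\<lambda>k. c k / d k) v" for c v
    unfolding S_def diagonal_matrix_mult diag_form_def by (simp add: power_mult_distrib power_divide)
  have "pullback (E ** S) (forms_span q1 q2) = model_pencil t"
    unfolding pullback_forms_span model_pencil_def
    by (simp add: matrix_vector_mul_assoc[symmetric] q Sc d del: matrix_vector_mul_assoc)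
  moreover have ns: "nonsingular_pencil (model_pencil t)"
    unfolding model_pencil_def by (rule diagonal_pair_nonsingular[OF model_diagonal_pair[OF t] n])
  ultimately have "(forms_span q1 q2, model_pencil t) \<in> pencil_rel"
    unfolding pencil_rel_def using invertible_mult[OF E S] diagonal_pair_nonsingular[OF dp n] by auto
  then show ?thesis using pencil_class_eq_iff[OF ns] by simp
qed

lemma forms_span_change:
  assumes "a * e - b * g \<noteq> 0"
  shows "forms_span (\<lambda>v. a * q v + b * r v) (\<lambda>v. g * q v + e * r v) = forms_span q r" (is "?L = ?R")
proof (intro set_eqI iffI)
  fix f assume "f \<in> ?L"
  then obtain s t where "f = (\<lambda>v. s * (a * q v + b * r v) + t * (g * q v + e * r v))"
    unfolding forms_span_def by auto
  then have "f = (\<lambda>v. (s * a + t * g) * q v + (s * b + t * e) * r v)" by (simp add: algebra_simps)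
  then show "f \<in> ?R" unfolding forms_span_def by blast
next
  fix f assume "f \<in> ?R"
  then obtain s t where f: "f = (\<lambda>v. s * q v + t * r v)" unfolding forms_span_def by auto
  let ?D = "a * e - b * g"
  let ?s = "(s * e - t * g) / ?D" and ?t = "(t * a - s * b) / ?D"
  have 1: "?s * a + ?t * g = s"
  proof -
    have "?s * a + ?t * g = ((s * e - t * g) * a + (t * a - s * b) * g) / ?D"
      by (simp add: add_divide_distrib)
    also have "(s * e - t * g) * a + (t * a - s * b) * g = s * ?D" by (simp add: algebra_simps)
    finally show ?thesis using assms by simp
  qed
  have 2: "?s * b + ?t * e = t"
  proof -
    have "?s * b + ?t * e = ((s * e - t * g) * b + (t * a - s * b) * e) / ?D"
      by (simp add: add_divide_distrib)
    also have "(s * e - t * g) * b + (t * a - s * b) * e = t * ?D" by (simp add: algebra_simps)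
    finally show ?thesis using assms by simp
  qed
  have "f = (\<lambda>v. ?s * (a * q v + b * r v) + ?t * (g * q v + e * r v))"
  proof
    fix v
    have "?s * (a * q v + b * r v) + ?t * (g * q v + e * r v)
        = (?s * a + ?t * g) * q v + (?s * b + ?t * e) * r v" by (simp only: algebra_simps)
    then show "f v = ?s * (a * q v + b * r v) + ?t * (g * q v + e * r v)"
      unfolding 1 2 f by simp
  qed
  then show "f \<in> ?L" unfolding forms_span_def by blast
qed

text \<open>Dividing the \<open>k\<close>-th coefficient pair \<open>(a * t k + b, g * t k + e)\<close> by its second entry is a diagonal
  change of coordinates, and replacing \<open>(t k, 1)\<close> by that pair is a change of basis of the pencil.\<close>

lemma model_class_moebius:
  fixes t s :: "'n::finite \<Rightarrow> complex"
  assumes t: "inj t" and s: "\<And>k. s k * (g * t k + e) = a * t k + b"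
    and det: "a * e - b * g \<noteq> 0" and n: "CARD('n) \<ge> 2"
  shows "pencil_class (model_pencil s) = pencil_class (model_pencil t)"
proof -
  let ?q1 = "\<lambda>v. a * diag_form t v + b * diag_form (\<lambda>_. 1) v"
  let ?q2 = "\<lambda>v. g * diag_form t v + e * diag_form (\<lambda>_. 1) v"
  have nz: "g * t k + e \<noteq> 0" for k by (rule moebius_denominator_nz[OF s det])
  have "inj s"
  proof (rule injI)
    fix i j assume "s i = s j"
    then have "(a * e - b * g) * (t i - t j) = 0" using moebius_diff[OF s[of i] s[of j]] by simp
    then show "i = j" using det t by (simp add: inj_eq)
  qed
  moreover have "?q1 v = diag_form (\<lambda>k. s k * (g * t k + e)) v" "?q2 v = diag_form (\<lambda>k. g * t k + e) v" for v
    unfolding s diag_form_def by (simp_all add: sum_distrib_left sum.distrib[symmetric] algebra_simps)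
  ultimately have "diagonal_pair ?q1 ?q2 s (mat 1) (\<lambda>k. g * t k + e)"
    using nz by (simp add: diagonal_pair_def invertible_mat_1)
  from diagonal_pair_class[OF this n] show ?thesis
    unfolding forms_span_change[OF det] model_pencil_def ..
qed

lemma mem_forms_span: "q \<in> forms_span q r" "r \<in> forms_span q r"
proof -
  have "q = (\<lambda>v. 1 * q v + 0 * r v)" "r = (\<lambda>v. 0 * q v + 1 * r v)" by auto
  then show "q \<in> forms_span q r" "r \<in> forms_span q r" unfolding forms_span_def by blast+
qed

text \<open>An equivalence of two diagonalized pencils maps degenerate elements to degenerate elements,
  through a projective transformation of the pencils, and their kernels, the lines spanned by the
  columns of \<open>E\<close> and \<open>E'\<close>, to each other. The factors \<open>m k\<close> on these lines are related to the values
  of the forms.\<close>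

lemma pencil_match:
  fixes E E' T :: "complex ^ 'n ^ 'n::finite"
  assumes dp: "diagonal_pair q1 q2 t E d" and dp': "diagonal_pair q1' q2' t' E' d'"
    and T: "invertible T" and pb: "forms_span q1' q2' = pullback T (forms_span q1 q2)"
    and n: "CARD('n) \<ge> 2"
  obtains a b g e \<pi> m where "bij \<pi>" "a * e - b * g \<noteq> 0"
    "\<And>k. t' (\<pi> k) * (g * t k + e) = a * t k + b"
    "\<And>k. E *v axis k 1 = T *v (E' *v (m k *s axis (\<pi> k) 1))"
    "\<And>k. d k * (g * t k + e) = (m k)\<^sup>2 * (a * e - b * g) * d' (\<pi> k)"
proof -
  have t: "inj t" and d: "\<And>k. d k \<noteq> 0" and E: "invertible E"
    and q: "\<And>z. q1 (E *v z) = diag_form (\<lambda>k. t k * d k) z" "\<And>z. q2 (E *v z) = diag_form d z"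
    using dp by (auto simp: diagonal_pair_def)
  have t': "inj t'" and d': "\<And>k. d' k \<noteq> 0" and E': "invertible E'"
    and q': "\<And>z. q1' (E' *v z) = diag_form (\<lambda>k. t' k * d' k) z" "\<And>z. q2' (E' *v z) = diag_form d' z"
    using dp' by (auto simp: diagonal_pair_def)
  have "(\<lambda>v. q1 (T *v v)) \<in> forms_span q1' q2'" "(\<lambda>v. q2 (T *v v)) \<in> forms_span q1' q2'"
    unfolding pb pullback_forms_span by (rule mem_forms_span)+
  then obtain A B C D where AB: "\<And>v. q1 (T *v v) = A * q1' v + B * q2' v"
    and CD: "\<And>v. q2 (T *v v) = C * q1' v + D * q2' v"
    unfolding forms_span_def by (auto simp: fun_eq_iff)
  have det: "A * D - B * C \<noteq> 0"
  proof
    assume z: "A * D - B * C = 0"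
    have rel: "s = 0 \<and> r = 0" if "s * A + r * C = 0" "s * B + r * D = 0" for s r
    proof -
      have "s * q1 v + r * q2 v = 0" for v
      proof -
        obtain w where w: "v = T *v w" using invertible_surj[OF T] by metis
        have "s * q1 v + r * q2 v = (s * A + r * C) * q1' w + (s * B + r * D) * q2' w"
          unfolding w AB CD by (simp add: algebra_simps)
        then show ?thesis using that by simp
      qed
      then show ?thesis using diagonal_pair_independent[OF dp n] unfolding forms_independent_def by blast
    qed
    have "C = 0 \<and> - A = 0" by (rule rel) (use z in \<open>auto simp: algebra_simps\<close>)
    moreover have "D = 0 \<and> - B = 0" by (rule rel) (use z in \<open>auto simp: algebra_simps\<close>)
    ultimately have "(1::complex) = 0 \<and> (0::complex) = 0" by (intro rel) auto
    then show False by simp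
  qed
  have "\<exists>z. E *v axis k 1 = T *v (E' *v z)" for k
    using invertible_surj[OF T] invertible_surj[OF E'] by metis
  then obtain z where z: "\<And>k. E *v axis k 1 = T *v (E' *v z k)" by metis
  \<comment> \<open>Pairing with the column \<open>j\<close> of \<open>E'\<close>: the element of the pencil with root \<open>t k\<close> annihilates the column \<open>k\<close> of \<open>E\<close>.\<close>
  have zero: "z k $ j * (t' j * (A - C * t k) - (D * t k - B)) = 0" for k j
  proof -
    obtain w where w: "T *v (E' *v axis j 1) = E *v w" using invertible_surj[OF E] by metis
    let ?p = "\<lambda>v. 1 * q1 v + (- t k) * q2 v"
    have pT: "?p (T *v v) = (A - t k * C) * q1' v + (B - t k * D) * q2' v" for v
      unfolding AB CD by (simp add: algebra_simps)
    have "polar ?p (E *v axis k 1) (E *v w) = 0"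
      unfolding diagonal_pair_polar[OF dp] by (intro sum.neutral) (auto simp: axis_def)
    moreover have "polar ?p (T *v u) (T *v v) = polar (\<lambda>v. (A - t k * C) * q1' v + (B - t k * D) * q2' v) u v" for u v
      unfolding polar_def pT[symmetric] matrix_vector_right_distrib ..
    ultimately have "polar (\<lambda>v. (A - t k * C) * q1' v + (B - t k * D) * q2' v) (E' *v z k) (E' *v axis j 1) = 0"
      unfolding z w[symmetric] by simp
    then have "((A - t k * C) * t' j + (B - t k * D)) * d' j * z k $ j = 0"
      unfolding diagonal_pair_polar[OF dp'] sum_axis .
    then have "((A - t k * C) * t' j + (B - t k * D)) * z k $ j = 0" using d'[of j] by simp
    then show ?thesis by (simp add: algebra_simps)
  qed
  have znz: "\<exists>j. z k $ j \<noteq> 0" for k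
  proof (rule ccontr)
    assume "\<not> (\<exists>j. z k $ j \<noteq> 0)"
    then have "z k = 0" by (simp add: vec_eq_iff)
    then have "E *v axis k 1 = 0" unfolding z by simp
    then show False unfolding invertible_eq_0[OF E] by (simp add: axis_eq_0_iff)
  qed
  then obtain \<pi> where \<pi>: "\<And>k. z k $ \<pi> k \<noteq> 0" by metis
  define m where "m k = z k $ \<pi> k" for k
  have h: "t' (\<pi> k) * ((- C) * t k + A) = D * t k + (- B)" for k
  proof -
    have "t' (\<pi> k) * (A - C * t k) - (D * t k - B) = 0" using zero[of k "\<pi> k"] \<pi>[of k] by simp
    then show ?thesis by (simp add: algebra_simps)
  qed
  have det': "D * A - (- B) * (- C) \<noteq> 0" using det by (simp add: mult.commute)
  have nz: "(- C) * t k + A \<noteq> 0" for k by (rule moebius_denominator_nz[OF h det'])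
  have zm: "z k = m k *s axis (\<pi> k) 1" for k
  proof (rule vec_eqI)
    fix j
    have "z k $ j = 0" if "j \<noteq> \<pi> k"
    proof (rule ccontr)
      assume "z k $ j \<noteq> 0"
      then have "t' j * (A - C * t k) - (D * t k - B) = 0" using zero[of k j] by simp
      then have "t' j * ((- C) * t k + A) = t' (\<pi> k) * ((- C) * t k + A)"
        unfolding h by (simp add: algebra_simps)
      then have "t' j = t' (\<pi> k)" using nz[of k] by simp
      then show False using t' that by (simp add: inj_eq)
    qed
    then show "z k $ j = (m k *s axis (\<pi> k) 1) $ j" by (auto simp: m_def axis_def)
  qed
  have "inj \<pi>"
  proof (rule injI)
    fix i j assume "\<pi> i = \<pi> j"
    then have "(D * A - (- B) * (- C)) * (t i - t j) = 0" using moebius_diff[OF h[of i] h[of j]] by simp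
    then show "i = j" using det' t by (simp add: inj_eq)
  qed
  then have bij: "bij \<pi>" by (simp add: bij_def finite_UNIV_inj_surj)
  show ?thesis
  proof (rule that[OF bij det' h])
    show "E *v axis k 1 = T *v (E' *v (m k *s axis (\<pi> k) 1))" for k
      unfolding z zm ..
    have df: "diag_form c (m k *s axis (\<pi> k) 1) = (m k)\<^sup>2 * c (\<pi> k)" for c k
      unfolding diag_form_def by (subst sum.remove[of _ "\<pi> k"]) (auto simp: axis_def mult_ac)
    show "d k * ((- C) * t k + A) = (m k)\<^sup>2 * (D * A - (- B) * (- C)) * d' (\<pi> k)" for k
    proof -
      have "d k = q2 (E *v axis k 1)" unfolding q diag_form_axis ..
      also have "\<dots> = (m k)\<^sup>2 * ((C * t' (\<pi> k) + D) * d' (\<pi> k))"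
        unfolding z zm CD q' df by (simp add: algebra_simps)
      finally have "d k * ((- C) * t k + A)
          = (m k)\<^sup>2 * (C * (t' (\<pi> k) * ((- C) * t k + A)) + D * ((- C) * t k + A)) * d' (\<pi> k)"
        by (simp add: algebra_simps)
      then show ?thesis unfolding h by (simp add: algebra_simps)
    qed
  qed
qed

lemma quadratic_poly_cases:
  assumes "degree p \<le> 2" obtains x y z where "p = [:x, y, z:]"
proof
  show "p = [:coeff p 0, coeff p 1, coeff p 2:]"
  proof (rule poly_eqI)
    fix i
    show "coeff p i = coeff [:coeff p 0, coeff p 1, coeff p 2:] i"
    proof (cases "i \<le> 2")
      case True
      then have "i = 0 \<or> i = 1 \<or> i = 2" by auto
      then show ?thesis by (auto simp: numeral_2_eq_2)
    next
      case False
      then have "coeff p i = 0" using assms by (intro coeff_eq_0) simp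
      moreover obtain j where "i = Suc (Suc (Suc j))" using False by (metis add_2_eq_Suc' not_less_eq_eq less_eqE add_Suc_right add.commute add_2_eq_Suc)
      ultimately show ?thesis by simp
    qed
  qed
qed

text \<open>In the coordinates of a tangent frame, this will be the kernel of the differential of the moduli map.\<close>

definition quadratic_curve_span :: "('n::finite \<Rightarrow> complex) \<Rightarrow> complex ^ 'n ^ 'n \<Rightarrow> (complex ^ 'n) set" where
  "quadratic_curve_span t E = {E *v (\<chi> k. poly p (t k)) | p. degree p \<le> 2}"

lemma vec_sum_axis: "z = (\<Sum>k\<in>UNIV. z $ k *s axis k 1)" for z :: "'a::comm_ring_1 ^ 'n::finite"
  by (rule vec_eqI) (simp add: sum_component sum_axis axis_def if_distrib cong: if_cong)

text \<open>A quadratic polynomial in \<open>t' (\<pi> k)\<close> times \<open>(g * t k + e)\<^sup>2\<close> is a quadratic polynomial in \<open>t k\<close>. So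
  multiplication by \<open>m k * (g * t k + e)\<^sup>2\<close> preserves the quadratic polynomials and is constant; four of the five
  powers of the denominator come from \<open>(m k)\<^sup>2\<close>.\<close>

lemma refined_pencil_match:
  fixes E E' T :: "complex ^ 'n ^ 'n::finite"
  assumes dp: "diagonal_pair q1 q2 t E d" and dp': "diagonal_pair q1' q2' t' E' d'"
    and T: "invertible T" and pb: "forms_span q1' q2' = pullback T (forms_span q1 q2)"
    and P: "quadratic_curve_span t' E' = (*v) T -` quadratic_curve_span t E"
    and n: "CARD('n) > 4"
  obtains a b g e \<pi> \<kappa> where "bij \<pi>" "a * e - b * g \<noteq> 0" "\<kappa> \<noteq> 0"
    "\<And>k. t' (\<pi> k) * (g * t k + e) = a * t k + b"
    "\<And>k. d' (\<pi> k) = \<kappa> * (g * t k + e) ^ 5 * d k"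
proof -
  have n2: "CARD('n) \<ge> 2" using n by simp
  obtain a b g e \<pi> m where \<pi>: "bij \<pi>" and det: "a * e - b * g \<noteq> 0"
    and h: "\<And>k. t' (\<pi> k) * (g * t k + e) = a * t k + b"
    and Em: "\<And>k. E *v axis k 1 = T *v (E' *v (m k *s axis (\<pi> k) 1))"
    and dm: "\<And>k. d k * (g * t k + e) = (m k)\<^sup>2 * (a * e - b * g) * d' (\<pi> k)"
    using pencil_match[OF dp dp' T pb n2] by metis
  have t: "inj t" and d: "\<And>k. d k \<noteq> 0" and E': "invertible E'"
    using dp dp' by (auto simp: diagonal_pair_def)
  let ?w = "\<lambda>k. g * t k + e"
  have w: "?w k \<noteq> 0" for k by (rule moebius_denominator_nz[OF h det])
  have "\<exists>c. \<forall>k. m k * (?w k)\<^sup>2 = c"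
  proof (rule quadratic_multiplier_constant[OF t n])
    fix p :: "complex poly" assume p: "degree p \<le> 2"
    let ?y = "\<Sum>k\<in>UNIV. (poly p (t k) * m k) *s axis (\<pi> k) (1::complex)"
    have "E *v (\<chi> k. poly p (t k)) = E *v (\<Sum>k\<in>UNIV. poly p (t k) *s axis k 1)"
      by (subst vec_sum_axis) simp
    also have "\<dots> = (\<Sum>k\<in>UNIV. poly p (t k) *s (E *v axis k 1))"
      by (simp add: matrix_vector_mult_sum vector_scalar_commute)
    also have "\<dots> = T *v (E' *v ?y)"
      unfolding Em by (simp add: matrix_vector_mult_sum vector_scalar_commute vector_smult_assoc)
    finally have "T *v (E' *v ?y) \<in> quadratic_curve_span t E"
      using p unfolding quadratic_curve_span_def by (metis (mono_tags, lifting) mem_Collect_eq)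
    then have "E' *v ?y \<in> quadratic_curve_span t' E'" unfolding P by simp
    then obtain p' where p': "degree p' \<le> 2" "E' *v ?y = E' *v (\<chi> k. poly p' (t' k))"
      unfolding quadratic_curve_span_def by auto
    then have y: "?y = (\<chi> k. poly p' (t' k))" unfolding invertible_inj[OF E'] by simp
    have val: "poly p (t k) * m k = poly p' (t' (\<pi> k))" for k
    proof -
      have "\<pi> k = \<pi> j \<longleftrightarrow> j = k" for j using \<pi> by (auto simp: bij_def inj_eq)
      then have "?y $ \<pi> k = (\<Sum>j\<in>UNIV. poly p (t j) * m j * axis k 1 $ j)"
        by (simp add: sum_component axis_def)
      then show ?thesis unfolding sum_axis y by simp
    qed
    obtain x y z where xyz: "p' = [:x, y, z:]" using quadratic_poly_cases[OF p'(1)] .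
    \<comment> \<open>\<open>p'\<close> with numerator and denominator of the Moebius map substituted, homogenized to degree two.\<close>
    define q where "q = smult x ([:e, g:] * [:e, g:]) + smult y ([:b, a:] * [:e, g:]) + smult z ([:b, a:] * [:b, a:])"
    show "\<exists>q. degree q \<le> 2 \<and> (\<forall>k. m k * (?w k)\<^sup>2 * poly p (t k) = poly q (t k))"
    proof (intro exI[of _ q] conjI allI)
      show "degree q \<le> 2" unfolding q_def by (simp add: degree_pCons_eq_if)
      fix k
      have "m k * (?w k)\<^sup>2 * poly p (t k) = poly p' (t' (\<pi> k)) * (?w k)\<^sup>2"
        unfolding val[symmetric] by (simp add: mult_ac)
      also have "\<dots> = x * (?w k)\<^sup>2 + y * (t' (\<pi> k) * ?w k) * ?w k + z * (t' (\<pi> k) * ?w k)\<^sup>2"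
        unfolding xyz by (simp add: algebra_simps power2_eq_square)
      also have "\<dots> = poly q (t k)"
        unfolding h q_def by (simp add: algebra_simps power2_eq_square)
      finally show "m k * (?w k)\<^sup>2 * poly p (t k) = poly q (t k)" .
    qed
  qed
  then obtain c where c: "\<And>k. m k * (?w k)\<^sup>2 = c" by auto
  have m: "m k \<noteq> 0" for k using dm[of k] d[of k] w[of k] by auto
  then have c0: "c \<noteq> 0" using c w by (metis mult_eq_0_iff power_not_zero)
  show ?thesis
  proof (rule that[OF \<pi> det _ h])
    show "1 / (c\<^sup>2 * (a * e - b * g)) \<noteq> 0" using c0 det by simp
    fix k
    have "d' (\<pi> k) * (c\<^sup>2 * (a * e - b * g)) = ((m k)\<^sup>2 * (a * e - b * g) * d' (\<pi> k)) * (?w k) ^ 4"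
      unfolding c[of k, symmetric] by (simp add: power_mult_distrib mult_ac flip: power_mult)
    also have "\<dots> = (?w k) ^ 5 * d k" unfolding dm[symmetric] by (simp add: eval_nat_numeral mult_ac)
    finally show "d' (\<pi> k) = 1 / (c\<^sup>2 * (a * e - b * g)) * (?w k) ^ 5 * d k"
      using c0 det by (simp add: field_simps)
  qed
qed

text \<open>A Moebius map that permutes the \<open>t k\<close> acts linearly on the coefficients \<open>(s, r)\<close> of
  \<open>s * q1 + r * q2\<close> and permutes the degenerate elements by \<open>\<pi>\<close>.\<close>

lemma no_pencil_automorphisms_moebius:
  fixes E :: "complex ^ 'n ^ 'n::finite"
  assumes dp: "diagonal_pair q1 q2 t E d" and n: "CARD('n) \<ge> 2"
    and no: "no_pencil_automorphisms (forms_span q1 q2)"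
    and pi: "bij \<pi>" and h: "\<And>k. t (\<pi> k) * (g * t k + e) = a * t k + b" and det: "a * e - b * g \<noteq> 0"
  shows "\<pi> k = k"
proof -
  have t: "inj t" using dp by (auto simp: diagonal_pair_def)
  note ind = diagonal_pair_independent[OF dp n]
  let ?w = "\<lambda>k. g * t k + e"
  have w: "?w k \<noteq> 0" for k by (rule moebius_denominator_nz[OF h det])
  define \<Phi> where "\<Phi> = forms_span q1 q2"
  define f where "f p v = fst p * q1 v + snd p * q2 v" for p :: "complex \<times> complex" and v
  have \<Phi>: "\<Phi> = range f"
  proof (intro set_eqI iffI)
    fix q assume "q \<in> \<Phi>"
    then obtain s r where "q = f (s, r)" unfolding \<Phi>_def forms_span_def f_def[abs_def] by auto
    then show "q \<in> range f" by simp
  qed (auto simp: \<Phi>_def forms_span_def f_def[abs_def])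
  have f: "inj f"
  proof (rule injI)
    fix p p' assume "f p = f p'"
    then have "fst p = fst p'" "snd p = snd p'"
      using forms_independent_inject[OF ind] unfolding f_def[abs_def] by blast+
    then show "p = p'" by (rule prod_eqI)
  qed
  \<comment> \<open>The action on coefficients that maps \<open>(1, - t k)\<close> to a multiple of \<open>(1, - t (\<pi> k))\<close>.\<close>
  define l where "l p = (e * fst p - g * snd p, a * snd p - b * fst p)" for p :: "complex \<times> complex"
  define l' where "l' p = ((a * fst p + g * snd p) / (a * e - b * g), (e * snd p + b * fst p) / (a * e - b * g))"
    for p :: "complex \<times> complex"
  have ll': "l (l' p) = p" for p
  proof -
    have "e * (a * fst p + g * snd p) - g * (e * snd p + b * fst p) = fst p * (a * e - b * g)"
      "a * (e * snd p + b * fst p) - b * (a * fst p + g * snd p) = snd p * (a * e - b * g)"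
      by (simp_all add: algebra_simps)
    then show ?thesis using det unfolding l_def l'_def
      by (intro prod_eqI) (simp_all add: diff_divide_distrib[symmetric])
  qed
  have l'l: "l' (l p) = p" for p
  proof -
    have "a * (e * fst p - g * snd p) + g * (a * snd p - b * fst p) = fst p * (a * e - b * g)"
      "e * (a * snd p - b * fst p) + b * (e * fst p - g * snd p) = snd p * (a * e - b * g)"
      by (simp_all add: algebra_simps)
    then show ?thesis using det unfolding l_def l'_def by (intro prod_eqI) simp_all
  qed
  define L where "L q = f (l (inv f q))" for q
  have Lf: "L (f p) = f (l p)" for p by (simp add: L_def f)
  have L: "bij_betw L \<Phi> \<Phi>"
  proof (rule bij_betwI[where g = "\<lambda>q. f (l' (inv f q))"])
    show "L \<in> \<Phi> \<rightarrow> \<Phi>" "(\<lambda>q. f (l' (inv f q))) \<in> \<Phi> \<rightarrow> \<Phi>" by (auto simp: \<Phi> L_def)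
  qed (auto simp: \<Phi> Lf f l'l ll')
  have lin: "L (\<lambda>v. s * q v + r * q' v) = (\<lambda>v. s * L q v + r * L q' v)"
    if qq: "q \<in> \<Phi>" "q' \<in> \<Phi>" for q q' s r
  proof -
    obtain p p' where p: "q = f p" "q' = f p'" using qq unfolding \<Phi> by blast
    have 1: "(\<lambda>v. s * f p v + r * f p' v) = f (s * fst p + r * fst p', s * snd p + r * snd p')" for p p'
      by (auto simp: f_def algebra_simps)
    show ?thesis unfolding p Lf 1 by (simp add: l_def algebra_simps)
  qed
  have line: "(\<lambda>v. c * f p v) = f (c * fst p, c * snd p)" for c p by (auto simp: f_def algebra_simps)
  have Lline: "L ` form_line (f p) = form_line (f (l p))" for p
  proof -
    have "L (\<lambda>v. c * f p v) = (\<lambda>v. c * f (l p) v)" for c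
      unfolding line Lf by (simp add: l_def algebra_simps)
    then show ?thesis unfolding form_line_def by (auto simp: image_def)
  qed
  define D where "D k = form_line (\<lambda>v. q1 v - t k * q2 v)" for k
  have Dl: "D k = form_line (f (1, - t k))" for k by (simp add: D_def f_def[abs_def])
  have LD: "L ` D k = D (\<pi> k)" for k
  proof -
    have "l (1, - t k) = (?w k * 1, ?w k * - t (\<pi> k))"
      using h[of k] by (simp add: l_def algebra_simps)
    then have "f (l (1, - t k)) = (\<lambda>v. ?w k * f (1, - t (\<pi> k)) v)" unfolding line by simp
    then show ?thesis unfolding Dl Lline using form_line_scale[OF w[of k]] by simp
  qed
  have deg: "degenerate_elements \<Phi> = range D"
    unfolding \<Phi>_def D_def using diagonal_pair_degenerate_elements(1)[OF dp n] .
  have "(\<lambda>l. L ` l) ` degenerate_elements \<Phi> = D ` (\<pi> ` UNIV)"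
    unfolding deg image_image LD ..
  also have "\<pi> ` UNIV = UNIV" using pi by (simp add: bij_def)
  finally have perm: "(\<lambda>l. L ` l) ` degenerate_elements \<Phi> = degenerate_elements \<Phi>" unfolding deg .
  have fix_el: "\<forall>l\<in>pencil_elements \<Phi>. L ` l = l"
    by (rule no[unfolded no_pencil_automorphisms_def, folded \<Phi>_def, THEN spec[of _ L], THEN mp])
       (intro conjI ballI allI L lin perm)
  have "D k \<in> pencil_elements \<Phi>"
    using deg unfolding degenerate_elements_def pencil_elements_def by blast
  then have "D (\<pi> k) = D k" using fix_el LD by metis
  then show ?thesis
    using diagonal_pair_degenerate_elements(2)[OF dp n] unfolding D_def by (meson injD)
qed

section \<open>Diagonalization by eigenvectors\<close>

definition bil :: "complex ^ 'n ^ 'n \<Rightarrow> complex ^ 'n \<Rightarrow> complex ^ 'n \<Rightarrow> complex" where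
  "bil M u v = (\<Sum>i\<in>UNIV. u $ i * (M *v v) $ i)"

lemma quad_form_bil: "quad_form M v = bil M v v"
  unfolding quad_form_def bil_def matrix_vector_mult_def
  by (simp add: sum_distrib_left mult_ac)

lemma bil_commute:
  assumes "\<And>i j. M $ i $ j = M $ j $ i"
  shows "bil M u v = bil M v u"
proof -
  have "bil M u v = (\<Sum>i\<in>UNIV. \<Sum>j\<in>UNIV. u $ i * M $ i $ j * v $ j)" for u v
    unfolding bil_def matrix_vector_mult_def by (simp add: sum_distrib_left mult_ac)
  note e = this
  have "(\<Sum>i\<in>UNIV. \<Sum>j\<in>UNIV. u $ i * M $ i $ j * v $ j) = (\<Sum>j\<in>UNIV. \<Sum>i\<in>UNIV. u $ i * M $ i $ j * v $ j)"
    by (rule sum.swap)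
  also have "\<dots> = (\<Sum>j\<in>UNIV. \<Sum>i\<in>UNIV. v $ j * M $ j $ i * u $ i)"
    by (intro sum.cong refl) (simp add: assms mult_ac)
  finally show ?thesis unfolding e .
qed

lemma bil_sum_left: "bil M (\<Sum>k\<in>S. f k) v = (\<Sum>k\<in>S. bil M (f k) v)"
  unfolding bil_def sum_component sum_distrib_right by (rule sum.swap)

lemma bil_sum_right: "bil M u (\<Sum>k\<in>S. f k) = (\<Sum>k\<in>S. bil M u (f k))"
  unfolding bil_def matrix_vector_mult_sum sum_component sum_distrib_left by (rule sum.swap)

lemma bil_scale: "bil M (a *s u) v = a * bil M u v" "bil M u (a *s v) = a * bil M u v"
  by (simp_all add: bil_def vector_scalar_commute sum_distrib_left mult_ac)

text \<open>The usual induction: subtracting \<open>\<tau> a\<close> times \<open>B\<close> from \<open>A\<close> removes one eigenvector.\<close>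

lemma eigenvectors_independent:
  fixes A B :: "complex ^ 'n ^ 'n"
  assumes S: "finite S" and t: "inj \<tau>" and B: "\<And>v. B *v v = 0 \<Longrightarrow> v = 0"
    and ev: "\<And>k. A *v v k = \<tau> k *s (B *v v k)" and nz: "\<And>k. v k \<noteq> 0"
  shows "(\<Sum>k\<in>S. c k *s v k) = 0 \<Longrightarrow> k \<in> S \<Longrightarrow> c k = 0"
  using S
proof (induction S arbitrary: c k rule: finite_induct)
  case (insert a S)
  have 0: "(\<Sum>k\<in>insert a S. c k *s v k) = 0" by fact
  have "B *v (\<Sum>k\<in>S. (c k * (\<tau> k - \<tau> a)) *s v k) = (\<Sum>k\<in>insert a S. (c k * (\<tau> k - \<tau> a)) *s (B *v v k))"
    using insert.hyps by (simp add: matrix_vector_mult_sum vector_scalar_commute)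
  also have "\<dots> = (\<Sum>k\<in>insert a S. c k *s (A *v v k)) - (\<Sum>k\<in>insert a S. \<tau> a *s (c k *s (B *v v k)))"
    unfolding sum_subtractf[symmetric] ev
    by (intro sum.cong refl) (simp add: vec_eq_iff algebra_simps)
  also have "\<dots> = A *v (\<Sum>k\<in>insert a S. c k *s v k) - \<tau> a *s (B *v (\<Sum>k\<in>insert a S. c k *s v k))"
    by (simp only: matrix_vector_mult_sum vector_scalar_commute vec.scale_sum_right)
  also have "\<dots> = 0" unfolding 0 by simp
  finally have "(\<Sum>k\<in>S. (c k * (\<tau> k - \<tau> a)) *s v k) = 0" by (rule B)
  then have "c j * (\<tau> j - \<tau> a) = 0" if "j \<in> S" for j
    using insert.IH[of "\<lambda>k. c k * (\<tau> k - \<tau> a)" j] that by simp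
  moreover have "\<tau> j \<noteq> \<tau> a" if "j \<in> S" for j using insert.hyps that t by (auto simp: inj_eq)
  ultimately have S0: "c j = 0" if "j \<in> S" for j using that by auto
  then have "c a *s v a = 0" using 0 insert.hyps by simp
  then have "c a = 0" using nz[of a] by simp
  then show ?case using S0 insert.prems by auto
qed simp

text \<open>Distinct roots of the determinant of \<open>A - s * B\<close> have eigenvectors, which are orthogonal for both
  symmetric matrices.\<close>

lemma eigen_diagonal_pair:
  fixes A B :: "complex ^ 'n ^ 'n"
  assumes symA: "\<And>i j. A $ i $ j = A $ j $ i" and symB: "\<And>i j. B $ i $ j = B $ j $ i"
    and t: "inj \<tau>" and root: "\<And>k. det (\<chi> i j. A $ i $ j - \<tau> k * B $ i $ j) = 0" and B: "det B \<noteq> 0"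
  obtains E d where "diagonal_pair (quad_form A) (quad_form B) \<tau> E d"
proof -
  have B0: "v = 0" if "B *v v = 0" for v
    using B that invertible_eq_0[of B] by (simp add: invertible_det_nz)
  have "\<exists>v. v \<noteq> 0 \<and> A *v v = \<tau> k *s (B *v v)" for k
  proof -
    let ?M = "\<chi> i j. A $ i $ j - \<tau> k * B $ i $ j"
    have "\<not> invertible ?M" using root[of k] by (simp add: invertible_det_nz)
    then obtain v where v: "?M *v v = 0" "v \<noteq> 0"
      unfolding invertible_left_inverse matrix_left_invertible_ker by blast
    have "?M *v v = A *v v - \<tau> k *s (B *v v)"
      by (simp add: vec_eq_iff matrix_vector_mult_def sum_subtractf sum_distrib_left algebra_simps)
    then show ?thesis using v by auto
  qed
  then obtain v where nz: "\<And>k. v k \<noteq> 0" and ev: "\<And>k. A *v v k = \<tau> k *s (B *v v k)" by metis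
  define E :: "complex ^ 'n ^ 'n" where "E = (\<chi> i k. v k $ i)"
  have Ez: "E *v z = (\<Sum>k\<in>UNIV. z $ k *s v k)" for z
    by (simp add: E_def vec_eq_iff matrix_vector_mult_def sum_component mult.commute)
  have E: "invertible E"
    unfolding invertible_left_inverse matrix_left_invertible_ker
  proof (intro allI impI)
    fix z assume "E *v z = 0"
    then have 0: "(\<Sum>k\<in>UNIV. z $ k *s v k) = 0" unfolding Ez .
    have "z $ k = 0" for k
      by (rule eigenvectors_independent[OF finite t B0 ev nz 0 UNIV_I])
    then show "z = 0" by (simp add: vec_eq_iff)
  qed
  have bA: "bil A u (v k) = \<tau> k * bil B u (v k)" for u k
    unfolding bil_def ev by (simp add: sum_distrib_left mult_ac)
  have orth: "bil B (v k) (v l) = 0" if "k \<noteq> l" for k l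
  proof -
    have "\<tau> l * bil B (v k) (v l) = \<tau> k * bil B (v k) (v l)"
      using bA[of "v k" l] bA[of "v l" k] bil_commute[OF symA, of "v k" "v l"]
        bil_commute[OF symB, of "v k" "v l"] by metis
    moreover have "\<tau> l \<noteq> \<tau> k" using that t by (auto simp: inj_eq)
    ultimately show ?thesis by simp
  qed
  define d where "d k = bil B (v k) (v k)" for k
  have BE: "bil B (E *v z) (v k) = z $ k * d k" for z k
    unfolding Ez bil_sum_left bil_scale
    by (subst sum.remove[of _ k]) (auto simp: orth d_def)
  have d0: "d k \<noteq> 0" for k
  proof
    assume "d k = 0"
    have "(B *v v k) $ i = 0" for i
    proof -
      obtain z where z: "axis i 1 = E *v z" using invertible_surj[OF E] by metis
      have "bil B (axis i 1) (v k) = 0" unfolding z BE using \<open>d k = 0\<close> by simp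
      then show ?thesis unfolding bil_def
        by (subst (asm) sum.remove[of _ i]) (auto simp: axis_def)
    qed
    then have "B *v v k = 0" by (simp add: vec_eq_iff)
    then show False using B0 nz by blast
  qed
  have qB: "quad_form B (E *v z) = diag_form d z" for z
  proof -
    have "bil B (E *v z) (E *v z) = (\<Sum>k\<in>UNIV. z $ k * bil B (E *v z) (v k))"
      unfolding bil_scale(2)[symmetric] bil_sum_right[symmetric] Ez[symmetric] ..
    then show ?thesis unfolding quad_form_bil BE diag_form_def by (simp add: power2_eq_square mult_ac)
  qed
  have qA: "quad_form A (E *v z) = diag_form (\<lambda>k. \<tau> k * d k) z" for z
  proof -
    have "bil A (E *v z) (E *v z) = (\<Sum>k\<in>UNIV. z $ k * bil A (E *v z) (v k))"
      unfolding bil_scale(2)[symmetric] bil_sum_right[symmetric] Ez[symmetric] ..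
    then show ?thesis unfolding quad_form_bil bA BE diag_form_def by (simp add: power2_eq_square mult_ac)
  qed
  show ?thesis by (rule that[of E d]) (use t d0 E qA qB in \<open>simp add: diagonal_pair_def\<close>)
qed

section \<open>Complex differentiability on matrices\<close>

text \<open>Pairs of matrices do not form a complex vector space in the sense of a type class, so
  the multiplication by \<open>\<i>\<close> is passed as the map \<open>J\<close>.\<close>

definition complex_diff_at :: "('a::real_normed_vector \<Rightarrow> 'a) \<Rightarrow> ('a \<Rightarrow> complex) \<Rightarrow> 'a \<Rightarrow> bool" where
  "complex_diff_at J f x \<longleftrightarrow> (\<exists>D. (f has_derivative D) (at x) \<and> (\<forall>v. D (J v) = \<i> * D v))"

lemma complex_diff_at_const: "complex_diff_at J (\<lambda>x. c) x"
  unfolding complex_diff_at_def by (rule exI[of _ "\<lambda>_. 0"]) auto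

lemma complex_diff_at_linear:
  assumes "bounded_linear f" "\<And>v. f (J v) = \<i> * f v" shows "complex_diff_at J f x"
  unfolding complex_diff_at_def using bounded_linear.has_derivative[OF assms(1) has_derivative_ident] assms(2)
  by auto

lemma complex_diff_at_diff:
  assumes "complex_diff_at J f x" "complex_diff_at J g x"
  shows "complex_diff_at J (\<lambda>x. f x - g x) x"
proof -
  obtain D E where "(f has_derivative D) (at x)" "\<forall>v. D (J v) = \<i> * D v"
    "(g has_derivative E) (at x)" "\<forall>v. E (J v) = \<i> * E v"
    using assms unfolding complex_diff_at_def by blast
  then show ?thesis unfolding complex_diff_at_def
    by (intro exI[of _ "\<lambda>v. D v - E v"]) (auto intro!: has_derivative_diff simp: algebra_simps)
qed

lemma complex_diff_at_add:
  assumes "complex_diff_at J f x" "complex_diff_at J g x"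
  shows "complex_diff_at J (\<lambda>x. f x + g x) x"
proof -
  obtain D E where "(f has_derivative D) (at x)" "\<forall>v. D (J v) = \<i> * D v"
    "(g has_derivative E) (at x)" "\<forall>v. E (J v) = \<i> * E v"
    using assms unfolding complex_diff_at_def by blast
  then show ?thesis unfolding complex_diff_at_def
    by (intro exI[of _ "\<lambda>v. D v + E v"]) (auto intro!: has_derivative_add simp: algebra_simps)
qed

lemma complex_diff_at_mult:
  assumes "complex_diff_at J f x" "complex_diff_at J g x"
  shows "complex_diff_at J (\<lambda>x. f x * g x) x"
proof -
  obtain D E where "(f has_derivative D) (at x)" "\<forall>v. D (J v) = \<i> * D v"
    "(g has_derivative E) (at x)" "\<forall>v. E (J v) = \<i> * E v"
    using assms unfolding complex_diff_at_def by blast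
  note DE = this
  show ?thesis unfolding complex_diff_at_def
  proof (intro exI conjI allI)
    show "((\<lambda>x. f x * g x) has_derivative (\<lambda>v. f x * E v + D v * g x)) (at x)"
      by (rule has_derivative_mult) (fact DE)+
    show "f x * E (J v) + D (J v) * g x = \<i> * (f x * E v + D v * g x)" for v
      using DE by (simp add: algebra_simps)
  qed
qed

lemma complex_diff_at_divide:
  assumes "complex_diff_at J f x" "complex_diff_at J g x" "g x \<noteq> 0"
  shows "complex_diff_at J (\<lambda>x. f x / g x) x"
proof -
  obtain D E where "(f has_derivative D) (at x)" "\<forall>v. D (J v) = \<i> * D v"
    "(g has_derivative E) (at x)" "\<forall>v. E (J v) = \<i> * E v"
    using assms unfolding complex_diff_at_def by blast
  note DE = this
  show ?thesis unfolding complex_diff_at_def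
  proof (intro exI conjI allI)
    show "((\<lambda>x. f x / g x) has_derivative (\<lambda>v. (D v * g x - f x * E v) / (g x * g x))) (at x)"
      by (rule has_derivative_divide') (fact DE assms)+
    show "(D (J v) * g x - f x * E (J v)) / (g x * g x) = \<i> * ((D v * g x - f x * E v) / (g x * g x))" for v
    proof -
      have "D (J v) * g x - f x * E (J v) = \<i> * (D v * g x - f x * E v)"
        using DE by (simp add: algebra_simps)
      then show ?thesis by simp
    qed
  qed
qed

lemma complex_diff_at_sum:
  assumes "\<And>i. i \<in> A \<Longrightarrow> complex_diff_at J (f i) x"
  shows "complex_diff_at J (\<lambda>x. \<Sum>i\<in>A. f i x) x"
  using assms by (induction A rule: infinite_finite_induct) (auto intro: complex_diff_at_const complex_diff_at_add)

lemma complex_diff_at_prod: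
  assumes "\<And>i. i \<in> A \<Longrightarrow> complex_diff_at J (f i) x"
  shows "complex_diff_at J (\<lambda>x. \<Prod>i\<in>A. f i x) x"
  using assms by (induction A rule: infinite_finite_induct) (auto intro: complex_diff_at_const complex_diff_at_mult)

lemma complex_diff_at_det:
  assumes "\<And>i j. complex_diff_at J (\<lambda>x. M x $ i $ j) x"
  shows "complex_diff_at J (\<lambda>x. det (M x)) x"
  unfolding det_def
  by (intro complex_diff_at_sum complex_diff_at_mult complex_diff_at_const complex_diff_at_prod assms)

lemma complex_diff_at_continuous:
  "complex_diff_at J f x \<Longrightarrow> continuous (at x) f"
  unfolding complex_diff_at_def using has_derivative_continuous by blast

abbreviation times_i :: "complex ^ 'n ^ 'm \<Rightarrow> complex ^ 'n ^ 'm" where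
  "times_i A \<equiv> (\<chi> i j. \<i> * A $ i $ j)"

definition times_i_pair :: "(complex ^ 'n ^ 'm) \<times> (complex ^ 'n ^ 'm) \<Rightarrow> (complex ^ 'n ^ 'm) \<times> (complex ^ 'n ^ 'm)" where
  "times_i_pair p = (times_i (fst p), times_i (snd p))"

abbreviation matrix_unit :: "'n \<Rightarrow> 'n \<Rightarrow> complex \<Rightarrow> complex ^ 'n ^ 'n" where
  "matrix_unit k l c \<equiv> (\<chi> i j. if i = k \<and> j = l then c else 0)"

text \<open>The coefficients are the values of \<open>D\<close> on the matrix units.\<close>

lemma complex_linear_matrix_pair:
  fixes D :: "(complex ^ 'n ^ 'n) \<times> (complex ^ 'n ^ 'n) \<Rightarrow> complex"
  assumes lin: "linear D" and J: "\<And>v. D (times_i_pair v) = \<i> * D v"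
  shows "\<exists>J K. D = (\<lambda>(A, B). \<Sum>i\<in>UNIV. \<Sum>j\<in>UNIV. J $ i $ j * A $ i $ j + K $ i $ j * B $ i $ j)"
proof -
  interpret linear D by fact
  have decomp: "A = (\<Sum>i\<in>UNIV. \<Sum>j\<in>UNIV. matrix_unit i j (A $ i $ j))" for A :: "complex ^ 'n ^ 'n"
  proof (intro vec_eqI)
    fix k l
    have "(\<Sum>j\<in>UNIV. matrix_unit i j (A $ i $ j) $ k $ l) = (if i = k then A $ k $ l else 0)" for i
      by (cases "i = k") (auto simp: sum.delta' cong: if_cong)
    then show "A $ k $ l = (\<Sum>i\<in>UNIV. \<Sum>j\<in>UNIV. matrix_unit i j (A $ i $ j)) $ k $ l"
      by (simp add: sum_component)
  qed
  have unit: "matrix_unit k l c = Re c *\<^sub>R matrix_unit k l 1 + Im c *\<^sub>R times_i (matrix_unit k l 1)" for k l c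
    by (auto simp: vec_eq_iff complex_eq_iff)
  have cl: "D (Re c *\<^sub>R v + Im c *\<^sub>R times_i_pair v) = c * D v" for c v
  proof -
    have "D (Re c *\<^sub>R v + Im c *\<^sub>R times_i_pair v) = (of_real (Re c) + \<i> * of_real (Im c)) * D v"
      by (simp add: add scale J scaleR_conv_of_real algebra_simps)
    then show ?thesis by (simp flip: complex_eq)
  qed
  have l: "D (matrix_unit k l c, 0) = c * D (matrix_unit k l 1, 0)" for k l c
  proof -
    have "times_i (0 :: complex ^ 'n ^ 'n) = 0" by (simp add: vec_eq_iff)
    then have "(matrix_unit k l c, 0) = Re c *\<^sub>R (matrix_unit k l 1, 0) + Im c *\<^sub>R times_i_pair (matrix_unit k l 1, 0)"
      by (subst unit) (simp add: times_i_pair_def)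
    then show ?thesis using cl by metis
  qed
  have r: "D (0, matrix_unit k l c) = c * D (0, matrix_unit k l 1)" for k l c
  proof -
    have "times_i (0 :: complex ^ 'n ^ 'n) = 0" by (simp add: vec_eq_iff)
    then have "(0, matrix_unit k l c) = Re c *\<^sub>R (0, matrix_unit k l 1) + Im c *\<^sub>R times_i_pair (0, matrix_unit k l 1)"
      by (subst unit) (simp add: times_i_pair_def)
    then show ?thesis using cl by metis
  qed
  have pair1: "(\<Sum>i\<in>S. (f i, 0)) = (\<Sum>i\<in>S. f i, 0)" for S :: "'n set" and f :: "'n \<Rightarrow> complex ^ 'n ^ 'n"
    by (simp add: sum_prod)
  have pair2: "(\<Sum>i\<in>S. (0, f i)) = (0, \<Sum>i\<in>S. f i)" for S :: "'n set" and f :: "'n \<Rightarrow> complex ^ 'n ^ 'n"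
    by (simp add: sum_prod)
  have L: "D (A, 0) = (\<Sum>i\<in>UNIV. \<Sum>j\<in>UNIV. D (matrix_unit i j 1, 0) * A $ i $ j)" for A
  proof -
    have "(A, 0) = (\<Sum>i\<in>UNIV. \<Sum>j\<in>UNIV. (matrix_unit i j (A $ i $ j), 0 :: complex ^ 'n ^ 'n))"
      unfolding pair1 using decomp[of A] by simp
    then have "D (A, 0) = (\<Sum>i\<in>UNIV. \<Sum>j\<in>UNIV. D (matrix_unit i j (A $ i $ j), 0))"
      by (simp only: sum)
    also have "\<dots> = (\<Sum>i\<in>UNIV. \<Sum>j\<in>UNIV. D (matrix_unit i j 1, 0) * A $ i $ j)"
      by (intro sum.cong refl) (subst l, rule mult.commute)
    finally show ?thesis .
  qed
  have R: "D (0, A) = (\<Sum>i\<in>UNIV. \<Sum>j\<in>UNIV. D (0, matrix_unit i j 1) * A $ i $ j)" for A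
  proof -
    have "(0, A) = (\<Sum>i\<in>UNIV. \<Sum>j\<in>UNIV. (0 :: complex ^ 'n ^ 'n, matrix_unit i j (A $ i $ j)))"
      unfolding pair2 using decomp[of A] by simp
    then have "D (0, A) = (\<Sum>i\<in>UNIV. \<Sum>j\<in>UNIV. D (0, matrix_unit i j (A $ i $ j)))"
      by (simp only: sum)
    also have "\<dots> = (\<Sum>i\<in>UNIV. \<Sum>j\<in>UNIV. D (0, matrix_unit i j 1) * A $ i $ j)"
      by (intro sum.cong refl) (subst r, rule mult.commute)
    finally show ?thesis .
  qed
  define JJ where "JJ = (\<chi> i j. D (matrix_unit i j 1, 0))"
  define KK where "KK = (\<chi> i j. D (0, matrix_unit i j 1))"
  have DAB: "D (A, B) = (\<Sum>i\<in>UNIV. \<Sum>j\<in>UNIV. JJ $ i $ j * A $ i $ j + KK $ i $ j * B $ i $ j)" for A B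
  proof -
    have "D (A, B) = D (A, 0) + D (0, B)" using add[of "(A, 0)" "(0, B)"] by simp
    then show ?thesis unfolding L[of A] R[of B] by (simp add: sum.distrib JJ_def KK_def)
  qed
  have "D = (\<lambda>(A, B). \<Sum>i\<in>UNIV. \<Sum>j\<in>UNIV. JJ $ i $ j * A $ i $ j + KK $ i $ j * B $ i $ j)"
    by (rule ext) (simp add: DAB split: prod.split)
  then show ?thesis by blast
qed

lemma vec_has_derivative:
  fixes f :: "'a::real_normed_vector \<Rightarrow> 'b::euclidean_space ^ 'n"
  assumes "\<And>i. ((\<lambda>x. f x $ i) has_derivative (\<lambda>v. D v $ i)) F"
  shows "(f has_derivative D) F"
proof -
  have ax: "bounded_linear (axis i :: 'b \<Rightarrow> 'b ^ 'n)" for i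
    by (rule linear_conv_bounded_linear[THEN iffD1], rule linearI) (auto simp: vec_eq_iff axis_def)
  have s: "x = (\<Sum>i\<in>UNIV. axis i (x $ i))" for x :: "'b ^ 'n"
    by (simp add: vec_eq_iff sum_component axis_def if_distrib cong: if_cong)
  have "((\<lambda>x. \<Sum>i\<in>UNIV. axis i (f x $ i)) has_derivative (\<lambda>v. \<Sum>i\<in>UNIV. axis i (D v $ i))) F"
    by (intro has_derivative_sum bounded_linear.has_derivative[OF ax] assms)
  then show ?thesis by (simp flip: s)
qed

section \<open>Cross ratios and rigid tuples\<close>

definition cross_ratio :: "('n \<Rightarrow> 'a::field) \<Rightarrow> 'n \<Rightarrow> 'n \<Rightarrow> 'n \<Rightarrow> 'n \<Rightarrow> 'a" where
  "cross_ratio t i j k l = (t i - t k) * (t j - t l) / ((t i - t l) * (t j - t k))"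

lemma cross_ratio_moebius:
  fixes t s :: "'n \<Rightarrow> 'a::field"
  assumes s: "\<And>k. s k * (g * t k + e) = a * t k + b" and det: "a * e - b * g \<noteq> 0"
  shows "cross_ratio s i j k l = cross_ratio t i j k l"
proof -
  let ?w = "\<lambda>k. g * t k + e" and ?D = "a * e - b * g"
  have w: "?w k \<noteq> 0" for k by (rule moebius_denominator_nz[OF s det])
  have d: "s x - s y = ?D * (t x - t y) / (?w x * ?w y)" for x y
    using moebius_diff[OF s[of x] s[of y]] w[of x] w[of y] by (simp add: nonzero_eq_divide_eq)
  have "cross_ratio s i j k l =
     (?D * ?D / (?w i * ?w j * ?w k * ?w l)) * ((t i - t k) * (t j - t l)) /
     ((?D * ?D / (?w i * ?w j * ?w k * ?w l)) * ((t i - t l) * (t j - t k)))"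
    unfolding cross_ratio_def d by (simp add: mult_ac)
  also have "\<dots> = cross_ratio t i j k l"
    unfolding cross_ratio_def using w det by (intro mult_divide_mult_cancel_left) simp
  finally show ?thesis .
qed

lemma three_indices:
  assumes "CARD('n::finite) \<ge> 3"
  obtains i j k :: "'n::finite" where "distinct [i, j, k]"
proof -
  obtain i j :: 'n where ij: "i \<noteq> j" by (rule two_indices) (use assms in auto)
  have "card {i, j} < CARD('n)" using assms by (simp add: card_insert_if)
  then have "{i, j} \<noteq> (UNIV :: 'n set)" by (metis nat_neq_iff)
  then obtain k where "k \<notin> {i, j}" by blast
  then show ?thesis using ij that[of i j k] by auto
qed

text \<open>The Moebius map that matches \<open>t\<close> and \<open>s\<close> at three indices matches them at a fourth one as soon as the
  cross ratios agree.\<close>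

lemma cross_ratios_determine_moebius:
  fixes t s :: "'n::finite \<Rightarrow> 'a::field"
  assumes t: "inj t" and s: "inj s" and n: "CARD('n) \<ge> 3"
    and cr: "\<And>i j k l. distinct [i, j, k, l] \<Longrightarrow> cross_ratio s i j k l = cross_ratio t i j k l"
  obtains a b g e where "a * e - b * g \<noteq> 0" "\<And>k. s k * (g * t k + e) = a * t k + b"
proof -
  obtain i j k :: 'n where d: "distinct [i, j, k]" using three_indices[OF n] .
  have tn: "t x - t y \<noteq> 0" "s x - s y \<noteq> 0" if "x \<noteq> y" for x y
    using that t s by (auto simp: inj_eq)
  \<comment> \<open>The Moebius map with equation \<open>(s j - w) (t i - u) = K (t j - u) (s i - w)\<close> matches the indices \<open>i\<close> and \<open>j\<close> for every \<open>K\<close>; this \<open>K\<close> makes it match \<open>k\<close>.\<close>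
  define K where "K = (t i - t k) * (s j - s k) / ((s i - s k) * (t j - t k))"
  have K: "K \<noteq> 0" unfolding K_def using d tn by simp
  have Kk: "K * ((s i - s k) * (t j - t k)) = (t i - t k) * (s j - s k)"
    unfolding K_def using d tn by simp
  have main: "(s j - s l) * (t i - t l) = K * ((t j - t l) * (s i - s l))" for l
  proof (cases "l \<in> {i, j, k}")
    case True
    then show ?thesis using Kk by (auto simp: mult_ac)
  next
    case False
    then have d': "distinct [i, j, k, l]" using d by auto
    have "(s i - s k) * (s j - s l) * ((t i - t l) * (t j - t k)) =
          (t i - t k) * (t j - t l) * ((s i - s l) * (s j - s k))"
      using cr[OF d'] d' tn unfolding cross_ratio_def by (simp add: frac_eq_eq)
    then have "((s i - s k) * (t j - t k)) * ((s j - s l) * (t i - t l)) =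
        ((t i - t k) * (s j - s k)) * ((t j - t l) * (s i - s l))" by (simp add: mult_ac)
    also have "\<dots> = ((s i - s k) * (t j - t k)) * (K * ((t j - t l) * (s i - s l)))"
      unfolding Kk[symmetric] by (simp add: mult_ac)
    finally show ?thesis using d tn by simp
  qed
  show ?thesis
  proof (rule that)
    have "(s j - K * s i) * (K * t j - t i) - (K * t j * s i - s j * t i) * (1 - K)
        = K * ((s j - s i) * (t j - t i))" by (simp add: algebra_simps)
    also have "\<dots> \<noteq> 0" using K d tn[of j i] by auto
    finally show "(s j - K * s i) * (K * t j - t i) - (K * t j * s i - s j * t i) * (1 - K) \<noteq> 0" .
    show "s l * ((1 - K) * t l + (K * t j - t i)) = (s j - K * s i) * t l + (K * t j * s i - s j * t i)" for l
    proof -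
      have "s l * ((1 - K) * t l + (K * t j - t i)) - ((s j - K * s i) * t l + (K * t j * s i - s j * t i))
        = (s j - s l) * (t i - t l) - K * ((t j - t l) * (s i - s l))" by (simp add: algebra_simps)
      then show ?thesis using main[of l] by simp
    qed
  qed
qed

definition cross_ratios_near :: "('n::finite \<Rightarrow> complex) \<Rightarrow> real \<Rightarrow> ('n \<Rightarrow> complex) \<Rightarrow> bool" where
  "cross_ratios_near t0 \<epsilon> t \<longleftrightarrow> inj t \<and>
     (\<forall>i j k l. distinct [i, j, k, l] \<longrightarrow> norm (cross_ratio t i j k l - cross_ratio t0 i j k l) < \<epsilon>)"

definition moebius_rigid :: "('n \<Rightarrow> complex) \<Rightarrow> bool" where
  "moebius_rigid t \<longleftrightarrow> (\<forall>\<pi> a b g e. bij \<pi> \<and> a * e - b * g \<noteq> 0 \<and>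
      (\<forall>k. t (\<pi> k) * (g * t k + e) = a * t k + b) \<longrightarrow> \<pi> = id)"

text \<open>Finitely many cross ratios occur, so for small \<open>\<epsilon>\<close> two of them that are \<open>2 * \<epsilon>\<close>-close are equal. If a
  tuple and a permuted copy of it are both close to \<open>t0\<close>, then \<open>t0\<close> and \<open>t0 \<circ> \<pi>\<close> have
  equal cross ratios and differ by a Moebius map.\<close>

lemma rigid_labelling_unique:
  fixes t0 :: "'n::finite \<Rightarrow> complex"
  assumes rig: "moebius_rigid t0" and t0: "inj t0" and n: "CARD('n) \<ge> 3"
  obtains \<epsilon> where "\<epsilon> > 0"
    "\<And>\<pi> t. bij \<pi> \<Longrightarrow> cross_ratios_near t0 \<epsilon> t \<Longrightarrow> cross_ratios_near t0 \<epsilon> (t \<circ> \<pi>) \<Longrightarrow> \<pi> = id"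
proof -
  define cr where "cr p = (case p of (i, j, k, l) \<Rightarrow> cross_ratio t0 i j k l)" for p
  \<comment> \<open>The nonzero distances between cross ratios of \<open>t0\<close>; the \<open>1\<close> keeps the set nonempty.\<close>
  define V where "V = insert 1 ((\<lambda>(p, q). norm (cr p - cr q)) ` UNIV - {0})"
  have V: "finite V" "V \<noteq> {}" "\<And>v. v \<in> V \<Longrightarrow> v > 0" by (auto simp: V_def)
  define \<epsilon> where "\<epsilon> = Min V / 2"
  have sep: "cr p = cr q" if "norm (cr p - cr q) < 2 * \<epsilon>" for p q
  proof (rule ccontr)
    assume "cr p \<noteq> cr q"
    then have "norm (cr p - cr q) \<in> V" unfolding V_def by (auto intro!: image_eqI[of _ _ "(p, q)"])
    then have "Min V \<le> norm (cr p - cr q)" using V by (intro Min_le)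
    then show False using that by (simp add: \<epsilon>_def)
  qed
  show ?thesis
  proof (rule that)
    show "\<epsilon> > 0" using V by (simp add: \<epsilon>_def)
    fix \<pi> :: "'n \<Rightarrow> 'n" and t
    assume \<pi>: "bij \<pi>" and near: "cross_ratios_near t0 \<epsilon> t" and near': "cross_ratios_near t0 \<epsilon> (t \<circ> \<pi>)"
    have eq: "cross_ratio (t0 \<circ> \<pi>) i j k l = cross_ratio t0 i j k l" if d: "distinct [i, j, k, l]" for i j k l
    proof -
      have d': "distinct [\<pi> i, \<pi> j, \<pi> k, \<pi> l]" using d \<pi> by (auto simp: bij_def inj_eq)
      have c: "cross_ratio (u \<circ> \<pi>) i j k l = cross_ratio u (\<pi> i) (\<pi> j) (\<pi> k) (\<pi> l)" for u :: "'n \<Rightarrow> complex"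
        by (simp add: cross_ratio_def)
      have 1: "norm (cross_ratio t (\<pi> i) (\<pi> j) (\<pi> k) (\<pi> l) - cross_ratio t0 (\<pi> i) (\<pi> j) (\<pi> k) (\<pi> l)) < \<epsilon>"
        using near d' unfolding cross_ratios_near_def by blast
      have 2: "norm (cross_ratio t (\<pi> i) (\<pi> j) (\<pi> k) (\<pi> l) - cross_ratio t0 i j k l) < \<epsilon>"
      proof -
        have "norm (cross_ratio (t \<circ> \<pi>) i j k l - cross_ratio t0 i j k l) < \<epsilon>"
          using near' d unfolding cross_ratios_near_def by blast
        then show ?thesis unfolding c .
      qed
      have "norm (cr (\<pi> i, \<pi> j, \<pi> k, \<pi> l) - cr (i, j, k, l)) < 2 * \<epsilon>"
        using 1 2 norm_triangle_ineq4[of "cross_ratio t (\<pi> i) (\<pi> j) (\<pi> k) (\<pi> l) - cross_ratio t0 i j k l"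
            "cross_ratio t (\<pi> i) (\<pi> j) (\<pi> k) (\<pi> l) - cross_ratio t0 (\<pi> i) (\<pi> j) (\<pi> k) (\<pi> l)"]
        by (simp add: cr_def)
      then show ?thesis unfolding c using sep by (simp add: cr_def) (metis case_prod_conv)
    qed
    have "inj (t0 \<circ> \<pi>)" using t0 \<pi> by (auto simp: bij_def intro: inj_compose)
    then obtain a b g e where "a * e - b * g \<noteq> 0" "\<And>k. (t0 \<circ> \<pi>) k * (g * t0 k + e) = a * t0 k + b"
      using cross_ratios_determine_moebius[OF t0 _ n eq] by metis
    then show "\<pi> = id" using rig \<pi> unfolding moebius_rigid_def o_apply by blast
  qed
qed

lemma model_class_eq_moebius:
  fixes t s :: "'n::finite \<Rightarrow> complex"
  assumes t: "inj t" and s: "inj s" and n: "CARD('n) \<ge> 2"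
    and eq: "pencil_class (model_pencil t) = pencil_class (model_pencil s)"
  obtains \<pi> a b g e where "bij \<pi>" "a * e - b * g \<noteq> 0" "\<And>k. s (\<pi> k) * (g * t k + e) = a * t k + b"
proof -
  note dp = model_diagonal_pair[OF t] and dp' = model_diagonal_pair[OF s]
  have "(model_pencil t, model_pencil s) \<in> pencil_rel"
    using eq pencil_class_eq_iff[OF diagonal_pair_nonsingular[OF dp' n]] unfolding model_pencil_def by blast
  then obtain T where T: "invertible T" "model_pencil s = pullback T (model_pencil t)"
    unfolding pencil_rel_def by blast
  show ?thesis
    using pencil_match[OF dp dp' T(1) T(2)[unfolded model_pencil_def] n] that by metis
qed

text \<open>The labelling of the roots is not part of the class of a pencil. Near a rigid tuple the closeness of
  the cross ratios selects it, which makes each of them a function of the class.\<close>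

definition near_cross_ratio ::
    "('n::finite \<Rightarrow> complex) \<Rightarrow> real \<Rightarrow> 'n \<Rightarrow> 'n \<Rightarrow> 'n \<Rightarrow> 'n \<Rightarrow> (complex ^ 'n \<Rightarrow> complex) set set \<Rightarrow> complex" where
  "near_cross_ratio t0 \<epsilon> i j k l m =
     (SOME c. \<exists>t. cross_ratios_near t0 \<epsilon> t \<and> m = pencil_class (model_pencil t) \<and> c = cross_ratio t i j k l)"

lemma near_cross_ratio_model:
  fixes t :: "'n::finite \<Rightarrow> complex"
  assumes n: "CARD('n) \<ge> 2" and near: "cross_ratios_near t0 \<epsilon> t"
    and uniq: "\<And>\<pi> t. bij \<pi> \<Longrightarrow> cross_ratios_near t0 \<epsilon> t \<Longrightarrow> cross_ratios_near t0 \<epsilon> (t \<circ> \<pi>) \<Longrightarrow> \<pi> = id"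
  shows "near_cross_ratio t0 \<epsilon> i j k l (pencil_class (model_pencil t)) = cross_ratio t i j k l"
  unfolding near_cross_ratio_def
proof (rule some_equality)
  show "\<exists>t'. cross_ratios_near t0 \<epsilon> t' \<and> pencil_class (model_pencil t) = pencil_class (model_pencil t') \<and>
      cross_ratio t i j k l = cross_ratio t' i j k l"
    using near by blast
  fix c assume "\<exists>t'. cross_ratios_near t0 \<epsilon> t' \<and> pencil_class (model_pencil t) = pencil_class (model_pencil t') \<and>
      c = cross_ratio t' i j k l"
  then obtain s where s: "cross_ratios_near t0 \<epsilon> s" "pencil_class (model_pencil t) = pencil_class (model_pencil s)"
    "c = cross_ratio s i j k l" by blast
  have inj: "inj t" "inj s" using near s(1) by (auto simp: cross_ratios_near_def)
  obtain \<pi> a b g e where \<pi>: "bij \<pi>" and det: "a * e - b * g \<noteq> 0" and h: "\<And>k. s (\<pi> k) * (g * t k + e) = a * t k + b"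
    using model_class_eq_moebius[OF inj n s(2)] by metis
  have cr: "cross_ratio (s \<circ> \<pi>) i j k l = cross_ratio t i j k l" for i j k l
    by (rule cross_ratio_moebius[OF _ det]) (simp add: h)
  have "inj (s \<circ> \<pi>)" using inj \<pi> by (auto simp: bij_def intro: inj_compose)
  then have "cross_ratios_near t0 \<epsilon> (s \<circ> \<pi>)" using near by (simp add: cross_ratios_near_def cr)
  then have "\<pi> = id" using uniq \<pi> s(1) by blast
  then show "c = cross_ratio t i j k l" using s(3) cr by simp
qed

section \<open>Holomorphic functions on the moduli space\<close>

text \<open>Forms are given by matrices that need not be symmetric, while determinants see only
  symmetric ones.\<close>

definition symm :: "complex ^ 'n ^ 'n \<Rightarrow> complex ^ 'n ^ 'n" where
  "symm M = (\<chi> i j. (M $ i $ j + M $ j $ i) / 2)"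

lemma quad_form_symm: "quad_form (symm M) = quad_form M"
proof
  fix v
  have "(\<Sum>i\<in>UNIV. \<Sum>j\<in>UNIV. M $ j $ i * v $ i * v $ j) = (\<Sum>j\<in>UNIV. \<Sum>i\<in>UNIV. M $ j $ i * v $ i * v $ j)"
    by (rule sum.swap)
  also have "\<dots> = quad_form M v" unfolding quad_form_def by (simp add: mult_ac)
  finally have sw: "(\<Sum>i\<in>UNIV. \<Sum>j\<in>UNIV. M $ j $ i * v $ i * v $ j) = quad_form M v" .
  have "2 * quad_form (symm M) v = (\<Sum>i\<in>UNIV. \<Sum>j\<in>UNIV. M $ i $ j * v $ i * v $ j + M $ j $ i * v $ i * v $ j)"
    unfolding quad_form_def symm_def sum_distrib_left by (intro sum.cong refl) (simp add: algebra_simps)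
  also have "\<dots> = 2 * quad_form M v" unfolding sum.distrib sw by (simp add: quad_form_def)
  finally show "quad_form (symm M) v = quad_form M v" by simp
qed

lemma quad_form_lincomb:
  "quad_form (\<chi> i j. a * A $ i $ j + b * B $ i $ j) v = a * quad_form A v + b * quad_form B v"
  unfolding quad_form_def sum_distrib_left sum.distrib[symmetric]
  by (intro sum.cong refl) (simp add: algebra_simps)

lemma polar_quad_form:
  assumes "\<And>i j. M $ i $ j = M $ j $ i"
  shows "polar (quad_form M) u v = bil M u v"
proof -
  have "bil M (u + v) (u + v) = bil M u u + bil M u v + bil M v u + bil M v v"
    unfolding bil_def matrix_vector_right_distrib by (simp add: algebra_simps sum.distrib)
  then show ?thesis unfolding polar_def quad_form_bil using bil_commute[OF assms, of u v] by simp
qed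

lemma matrix_vector_mult_axis: "(A *v axis k 1) $ i = A $ i $ k" for A :: "'a::comm_ring_1 ^ 'n ^ 'm"
  unfolding matrix_vector_mult_def by (simp add: sum_axis)

text \<open>The Gram determinant of a quadratic form in two bases.\<close>

lemma det_congruence:
  fixes M T :: "complex ^ 'n ^ 'n"
  assumes sym: "\<And>i j. M $ i $ j = M $ j $ i" and q: "\<And>z. quad_form M (T *v z) = diag_form c z"
  shows "(det T)\<^sup>2 * det M = (\<Prod>k\<in>UNIV. c k)"
proof -
  define P where "P = transpose T ** (M ** T)"
  have "P $ i $ j = bil M (T *v axis i 1) (T *v axis j 1)" for i j
    unfolding P_def bil_def matrix_vector_mul_assoc matrix_vector_mult_axis
    by (simp add: matrix_matrix_mult_def transpose_def)
  then have P: "P $ i $ j = (\<Sum>k\<in>UNIV. c k * axis i 1 $ k * axis j 1 $ k)" for i j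
    unfolding polar_quad_form[OF sym, symmetric] polar_diag_form[OF q] .
  have off: "P $ i $ j = 0" if "i \<noteq> j" for i j
    unfolding P using that by (intro sum.neutral) (auto simp: axis_def)
  have on: "P $ i $ i = c i" for i
    unfolding P sum_axis by (simp add: axis_def)
  have "(\<Prod>k\<in>UNIV. c k) = det P" by (subst det_diagonal) (auto simp: off on)
  also have "\<dots> = (det T)\<^sup>2 * det M" unfolding P_def det_mul det_transpose by (simp add: power2_eq_square)
  finally show ?thesis ..
qed

lemma lincomb_det_nz:
  assumes "forms_independent f1 f2" and "\<And>v. f1 v = a * q v + b * r v" and "\<And>v. f2 v = g * q v + e * r v"
  shows "a * e - b * g \<noteq> 0"
proof
  assume z: "a * e - b * g = 0"
  have rel: "s = 0 \<and> t = 0" if "s * a + t * g = 0" "s * b + t * e = 0" for s t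
  proof -
    have "s * f1 v + t * f2 v = (s * a + t * g) * q v + (s * b + t * e) * r v" for v
      unfolding assms(2,3) by (simp add: algebra_simps)
    then have "\<forall>v. s * f1 v + t * f2 v = 0" using that by simp
    then show ?thesis using assms(1) unfolding forms_independent_def by blast
  qed
  have "g = 0 \<and> - a = 0" by (rule rel) (use z in \<open>auto simp: algebra_simps\<close>)
  moreover have "e = 0 \<and> - b = 0" by (rule rel) (use z in \<open>auto simp: algebra_simps\<close>)
  ultimately have "(1::complex) = 0 \<and> (0::complex) = 0" by (intro rel) auto
  then show False by simp
qed

type_synonym 'n matrix_pair = "(complex ^ 'n ^ 'n) \<times> (complex ^ 'n ^ 'n)"

definition times_i_pair_scalar :: "'n::finite matrix_pair \<times> complex \<Rightarrow> 'n matrix_pair \<times> complex" where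
  "times_i_pair_scalar p = (times_i_pair (fst p), \<i> * snd p)"

abbreviation pair_pencil :: "'n::finite matrix_pair \<Rightarrow> (complex ^ 'n \<Rightarrow> complex) set" where
  "pair_pencil p \<equiv> forms_span (quad_form (fst p)) (quad_form (snd p))"

text \<open>After a change of the basis of the pencil by \<open>(a, b, g, e)\<close> the second form is nondegenerate at \<open>p0\<close>, and
  \<open>t k\<close> are the simple roots of the determinant \<open>R p0\<close>. The implicit function theorem continues them to nearby
  \<open>p\<close>, and eigenvectors for the continued roots diagonalize the pencil.\<close>

lemma local_roots:
  fixes p0 :: "'n::finite matrix_pair" and t :: "'n \<Rightarrow> complex"
  assumes cls: "pencil_class (pair_pencil p0) = pencil_class (model_pencil t)"
    and t: "inj t" and n: "CARD('n) \<ge> 2"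
  obtains \<tau> where "\<And>k. \<tau> k p0 = t k" "\<And>k. complex_diff_at times_i_pair (\<tau> k) p0"
    "\<forall>\<^sub>F p in nhds p0. inj (\<lambda>k. \<tau> k p) \<and> pencil_class (pair_pencil p) = pencil_class (model_pencil (\<lambda>k. \<tau> k p))"
proof -
  note dpm = model_diagonal_pair[OF t]
  have "(pair_pencil p0, model_pencil t) \<in> pencil_rel"
    using cls pencil_class_eq_iff[OF diagonal_pair_nonsingular[OF dpm n]] unfolding model_pencil_def by blast
  then obtain T where T: "invertible T" "model_pencil t = pullback T (pair_pencil p0)"
    unfolding pencil_rel_def by blast
  have "diag_form t \<in> model_pencil t" "diag_form (\<lambda>_. 1) \<in> model_pencil t"
    unfolding model_pencil_def by (rule mem_forms_span)+
  then obtain a b g e where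
    ab: "\<And>z. diag_form t z = a * quad_form (fst p0) (T *v z) + b * quad_form (snd p0) (T *v z)" and
    ge: "\<And>z. diag_form (\<lambda>_. 1) z = g * quad_form (fst p0) (T *v z) + e * quad_form (snd p0) (T *v z)"
    unfolding T(2) pullback_forms_span unfolding forms_span_def by (auto simp: fun_eq_iff)
  have det: "a * e - b * g \<noteq> 0"
    by (rule lincomb_det_nz[OF diagonal_pair_independent[OF dpm n] ab ge])
  define A where "A p = symm (\<chi> i j. a * fst p $ i $ j + b * snd p $ i $ j)" for p :: "'n matrix_pair"
  define B where "B p = symm (\<chi> i j. g * fst p $ i $ j + e * snd p $ i $ j)" for p :: "'n matrix_pair"
  have symAB: "A p $ i $ j = A p $ j $ i" "B p $ i $ j = B p $ j $ i" for p i j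
    by (simp_all add: A_def B_def symm_def add.commute)
  have qA: "quad_form (A p) v = a * quad_form (fst p) v + b * quad_form (snd p) v"
    and qB: "quad_form (B p) v = g * quad_form (fst p) v + e * quad_form (snd p) v" for p v
    unfolding A_def B_def quad_form_symm quad_form_lincomb by simp_all
  have span: "forms_span (quad_form (A p)) (quad_form (B p)) = pair_pencil p" for p
    using forms_span_change[OF det, of "quad_form (fst p)" "quad_form (snd p)"]
    by (simp add: qA[abs_def] qB[abs_def])
  define M where "M p s = (\<chi> i j. A p $ i $ j - s * B p $ i $ j)" for p s
  define R where "R p s = det (M p s)" for p s
  have J1: "bounded_linear (\<lambda>q :: 'n matrix_pair \<times> complex. fst (fst q) $ i $ j)"
    "bounded_linear (\<lambda>q :: 'n matrix_pair \<times> complex. snd (fst q) $ i $ j)" for i j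
    by (intro bounded_linear_compose[OF bounded_linear_vec_nth] bounded_linear_fst_comp
        bounded_linear_snd_comp bounded_linear_fst)+
  have J1': "bounded_linear (\<lambda>q :: 'n matrix_pair. fst q $ i $ j)"
    "bounded_linear (\<lambda>q :: 'n matrix_pair. snd q $ i $ j)" for i j
    by (intro bounded_linear_compose[OF bounded_linear_vec_nth] bounded_linear_fst
        bounded_linear_snd)+
  have cd: "complex_diff_at times_i_pair_scalar (\<lambda>q. R (fst q) (snd q)) q" for q
    unfolding R_def
  proof (rule complex_diff_at_det)
    fix i j
    have 1: "complex_diff_at times_i_pair_scalar (\<lambda>q. fst (fst q) $ i $ j) q" for i j
      by (rule complex_diff_at_linear[OF J1(1)]) (simp add: times_i_pair_scalar_def times_i_pair_def)
    have 2: "complex_diff_at times_i_pair_scalar (\<lambda>q. snd (fst q) $ i $ j) q" for i j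
      by (rule complex_diff_at_linear[OF J1(2)]) (simp add: times_i_pair_scalar_def times_i_pair_def)
    have 3: "complex_diff_at times_i_pair_scalar (\<lambda>q. snd q) q"
      by (rule complex_diff_at_linear[OF bounded_linear_snd]) (simp add: times_i_pair_scalar_def)
    show "complex_diff_at times_i_pair_scalar (\<lambda>q. M (fst q) (snd q) $ i $ j) q"
      unfolding M_def A_def B_def symm_def vec_lambda_beta
      by (intro complex_diff_at_diff complex_diff_at_mult complex_diff_at_divide complex_diff_at_add
          complex_diff_at_const 1 2 3) simp_all
  qed
  have cdB: "complex_diff_at times_i_pair (\<lambda>p. det (B p)) p" for p
  proof (rule complex_diff_at_det)
    fix i j
    have 1: "complex_diff_at times_i_pair (\<lambda>q. fst q $ i $ j) p" for i j
      by (rule complex_diff_at_linear[OF J1'(1)]) (simp add: times_i_pair_def)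
    have 2: "complex_diff_at times_i_pair (\<lambda>q. snd q $ i $ j) p" for i j
      by (rule complex_diff_at_linear[OF J1'(2)]) (simp add: times_i_pair_def)
    show "complex_diff_at times_i_pair (\<lambda>q. B q $ i $ j) p"
      unfolding B_def symm_def vec_lambda_beta
      by (intro complex_diff_at_mult complex_diff_at_divide complex_diff_at_add
          complex_diff_at_const 1 2) simp_all
  qed
  have dT: "det T \<noteq> 0" using T(1) by (simp add: invertible_det_nz)
  have R0: "(det T)\<^sup>2 * R p0 s = (\<Prod>k\<in>UNIV. (t k - s))" for s
    unfolding R_def
  proof (rule det_congruence)
    show "M p0 s $ i $ j = M p0 s $ j $ i" for i j by (simp add: M_def symAB(1)[of p0 i j] symAB(2)[of p0 i j])
    fix z
    have Ms: "M p0 s = (\<chi> i j. 1 * A p0 $ i $ j + (- s) * B p0 $ i $ j)" by (simp add: M_def)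
    show "quad_form (M p0 s) (T *v z) = diag_form (\<lambda>k. t k - s) z"
      unfolding Ms quad_form_lincomb qA qB ab[symmetric] ge[symmetric] diag_form_def
      by (simp add: sum_distrib_left sum_negf[symmetric] sum.distrib[symmetric] algebra_simps)
  qed
  have B0: "det (B p0) \<noteq> 0"
  proof -
    have "(det T)\<^sup>2 * det (B p0) = (\<Prod>k\<in>(UNIV :: 'n set). 1)"
      by (rule det_congruence[where c = "\<lambda>_. 1"]) (rule symAB(2), simp add: qB ge)
    then show ?thesis by auto
  qed
  have ex: "\<exists>\<tau>. \<tau> p0 = t k \<and> complex_diff_at times_i_pair \<tau> p0 \<and> (\<forall>\<^sub>F p in nhds p0. R p (\<tau> p) = 0)" for k
  proof -
    obtain D where D: "((\<lambda>q. R (fst q) (snd q)) has_derivative D) (at (p0, t k))"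
      "\<And>v. D (times_i_pair_scalar v) = \<i> * D v"
      using cd unfolding complex_diff_at_def by blast
    interpret D: bounded_linear D by (rule has_derivative_bounded_linear[OF D(1)])
    have i: "times_i_pair_scalar (0, s) = (0, \<i> * s)" for s
      by (simp add: times_i_pair_scalar_def times_i_pair_def vec_eq_iff prod_eq_iff)
    have Ds: "D (0, s) = D (0, 1) * s" for s
    proof -
      have "(0 :: 'n matrix_pair, s) = Re s *\<^sub>R (0, 1) + Im s *\<^sub>R (0, \<i>)"
        by (simp add: complex_eq_iff)
      then have "D (0, s) = Re s *\<^sub>R D (0, 1) + Im s *\<^sub>R D (0, \<i>)"
        by (simp only: D.add D.scaleR)
      also have "D (0, \<i>) = \<i> * D (0, 1)" using D(2)[of "(0, 1)"] unfolding i by simp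
      finally have "D (0, s) = (of_real (Re s) + \<i> * of_real (Im s)) * D (0, 1)"
        by (simp add: scaleR_conv_of_real algebra_simps)
      then have "D (0, s) = s * D (0, 1)" unfolding complex_eq[of s, symmetric] .
      then show ?thesis by (rule trans[OF _ mult.commute])
    qed
    have Dsplit: "D q = D (fst q, 0) + D (0, 1) * snd q" for q
      using D.add[of "(fst q, 0)" "(0, snd q)"] Ds[of "snd q"] by simp
    \<comment> \<open>\<open>D (0, 1)\<close> is the derivative of \<open>R p0\<close> at its simple root \<open>t k\<close>.\<close>
    have nz: "D (0, 1) \<noteq> 0"
    proof
      assume z: "D (0, 1) = 0"
      have "((\<lambda>s. (p0, s)) has_derivative (\<lambda>s. (0, s))) (at (t k))"
        by (intro has_derivative_Pair has_derivative_const has_derivative_ident)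
      then have "((\<lambda>s. R p0 s) has_derivative (\<lambda>s. D (0, s))) (at (t k))"
        using has_derivative_compose[of "\<lambda>s. (p0, s)" "\<lambda>s. (0, s)" "t k" UNIV "\<lambda>q. R (fst q) (snd q)" D] D(1)
        by simp
      moreover have "D (0, s) = 0 * s" for s using Ds[of s] z by simp
      ultimately have "(R p0 has_field_derivative 0) (at (t k))"
        by (intro has_derivative_imp_has_field_derivative[where D = "\<lambda>s. D (0, s)"]) simp_all
      then have "((\<lambda>s. (det T)\<^sup>2 * R p0 s) has_field_derivative (det T)\<^sup>2 * 0) (at (t k))"
        by (rule DERIV_cmult)
      then have 1: "((\<lambda>s. \<Prod>j\<in>UNIV. (t j - s)) has_field_derivative 0) (at (t k))"
        unfolding R0 by simp
      have "((\<lambda>s. \<Prod>j\<in>UNIV. (t j - s)) has_field_derivative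
          (\<Sum>i\<in>UNIV. (- 1) * (\<Prod>j\<in>UNIV-{i}. (t j - t k)))) (at (t k))"
        by (rule has_field_derivative_prod) (auto intro!: derivative_eq_intros)
      from DERIV_unique[OF 1 this]
      have "(\<Sum>i\<in>UNIV. (\<Prod>j\<in>UNIV-{i}. (t j - t k))) = 0" by (simp add: sum_negf)
      moreover have "(\<Sum>i\<in>UNIV. (\<Prod>j\<in>UNIV-{i}. (t j - t k))) = (\<Prod>j\<in>UNIV-{k}. (t j - t k))"
      proof -
        have "(\<Prod>j\<in>UNIV-{i}. (t j - t k)) = 0" if "i \<noteq> k" for i
          using that by (intro prod_zero) (auto intro!: bexI[of _ k])
        note off = this
        have "(\<Sum>i\<in>UNIV-{k}. (\<Prod>j\<in>UNIV-{i}. (t j - t k))) = 0"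
          by (intro sum.neutral ballI off) simp
        then show ?thesis using sum.remove[of UNIV k "\<lambda>i. \<Prod>j\<in>UNIV-{i}. (t j - t k)"] by simp
      qed
      moreover have "(\<Prod>j\<in>UNIV-{k}. (t j - t k)) \<noteq> 0" using t by (auto simp: inj_eq)
      ultimately show False by simp
    qed
    have cont: "continuous_on UNIV (\<lambda>q. R (fst q) (snd q))"
      by (intro continuous_at_imp_continuous_on ballI complex_diff_at_continuous[OF cd])
    have root: "R p0 (t k) = 0"
    proof -
      have "(\<Prod>j\<in>UNIV. (t j - t k)) = 0" by auto
      then have "(det T)\<^sup>2 * R p0 (t k) = 0" unfolding R0 .
      then show ?thesis using dT by simp
    qed
    have der: "((\<lambda>q. R (fst q) (snd q)) has_derivative (\<lambda>q. D (fst q, 0) + D (0, 1) * snd q)) (at (p0, t k))"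
    proof -
      have "(\<lambda>q. D (fst q, 0) + D (0, 1) * snd q) = D" by (rule ext) (rule Dsplit[symmetric])
      then show ?thesis using D(1) by simp
    qed
    show ?thesis
    proof (rule implicit_root[where R = R and z = p0 and W = UNIV, OF open_UNIV UNIV_I cont root der nz])
      fix \<tau> N
      assume \<tau>: "open N" "p0 \<in> N" "\<tau> p0 = t k" "\<And>u. u \<in> N \<Longrightarrow> R u (\<tau> u) = 0"
      "(\<tau> has_derivative (\<lambda>v. - D (v, 0) / D (0, 1))) (at p0)"
    have "- D (times_i_pair v, 0) / D (0, 1) = \<i> * (- D (v, 0) / D (0, 1))" for v
      using D(2)[of "(v, 0)"] by (simp add: times_i_pair_scalar_def)
    then have "complex_diff_at times_i_pair \<tau> p0" unfolding complex_diff_at_def using \<tau>(5) by blast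
    moreover have "\<forall>\<^sub>F p in nhds p0. R p (\<tau> p) = 0"
      using eventually_nhds_in_open[OF \<tau>(1,2)] by eventually_elim (rule \<tau>(4))
    ultimately show ?thesis using \<tau>(3) by blast
    qed
  qed
  obtain \<tau> where \<tau>: "\<And>k. \<tau> k p0 = t k" "\<And>k. complex_diff_at times_i_pair (\<tau> k) p0"
    "\<And>k. \<forall>\<^sub>F p in nhds p0. R p (\<tau> k p) = 0"
  proof -
    have "\<forall>k. \<exists>\<tau>. \<tau> p0 = t k \<and> complex_diff_at times_i_pair \<tau> p0 \<and> (\<forall>\<^sub>F p in nhds p0. R p (\<tau> p) = 0)"
      using ex by blast
    from choice[OF this] show ?thesis using that by blast
  qed
  have tend: "(\<tau> k \<longlongrightarrow> t k) (nhds p0)" for k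
    using complex_diff_at_continuous[OF \<tau>(2)[of k]] \<tau>(1)[of k]
    by (simp add: continuous_at tendsto_nhds_iff)
  have ev1: "\<forall>\<^sub>F p in nhds p0. \<forall>k l. k \<noteq> l \<longrightarrow> \<tau> k p \<noteq> \<tau> l p"
    by (rule eventually_distinct[OF tend t])
  have ev2: "\<forall>\<^sub>F p in nhds p0. det (B p) \<noteq> 0"
  proof (rule tendsto_imp_eventually_ne[OF _ B0])
    show "((\<lambda>p. det (B p)) \<longlongrightarrow> det (B p0)) (nhds p0)"
      using complex_diff_at_continuous[OF cdB] by (simp add: continuous_at tendsto_nhds_iff)
  qed
  have ev3: "\<forall>\<^sub>F p in nhds p0. \<forall>k. R p (\<tau> k p) = 0"
    by (intro eventually_all_finite \<tau>(3))
  show ?thesis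
  proof (rule that[OF \<tau>(1,2)])
    show "\<forall>\<^sub>F p in nhds p0. inj (\<lambda>k. \<tau> k p) \<and>
        pencil_class (pair_pencil p) = pencil_class (model_pencil (\<lambda>k. \<tau> k p))"
      using ev1 ev2 ev3
    proof eventually_elim
      case (elim p)
      have inj: "inj (\<lambda>k. \<tau> k p)" using elim(1) by (auto intro!: injI)
      have root: "det (\<chi> i j. A p $ i $ j - \<tau> k p * B p $ i $ j) = 0" for k
        using elim(3) unfolding R_def M_def by blast
      show ?case
      proof (rule eigen_diagonal_pair[OF symAB inj root elim(2)])
        fix E d assume "diagonal_pair (quad_form (A p)) (quad_form (B p)) (\<lambda>k. \<tau> k p) E d"
        from diagonal_pair_class[OF this n] inj show ?case unfolding span by simp
      qed
    qed
  qed
qed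

lemma model_pencil_matrices:
  "model_pencil t = pair_pencil ((\<chi> i j. if i = j then t i else 0), mat 1)"
  unfolding model_pencil_def mat_def fst_conv snd_conv quad_form_diagonal[of t]
    quad_form_diagonal[of "\<lambda>_. 1"] by (rule refl)

lemma model_class_in_moduli:
  fixes t :: "'n::finite \<Rightarrow> complex"
  assumes "inj t" "CARD('n) \<ge> 2" shows "pencil_class (model_pencil t) \<in> moduli_PQ"
  unfolding moduli_PQ_def pencil_class_def
  by (rule quotientI) (use diagonal_pair_nonsingular[OF model_diagonal_pair[OF assms(1)] assms(2)] in
      \<open>simp add: model_pencil_def\<close>)

lemma eventually_cross_ratios_near:
  assumes near: "cross_ratios_near t0 \<epsilon> (t :: 'n::finite \<Rightarrow> complex)" and tend: "\<And>k. ((\<lambda>p. \<tau> p k) \<longlongrightarrow> t k) F"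
  shows "\<forall>\<^sub>F p in F. cross_ratios_near t0 \<epsilon> (\<tau> p)"
proof -
  have t: "inj t" using near by (simp add: cross_ratios_near_def)
  have 1: "\<forall>\<^sub>F p in F. \<forall>k l. k \<noteq> l \<longrightarrow> \<tau> p k \<noteq> \<tau> p l"
    by (rule eventually_distinct[OF tend t])
  have 2: "\<forall>\<^sub>F p in F. \<forall>i j k l. distinct [i, j, k, l] \<longrightarrow>
      norm (cross_ratio (\<tau> p) i j k l - cross_ratio t0 i j k l) < \<epsilon>"
  proof (intro eventually_all_finite)
    fix i j k l
    show "\<forall>\<^sub>F p in F. distinct [i, j, k, l] \<longrightarrow> norm (cross_ratio (\<tau> p) i j k l - cross_ratio t0 i j k l) < \<epsilon>"
    proof (cases "distinct [i, j, k, l]")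
      case True
      then have "(t i - t l) * (t j - t k) \<noteq> 0" using t by (auto simp: inj_eq)
      then have "((\<lambda>p. norm (cross_ratio (\<tau> p) i j k l - cross_ratio t0 i j k l)) \<longlongrightarrow>
          norm (cross_ratio t i j k l - cross_ratio t0 i j k l)) F"
        unfolding cross_ratio_def by (intro tendsto_intros tend)
      moreover have "norm (cross_ratio t i j k l - cross_ratio t0 i j k l) < \<epsilon>"
        using near True unfolding cross_ratios_near_def by blast
      ultimately have "\<forall>\<^sub>F p in F. norm (cross_ratio (\<tau> p) i j k l - cross_ratio t0 i j k l) < \<epsilon>"
        by (rule order_tendstoD(2))
      then show ?thesis by eventually_elim simp
    next
      case False
      then have "\<forall>p. distinct [i, j, k, l] \<longrightarrow> norm (cross_ratio (\<tau> p) i j k l - cross_ratio t0 i j k l) < \<epsilon>"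
        by blast
      then show ?thesis by (rule always_eventually)
    qed
  qed
  show ?thesis using 1 2
  proof eventually_elim
    case (elim p)
    then show ?case unfolding cross_ratios_near_def by (meson injI)
  qed
qed

text \<open>Enough holomorphic functions on the moduli space near the class of a rigid tuple.\<close>

lemma cross_ratio_coordinate:
  fixes t0 :: "'n::finite \<Rightarrow> complex"
  assumes rig: "moebius_rigid t0" and t0: "inj t0" and n: "CARD('n) \<ge> 3" and d: "distinct [i, j, k, l]"
  obtains \<epsilon> G where "\<epsilon> > 0" "moduli_holomorphic_near G (pencil_class (model_pencil t0))"
    "\<And>t. cross_ratios_near t0 \<epsilon> t \<Longrightarrow> G (pencil_class (model_pencil t)) = cross_ratio t i j k l"
proof -
  have n2: "CARD('n) \<ge> 2" using n by simp
  obtain \<epsilon> where \<epsilon>: "\<epsilon> > 0"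
    and uniq: "\<And>\<pi> t. bij \<pi> \<Longrightarrow> cross_ratios_near t0 \<epsilon> t \<Longrightarrow> cross_ratios_near t0 \<epsilon> (t \<circ> \<pi>) \<Longrightarrow> \<pi> = id"
    using rigid_labelling_unique[OF rig t0 n] by metis
  define G where "G = near_cross_ratio t0 \<epsilon> i j k l"
  have G: "G (pencil_class (model_pencil t)) = cross_ratio t i j k l" if "cross_ratios_near t0 \<epsilon> t" for t
    unfolding G_def by (rule near_cross_ratio_model[OF n2 that uniq])
  define U where "U = {pencil_class (model_pencil t) | t. cross_ratios_near t0 \<epsilon> t}"
  define S where "S = {p :: 'n matrix_pair. pencil_class (pair_pencil p) \<in> U}"
  have S': "S = {(A, B). pencil_class (forms_span (quad_form A) (quad_form B)) \<in> U}"
    by (auto simp: S_def)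
  have loc: "(\<forall>\<^sub>F p in nhds p0. p \<in> S) \<and>
      complex_diff_at times_i_pair (\<lambda>p. G (pencil_class (pair_pencil p))) p0" if p0: "p0 \<in> S" for p0
  proof -
    obtain t where t: "pencil_class (pair_pencil p0) = pencil_class (model_pencil t)" "cross_ratios_near t0 \<epsilon> t"
      using p0 unfolding S_def U_def by auto
    have inj: "inj t" using t(2) by (simp add: cross_ratios_near_def)
    obtain \<tau> where \<tau>: "\<And>k. \<tau> k p0 = t k" "\<And>k. complex_diff_at times_i_pair (\<tau> k) p0"
      "\<forall>\<^sub>F p in nhds p0. inj (\<lambda>k. \<tau> k p) \<and> pencil_class (pair_pencil p) = pencil_class (model_pencil (\<lambda>k. \<tau> k p))"
      by (rule local_roots[OF t(1) inj n2]) (rule that; assumption)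
    have tend: "(\<tau> k \<longlongrightarrow> t k) (nhds p0)" for k
      using complex_diff_at_continuous[OF \<tau>(2)[of k]] \<tau>(1)[of k]
      by (simp add: continuous_at tendsto_nhds_iff)
    have near: "\<forall>\<^sub>F p in nhds p0. cross_ratios_near t0 \<epsilon> (\<lambda>k. \<tau> k p)"
      by (rule eventually_cross_ratios_near[OF t(2) tend])
    have val: "\<forall>\<^sub>F p in nhds p0. p \<in> S \<and>
        G (pencil_class (pair_pencil p)) = cross_ratio (\<lambda>k. \<tau> k p) i j k l"
      using \<tau>(3) near
    proof eventually_elim
      case (elim p)
      then show ?case using G[OF elim(2)] unfolding S_def U_def by auto
    qed
    have den: "(\<tau> i p0 - \<tau> l p0) * (\<tau> j p0 - \<tau> k p0) \<noteq> 0"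
      unfolding \<tau>(1) using inj d by (auto simp: inj_eq)
    have "complex_diff_at times_i_pair (\<lambda>p. cross_ratio (\<lambda>k. \<tau> k p) i j k l) p0"
      unfolding cross_ratio_def
      by (rule complex_diff_at_divide; (rule den)?) (intro complex_diff_at_mult complex_diff_at_diff \<tau>(2))+
    then obtain D where D: "((\<lambda>p. cross_ratio (\<lambda>k. \<tau> k p) i j k l) has_derivative D) (at p0)"
      "\<forall>v. D (times_i_pair v) = \<i> * D v"
      unfolding complex_diff_at_def by blast
    have "\<forall>\<^sub>F p in at p0. cross_ratio (\<lambda>k. \<tau> k p) i j k l = G (pencil_class (pair_pencil p))"
      using val unfolding eventually_at_filter by eventually_elim simp
    then have "((\<lambda>p. G (pencil_class (pair_pencil p))) has_derivative D) (at p0)"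
      by (rule has_derivative_transform_eventually[OF D(1)])
         (use eventually_nhds_x_imp_x[OF val] in auto)
    moreover have "\<forall>\<^sub>F p in nhds p0. p \<in> S" using val by eventually_elim simp
    ultimately show ?thesis unfolding complex_diff_at_def using D(2) by blast
  qed
  have openS: "open S"
    unfolding open_subopen[of S]
  proof
    fix p assume "p \<in> S"
    then have "\<forall>\<^sub>F p in nhds p. p \<in> S" using loc by blast
    then show "\<exists>T. open T \<and> p \<in> T \<and> T \<subseteq> S" unfolding eventually_nhds by blast
  qed
  have "moduli_holomorphic_near G (pencil_class (model_pencil t0))"
    unfolding moduli_holomorphic_near_def
  proof (intro exI[of _ U] exI[of _ S] conjI ballI)
    show "U \<subseteq> moduli_PQ" unfolding U_def cross_ratios_near_def using model_class_in_moduli[OF _ n2] by auto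
    show "pencil_class (model_pencil t0) \<in> U"
      unfolding U_def cross_ratios_near_def using t0 \<epsilon> by auto
    show "S = {(A, B). pencil_class (forms_span (quad_form A) (quad_form B)) \<in> U}" by (rule S')
    show "open S" by (rule openS)
    fix p assume "p \<in> S"
    then obtain D where D: "((\<lambda>p. G (pencil_class (pair_pencil p))) has_derivative D) (at p)"
      "\<And>v. D (times_i_pair v) = \<i> * D v"
      using loc unfolding complex_diff_at_def by blast
    obtain J K where JK: "D = (\<lambda>(A, B). \<Sum>i\<in>UNIV. \<Sum>j\<in>UNIV. J $ i $ j * A $ i $ j + K $ i $ j * B $ i $ j)"
      using complex_linear_matrix_pair[OF has_derivative_linear[OF D(1)] D(2)] by blast
    show "\<exists>J K. ((\<lambda>(A, B). G (pencil_class (forms_span (quad_form A) (quad_form B)))) has_derivative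
            (\<lambda>(A, B). \<Sum>i\<in>UNIV. \<Sum>j\<in>UNIV. J $ i $ j * A $ i $ j + K $ i $ j * B $ i $ j)) (at p)"
      using D(1) unfolding JK by (auto simp: case_prod_unfold)
  qed
  then show ?thesis using that \<epsilon> G by blast
qed

lemma has_derivative_constant_curve:
  fixes G :: "'a::real_normed_vector \<Rightarrow> complex" and \<gamma> :: "real \<Rightarrow> 'a"
  assumes G: "(G has_derivative D) (at (\<gamma> 0))" and \<gamma>: "(\<gamma> has_vector_derivative v) (at 0)"
    and const: "\<forall>\<^sub>F r in nhds 0. G (\<gamma> r) = c"
  shows "D v = 0"
proof -
  have "((\<lambda>r. G (\<gamma> r)) has_derivative (\<lambda>r. D (r *\<^sub>R v))) (at 0)"
    using has_derivative_compose[OF \<gamma>[unfolded has_vector_derivative_def] G] .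
  moreover have "((\<lambda>r. G (\<gamma> r)) has_derivative (\<lambda>r. 0)) (at 0)"
  proof (rule has_derivative_transform_eventually[of "\<lambda>_. c"])
    show "\<forall>\<^sub>F r in at 0. c = G (\<gamma> r)"
      using const unfolding eventually_at_filter by eventually_elim simp
  qed (use eventually_nhds_x_imp_x[OF const] in auto)
  ultimately have "(\<lambda>r. D (r *\<^sub>R v)) = (\<lambda>r. 0)" by (rule has_derivative_unique)
  from fun_cong[OF this, of 1] show ?thesis by simp
qed

text \<open>A quadratic polynomial is the velocity of a one-parameter family of Moebius maps, along which
  the class of the model pencil does not change.\<close>

lemma moduli_function_on_models:
  fixes t0 :: "'n::finite \<Rightarrow> complex"
  assumes hol: "moduli_holomorphic_near G (pencil_class (model_pencil t0))"
    and t0: "inj t0" and n: "CARD('n) \<ge> 2"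
  obtains D where
    "((\<lambda>s :: complex ^ 'n. G (pencil_class (model_pencil (\<lambda>k. s $ k)))) has_derivative D) (at (\<chi> k. t0 k))"
    "\<And>p. degree p \<le> 2 \<Longrightarrow> D (\<chi> k. poly p (t0 k)) = 0"
proof -
  define \<Delta> :: "complex ^ 'n \<Rightarrow> complex ^ 'n ^ 'n" where "\<Delta> s = (\<chi> i j. if i = j then s $ i else 0)" for s
  have mod: "model_pencil (\<lambda>k. s $ k) = pair_pencil (\<Delta> s, mat 1)" for s
    unfolding model_pencil_matrices \<Delta>_def ..
  define s0 where "s0 = (\<chi> k. t0 k)"
  have t0s: "t0 = (\<lambda>k. s0 $ k)" by (simp add: s0_def)
  obtain U S where US: "pencil_class (model_pencil t0) \<in> U"
    "S = {(A, B). pencil_class (forms_span (quad_form A) (quad_form B)) \<in> U}"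
    "\<And>x. x \<in> S \<Longrightarrow> \<exists>J K. ((\<lambda>(A, B). G (pencil_class (forms_span (quad_form A) (quad_form B)))) has_derivative
            (\<lambda>(A, B). \<Sum>i\<in>UNIV. \<Sum>j\<in>UNIV. J $ i $ j * A $ i $ j + K $ i $ j * B $ i $ j)) (at x)"
    using hol unfolding moduli_holomorphic_near_def by blast
  have "(\<Delta> s0, mat 1) \<in> S" using US(1) unfolding US(2) t0s mod by simp
  then obtain D' where D': "((\<lambda>p. G (pencil_class (pair_pencil p))) has_derivative D') (at (\<Delta> s0, mat 1))"
    using US(3) unfolding case_prod_unfold by blast
  have "bounded_linear \<Delta>"
    by (rule linear_conv_bounded_linear[THEN iffD1], rule linearI) (auto simp: \<Delta>_def vec_eq_iff)
  then have "((\<lambda>s. (\<Delta> s, mat 1 :: complex ^ 'n ^ 'n)) has_derivative (\<lambda>v. (\<Delta> v, 0))) (at s0)"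
    by (intro has_derivative_Pair has_derivative_const bounded_linear.has_derivative[OF _ has_derivative_ident])
  from has_derivative_compose[OF this D']
  have der: "((\<lambda>s. G (pencil_class (model_pencil (\<lambda>k. s $ k)))) has_derivative (\<lambda>v. D' (\<Delta> v, 0))) (at s0)"
    unfolding mod .
  show ?thesis
  proof (rule that[OF der[unfolded s0_def]])
    fix p :: "complex poly" assume "degree p \<le> 2"
    then obtain x y z where p: "p = [:x, y, z:]" by (rule quadratic_poly_cases)
    \<comment> \<open>the curve through \<open>t0\<close> in its Moebius orbit with velocity \<open>x + y t + z t^2\<close>\<close>
    define h where "h k r = (t0 k * (1 + of_real r * y) + of_real r * x) / (1 - of_real r * z * t0 k)"
      for k and r :: real
    define \<gamma> where "\<gamma> r = (\<chi> k. h k r)" for r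
    show "D' (\<Delta> (\<chi> k. poly p (t0 k)), 0) = 0"
    proof (rule has_derivative_constant_curve[where \<gamma> = \<gamma> and c = "G (pencil_class (model_pencil t0))"
          and G = "\<lambda>s. G (pencil_class (model_pencil (\<lambda>k. s $ k)))" and D = "\<lambda>v. D' (\<Delta> v, 0)"])
      have g0: "\<gamma> 0 = s0" by (simp add: \<gamma>_def h_def s0_def)
      show "((\<lambda>s. G (pencil_class (model_pencil (\<lambda>k. s $ k)))) has_derivative (\<lambda>v. D' (\<Delta> v, 0))) (at (\<gamma> 0))"
        unfolding g0 by (rule der)
      show "(\<gamma> has_vector_derivative (\<chi> k. poly p (t0 k))) (at 0)"
        unfolding has_vector_derivative_def
      proof (rule vec_has_derivative)
        fix k
        have "(h k has_vector_derivative (t0 k * y + x) * 1 - t0 k * (- z * t0 k)) (at 0)"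
          unfolding h_def by (auto intro!: derivative_eq_intros simp: has_vector_derivative_def scaleR_conv_of_real fun_eq_iff algebra_simps)
        then show "((\<lambda>r. \<gamma> r $ k) has_derivative (\<lambda>v. (v *\<^sub>R (\<chi> k. poly p (t0 k))) $ k)) (at 0)"
          unfolding has_vector_derivative_def by (simp add: \<gamma>_def p algebra_simps)
      qed
      have 1: "\<forall>\<^sub>F r in nhds (0::real). 1 - of_real r * z * t0 k \<noteq> 0" for k
        by (rule tendsto_imp_eventually_ne[of _ "1 - of_real 0 * z * t0 k"])
           (auto intro!: tendsto_eq_intros filterlim_ident)
      have all1: "\<forall>\<^sub>F r in nhds (0::real). \<forall>k. 1 - of_real r * z * t0 k \<noteq> 0"
        by (intro eventually_all_finite 1)
      have 2: "\<forall>\<^sub>F r in nhds (0::real). (1 + of_real r * y) * 1 - (of_real r * x) * (- of_real r * z) \<noteq> 0"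
        by (rule tendsto_imp_eventually_ne[of _ "(1 + of_real 0 * y) * 1 - (of_real 0 * x) * (- of_real 0 * z)"])
           (auto intro!: tendsto_eq_intros filterlim_ident)
      show "\<forall>\<^sub>F r in nhds 0. G (pencil_class (model_pencil (\<lambda>k. \<gamma> r $ k))) = G (pencil_class (model_pencil t0))"
        using all1 2
      proof eventually_elim
        case (elim r)
        have "pencil_class (model_pencil (\<lambda>k. h k r)) = pencil_class (model_pencil t0)"
        proof (rule model_class_moebius[OF t0 _ elim(2) n])
          fix k
          have "(- of_real r * z) * t0 k + 1 = 1 - of_real r * z * t0 k" by simp
          then show "h k r * ((- of_real r * z) * t0 k + 1) = (1 + of_real r * y) * t0 k + of_real r * x"
            unfolding h_def using elim(1) by (simp add: mult.commute)
        qed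
        then show ?case by (simp add: \<gamma>_def)
      qed
    qed
  qed
qed

section \<open>Points of the diagonal quadrics and their roots\<close>

text \<open>At a point of \<open>X\<close> with nonzero coordinates such a tuple \<open>t\<close> exists iff the second fundamental form at the point is a nonsingular pencil without
  \<open>\<phi>\<^sub>2\<close> among its degenerate elements, and then \<open>t\<close> labels these elements.\<close>

definition diagonal_point :: "('k::finite \<Rightarrow> complex) \<Rightarrow> complex ^ 'k \<Rightarrow> ('n::finite \<Rightarrow> complex) \<Rightarrow> bool" where
  "diagonal_point lam x t \<longleftrightarrow> (\<forall>i. x $ i \<noteq> 0) \<and> (\<Sum>i\<in>UNIV. (x $ i)\<^sup>2) = 0 \<and>
     (\<Sum>i\<in>UNIV. lam i * (x $ i)\<^sup>2) = 0 \<and> inj t \<and> (\<forall>k i. t k \<noteq> lam i) \<and>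
     (\<forall>k. resolvent lam (($) x) (t k) = 0)"

text \<open>For a root \<open>s\<close> of the resolvent this spans, modulo \<open>x\<close>, the kernel of \<open>\<phi>\<^sub>1 - s \<phi>\<^sub>2\<close> on the tangent space.\<close>

definition eigen_tangent :: "('k::finite \<Rightarrow> complex) \<Rightarrow> complex ^ 'k \<Rightarrow> complex \<Rightarrow> complex ^ 'k" where
  "eigen_tangent lam x s = (\<chi> i. x $ i / (lam i - s))"

text \<open>Partial fractions; this makes the vectors \<open>eigen_tangent\<close> for distinct roots orthogonal.\<close>

lemma resolvent_cross:
  assumes "\<And>i. s \<noteq> lam i" "\<And>i. r \<noteq> lam i" "s \<noteq> r"
  shows "(\<Sum>i\<in>UNIV. x $ i / (lam i - s) * (x $ i / (lam i - r))) =
    (resolvent lam (($) x) s - resolvent lam (($) x) r) / (s - r)"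
  unfolding resolvent_def sum_subtractf[symmetric] sum_divide_distrib
proof (rule sum.cong[OF refl])
  fix i
  have "lam i - s \<noteq> 0" "lam i - r \<noteq> 0" "s - r \<noteq> 0" using assms(1)[of i] assms(2)[of i] assms(3) by auto
  then show "x $ i / (lam i - s) * (x $ i / (lam i - r)) = ((x $ i)\<^sup>2 / (lam i - s) - (x $ i)\<^sup>2 / (lam i - r)) / (s - r)"
    by (simp add: divide_simps power2_eq_square) (simp add: algebra_simps)
qed

lemma eigen_tangent_relations:
  fixes t :: "'n::finite \<Rightarrow> complex" and lam :: "'k::finite \<Rightarrow> complex"
  assumes dp: "diagonal_point lam x t"
  defines "w \<equiv> \<lambda>k. eigen_tangent lam x (t k)"
  shows "(\<Sum>i\<in>UNIV. x $ i * w k $ i) = 0" and "(\<Sum>i\<in>UNIV. lam i * x $ i * w k $ i) = 0"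
    and "(\<Sum>i\<in>UNIV. w k $ i * w l $ i) = (if k = l then resolvent_deriv lam (($) x) (t k) else 0)"
    and "(\<Sum>i\<in>UNIV. lam i * w k $ i * w l $ i) = (if k = l then t k * resolvent_deriv lam (($) x) (t k) else 0)"
proof -
  have t: "inj t" and tl: "\<And>k i. t k \<noteq> lam i" and root: "\<And>k. resolvent lam (($) x) (t k) = 0"
    and s0: "(\<Sum>i\<in>UNIV. (x $ i)\<^sup>2) = 0"
    using dp by (auto simp: diagonal_point_def)
  have nz: "lam i - t k \<noteq> 0" for i k using tl[of k i] by auto
  show xw: "(\<Sum>i\<in>UNIV. x $ i * w k $ i) = 0" for k
    using root[of k] by (simp add: w_def eigen_tangent_def resolvent_def power2_eq_square)
  have split: "lam i * y * w k $ i = x $ i * y + t k * (y * w k $ i)" for i k y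
  proof -
    have "(lam i - t k) * w k $ i = x $ i" using nz[of i k] by (simp add: w_def eigen_tangent_def)
    then have "lam i * w k $ i = x $ i + t k * w k $ i" by (simp add: algebra_simps)
    then have "y * (lam i * w k $ i) = y * (x $ i + t k * w k $ i)" by simp
    then show ?thesis by (simp add: algebra_simps)
  qed
  have split_sum: "(\<Sum>i\<in>UNIV. lam i * y i * w k $ i) = (\<Sum>i\<in>UNIV. x $ i * y i) + t k * (\<Sum>i\<in>UNIV. y i * w k $ i)" for y k
    unfolding split by (simp add: sum.distrib sum_distrib_left)
  show "(\<Sum>i\<in>UNIV. lam i * x $ i * w k $ i) = 0"
    unfolding split_sum xw using s0 by (simp add: power2_eq_square)
  show ww: "(\<Sum>i\<in>UNIV. w k $ i * w l $ i) = (if k = l then resolvent_deriv lam (($) x) (t k) else 0)" for k l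
  proof (cases "k = l")
    case True
    then show ?thesis by (simp add: w_def eigen_tangent_def resolvent_deriv_def power2_eq_square)
  next
    case False
    then have "t k \<noteq> t l" using t by (simp add: inj_eq)
    then show ?thesis using False resolvent_cross[of "t k" lam "t l" x] tl root
      by (simp add: w_def eigen_tangent_def)
  qed
  show "(\<Sum>i\<in>UNIV. lam i * w k $ i * w l $ i) = (if k = l then t k * resolvent_deriv lam (($) x) (t k) else 0)"
    unfolding split_sum ww xw by auto
qed

lemma diagonal_point_representation:
  fixes t :: "'n::finite \<Rightarrow> complex" and lam :: "'k::finite \<Rightarrow> complex"
  assumes dp: "diagonal_point lam x t" and lam: "inj lam" and card: "CARD('k) = CARD('n) + 3"
  obtains c where "c \<noteq> 0"
    "\<And>i. (x $ i)\<^sup>2 * (\<Prod>j\<in>UNIV-{i}. (lam j - lam i)) = c * (\<Prod>k\<in>UNIV. (t k - lam i))"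
    "\<And>k. resolvent_deriv lam (($) x) (t k) * (\<Prod>i\<in>UNIV. (lam i - t k)) = - c * (\<Prod>j\<in>UNIV-{k}. (t j - t k))"
    "\<And>k. resolvent_deriv lam (($) x) (t k) \<noteq> 0"
proof -
  have x: "\<And>i. x $ i \<noteq> 0" and s0: "(\<Sum>i\<in>UNIV. (x $ i)\<^sup>2) = 0" and s1: "(\<Sum>i\<in>UNIV. lam i * (x $ i)\<^sup>2) = 0"
    and t: "inj t" and tl: "\<And>k i. t k \<noteq> lam i" and root: "\<And>k. resolvent lam (($) x) (t k) = 0"
    using dp by (auto simp: diagonal_point_def)
  obtain c where c: "c \<noteq> 0"
    "\<And>i. (x $ i)\<^sup>2 * (\<Prod>j\<in>UNIV-{i}. (lam j - lam i)) = c * (\<Prod>k\<in>UNIV. (t k - lam i))"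
    by (rule resolvent_roots[OF lam t card s0 s1 x tl root]) (rule that; assumption)
  have d: "resolvent_deriv lam (($) x) (t k) * (\<Prod>i\<in>UNIV. (lam i - t k)) = - c * (\<Prod>j\<in>UNIV-{k}. (t j - t k))" for k
    by (rule resolvent_of_roots(5)[OF lam card tl c(2)])
  have "(\<Prod>j\<in>UNIV-{k}. (t j - t k)) \<noteq> 0" for k using t by (auto simp: inj_eq)
  then have "resolvent_deriv lam (($) x) (t k) \<noteq> 0" for k
    using d[of k] c(1) by (metis mult_eq_0_iff neg_equal_0_iff_equal)
  then show ?thesis using that c d by blast
qed

text \<open>By \<open>two_moments_interpolant\<close>, the tangent vector \<open>y\<close> corresponds to a polynomial of degree at most
  \<open>CARD('n)\<close>, and the vectors \<open>eigen_tangent lam x (t k)\<close> and \<open>x\<close> to the products of all \<open>t j - s\<close> with one or no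
  factor omitted, which form a basis of these polynomials.\<close>

lemma tangent_decomposition:
  fixes t :: "'n::finite \<Rightarrow> complex" and lam :: "'k::finite \<Rightarrow> complex"
  assumes dp: "diagonal_point lam x t" and lam: "inj lam" and card: "CARD('k) = CARD('n) + 3"
    and y0: "(\<Sum>i\<in>UNIV. x $ i * y $ i) = 0" and y1: "(\<Sum>i\<in>UNIV. lam i * x $ i * y $ i) = 0"
  obtains a c where "y = (\<Sum>k\<in>UNIV. a k *s eigen_tangent lam x (t k)) + c *s x"
proof -
  have x: "\<And>i. x $ i \<noteq> 0" and t: "inj t" and tl: "\<And>k i. t k \<noteq> lam i"
    using dp by (auto simp: diagonal_point_def)
  obtain c where c: "c \<noteq> 0"
    and rep: "\<And>i. (x $ i)\<^sup>2 * (\<Prod>j\<in>UNIV-{i}. (lam j - lam i)) = c * (\<Prod>k\<in>UNIV. (t k - lam i))"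
    by (rule diagonal_point_representation[OF dp lam card]) (rule that; assumption)
  have s1: "(\<Sum>i\<in>UNIV. lam i * (x $ i * y $ i)) = 0" using y1 by (simp add: mult_ac)
  have "CARD('k) \<ge> 3" using card by simp
  then obtain H where H3: "degree H + 3 \<le> CARD('k)"
    and lamH: "\<And>i. poly H (lam i) = (x $ i * y $ i) * (\<Prod>j\<in>UNIV-{i}. (lam j - lam i))"
    by (rule two_moments_interpolant[OF lam _ y0 s1]) (rule that; assumption)
  define b where "b k = poly H (t k) / (\<Prod>j\<in>UNIV-{k}. (t j - t k))" for k
  define D where "D = H - (\<Sum>k\<in>UNIV. smult (b k) (node_poly t (UNIV - {k})))"
  define T where "T = node_poly t (UNIV :: 'n set)"
  have Tl: "poly T (lam i) \<noteq> 0" for i using tl by (auto simp: T_def poly_node_poly)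
  obtain i0 :: 'k where True by simp
  define c' where "c' = poly D (lam i0) / poly T (lam i0)"
  let ?A = "insert (lam i0) (range t)"
  have cA: "card ?A = CARD('n) + 1"
    using tl[symmetric] t by (subst card_insert_disjoint) (auto simp: card_image)
  have dS: "degree (\<Sum>k\<in>UNIV. smult (b k) (node_poly t (UNIV - {k}))) \<le> CARD('n)"
    by (intro degree_sum_le order_trans[OF degree_smult_le]) (auto simp: degree_node_poly card_Diff_singleton)
  have nz: "(\<Prod>j\<in>UNIV-{k}. (t j - t k)) \<noteq> 0" for k using t by (auto simp: inj_eq)
  have "D = smult c' T"
  proof (rule poly_eq_if_agree[where t = id and A = ?A])
    have "degree D \<le> CARD('n)" unfolding D_def using H3 card dS by (intro degree_diff_le) auto
    then show "degree D < card ?A" unfolding cA by simp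
    show "degree (smult c' T) < card ?A"
      unfolding cA T_def using degree_smult_le[of c' "node_poly t (UNIV :: 'n set)"] by (simp add: degree_node_poly)
    fix s assume "s \<in> ?A"
    moreover have "poly T (t m) = 0" for m by (auto simp: T_def poly_node_poly)
    moreover have "poly D (t m) = 0" for m
    proof -
      have off: "poly (node_poly t (UNIV - {k})) (t m) = 0" if "k \<noteq> m" for k
        using that by (auto simp: poly_node_poly)
      have "(\<Sum>k\<in>UNIV. b k * poly (node_poly t (UNIV - {k})) (t m)) = b m * poly (node_poly t (UNIV - {m})) (t m)"
        by (subst sum.remove[of _ m]) (auto simp: off)
      then show ?thesis unfolding D_def poly_diff poly_sum poly_smult
        using nz[of m] by (simp add: b_def poly_node_poly)
    qed
    ultimately show "poly D (id s) = poly (smult c' T) (id s)" using Tl[of i0] by (auto simp: c'_def)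
  qed auto
  then have Hs: "poly H (lam i) = c' * poly T (lam i) + (\<Sum>k\<in>UNIV. b k * poly (node_poly t (UNIV - {k})) (lam i))" for i
    using arg_cong[of D _ "\<lambda>p. poly p (lam i)"] by (simp add: D_def poly_sum algebra_simps)
  have "y $ i = ((\<Sum>k\<in>UNIV. (- b k / c) *s eigen_tangent lam x (t k)) + (c' / c) *s x) $ i" for i
  proof -
    define P where "P = (\<Prod>j\<in>UNIV-{i}. (lam j - lam i))"
    have P: "P \<noteq> 0" unfolding P_def using lam by (auto simp: inj_eq)
    have TP: "poly T (lam i) = (x $ i)\<^sup>2 * P / c"
      using rep[of i] c by (simp add: T_def poly_node_poly P_def)
    have "poly (node_poly t (UNIV - {k})) (lam i) = - poly T (lam i) / (lam i - t k)" for k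
    proof -
      have "t k - lam i \<noteq> 0" "lam i - t k \<noteq> 0" using tl[of k i] by auto
      moreover have "(t k - lam i) * poly (node_poly t (UNIV - {k})) (lam i) = poly T (lam i)"
        unfolding T_def poly_node_poly by (rule prod_remove_univ)
      ultimately have "poly (node_poly t (UNIV - {k})) (lam i) = poly T (lam i) / (t k - lam i)"
        by (metis nonzero_mult_div_cancel_left)
      also have "\<dots> = - poly T (lam i) / - (t k - lam i)" by (rule minus_divide_divide[symmetric])
      finally show ?thesis by simp
    qed
    then have "x $ i * y $ i * P = poly T (lam i) * (c' + (\<Sum>k\<in>UNIV. - b k / (lam i - t k)))"
      using Hs[of i] lamH[of i] by (simp add: P_def algebra_simps sum_distrib_left sum_negf)
    then have "(x $ i * P) * y $ i = (x $ i * P) * (x $ i * (c' + (\<Sum>k\<in>UNIV. - b k / (lam i - t k))) / c)"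
      unfolding TP by (simp add: power2_eq_square mult_ac)
    moreover have "x $ i * P \<noteq> 0" using x[of i] P by simp
    ultimately have "y $ i = x $ i * (c' + (\<Sum>k\<in>UNIV. - b k / (lam i - t k))) / c"
      by (metis mult_left_cancel)
    also have "\<dots> = (\<Sum>k\<in>UNIV. (- b k / c) * (x $ i / (lam i - t k))) + (c' / c) * x $ i"
      by (simp add: sum_distrib_left add_divide_distrib algebra_simps sum_divide_distrib)
    finally show ?thesis by (simp add: sum_component eigen_tangent_def)
  qed
  then have "y = (\<Sum>k\<in>UNIV. (- b k / c) *s eigen_tangent lam x (t k)) + (c' / c) *s x" by (rule vec_eqI)
  then show ?thesis by (rule that)
qed

text \<open>For three indices the vector \<open>y\<close> supported there and orthogonal to \<open>x\<close> and \<open>lam * x\<close> shows that the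
  quotients \<open>l / x\<close> lie on an affine line in \<open>lam\<close>; two indices fix this line.\<close>

lemma linear_multipliers:
  fixes lam x l :: "'k::finite \<Rightarrow> 'a::field"
  assumes lam: "inj lam" and k: "CARD('k) \<ge> 2" and x: "\<And>i. x i \<noteq> 0"
    and l: "\<And>y. (\<Sum>i\<in>UNIV. x i * y i) = 0 \<Longrightarrow> (\<Sum>i\<in>UNIV. lam i * x i * y i) = 0 \<Longrightarrow> (\<Sum>i\<in>UNIV. l i * y i) = 0"
  obtains \<alpha> \<beta> where "\<And>i. l i = (\<alpha> + \<beta> * lam i) * x i"
proof -
  obtain i j :: 'k where ij: "i \<noteq> j" using two_indices[OF k] .
  have d: "lam i - lam j \<noteq> 0" using lam ij by (simp add: inj_eq)
  define m where "m k = l k / x k" for k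
  have lm: "l k = m k * x k" for k using x[of k] by (simp add: m_def)
  define \<beta> where "\<beta> = (m i - m j) / (lam i - lam j)"
  define \<alpha> where "\<alpha> = m i - \<beta> * lam i"
  have mi: "m i = \<alpha> + \<beta> * lam i" by (simp add: \<alpha>_def)
  have "\<beta> * (lam i - lam j) = m i - m j" using d by (simp add: \<beta>_def)
  then have mj: "m j = \<alpha> + \<beta> * lam j" by (simp add: \<alpha>_def algebra_simps)
  have "m k = \<alpha> + \<beta> * lam k" for k
  proof (cases "k \<in> {i, j}")
    case True
    then show ?thesis using mi mj by auto
  next
    case False
    \<comment> \<open>The coefficients of the affine dependence of \<open>lam k\<close>, \<open>lam i\<close>, \<open>lam j\<close>.\<close>
    define p where "p = (lam j - lam k) / (lam i - lam j)"
    define q where "q = (lam k - lam i) / (lam i - lam j)"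
    have pq: "1 + p + q = 0"
    proof -
      have "1 + p + q = ((lam i - lam j) + (lam j - lam k) + (lam k - lam i)) / (lam i - lam j)"
        unfolding p_def q_def add_divide_distrib using d by simp
      then show ?thesis by simp
    qed
    have pql: "lam k + p * lam i + q * lam j = 0"
    proof -
      have "lam k + p * lam i + q * lam j = (lam k * (lam i - lam j) + (lam j - lam k) * lam i + (lam k - lam i) * lam j) / (lam i - lam j)"
        unfolding p_def q_def add_divide_distrib using d by simp
      also have "lam k * (lam i - lam j) + (lam j - lam k) * lam i + (lam k - lam i) * lam j = 0"
        by (simp add: algebra_simps)
      finally show ?thesis by simp
    qed
    define y where "y r = (if r = k then 1 / x k else if r = i then p / x i else if r = j then q / x j else 0)" for r
    have S: "(\<Sum>r\<in>UNIV. f r * y r) = f k / x k + f i * p / x i + f j * q / x j" for f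
    proof -
      have "(\<Sum>r\<in>UNIV. f r * y r) = (\<Sum>r\<in>{k, i, j}. f r * y r)"
        by (rule sum.mono_neutral_right) (auto simp: y_def)
      also have "\<dots> = f k * y k + (f i * y i + f j * y j)" using False ij by simp
      finally have e: "(\<Sum>r\<in>UNIV. f r * y r) = f k * y k + (f i * y i + f j * y j)" .
      have "y k = 1 / x k" "y i = p / x i" "y j = q / x j" using False ij by (auto simp: y_def)
      then show ?thesis using e by simp
    qed
    have "(\<Sum>r\<in>UNIV. l r * y r) = 0"
    proof (rule l)
      show "(\<Sum>r\<in>UNIV. x r * y r) = 0" unfolding S using x pq by simp
      show "(\<Sum>r\<in>UNIV. lam r * x r * y r) = 0" unfolding S using x pql by (simp add: mult.commute)
    qed
    then have "m k + p * m i + q * m j = 0" by (simp add: S m_def mult.commute)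
    then have "m k = - (p * (\<alpha> + \<beta> * lam i) + q * (\<alpha> + \<beta> * lam j))" unfolding mi[symmetric] mj[symmetric]
        eq_neg_iff_add_eq_0 by (simp add: add.assoc)
    also have "\<dots> = \<alpha> + \<beta> * lam k - (\<alpha> * (1 + p + q) + \<beta> * (lam k + p * lam i + q * lam j))"
      by (simp add: algebra_simps)
    finally show ?thesis unfolding pq pql by simp
  qed
  then show ?thesis using that[of \<alpha> \<beta>] lm by simp
qed

text \<open>The point near \<open>x\<close> whose resolvent has the roots \<open>s\<close>: the square of each coordinate is a product over
  the roots, and the sign is the one that gives \<open>x\<close> itself for \<open>s = t\<close>.\<close>

definition root_chart :: "('k::finite \<Rightarrow> complex) \<Rightarrow> complex ^ 'k \<Rightarrow> ('n::finite \<Rightarrow> complex) \<Rightarrow> ('n \<Rightarrow> complex) \<Rightarrow> complex ^ 'k" where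
  "root_chart lam x t s = (\<chi> i. x $ i * csqrt (\<Prod>k\<in>UNIV. (s k - lam i) / (t k - lam i)))"

lemma root_chart_diagonal_point:
  fixes t :: "'n::finite \<Rightarrow> complex" and lam :: "'k::finite \<Rightarrow> complex"
  assumes dp: "diagonal_point lam x t" and lam: "inj lam" and card: "CARD('k) = CARD('n) + 3"
    and s: "inj s" and sl: "\<And>k i. s k \<noteq> lam i"
  shows "diagonal_point lam (root_chart lam x t s) s"
proof -
  have x: "\<And>i. x $ i \<noteq> 0" and tl: "\<And>k i. t k \<noteq> lam i"
    using dp by (auto simp: diagonal_point_def)
  obtain c where c: "c \<noteq> 0"
    and rep: "\<And>i. (x $ i)\<^sup>2 * (\<Prod>j\<in>UNIV-{i}. (lam j - lam i)) = c * (\<Prod>k\<in>UNIV. (t k - lam i))"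
    by (rule diagonal_point_representation[OF dp lam card]) (rule that; assumption)
  have rep': "(root_chart lam x t s $ i)\<^sup>2 * (\<Prod>j\<in>UNIV-{i}. (lam j - lam i)) = c * (\<Prod>k\<in>UNIV. (s k - lam i))" for i
  proof -
    have nz: "(\<Prod>k\<in>UNIV. (t k - lam i)) \<noteq> 0" using tl by auto
    have "(root_chart lam x t s $ i)\<^sup>2 * (\<Prod>j\<in>UNIV-{i}. (lam j - lam i))
      = ((x $ i)\<^sup>2 * (\<Prod>j\<in>UNIV-{i}. (lam j - lam i))) * ((\<Prod>k\<in>UNIV. (s k - lam i)) / (\<Prod>k\<in>UNIV. (t k - lam i)))"
      by (simp add: root_chart_def power_mult_distrib prod_dividef)
    then show ?thesis unfolding rep using nz by simp
  qed
  have "root_chart lam x t s $ i \<noteq> 0" for i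
    using x sl tl by (simp add: root_chart_def)
  then show ?thesis
    unfolding diagonal_point_def using resolvent_of_roots(1,2,4)[OF lam card sl rep'] s sl by simp
qed

lemma root_chart_base:
  assumes "diagonal_point lam x t" shows "root_chart lam x t t = x"
  using assms by (simp add: root_chart_def diagonal_point_def vec_eq_iff)

lemma root_chart_continuous:
  fixes t :: "'n::finite \<Rightarrow> complex"
  assumes dp: "diagonal_point lam x t" and tend: "\<And>k. ((\<lambda>p. \<sigma> p k) \<longlongrightarrow> t k) F"
  shows "((\<lambda>p. root_chart lam x t (\<sigma> p)) \<longlongrightarrow> x) F"
proof -
  have tl: "\<And>k i. t k \<noteq> lam i" using dp by (auto simp: diagonal_point_def)
  have "((\<lambda>p. root_chart lam x t (\<sigma> p) $ i) \<longlongrightarrow> x $ i) F" for i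
  proof -
    have "((\<lambda>p. \<Prod>k\<in>UNIV. (\<sigma> p k - lam i) / (t k - lam i)) \<longlongrightarrow> (\<Prod>k\<in>UNIV. (t k - lam i) / (t k - lam i))) F"
      using tl by (intro tendsto_intros tend) auto
    moreover have "(\<Prod>k\<in>UNIV. (t k - lam i) / (t k - lam i)) = 1" using tl by simp
    ultimately have lim: "((\<lambda>p. \<Prod>k\<in>UNIV. (\<sigma> p k - lam i) / (t k - lam i)) \<longlongrightarrow> 1) F" by simp
    have "isCont csqrt 1" by (rule continuous_at_csqrt) simp
    from isCont_tendsto_compose[OF this lim]
    have "((\<lambda>p. csqrt (\<Prod>k\<in>UNIV. (\<sigma> p k - lam i) / (t k - lam i))) \<longlongrightarrow> csqrt 1) F" .
    then have "((\<lambda>p. x $ i * csqrt (\<Prod>k\<in>UNIV. (\<sigma> p k - lam i) / (t k - lam i))) \<longlongrightarrow> x $ i * csqrt 1) F"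
      by (intro tendsto_intros)
    then show ?thesis by (simp add: root_chart_def)
  qed
  then have "((\<lambda>p. \<chi> i. root_chart lam x t (\<sigma> p) $ i) \<longlongrightarrow> (\<chi> i. x $ i)) F" by (rule tendsto_vec_lambda)
  then show ?thesis by simp
qed

text \<open>In the direction of \<open>eigen_tangent lam x (t k)\<close> the root \<open>t k\<close> moves with velocity \<open>-2\<close> and the other
  roots stay.\<close>

lemma root_chart_derivative:
  fixes t :: "'n::finite \<Rightarrow> complex" and lam :: "'k::finite \<Rightarrow> complex"
  assumes dp: "diagonal_point lam x t"
  shows "((\<lambda>r::real. (1 + of_real r * c) *s root_chart lam x t (\<lambda>k. t k - 2 * of_real r * a k)) has_vector_derivative
     (\<Sum>k\<in>UNIV. a k *s eigen_tangent lam x (t k)) + c *s x) (at 0)"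
  unfolding has_vector_derivative_def
proof (rule vec_has_derivative)
  fix i
  have tl: "t k - lam i \<noteq> 0" for k using dp by (auto simp: diagonal_point_def)
  let ?P = "\<lambda>z. \<Prod>k\<in>UNIV. (t k - 2 * z * a k - lam i) / (t k - lam i)"
  have P0: "?P 0 = 1" using tl by simp
  have "(?P has_field_derivative (\<Sum>k\<in>UNIV. (- 2 * a k / (t k - lam i)) *
      (\<Prod>j\<in>UNIV-{k}. (t j - 2 * 0 * a j - lam i) / (t j - lam i)))) (at 0)"
    by (rule has_field_derivative_prod) (use tl in \<open>auto intro!: derivative_eq_intros\<close>)
  then have dP: "(?P has_field_derivative (\<Sum>k\<in>UNIV. - 2 * a k / (t k - lam i))) (at 0)"
    using tl by simp
  have "(csqrt has_field_derivative inverse (2 * csqrt 1)) (at (?P 0))"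
    unfolding P0 by (rule has_field_derivative_csqrt) simp
  from DERIV_chain2[OF this dP]
  have "((\<lambda>z. csqrt (?P z)) has_field_derivative (\<Sum>k\<in>UNIV. - a k / (t k - lam i))) (at 0)"
    by (simp add: sum_distrib_left)
  from DERIV_cmult[OF this, of "x $ i"]
  have d2: "((\<lambda>z. x $ i * csqrt (?P z)) has_field_derivative x $ i * (\<Sum>k\<in>UNIV. - a k / (t k - lam i))) (at 0)" .
  have d1: "((\<lambda>z. 1 + z * c) has_field_derivative c) (at 0)" by (auto intro!: derivative_eq_intros)
  have "((\<lambda>z. (1 + z * c) * (x $ i * csqrt (?P z))) has_field_derivative
      c * x $ i + x $ i * (\<Sum>k\<in>UNIV. - a k / (t k - lam i))) (at 0)"
    using DERIV_mult[OF d1 d2] unfolding P0 by simp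
  also have "x $ i * (\<Sum>k\<in>UNIV. - a k / (t k - lam i)) = (\<Sum>k\<in>UNIV. a k * (x $ i / (lam i - t k)))"
    unfolding sum_distrib_left
  proof (rule sum.cong[OF refl])
    fix k
    have "lam i - t k \<noteq> 0" using tl[of k] by auto
    then show "x $ i * (- a k / (t k - lam i)) = a k * (x $ i / (lam i - t k))"
      using tl[of k] by (simp add: divide_simps) (simp add: algebra_simps)
  qed
  finally have "((\<lambda>z. (1 + z * c) * (x $ i * csqrt (?P z))) has_field_derivative
      c * x $ i + (\<Sum>k\<in>UNIV. a k * (x $ i / (lam i - t k)))) (at (of_real 0))" by simp
  from has_vector_derivative_real_field[OF this]
  have "((\<lambda>r. (1 + of_real r * c) * (x $ i * csqrt (?P (of_real r)))) has_vector_derivative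
      c * x $ i + (\<Sum>k\<in>UNIV. a k * (x $ i / (lam i - t k)))) (at 0)" .
  then show "((\<lambda>r. ((1 + of_real r * c) *s root_chart lam x t (\<lambda>k. t k - 2 * of_real r * a k)) $ i) has_derivative
       (\<lambda>r. (r *\<^sub>R ((\<Sum>k\<in>UNIV. a k *s eigen_tangent lam x (t k)) + c *s x)) $ i)) (at 0)"
    unfolding has_vector_derivative_def
    by (simp add: root_chart_def eigen_tangent_def sum_component add.commute distrib_right)
qed

section \<open>The second fundamental form in diagonal coordinates\<close>

lemma span_line: "vec.span {u} = range (\<lambda>c. c *s u)" for u :: "complex ^ 'k"
  by (rule vec.span_singleton)

lemma span_line_mem: "u \<in> vec.span {u}" for u :: "complex ^ 'k"
  by (simp add: vec.span_base)

text \<open>The choice of diagonal coordinates for one of the two varieties.\<close>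

locale diagonal_quadrics =
  fixes X :: "(complex ^ ('n::finite + 3)) set set"
    and \<phi>\<^sub>1 \<phi>\<^sub>2 :: "complex ^ ('n + 3) \<Rightarrow> complex"
    and lam :: "'n + 3 \<Rightarrow> complex" and e :: "'n + 3 \<Rightarrow> complex ^ ('n + 3)"
  assumes diag: "diagonalization X \<phi>\<^sub>1 \<phi>\<^sub>2 lam e" and nonsing: "nonsingular_two_quadrics X"
begin

definition base_change :: "complex ^ ('n + 3) ^ ('n + 3)" where
  "base_change = (\<chi> r i. e i $ r)"

definition coords :: "complex ^ ('n + 3) \<Rightarrow> complex ^ ('n + 3)" where
  "coords u = matrix_inv base_change *v u"

lemma base_change_mult: "base_change *v x = (\<Sum>i\<in>UNIV. x $ i *s e i)"
  by (simp add: base_change_def vec_eq_iff matrix_vector_mult_def sum_component mult.commute)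

lemma inj_lam: "inj lam" using diag by (simp add: diagonalization_def)

lemma card_ambient: "CARD('n + 3) = CARD('n) + 3" by simp

lemma invertible_base_change: "invertible base_change"
proof -
  have "\<exists>x. v = base_change *v x" for v
  proof -
    have "v \<in> vec.span (range e)" using diag by (simp add: diagonalization_def)
    then have "v \<in> range ((*v) base_change)"
    proof (induction rule: vec.span_induct_alt)
      case base
      show ?case by (rule range_eqI[of _ _ 0]) simp
    next
      case (step c x y)
      then obtain i z where "x = e i" "y = base_change *v z" by auto
      moreover have "e i = base_change *v axis i 1" for i
        by (rule vec_eqI) (simp add: matrix_vector_mult_axis base_change_def)
      ultimately have "c *s x + y = base_change *v (c *s axis i 1 + z)"
        by (simp add: matrix_vector_right_distrib vector_scalar_commute)
      then show ?case by blast
    qed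
    then show ?thesis by blast
  qed
  then have "surj ((*v) base_change)" by (metis surjI)
  then show ?thesis unfolding invertible_right_inverse matrix_right_invertible_surjective .
qed

lemma base_change_coords [simp]: "base_change *v coords u = u"
  by (simp add: coords_def matrix_vector_mul_assoc matrix_inv[OF invertible_base_change])

lemma coords_base_change [simp]: "coords (base_change *v x) = x"
  by (simp add: coords_def matrix_vector_mul_assoc matrix_inv[OF invertible_base_change])

lemma coords_scale [simp]: "coords (c *s u) = c *s coords u"
  by (simp add: coords_def vector_scalar_commute)

lemma coords_eq_0 [simp]: "coords u = 0 \<longleftrightarrow> u = 0"
  by (metis base_change_coords coords_base_change matrix_vector_mult_0_right)

lemma phi1_base_change: "\<phi>\<^sub>1 (base_change *v x) = diag_form lam x"
  using diag unfolding diagonalization_def base_change_mult diag_form_def by blast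

lemma phi2_base_change: "\<phi>\<^sub>2 (base_change *v x) = diag_form (\<lambda>_. 1) x"
  using diag unfolding diagonalization_def base_change_mult diag_form_def by simp

lemma vanishing_forms_eq: "vanishing_forms X = forms_span \<phi>\<^sub>1 \<phi>\<^sub>2"
  using diag by (simp add: diagonalization_def)

text \<open>The equations of \<open>X\<close> are linear combinations of \<open>\<phi>\<^sub>1\<close> and \<open>\<phi>\<^sub>2\<close>, which vanish on \<open>X\<close> in turn.\<close>

lemma X_iff:
  assumes "u \<noteq> 0"
  shows "vec.span {u} \<in> X \<longleftrightarrow> (\<Sum>i\<in>UNIV. (coords u $ i)\<^sup>2) = 0 \<and> (\<Sum>i\<in>UNIV. lam i * (coords u $ i)\<^sup>2) = 0"
proof -
  have phi: "\<phi>\<^sub>1 (c *s u) = c\<^sup>2 * (\<Sum>i\<in>UNIV. lam i * (coords u $ i)\<^sup>2)"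
    "\<phi>\<^sub>2 (c *s u) = c\<^sup>2 * (\<Sum>i\<in>UNIV. (coords u $ i)\<^sup>2)" for c
  proof -
    have cs: "base_change *v (c *s coords u) = c *s u" by (simp add: vector_scalar_commute)
    show "\<phi>\<^sub>1 (c *s u) = c\<^sup>2 * (\<Sum>i\<in>UNIV. lam i * (coords u $ i)\<^sup>2)"
      "\<phi>\<^sub>2 (c *s u) = c\<^sup>2 * (\<Sum>i\<in>UNIV. (coords u $ i)\<^sup>2)"
      using phi1_base_change[of "c *s coords u"] phi2_base_change[of "c *s coords u"] unfolding cs
      by (simp_all add: diag_form_def power_mult_distrib sum_distrib_left mult_ac)
  qed
  obtain q r where qr: "quadratic_form q" "quadratic_form r" "X = {p \<in> proj_space. \<forall>z\<in>p. q z = 0 \<and> r z = 0}"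
    using nonsing unfolding nonsingular_two_quadrics_def by blast
  have "q \<in> vanishing_forms X" "r \<in> vanishing_forms X"
    unfolding vanishing_forms_def using qr by auto
  then obtain a b a' b' where ab: "q = (\<lambda>v. a * \<phi>\<^sub>1 v + b * \<phi>\<^sub>2 v)" "r = (\<lambda>v. a' * \<phi>\<^sub>1 v + b' * \<phi>\<^sub>2 v)"
    unfolding vanishing_forms_eq forms_span_def by blast
  show ?thesis
  proof
    assume p: "vec.span {u} \<in> X"
    have "\<phi>\<^sub>1 \<in> vanishing_forms X" "\<phi>\<^sub>2 \<in> vanishing_forms X"
      unfolding vanishing_forms_eq by (rule mem_forms_span)+
    then have "\<phi>\<^sub>1 (1 *s u) = 0" "\<phi>\<^sub>2 (1 *s u) = 0"
      using p span_line_mem[of u] unfolding vanishing_forms_def by auto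
    then show "(\<Sum>i\<in>UNIV. (coords u $ i)\<^sup>2) = 0 \<and> (\<Sum>i\<in>UNIV. lam i * (coords u $ i)\<^sup>2) = 0"
      unfolding phi by simp
  next
    assume "(\<Sum>i\<in>UNIV. (coords u $ i)\<^sup>2) = 0 \<and> (\<Sum>i\<in>UNIV. lam i * (coords u $ i)\<^sup>2) = 0"
    then have z: "\<phi>\<^sub>1 (c *s u) = 0" "\<phi>\<^sub>2 (c *s u) = 0" for c unfolding phi by simp_all
    have "vec.span {u} \<in> proj_space" unfolding proj_space_def using assms by blast
    then show "vec.span {u} \<in> X" unfolding qr(3) span_line ab using z by auto
  qed
qed

lemma polar_coords:
  "polar \<phi>\<^sub>1 u v = (\<Sum>i\<in>UNIV. lam i * coords u $ i * coords v $ i)"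
  "polar \<phi>\<^sub>2 u v = (\<Sum>i\<in>UNIV. coords u $ i * coords v $ i)"
  using polar_diag_form[OF phi1_base_change, of "coords u" "coords v"]
    polar_diag_form[OF phi2_base_change, of "coords u" "coords v"] by simp_all

lemma perp_span:
  "v \<in> perp X (vec.span {u}) \<longleftrightarrow> (\<Sum>i\<in>UNIV. coords u $ i * coords v $ i) = 0 \<and>
     (\<Sum>i\<in>UNIV. lam i * coords u $ i * coords v $ i) = 0"
proof -
  have lin: "polar (\<lambda>v. s * \<phi>\<^sub>1 v + t * \<phi>\<^sub>2 v) w v = s * polar \<phi>\<^sub>1 w v + t * polar \<phi>\<^sub>2 w v" for s t w
    unfolding polar_def by (simp add: algebra_simps add_divide_distrib diff_divide_distrib)
  have sc: "polar \<phi>\<^sub>1 (c *s u) v = c * polar \<phi>\<^sub>1 u v" "polar \<phi>\<^sub>2 (c *s u) v = c * polar \<phi>\<^sub>2 u v" for c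
    unfolding polar_coords by (simp_all add: sum_distrib_left mult_ac)
  have mem: "\<phi>\<^sub>1 \<in> vanishing_forms X" "\<phi>\<^sub>2 \<in> vanishing_forms X"
    unfolding vanishing_forms_eq by (rule mem_forms_span)+
  have "v \<in> perp X (vec.span {u}) \<longleftrightarrow> polar \<phi>\<^sub>1 u v = 0 \<and> polar \<phi>\<^sub>2 u v = 0"
  proof
    assume "v \<in> perp X (vec.span {u})"
    then show "polar \<phi>\<^sub>1 u v = 0 \<and> polar \<phi>\<^sub>2 u v = 0"
      unfolding perp_def using mem span_line_mem[of u] by blast
  next
    assume "polar \<phi>\<^sub>1 u v = 0 \<and> polar \<phi>\<^sub>2 u v = 0"
    then show "v \<in> perp X (vec.span {u})"
      unfolding perp_def vanishing_forms_eq forms_span_def span_line by (auto simp: lin sc)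
  qed
  then show ?thesis unfolding polar_coords by auto
qed

lemma phi_coords:
  "\<phi>\<^sub>1 u = (\<Sum>i\<in>UNIV. lam i * coords u $ i * coords u $ i)" "\<phi>\<^sub>2 u = (\<Sum>i\<in>UNIV. coords u $ i * coords u $ i)"
  using phi1_base_change[of "coords u"] phi2_base_change[of "coords u"]
  by (simp_all add: diag_form_def power2_eq_square mult.assoc)

definition eigen_frame :: "complex ^ ('n + 3) \<Rightarrow> ('n \<Rightarrow> complex) \<Rightarrow> complex ^ 'n \<Rightarrow> complex ^ ('n + 3)" where
  "eigen_frame x t a = base_change *v (\<Sum>k\<in>UNIV. a $ k *s eigen_tangent lam x (t k))"

lemma pairing_eigen_sum:
  assumes dp: "diagonal_point lam x t"
  defines "y \<equiv> \<lambda>a c. (\<Sum>k\<in>UNIV. a $ k *s eigen_tangent lam x (t k)) + c *s x"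
  shows "(\<Sum>i\<in>UNIV. x $ i * y a c $ i) = 0" and "(\<Sum>i\<in>UNIV. lam i * x $ i * y a c $ i) = 0"
    and "(\<Sum>i\<in>UNIV. eigen_tangent lam x (t k) $ i * y a c $ i) = a $ k * resolvent_deriv lam (($) x) (t k)"
    and "(\<Sum>i\<in>UNIV. lam i * eigen_tangent lam x (t k) $ i * y a c $ i) = t k * (a $ k * resolvent_deriv lam (($) x) (t k))"
    and "(\<Sum>i\<in>UNIV. y a c $ i * y b c' $ i) = (\<Sum>k\<in>UNIV. resolvent_deriv lam (($) x) (t k) * a $ k * b $ k)"
    and "(\<Sum>i\<in>UNIV. lam i * y a c $ i * y b c' $ i) = (\<Sum>k\<in>UNIV. t k * resolvent_deriv lam (($) x) (t k) * a $ k * b $ k)"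
proof -
  let ?w = "\<lambda>k. eigen_tangent lam x (t k)" and ?d = "\<lambda>k. resolvent_deriv lam (($) x) (t k)"
  note rel = eigen_tangent_relations[OF dp]
  have s0: "(\<Sum>i\<in>UNIV. x $ i * x $ i) = 0" and s1: "(\<Sum>i\<in>UNIV. lam i * x $ i * x $ i) = 0"
    using dp by (simp_all add: diagonal_point_def power2_eq_square mult.assoc)
  have expand: "(\<Sum>i\<in>UNIV. z i * y a c $ i) = (\<Sum>k\<in>UNIV. a $ k * (\<Sum>i\<in>UNIV. z i * ?w k $ i)) + c * (\<Sum>i\<in>UNIV. z i * x $ i)" for z a c
  proof -
    have "(\<Sum>i\<in>UNIV. z i * y a c $ i) = (\<Sum>i\<in>UNIV. \<Sum>k\<in>UNIV. z i * (a $ k * ?w k $ i)) + (\<Sum>i\<in>UNIV. z i * (c * x $ i))"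
      by (simp add: y_def sum_component distrib_left sum.distrib sum_distrib_left)
    also have "(\<Sum>i\<in>UNIV. \<Sum>k\<in>UNIV. z i * (a $ k * ?w k $ i)) = (\<Sum>k\<in>UNIV. \<Sum>i\<in>UNIV. z i * (a $ k * ?w k $ i))"
      by (rule sum.swap)
    finally show ?thesis by (simp add: sum_distrib_left mult_ac)
  qed
  have xw: "(\<Sum>i\<in>UNIV. ?w k $ i * x $ i) = 0" "(\<Sum>i\<in>UNIV. lam i * ?w k $ i * x $ i) = 0" for k
    using rel(1,2)[of k] by (simp_all add: mult_ac)
  show 1: "(\<Sum>i\<in>UNIV. x $ i * y a c $ i) = 0" for a c unfolding expand rel s0 by simp
  show 2: "(\<Sum>i\<in>UNIV. lam i * x $ i * y a c $ i) = 0" for a c unfolding expand rel s1 by simp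
  show 3: "(\<Sum>i\<in>UNIV. ?w k $ i * y a c $ i) = a $ k * ?d k" for a c k
    unfolding expand rel(3) xw by (simp add: if_distrib cong: if_cong)
  show 4: "(\<Sum>i\<in>UNIV. lam i * ?w k $ i * y a c $ i) = t k * (a $ k * ?d k)" for a c k
    unfolding expand rel(4) xw by (simp add: if_distrib mult_ac cong: if_cong)
  have "(\<Sum>i\<in>UNIV. y a c $ i * y b c' $ i) = (\<Sum>k\<in>UNIV. b $ k * (\<Sum>i\<in>UNIV. ?w k $ i * y a c $ i)) + c' * (\<Sum>i\<in>UNIV. x $ i * y a c $ i)"
    unfolding expand[of "\<lambda>i. y a c $ i" b c'] by (simp add: mult.commute)
  then show "(\<Sum>i\<in>UNIV. y a c $ i * y b c' $ i) = (\<Sum>k\<in>UNIV. ?d k * a $ k * b $ k)"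
    unfolding 1 3 by (simp add: mult_ac)
  have "(\<Sum>i\<in>UNIV. lam i * y a c $ i * y b c' $ i) = (\<Sum>k\<in>UNIV. b $ k * (\<Sum>i\<in>UNIV. lam i * ?w k $ i * y a c $ i)) + c' * (\<Sum>i\<in>UNIV. lam i * x $ i * y a c $ i)"
    unfolding expand[of "\<lambda>i. lam i * y a c $ i" b c'] by (simp add: mult_ac)
  then show "(\<Sum>i\<in>UNIV. lam i * y a c $ i * y b c' $ i) = (\<Sum>k\<in>UNIV. t k * ?d k * a $ k * b $ k)"
    unfolding 2 4 by (simp add: mult_ac)
qed

lemma eigen_sum_eq_0:
  assumes dp: "diagonal_point lam x t" and z: "(\<Sum>k\<in>UNIV. a $ k *s eigen_tangent lam x (t k)) + c *s x = 0"
  shows "a = (0 :: complex ^ 'n)"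
proof (rule vec_eqI)
  fix k
  have "a $ k * resolvent_deriv lam (($) x) (t k) = 0"
    using pairing_eigen_sum(3)[OF dp, of k a c] unfolding z by simp
  moreover have "resolvent_deriv lam (($) x) (t k) \<noteq> 0"
    by (rule diagonal_point_representation[OF dp inj_lam card_ambient]) blast
  ultimately show "a $ k = (0 :: complex ^ 'n) $ k" by simp
qed

lemma perp_decomposition:
  assumes dp: "diagonal_point lam (coords u) t"
  shows "v \<in> perp X (vec.span {u}) \<longleftrightarrow> (\<exists>a c. v = eigen_frame (coords u) t a + c *s u)"
proof
  assume "v \<in> perp X (vec.span {u})"
  then have y: "(\<Sum>i\<in>UNIV. coords u $ i * coords v $ i) = 0" "(\<Sum>i\<in>UNIV. lam i * coords u $ i * coords v $ i) = 0"
    unfolding perp_span by auto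
  obtain a c where ac: "coords v = (\<Sum>k\<in>UNIV. a k *s eigen_tangent lam (coords u) (t k)) + c *s coords u"
    by (rule tangent_decomposition[OF dp inj_lam card_ambient y])
  have "v = base_change *v coords v" by simp
  also have "\<dots> = eigen_frame (coords u) t (\<chi> k. a k) + c *s u"
    unfolding ac eigen_frame_def by (simp add: matrix_vector_right_distrib vector_scalar_commute)
  finally show "\<exists>a c. v = eigen_frame (coords u) t a + c *s u" by blast
next
  assume "\<exists>a c. v = eigen_frame (coords u) t a + c *s u"
  then obtain a c where v: "v = eigen_frame (coords u) t a + c *s u" by blast
  have "v = base_change *v ((\<Sum>k\<in>UNIV. a $ k *s eigen_tangent lam (coords u) (t k)) + c *s coords u)"
    unfolding v eigen_frame_def by (simp add: matrix_vector_right_distrib vector_scalar_commute)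
  then have "coords v = (\<Sum>k\<in>UNIV. a $ k *s eigen_tangent lam (coords u) (t k)) + c *s coords u" by simp
  then show "v \<in> perp X (vec.span {u})" unfolding perp_span using pairing_eigen_sum(1,2)[OF dp] by simp
qed

lemma coords_eigen_frame:
  "coords (eigen_frame (coords u) t a + c *s u) = (\<Sum>k\<in>UNIV. a $ k *s eigen_tangent lam (coords u) (t k)) + c *s coords u"
proof -
  have "eigen_frame (coords u) t a + c *s u = base_change *v ((\<Sum>k\<in>UNIV. a $ k *s eigen_tangent lam (coords u) (t k)) + c *s coords u)"
    unfolding eigen_frame_def by (simp add: matrix_vector_right_distrib vector_scalar_commute)
  then show ?thesis by simp
qed

lemma eigen_frame_add: "eigen_frame x t (a + b) = eigen_frame x t a + eigen_frame x t b"
  by (simp add: eigen_frame_def vec.scale_left_distrib sum.distrib matrix_vector_right_distrib)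

lemma eigen_frame_scale: "eigen_frame x t (c *s a) = c *s eigen_frame x t a"
  by (simp add: eigen_frame_def vec.scale_sum_right vector_scalar_commute[symmetric])

text \<open>Modulo \<open>x\<close> a tangent vector can be made to vanish at one index \<open>l\<close>; two further entries \<open>i\<close>, \<open>j\<close> are determined by
  the two orthogonality relations, and the other entries are free.\<close>

lemma tangent_frame_exists:
  fixes u :: "complex ^ ('n + 3)"
  defines "x \<equiv> coords u"
  assumes x: "\<And>i. x $ i \<noteq> 0" and s0: "(\<Sum>i\<in>UNIV. (x $ i)\<^sup>2) = 0" and s1: "(\<Sum>i\<in>UNIV. lam i * (x $ i)\<^sup>2) = 0"
  shows "\<exists>T. tangent_frame X (vec.span {u}) T"
proof -
  have c3: "CARD('n + 3) \<ge> 3" by simp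
  obtain i j l :: "'n + 3" where ijl: "distinct [i, j, l]" by (rule three_indices[OF c3])
  have "card (UNIV - {i, j, l}) = CARD('n)"
    using ijl by (subst card_Diff_subset) auto
  then have "\<exists>\<iota>. bij_betw \<iota> (UNIV :: 'n set) (UNIV - {i, j, l})"
    by (intro finite_same_card_bij) auto
  then obtain \<iota> where \<iota>: "bij_betw \<iota> (UNIV :: 'n set) (UNIV - {i, j, l})" by blast
  have \<iota>_ne: "\<iota> k \<noteq> i" "\<iota> k \<noteq> j" "\<iota> k \<noteq> l" for k using \<iota> by (auto simp: bij_betw_def)
  have \<iota>_inj: "\<iota> k = \<iota> m \<longleftrightarrow> k = m" for k m using \<iota> by (auto simp: bij_betw_def inj_eq)
  have d: "lam i - lam j \<noteq> 0" using inj_lam ijl by (simp add: inj_eq)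
  \<comment> \<open>the tangent vector with entry 1 at \<open>\<iota> k\<close> that vanishes off \<open>\<iota> k\<close>, \<open>i\<close>, \<open>j\<close>\<close>
  define Y where "Y k = (\<chi> r. if r = \<iota> k then 1
      else if r = i then x $ \<iota> k * (lam j - lam (\<iota> k)) / ((lam i - lam j) * x $ i)
      else if r = j then x $ \<iota> k * (lam (\<iota> k) - lam i) / ((lam i - lam j) * x $ j) else 0)" for k
  have Y\<iota>: "Y k $ \<iota> m = (if k = m then 1 else 0)" and Yl: "Y k $ l = 0" for k m
    using \<iota>_ne[of m] \<iota>_ne(3)[of k] \<iota>_inj ijl by (auto simp: Y_def)
  have SY: "(\<Sum>r\<in>UNIV. f r * Y k $ r) = f (\<iota> k) + (f i * Y k $ i + f j * Y k $ j)" for f k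
  proof -
    have "(\<Sum>r\<in>UNIV. f r * Y k $ r) = (\<Sum>r\<in>{\<iota> k, i, j}. f r * Y k $ r)"
      by (rule sum.mono_neutral_right) (auto simp: Y_def)
    also have "\<dots> = f (\<iota> k) * Y k $ \<iota> k + (f i * Y k $ i + f j * Y k $ j)" using \<iota>_ne[of k] ijl by simp
    finally show ?thesis by (simp add: Y\<iota>)
  qed
  have Yij: "x $ i * Y k $ i = x $ \<iota> k * (lam j - lam (\<iota> k)) / (lam i - lam j)"
    "x $ j * Y k $ j = x $ \<iota> k * (lam (\<iota> k) - lam i) / (lam i - lam j)" for k
    using \<iota>_ne[of k] ijl x by (simp_all add: Y_def)
  have Y0: "(\<Sum>r\<in>UNIV. x $ r * Y k $ r) = 0" for k
  proof -
    have "(\<Sum>r\<in>UNIV. x $ r * Y k $ r) =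
        (x $ \<iota> k * (lam i - lam j) + x $ \<iota> k * (lam j - lam (\<iota> k)) + x $ \<iota> k * (lam (\<iota> k) - lam i)) / (lam i - lam j)"
      unfolding SY Yij by (simp only: add_divide_distrib nonzero_mult_div_cancel_right[OF d] add.assoc)
    also have "x $ \<iota> k * (lam i - lam j) + x $ \<iota> k * (lam j - lam (\<iota> k)) + x $ \<iota> k * (lam (\<iota> k) - lam i) = 0"
      by (simp add: algebra_simps)
    finally show ?thesis by simp
  qed
  have Y1: "(\<Sum>r\<in>UNIV. lam r * x $ r * Y k $ r) = 0" for k
  proof -
    have "(\<Sum>r\<in>UNIV. lam r * x $ r * Y k $ r) = lam (\<iota> k) * x $ \<iota> k + (lam i * (x $ i * Y k $ i) + lam j * (x $ j * Y k $ j))"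
      unfolding SY by simp
    also have "\<dots> = (lam (\<iota> k) * x $ \<iota> k * (lam i - lam j) + lam i * (x $ \<iota> k * (lam j - lam (\<iota> k))) +
        lam j * (x $ \<iota> k * (lam (\<iota> k) - lam i))) / (lam i - lam j)"
      unfolding Yij by (simp only: add_divide_distrib nonzero_mult_div_cancel_right[OF d] add.assoc times_divide_eq_right)
    also have "lam (\<iota> k) * x $ \<iota> k * (lam i - lam j) + lam i * (x $ \<iota> k * (lam j - lam (\<iota> k))) +
        lam j * (x $ \<iota> k * (lam (\<iota> k) - lam i)) = 0"
      by (simp add: algebra_simps)
    finally show ?thesis by simp
  qed
  have xx: "(\<Sum>r\<in>UNIV. x $ r * x $ r) = 0" "(\<Sum>r\<in>UNIV. lam r * x $ r * x $ r) = 0"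
    using s0 s1 by (simp_all add: power2_eq_square mult.assoc)
  define y where "y a c = (\<Sum>k\<in>UNIV. a $ k *s Y k) + c *s x" for a c
  have pair_y: "(\<Sum>r\<in>UNIV. f r * y a c $ r) = (\<Sum>k\<in>UNIV. a $ k * (\<Sum>r\<in>UNIV. f r * Y k $ r)) + c * (\<Sum>r\<in>UNIV. f r * x $ r)" for f a c
  proof -
    have "(\<Sum>r\<in>UNIV. f r * y a c $ r) = (\<Sum>r\<in>UNIV. \<Sum>k\<in>UNIV. f r * (a $ k * Y k $ r)) + (\<Sum>r\<in>UNIV. f r * (c * x $ r))"
      by (simp add: y_def sum_component distrib_left sum.distrib sum_distrib_left)
    also have "(\<Sum>r\<in>UNIV. \<Sum>k\<in>UNIV. f r * (a $ k * Y k $ r)) = (\<Sum>k\<in>UNIV. \<Sum>r\<in>UNIV. f r * (a $ k * Y k $ r))"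
      by (rule sum.swap)
    finally show ?thesis by (simp add: sum_distrib_left mult_ac)
  qed
  have y_perp: "(\<Sum>r\<in>UNIV. x $ r * y a c $ r) = 0" "(\<Sum>r\<in>UNIV. lam r * x $ r * y a c $ r) = 0" for a c
    unfolding pair_y Y0 Y1 xx by simp_all
  have yl: "y a c $ l = c * x $ l" for a c by (simp add: y_def sum_component Yl)
  have y\<iota>: "y a c $ \<iota> k = a $ k + c * x $ \<iota> k" for a c k
    by (simp add: y_def sum_component Y\<iota> if_distrib cong: if_cong)
  have y_zero: "a = 0 \<and> c = 0" if "y a c = 0" for a c
  proof -
    have c: "c = 0" using yl[of a c] that x[of l] by simp
    have "a $ k = 0" for k using y\<iota>[of a c k] that c by simp
    then show ?thesis using c by (simp add: vec_eq_iff)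
  qed
  have y_all: "\<exists>a c. z = y a c" if z: "(\<Sum>r\<in>UNIV. x $ r * z $ r) = 0" "(\<Sum>r\<in>UNIV. lam r * x $ r * z $ r) = 0" for z
  proof -
    \<comment> \<open>Removing the multiple of \<open>x\<close> that accounts for the entry at \<open>l\<close>, then the free entries, leaves a vector supported on \<open>i\<close> and \<open>j\<close>.\<close>
    define c where "c = z $ l / x $ l"
    define a where "a = (\<chi> k. z $ \<iota> k - c * x $ \<iota> k)"
    define v where "v = z - y a c"
    have v0: "v $ r = 0" if "r \<noteq> i" "r \<noteq> j" for r
    proof (cases "r = l")
      case True
      then show ?thesis using x[of l] by (simp add: v_def yl c_def)
    next
      case False
      then have "r \<in> \<iota> ` UNIV" using that \<iota> by (auto simp: bij_betw_def)
      then show ?thesis by (auto simp: v_def y\<iota> a_def)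
    qed
    have Sv: "(\<Sum>r\<in>UNIV. f r * v $ r) = f i * v $ i + f j * v $ j" for f
    proof -
      have "(\<Sum>r\<in>UNIV. f r * v $ r) = (\<Sum>r\<in>{i, j}. f r * v $ r)"
        by (rule sum.mono_neutral_right) (auto simp: v0)
      then show ?thesis using ijl by simp
    qed
    have "(\<Sum>r\<in>UNIV. x $ r * v $ r) = 0" "(\<Sum>r\<in>UNIV. lam r * x $ r * v $ r) = 0"
      using z y_perp[of a c] by (simp_all add: v_def right_diff_distrib sum_subtractf)
    then have 1: "x $ i * v $ i + x $ j * v $ j = 0" and 2: "lam i * (x $ i * v $ i) + lam j * (x $ j * v $ j) = 0"
      unfolding Sv by (simp_all add: mult.assoc)
    have "(lam i - lam j) * (x $ i * v $ i) = 0" "(lam j - lam i) * (x $ j * v $ j) = 0"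
    proof -
      have "(lam i - lam j) * (x $ i * v $ i) = lam i * (x $ i * v $ i) + lam j * (x $ j * v $ j) - lam j * (x $ i * v $ i + x $ j * v $ j)"
        by (simp add: algebra_simps)
      then show "(lam i - lam j) * (x $ i * v $ i) = 0" unfolding 1 2 by simp
      have "(lam j - lam i) * (x $ j * v $ j) = lam i * (x $ i * v $ i) + lam j * (x $ j * v $ j) - lam i * (x $ i * v $ i + x $ j * v $ j)"
        by (simp add: algebra_simps)
      then show "(lam j - lam i) * (x $ j * v $ j) = 0" unfolding 1 2 by simp
    qed
    then have "v $ i = 0" "v $ j = 0" using d x by auto
    then have "v = 0" using v0 by (metis vec_eq_iff zero_index)
    then show ?thesis by (auto simp: v_def)
  qed
  define T where "T = (\<chi> r k. (base_change *v Y k) $ r)"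
  have T: "T *v a + c *s u = base_change *v y a c" for a c
  proof -
    have "T *v a = base_change *v (\<Sum>k\<in>UNIV. a $ k *s Y k)"
      by (simp add: T_def vec_eq_iff matrix_vector_mult_sum vector_scalar_commute sum_component)
         (simp add: matrix_vector_mult_def mult.commute)
    then show ?thesis by (simp add: y_def matrix_vector_right_distrib vector_scalar_commute x_def)
  qed
  have T_zero: "a = 0 \<and> c = 0" if "T *v a + c *s u = 0" for a c
    using that y_zero[of a c] invertible_eq_0[OF invertible_base_change] unfolding T by simp
  have "tangent_frame X (vec.span {u}) T"
    unfolding tangent_frame_def
  proof (intro conjI)
    show "inj ((*v) T)"
    proof (rule injI)
      fix a b assume "T *v a = T *v b"
      then have "T *v (a - b) + 0 *s u = 0" by (simp add: matrix_vector_mult_diff_distrib)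
      then show "a = b" using T_zero[of "a - b" 0] by simp
    qed
    show "range ((*v) T) \<inter> vec.span {u} = {0}"
    proof (intro equalityI subsetI)
      fix v assume "v \<in> range ((*v) T) \<inter> vec.span {u}"
      then obtain a c where v: "v = T *v a" "v = c *s u" unfolding span_line by blast
      then have "T *v a + (- c) *s u = 0" by (simp add: vec.scale_minus_left)
      then show "v \<in> {0}" using T_zero[of a "- c"] v(2) by simp
    next
      fix v :: "complex ^ ('n + 3)" assume "v \<in> {0}"
      moreover have "T *v 0 = 0" by simp
      ultimately show "v \<in> range ((*v) T) \<inter> vec.span {u}" by (metis Int_iff rangeI singletonD vec.span_zero)
    qed
    show "{w + u' |w u'. w \<in> range ((*v) T) \<and> u' \<in> vec.span {u}} = perp X (vec.span {u})"
    proof (intro equalityI subsetI)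
      fix v assume "v \<in> {w + u' |w u'. w \<in> range ((*v) T) \<and> u' \<in> vec.span {u}}"
      then obtain a c where "v = T *v a + c *s u" unfolding span_line by auto
      then have "coords v = y a c" unfolding T by simp
      then show "v \<in> perp X (vec.span {u})" unfolding perp_span using y_perp by (simp flip: x_def)
    next
      fix v assume "v \<in> perp X (vec.span {u})"
      then obtain a c where "coords v = y a c" using y_all[of "coords v"] unfolding perp_span x_def by blast
      then have "v = T *v a + c *s u" unfolding T by (metis base_change_coords)
      then show "v \<in> {w + u' |w u'. w \<in> range ((*v) T) \<and> u' \<in> vec.span {u}}" unfolding span_line by blast
    qed
  qed
  then show ?thesis by blast
qed

lemma frame_at_tangent:
  assumes "\<And>i. coords u $ i \<noteq> 0" "(\<Sum>i\<in>UNIV. (coords u $ i)\<^sup>2) = 0" "(\<Sum>i\<in>UNIV. lam i * (coords u $ i)\<^sup>2) = 0"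
  shows "tangent_frame X (vec.span {u}) (frame_at X (vec.span {u}))"
  unfolding frame_at_def using tangent_frame_exists[OF assms] by (rule someI_ex)

text \<open>The frame of \<open>frame_at\<close> spans some complement of the point; expressing the vectors
  \<open>eigen_tangent\<close> in it modulo the point gives the diagonalizing matrix.\<close>

lemma second_fundamental_form_diagonal:
  fixes t :: "'n \<Rightarrow> complex"
  assumes dp: "diagonal_point lam (coords u) t"
  defines "F \<equiv> frame_at X (vec.span {u})"
  obtains E where "diagonal_pair (\<lambda>w. \<phi>\<^sub>1 (F *v w)) (\<lambda>w. \<phi>\<^sub>2 (F *v w)) t E
       (\<lambda>k. resolvent_deriv lam (($) (coords u)) (t k))"
    "\<And>a. \<exists>c. F *v (E *v a) = eigen_frame (coords u) t a + c *s u"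
proof -
  have F: "tangent_frame X (vec.span {u}) F" unfolding F_def
    by (rule frame_at_tangent) (use dp in \<open>auto simp: diagonal_point_def\<close>)
  have "\<exists>w c. F *v w = eigen_frame (coords u) t (axis k 1) + c *s u" for k
  proof -
    have "eigen_frame (coords u) t (axis k 1) + 0 *s u \<in> perp X (vec.span {u})"
      unfolding perp_decomposition[OF dp] by blast
    then have "eigen_frame (coords u) t (axis k 1) + 0 *s u \<in> {w + u' |w u'. w \<in> range ((*v) F) \<and> u' \<in> vec.span {u}}"
      using F unfolding tangent_frame_def by blast
    then obtain w c where "eigen_frame (coords u) t (axis k 1) + 0 *s u = F *v w + c *s u" unfolding span_line by auto
    then have "F *v w = eigen_frame (coords u) t (axis k 1) + (- c) *s u" by (simp add: algebra_simps)
    then show ?thesis by blast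
  qed
  then obtain w m where w: "\<And>k. F *v w k = eigen_frame (coords u) t (axis k 1) + m k *s u" by metis
  define E :: "complex ^ 'n ^ 'n" where "E = (\<chi> r k. w k $ r)"
  have Ea: "E *v a = (\<Sum>k\<in>UNIV. a $ k *s w k)" for a
    by (simp add: E_def vec_eq_iff matrix_vector_mult_def sum_component mult.commute)
  have ef: "eigen_frame (coords u) t a = (\<Sum>k\<in>UNIV. a $ k *s eigen_frame (coords u) t (axis k 1))" for a
  proof -
    have "(\<Sum>j\<in>UNIV. axis k 1 $ j *s eigen_tangent lam (coords u) (t j)) = eigen_tangent lam (coords u) (t k)" for k :: 'n
      by (subst sum.remove[of _ k]) (auto simp: axis_def intro!: sum.neutral)
    then show ?thesis by (simp add: eigen_frame_def matrix_vector_mult_sum vector_scalar_commute)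
  qed
  have FE: "F *v (E *v a) = eigen_frame (coords u) t a + (\<Sum>k\<in>UNIV. a $ k * m k) *s u" for a
    unfolding Ea ef[of a]
    by (simp add: matrix_vector_mult_sum vector_scalar_commute w vec.scale_right_distrib sum.distrib vec.scale_sum_left)
  have cFE: "coords (F *v (E *v a)) = (\<Sum>k\<in>UNIV. a $ k *s eigen_tangent lam (coords u) (t k)) + (\<Sum>k\<in>UNIV. a $ k * m k) *s coords u" for a
    unfolding FE by (rule coords_eigen_frame)
  have "invertible E"
    unfolding invertible_left_inverse matrix_left_invertible_ker
  proof (intro allI impI)
    fix a assume "E *v a = 0"
    then have "coords (F *v (E *v a)) = 0" by simp
    then show "a = 0" unfolding cFE by (rule eigen_sum_eq_0[OF dp])
  qed
  moreover have "resolvent_deriv lam (($) (coords u)) (t k) \<noteq> 0" for k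
    by (rule diagonal_point_representation[OF dp inj_lam card_ambient]) blast
  moreover have "inj t" using dp by (simp add: diagonal_point_def)
  moreover have "\<phi>\<^sub>1 (F *v (E *v a)) = diag_form (\<lambda>k. t k * resolvent_deriv lam (($) (coords u)) (t k)) a"
    "\<phi>\<^sub>2 (F *v (E *v a)) = diag_form (\<lambda>k. resolvent_deriv lam (($) (coords u)) (t k)) a" for a
    unfolding phi_coords cFE pairing_eigen_sum(5,6)[OF dp] diag_form_def by (simp_all add: power2_eq_square mult.assoc)
  ultimately have "diagonal_pair (\<lambda>w. \<phi>\<^sub>1 (F *v w)) (\<lambda>w. \<phi>\<^sub>2 (F *v w)) t E
       (\<lambda>k. resolvent_deriv lam (($) (coords u)) (t k))" unfolding diagonal_pair_def by blast
  then show ?thesis using that FE by blast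
qed

lemma second_fundamental_form_span:
  "second_fundamental_form X p = forms_span (\<lambda>w. \<phi>\<^sub>1 (frame_at X p *v w)) (\<lambda>w. \<phi>\<^sub>2 (frame_at X p *v w))"
  unfolding second_fundamental_form_def vanishing_forms_eq pullback_forms_span ..

lemma moduli_map_diagonal_point:
  assumes dp: "diagonal_point lam (coords u) t" and n: "CARD('n) \<ge> 2"
  shows "moduli_map X (vec.span {u}) = pencil_class (model_pencil t)"
proof (rule second_fundamental_form_diagonal[OF dp])
  fix E
  assume "diagonal_pair (\<lambda>w. \<phi>\<^sub>1 (frame_at X (vec.span {u}) *v w)) (\<lambda>w. \<phi>\<^sub>2 (frame_at X (vec.span {u}) *v w)) t E
       (\<lambda>k. resolvent_deriv lam (($) (coords u)) (t k))"
  from diagonal_pair_class[OF this n] show ?thesis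
    unfolding moduli_map_def second_fundamental_form_span .
qed

end

lemma scaleR_complex_vec: "r *\<^sub>R v = complex_of_real r *s v" for v :: "complex ^ 'k"
  by (rule vec_eqI) (simp add: scaleR_conv_of_real[where 'a = complex])

context diagonal_quadrics
begin

lemma span_of_member:
  assumes "p \<in> X" "u \<in> p" "u \<noteq> 0" shows "p = vec.span {u}"
proof -
  obtain q r where qr: "quadratic_form q" "quadratic_form r" "X = {p \<in> proj_space. \<forall>z\<in>p. q z = 0 \<and> r z = 0}"
    using nonsing unfolding nonsingular_two_quadrics_def by blast
  have "p \<in> proj_space" using assms(1) unfolding qr(3) by (elim CollectE conjE)
  then obtain z where z: "p = vec.span {z}" unfolding proj_space_def by blast
  then obtain c where c: "u = c *s z" using assms(2) unfolding span_line by auto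
  then have c0: "c \<noteq> 0" using assms(3) by auto
  show ?thesis unfolding z span_line
  proof (intro equalityI subsetI)
    fix v assume "v \<in> range (\<lambda>c. c *s z)"
    then obtain b where "v = b *s z" by auto
    then have "v = (b / c) *s u" using c0 by (simp add: c vector_smult_assoc)
    then show "v \<in> range (\<lambda>c. c *s u)" by blast
  next
    fix v assume "v \<in> range (\<lambda>c. c *s u)"
    then show "v \<in> range (\<lambda>c. c *s z)" by (auto simp: c vector_smult_assoc)
  qed
qed

lemma regular_point_coords:
  assumes reg: "vec.span {u} \<in> regular_points X \<phi>\<^sub>1 \<phi>\<^sub>2 e" and u: "u \<noteq> 0"
  shows "coords u $ i \<noteq> 0" and "(\<Sum>i\<in>UNIV. (coords u $ i)\<^sup>2) = 0" and "(\<Sum>i\<in>UNIV. lam i * (coords u $ i)\<^sup>2) = 0"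
proof -
  have "(\<Sum>i\<in>UNIV. coords u $ i *s e i) = u" unfolding base_change_mult[symmetric] by simp
  then have mem: "(\<Sum>i\<in>UNIV. coords u $ i *s e i) \<in> vec.span {u} - {0}" using u span_line_mem[of u] by simp
  have all: "\<forall>x. (\<Sum>i\<in>UNIV. x i *s e i) \<in> vec.span {u} - {0} \<longrightarrow> (\<forall>i. x i \<noteq> 0)"
    using reg unfolding regular_points_def mem_Collect_eq by (elim conjE)
  show "coords u $ i \<noteq> 0" using all[THEN spec, of "($) (coords u)"] mem by simp
  have "vec.span {u} \<in> X" using reg unfolding regular_points_def by blast
  then show "(\<Sum>i\<in>UNIV. (coords u $ i)\<^sup>2) = 0" "(\<Sum>i\<in>UNIV. lam i * (coords u $ i)\<^sup>2) = 0"
    using X_iff[OF u] by auto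
qed

text \<open>A vector \<open>y\<close> in the kernel of \<open>a \<phi>\<^sub>1 + b \<phi>\<^sub>2\<close> on the tangent space satisfies
  \<open>(a lam\<^sub>i + b) y\<^sub>i = (\<alpha> + \<beta> lam\<^sub>i) x\<^sub>i\<close> by Lagrange multipliers. Subtracting a multiple of \<open>x\<close> makes the right side a multiple of \<open>x\<^sub>i\<close>, so
  \<open>y\<close> is proportional to \<open>eigen_tangent\<close> for \<open>s = - b / a\<close>; its orthogonality to \<open>x\<close> is the resolvent equation.\<close>

lemma degenerate_element_root:
  assumes x: "\<And>i. coords u $ i \<noteq> 0" and s0: "(\<Sum>i\<in>UNIV. (coords u $ i)\<^sup>2) = 0"
    and s1: "(\<Sum>i\<in>UNIV. lam i * (coords u $ i)\<^sup>2) = 0"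
  defines "q1 \<equiv> \<lambda>w. \<phi>\<^sub>1 (frame_at X (vec.span {u}) *v w)" and "q2 \<equiv> \<lambda>w. \<phi>\<^sub>2 (frame_at X (vec.span {u}) *v w)"
  assumes nd: "\<not> degenerate q2" and deg: "degenerate (\<lambda>w. a * q1 w + b * q2 w)" and ab: "(\<lambda>w. a * q1 w + b * q2 w) \<noteq> (\<lambda>w. 0)"
  shows "a \<noteq> 0" and "\<forall>i. - b / a \<noteq> lam i" and "resolvent lam (($) (coords u)) (- b / a) = 0"
proof -
  define F where "F = frame_at X (vec.span {u})"
  define x where "x = coords u"
  have x0: "x $ i \<noteq> 0" for i using x by (simp add: x_def)
  have tf: "tangent_frame X (vec.span {u}) F" unfolding F_def by (rule frame_at_tangent[OF x s0 s1])
  obtain w0 where w0: "w0 \<noteq> 0" "\<And>v. polar (\<lambda>w. a * q1 w + b * q2 w) w0 v = 0"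
    using deg unfolding degenerate_def by blast
  have pol: "polar (\<lambda>w. a * q1 w + b * q2 w) w v = a * polar \<phi>\<^sub>1 (F *v w) (F *v v) + b * polar \<phi>\<^sub>2 (F *v w) (F *v v)" for w v
    unfolding polar_def q1_def q2_def F_def[symmetric] matrix_vector_right_distrib
    by (simp add: field_simps)
  show a: "a \<noteq> 0"
  proof
    assume a: "a = 0"
    then have "b \<noteq> 0" using ab by auto
    moreover have "b * polar q2 w0 v = 0" for v
      using w0(2)[of v] a unfolding polar_def by (simp add: algebra_simps)
    ultimately have "degenerate q2" unfolding degenerate_def using w0(1) by auto
    then show False using nd by simp
  qed
  define y where "y = coords (F *v w0)"
  have Fw_perp: "F *v w \<in> perp X (vec.span {u})" for w
  proof -
    have "F *v w + 0 \<in> {w + u' |w u'. w \<in> range ((*v) F) \<and> u' \<in> vec.span {u}}"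
      using vec.span_zero by blast
    then show ?thesis using tf unfolding tangent_frame_def by simp
  qed
  have xy: "(\<Sum>i\<in>UNIV. x $ i * y $ i) = 0" "(\<Sum>i\<in>UNIV. lam i * x $ i * y $ i) = 0"
    using Fw_perp[of w0] unfolding perp_span x_def y_def by auto
  obtain \<alpha> \<beta> where ml: "\<And>i. (a * lam i + b) * y $ i = (\<alpha> + \<beta> * lam i) * x $ i"
  proof (rule linear_multipliers[where l = "\<lambda>i. (a * lam i + b) * y $ i", OF inj_lam _ x0])
    show "2 \<le> CARD('n + 3)" by simp
    fix z' assume z': "(\<Sum>i\<in>UNIV. x $ i * z' i) = 0" "(\<Sum>i\<in>UNIV. lam i * x $ i * z' i) = 0"
    define z where "z = (\<chi> i. z' i)"
    have "base_change *v z \<in> perp X (vec.span {u})" unfolding perp_span using z' by (simp add: z_def x_def)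
    then have "base_change *v z \<in> {w + u' |w u'. w \<in> range ((*v) F) \<and> u' \<in> vec.span {u}}"
      using tf unfolding tangent_frame_def by blast
    then obtain w c where wc: "base_change *v z = F *v w + c *s u" unfolding span_line by auto
    define v where "v = coords (F *v w)"
    have "coords (base_change *v z) = v + c *s x"
      unfolding wc by (simp add: coords_def matrix_vector_right_distrib vector_scalar_commute v_def x_def)
    then have z: "z = v + c *s x" by simp
    have "a * (\<Sum>i\<in>UNIV. lam i * y $ i * v $ i) + b * (\<Sum>i\<in>UNIV. y $ i * v $ i) = 0"
      using w0(2)[of w] unfolding pol polar_coords by (simp add: v_def y_def)
    moreover have "(\<Sum>i\<in>UNIV. (a * lam i + b) * y $ i * z' i) =
        (a * (\<Sum>i\<in>UNIV. lam i * y $ i * v $ i) + b * (\<Sum>i\<in>UNIV. y $ i * v $ i)) +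
        c * (a * (\<Sum>i\<in>UNIV. lam i * x $ i * y $ i) + b * (\<Sum>i\<in>UNIV. x $ i * y $ i))"
    proof -
      have "z' i = v $ i + c * x $ i" for i
        using arg_cong[OF z, of "\<lambda>z. z $ i"] by (simp add: z_def)
      then show ?thesis by (simp add: sum_distrib_left sum.distrib[symmetric] algebra_simps)
    qed
    ultimately show "(\<Sum>i\<in>UNIV. (a * lam i + b) * y $ i * z' i) = 0" using xy by simp
  next
    fix \<alpha> \<beta> assume "\<And>i. (a * lam i + b) * y $ i = (\<alpha> + \<beta> * lam i) * x $ i"
    then show thesis by (rule that)
  qed
  define s where "s = - b / a"
  \<comment> \<open>This choice turns the affine multiplier \<open>\<alpha> + \<beta> * lam i\<close> into the constant \<open>g\<close>, up to the factor \<open>a\<close>.\<close>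
  define y' where "y' = y - (\<beta> / a) *s x"
  define g where "g = (\<alpha> - b * \<beta> / a) / a"
  have as: "a * lam i + b = a * (lam i - s)" for i using a by (simp add: s_def algebra_simps)
  have y's: "(lam i - s) * y' $ i = g * x $ i" for i
  proof -
    have "a * ((lam i - s) * y' $ i) = (a * lam i + b) * y $ i - (a * lam i + b) * (\<beta> / a) * x $ i"
    proof -
      define L where "L = lam i - s"
      show ?thesis unfolding as L_def[symmetric] y'_def
        by (simp only: right_diff_distrib mult.assoc vector_minus_component vector_smult_component)
    qed
    also have "\<dots> = (\<alpha> - b * \<beta> / a) * x $ i" unfolding ml using a by (simp add: field_simps)
    also have "\<dots> = a * (g * x $ i)" using a by (simp add: g_def)
    finally show ?thesis using a by simp
  qed
  have y'0: "y' \<noteq> 0"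
  proof
    assume "y' = 0"
    then have "y = (\<beta> / a) *s x" by (simp add: y'_def)
    then have "F *v w0 = (\<beta> / a) *s u" unfolding y_def x_def by (metis base_change_coords coords_scale)
    then have "F *v w0 \<in> range ((*v) F) \<inter> vec.span {u}" unfolding span_line by blast
    then have "F *v w0 = F *v 0" using tf unfolding tangent_frame_def by simp
    then have "w0 = 0" using tf unfolding tangent_frame_def by (meson injD)
    then show False using w0(1) by simp
  qed
  have xx: "(\<Sum>i\<in>UNIV. x $ i * x $ i) = 0" using s0 by (simp add: x_def power2_eq_square)
  have xy': "(\<Sum>i\<in>UNIV. x $ i * y' $ i) = 0"
  proof -
    have "(\<Sum>i\<in>UNIV. x $ i * y' $ i) = (\<Sum>i\<in>UNIV. x $ i * y $ i) - (\<beta> / a) * (\<Sum>i\<in>UNIV. x $ i * x $ i)"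
      by (simp add: y'_def sum_distrib_left sum_subtractf[symmetric] algebra_simps)
    then show ?thesis unfolding xy xx by simp
  qed
  \<comment> \<open>Otherwise \<open>y'\<close> would be supported at \<open>j\<close> and yet be orthogonal to \<open>x\<close>.\<close>
  have s_lam: "s \<noteq> lam j" for j
  proof
    assume s: "s = lam j"
    then have "g = 0" using y's[of j] x0[of j] by simp
    have z: "y' $ i = 0" if "i \<noteq> j" for i
      using y's[of i] that inj_lam by (auto simp: s \<open>g = 0\<close> inj_eq)
    have "(\<Sum>i\<in>UNIV. x $ i * y' $ i) = x $ j * y' $ j"
      by (subst sum.remove[of _ j]) (auto simp: z)
    then have "y' $ j = 0" using xy' x0[of j] by simp
    then show False using z y'0 by (metis vec_eq_iff zero_index)
  qed
  then show "\<forall>i. - b / a \<noteq> lam i" by (simp add: s_def)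
  have y'i: "y' $ i = g * (x $ i / (lam i - s))" for i
  proof -
    have "lam i - s \<noteq> 0" using s_lam[of i] by auto
    then show ?thesis using y's[of i] by (simp add: nonzero_eq_divide_eq mult.commute)
  qed
  have "g \<noteq> 0" using y'0 y'i by (auto simp: vec_eq_iff)
  moreover have "(\<Sum>i\<in>UNIV. x $ i * y' $ i) = g * resolvent lam (($) x) s"
    unfolding y'i resolvent_def by (simp add: sum_distrib_left power2_eq_square mult_ac)
  ultimately show "resolvent lam (($) (coords u)) (- b / a) = 0" using xy' by (simp add: x_def s_def)
qed

text \<open>Every degenerate element of the second fundamental form comes from a root of the resolvent, and there are \<open>CARD('n)\<close>
  of them.\<close>

lemma regular_point_roots:
  assumes reg: "vec.span {u} \<in> regular_points X \<phi>\<^sub>1 \<phi>\<^sub>2 e" and u: "u \<noteq> 0"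
  obtains t :: "'n \<Rightarrow> complex" where "diagonal_point lam (coords u) t"
proof -
  note c = regular_point_coords[OF reg u]
  define q1 where "q1 = (\<lambda>w. \<phi>\<^sub>1 (frame_at X (vec.span {u}) *v w))"
  define q2 where "q2 = (\<lambda>w. \<phi>\<^sub>2 (frame_at X (vec.span {u}) *v w))"
  have sff: "second_fundamental_form X (vec.span {u}) = forms_span q1 q2"
    unfolding second_fundamental_form_span q1_def q2_def ..
  have "card (degenerate_elements (second_fundamental_form X (vec.span {u}))) = CARD('n)"
    using reg unfolding regular_points_def nonsingular_pencil_def by blast
  then have ns: "card (degenerate_elements (forms_span q1 q2)) = CARD('n)" unfolding sff .
  have nd: "\<not> degenerate q2" using reg unfolding regular_points_def q2_def by blast
  define Z where "Z = {s. (\<forall>i. s \<noteq> lam i) \<and> resolvent lam (($) (coords u)) s = 0}"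
  have "degenerate_elements (forms_span q1 q2) \<subseteq> (\<lambda>s. form_line (\<lambda>w. q1 w - s * q2 w)) ` Z"
  proof
    fix l assume "l \<in> degenerate_elements (forms_span q1 q2)"
    then obtain q where q: "l = form_line q" "q \<in> forms_span q1 q2" "q \<noteq> (\<lambda>w. 0)" "degenerate q"
      unfolding degenerate_elements_def by blast
    then obtain a b where ab: "q = (\<lambda>w. a * q1 w + b * q2 w)" unfolding forms_span_def by blast
    have deg: "degenerate (\<lambda>w. a * q1 w + b * q2 w)" "(\<lambda>w. a * q1 w + b * q2 w) \<noteq> (\<lambda>w. 0)"
      using q unfolding ab by auto
    note r = degenerate_element_root[OF c nd[unfolded q2_def] deg[unfolded q1_def q2_def]]
    have "q = (\<lambda>w. a * (q1 w - (- b / a) * q2 w))" unfolding ab using r(1) by (simp add: algebra_simps)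
    then have "l = form_line (\<lambda>w. q1 w - (- b / a) * q2 w)"
      unfolding q(1) using form_line_scale[OF r(1), of "\<lambda>w. q1 w - (- b / a) * q2 w"] by simp
    moreover have "- b / a \<in> Z" unfolding Z_def using r(2,3) by simp
    ultimately show "l \<in> (\<lambda>s. form_line (\<lambda>w. q1 w - s * q2 w)) ` Z" by blast
  qed
  then obtain U where U: "U \<subseteq> Z" "inj_on (\<lambda>s. form_line (\<lambda>w. q1 w - s * q2 w)) U"
    "degenerate_elements (forms_span q1 q2) = (\<lambda>s. form_line (\<lambda>w. q1 w - s * q2 w)) ` U"
    unfolding subset_image_inj by blast
  then have "card U = CARD('n)" using ns by (simp add: card_image)
  moreover from this have "finite U" by (metis card.infinite zero_less_card_finite less_irrefl)
  ultimately obtain t where t: "bij_betw t (UNIV :: 'n set) U"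
    using finite_same_card_bij[of "UNIV :: 'n set" U] by auto
  then have "inj t" "t k \<in> Z" for k using U(1) by (auto simp: bij_betw_def)
  then have "diagonal_point lam (coords u) t" unfolding diagonal_point_def using c by (auto simp: Z_def)
  then show ?thesis by (rule that)
qed

lemma regular_point_rigid:
  assumes reg: "vec.span {u} \<in> regular_points X \<phi>\<^sub>1 \<phi>\<^sub>2 e"
    and dp: "diagonal_point lam (coords u) (t :: 'n \<Rightarrow> complex)" and n: "CARD('n) \<ge> 2"
  shows "moebius_rigid t"
  unfolding moebius_rigid_def
proof (intro allI impI)
  fix \<pi> :: "'n \<Rightarrow> 'n" and a b g d
  assume h: "bij \<pi> \<and> a * d - b * g \<noteq> 0 \<and> (\<forall>k. t (\<pi> k) * (g * t k + d) = a * t k + b)"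
  have no: "no_pencil_automorphisms (second_fundamental_form X (vec.span {u}))"
    using reg unfolding regular_points_def by blast
  show "\<pi> = id"
  proof (rule second_fundamental_form_diagonal[OF dp])
    fix E
    assume E: "diagonal_pair (\<lambda>w. \<phi>\<^sub>1 (frame_at X (vec.span {u}) *v w)) (\<lambda>w. \<phi>\<^sub>2 (frame_at X (vec.span {u}) *v w)) t E
       (\<lambda>k. resolvent_deriv lam (($) (coords u)) (t k))"
    have "\<pi> k = k" for k
      by (rule no_pencil_automorphisms_moebius[OF E n no[unfolded second_fundamental_form_span], of \<pi> g d a b])
         (use h in auto)
    then show "\<pi> = id" by auto
  qed
qed

lemma diagonal_point_scale:
  assumes "diagonal_point lam x t" "c \<noteq> 0" shows "diagonal_point lam (c *s x) t"
proof -
  have "resolvent lam (($) (c *s x)) s = c\<^sup>2 * resolvent lam (($) x) s" for s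
    by (simp add: resolvent_def power_mult_distrib sum_distrib_left)
  moreover have "(\<Sum>i\<in>UNIV. ((c *s x) $ i)\<^sup>2) = c\<^sup>2 * (\<Sum>i\<in>UNIV. (x $ i)\<^sup>2)"
    "(\<Sum>i\<in>UNIV. lam i * ((c *s x) $ i)\<^sup>2) = c\<^sup>2 * (\<Sum>i\<in>UNIV. lam i * (x $ i)\<^sup>2)"
    by (simp_all add: power_mult_distrib sum_distrib_left mult_ac)
  ultimately show ?thesis using assms unfolding diagonal_point_def by simp
qed

definition cone :: "(complex ^ ('n + 3)) set" where
  "cone = {u. u \<noteq> 0 \<and> vec.span {u} \<in> X}"

lemma diagonal_point_cone:
  assumes "diagonal_point lam (coords u) t" shows "u \<in> cone"
proof -
  have "coords u \<noteq> 0" using assms by (auto simp: diagonal_point_def vec_eq_iff)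
  then have "u \<noteq> 0" by simp
  then show ?thesis using assms by (simp add: cone_def X_iff diagonal_point_def)
qed

lemma bounded_linear_coords: "bounded_linear (\<lambda>u. coords u $ i)"
  by (rule linear_conv_bounded_linear[THEN iffD1], rule linearI)
     (simp_all add: coords_def matrix_vector_right_distrib scaleR_complex_vec vector_scalar_commute scaleR_conv_of_real)

lemma pairing_tangent_derivative:
  assumes dp: "diagonal_point lam (coords u) (t :: 'n \<Rightarrow> complex)"
  shows "(\<Sum>i\<in>UNIV. 2 * coords u $ i * coords (eigen_frame (coords u) t a + c *s u) $ i / (lam i - t k))
    = 2 * (a $ k * resolvent_deriv lam (($) (coords u)) (t k))"
proof -
  have "(\<Sum>i\<in>UNIV. eigen_tangent lam (coords u) (t k) $ i * coords (eigen_frame (coords u) t a + c *s u) $ i)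
      = a $ k * resolvent_deriv lam (($) (coords u)) (t k)"
    unfolding coords_eigen_frame by (rule pairing_eigen_sum(3)[OF dp])
  then show ?thesis by (simp add: eigen_tangent_def sum_distrib_left[symmetric] mult_ac flip: times_divide_eq_right)
qed

lemma resolvent_has_derivative:
  assumes "\<And>i. s \<noteq> lam i"
  shows "((\<lambda>p. resolvent lam (($) (coords (fst p))) (snd p)) has_derivative
    (\<lambda>q. (\<Sum>i\<in>UNIV. 2 * coords u $ i * coords (fst q) $ i / (lam i - s)) +
       resolvent_deriv lam (($) (coords u)) s * snd q)) (at (u, s))"
proof -
  have cd: "((\<lambda>p. coords (fst p) $ i) has_derivative (\<lambda>q. coords (fst q) $ i)) (at p)" for i p
    by (rule bounded_linear.has_derivative[OF bounded_linear_compose[OF bounded_linear_coords bounded_linear_fst] has_derivative_ident])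
  have "((\<lambda>p. (coords (fst p) $ i * coords (fst p) $ i) / (lam i - snd p)) has_derivative
      (\<lambda>q. ((coords u $ i * coords (fst q) $ i + coords (fst q) $ i * coords u $ i) * (lam i - s)
        - coords u $ i * coords u $ i * (0 - snd q)) / ((lam i - s) * (lam i - s)))) (at (u, s))" for i
  proof -
    have nz: "lam i - snd (u, s) \<noteq> 0" using assms[of i] by simp
    have 1: "((\<lambda>p. lam i - snd p) has_derivative (\<lambda>q. 0 - snd q)) (at (u, s))"
      by (intro has_derivative_diff has_derivative_const has_derivative_snd has_derivative_ident)
    from has_derivative_divide'[OF has_derivative_mult[OF cd[of i "(u, s)"] cd[of i "(u, s)"]] 1 nz]
    show ?thesis by (simp only: fst_conv snd_conv)
  qed
  then have "((\<lambda>p. \<Sum>i\<in>UNIV. (coords (fst p) $ i * coords (fst p) $ i) / (lam i - snd p)) has_derivative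
      (\<lambda>q. \<Sum>i\<in>UNIV. ((coords u $ i * coords (fst q) $ i + coords (fst q) $ i * coords u $ i) * (lam i - s)
        - coords u $ i * coords u $ i * (0 - snd q)) / ((lam i - s) * (lam i - s)))) (at (u, s))"
    by (intro has_derivative_sum)
  moreover have "(\<Sum>i\<in>UNIV. ((coords u $ i * coords (fst q) $ i + coords (fst q) $ i * coords u $ i) * (lam i - s)
        - coords u $ i * coords u $ i * (0 - snd q)) / ((lam i - s) * (lam i - s)))
     = (\<Sum>i\<in>UNIV. 2 * coords u $ i * coords (fst q) $ i / (lam i - s)) +
       resolvent_deriv lam (($) (coords u)) s * snd q" for q
    unfolding resolvent_deriv_def sum_distrib_right sum.distrib[symmetric]
  proof (rule sum.cong[OF refl])
    fix i
    have "lam i - s \<noteq> 0" using assms[of i] by auto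
    then show "((coords u $ i * coords (fst q) $ i + coords (fst q) $ i * coords u $ i) * (lam i - s)
        - coords u $ i * coords u $ i * (0 - snd q)) / ((lam i - s) * (lam i - s))
      = 2 * coords u $ i * coords (fst q) $ i / (lam i - s) + (coords u $ i)\<^sup>2 / (lam i - s)\<^sup>2 * snd q"
      by (simp add: divide_simps power2_eq_square)
  qed
  ultimately show ?thesis by (simp add: resolvent_def power2_eq_square)
qed

text \<open>Near \<open>z\<close> the roots are differentiable functions on the cone by \<open>implicit_root\<close>, through which the
  moduli map factors.\<close>

lemma moduli_derivative:
  fixes t :: "'n \<Rightarrow> complex"
  assumes dp: "diagonal_point lam (coords z) t" and n: "CARD('n) \<ge> 2"
    and hol: "moduli_holomorphic_near G (moduli_map X (vec.span {z}))"
  obtains D where "((\<lambda>u. G (moduli_map X (vec.span {u}))) has_derivative D) (at z within cone)"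
    "\<And>p c. degree p \<le> 2 \<Longrightarrow> D (eigen_frame (coords z) t (\<chi> k. poly p (t k)) + c *s z) = 0"
proof -
  have t: "inj t" and tl: "\<And>k i. t k \<noteq> lam i" and x0: "\<And>i. coords z $ i \<noteq> 0"
    and root: "\<And>k. resolvent lam (($) (coords z)) (t k) = 0"
    using dp by (auto simp: diagonal_point_def)
  note mz = moduli_map_diagonal_point[OF dp n]
  let ?R = "\<lambda>u s. resolvent lam (($) (coords u)) s"
  let ?r = "\<lambda>k. resolvent_deriv lam (($) (coords z)) (t k)"
  let ?D = "\<lambda>k v. \<Sum>i\<in>UNIV. 2 * coords z $ i * coords v $ i / (lam i - t k)"
  have r: "?r k \<noteq> 0" for k by (rule diagonal_point_representation[OF dp inj_lam card_ambient]) blast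
  define W where "W = (\<Inter>i. snd -` (- {lam i}) :: ((complex ^ ('n + 3)) \<times> complex) set)"
  have W: "open W" unfolding W_def by (intro open_INT ballI open_vimage) (auto intro!: continuous_intros)
  have zW: "(z, t k) \<in> W" for k using tl by (auto simp: W_def)
  have contW: "continuous_on W (\<lambda>p. ?R (fst p) (snd p))"
  proof (intro continuous_at_imp_continuous_on ballI)
    fix p assume "p \<in> W"
    then have "\<And>i. snd p \<noteq> lam i" by (auto simp: W_def)
    from has_derivative_continuous[OF resolvent_has_derivative[OF this, of "fst p"]]
    show "isCont (\<lambda>p. ?R (fst p) (snd p)) p" by simp
  qed
  have "\<exists>\<tau>. \<tau> z = t k \<and> (\<forall>\<^sub>F u in nhds z. ?R u (\<tau> u) = 0) \<and> (\<tau> has_derivative (\<lambda>v. - ?D k v / ?r k)) (at z)" for k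
  proof (rule implicit_root[where R = ?R and W = W and z = z, OF W zW contW root resolvent_has_derivative[OF tl] r])
    fix \<tau> N assume \<tau>: "open N" "z \<in> N" "\<tau> z = t k" "\<And>u. u \<in> N \<Longrightarrow> ?R u (\<tau> u) = 0"
      "(\<tau> has_derivative (\<lambda>v. - ?D k v / ?r k)) (at z)"
    have "\<forall>\<^sub>F u in nhds z. ?R u (\<tau> u) = 0"
      using eventually_nhds_in_open[OF \<tau>(1,2)] by eventually_elim (rule \<tau>(4))
    then show ?thesis using \<tau>(3,5) by blast
  qed
  then have "\<forall>k. \<exists>\<tau>. \<tau> z = t k \<and> (\<forall>\<^sub>F u in nhds z. ?R u (\<tau> u) = 0) \<and> (\<tau> has_derivative (\<lambda>v. - ?D k v / ?r k)) (at z)"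
    by blast
  from choice[OF this] obtain \<tau> where \<tau>: "\<And>k. \<tau> k z = t k" "\<And>k. \<forall>\<^sub>F u in nhds z. ?R u (\<tau> k u) = 0"
    "\<And>k. (\<tau> k has_derivative (\<lambda>v. - ?D k v / ?r k)) (at z)" by blast
  have tend: "(\<tau> k \<longlongrightarrow> t k) (nhds z)" for k
    using has_derivative_continuous[OF \<tau>(3)[of k]] \<tau>(1)[of k] by (simp add: continuous_at tendsto_nhds_iff)
  have ev1: "\<forall>\<^sub>F u in nhds z. \<forall>k l. k \<noteq> l \<longrightarrow> \<tau> k u \<noteq> \<tau> l u"
    by (rule eventually_distinct[OF tend t])
  have ev2: "\<forall>\<^sub>F u in nhds z. \<forall>k i. \<tau> k u \<noteq> lam i"
    by (intro eventually_all_finite tendsto_imp_eventually_ne[OF tend tl])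
  have ev3: "\<forall>\<^sub>F u in nhds z. \<forall>i. coords u $ i \<noteq> 0"
  proof (intro eventually_all_finite)
    fix i
    have "((\<lambda>u. coords u $ i) \<longlongrightarrow> coords z $ i) (nhds z)"
      using linear_continuous_at[OF bounded_linear_coords, of z i] by (simp add: continuous_at tendsto_nhds_iff)
    then show "\<forall>\<^sub>F u in nhds z. coords u $ i \<noteq> 0" using x0 by (rule tendsto_imp_eventually_ne)
  qed
  have ev4: "\<forall>\<^sub>F u in nhds z. \<forall>k. ?R u (\<tau> k u) = 0" by (intro eventually_all_finite \<tau>(2))
  have mod: "\<forall>\<^sub>F u in nhds z. u \<in> cone \<longrightarrow>
      G (moduli_map X (vec.span {u})) = G (pencil_class (model_pencil (\<lambda>k. \<tau> k u)))"
    using ev1 ev2 ev3 ev4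
  proof eventually_elim
    case (elim u)
    show ?case
    proof
      assume u: "u \<in> cone"
      then have "u \<noteq> 0" "vec.span {u} \<in> X" by (auto simp: cone_def)
      then have "diagonal_point lam (coords u) (\<lambda>k. \<tau> k u)"
        unfolding diagonal_point_def using elim X_iff[of u] by (auto intro!: injI)
      from moduli_map_diagonal_point[OF this n]
      show "G (moduli_map X (vec.span {u})) = G (pencil_class (model_pencil (\<lambda>k. \<tau> k u)))" by simp
    qed
  qed
  show ?thesis
  proof (rule moduli_function_on_models[OF hol[unfolded mz] t n])
    fix E
    assume E: "((\<lambda>s :: complex ^ 'n. G (pencil_class (model_pencil (\<lambda>k. s $ k)))) has_derivative E) (at (\<chi> k. t k))"
      "\<And>p. degree p \<le> 2 \<Longrightarrow> E (\<chi> k. poly p (t k)) = 0"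
    have d\<tau>: "((\<lambda>u. (\<chi> k. \<tau> k u)) has_derivative (\<lambda>v. (\<chi> k. - ?D k v / ?r k))) (at z)"
      by (rule vec_has_derivative) (simp only: vec_lambda_beta, rule \<tau>(3))
    have eq: "(\<chi> k. \<tau> k z) = (\<chi> k. t k)" unfolding \<tau>(1) ..
    have E1: "((\<lambda>s :: complex ^ 'n. G (pencil_class (model_pencil (\<lambda>k. s $ k)))) has_derivative E) (at (\<chi> k. \<tau> k z))"
      unfolding eq by (rule E(1))
    from has_derivative_compose[OF d\<tau> E1]
    have "((\<lambda>u. G (pencil_class (model_pencil (\<lambda>k. \<tau> k u)))) has_derivative (\<lambda>v. E (\<chi> k. - ?D k v / ?r k))) (at z)"
      by (simp only: vec_lambda_beta)
    then have der: "((\<lambda>u. G (pencil_class (model_pencil (\<lambda>k. \<tau> k u)))) has_derivative (\<lambda>v. E (\<chi> k. - ?D k v / ?r k))) (at z within cone)"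
      by (rule has_derivative_at_withinI)
    have zc: "z \<in> cone" by (rule diagonal_point_cone[OF dp])
    have "((\<lambda>u. G (moduli_map X (vec.span {u}))) has_derivative (\<lambda>v. E (\<chi> k. - ?D k v / ?r k))) (at z within cone)"
    proof (rule has_derivative_transform_eventually[OF der])
      show "\<forall>\<^sub>F u in at z within cone. G (pencil_class (model_pencil (\<lambda>k. \<tau> k u))) = G (moduli_map X (vec.span {u}))"
        using mod unfolding eventually_at_filter by eventually_elim simp
      show "G (pencil_class (model_pencil (\<lambda>k. \<tau> k z))) = G (moduli_map X (vec.span {z}))"
        using eventually_nhds_x_imp_x[OF mod] zc by simp
    qed (rule zc)
    then show ?thesis
    proof (rule that)
      fix p :: "complex poly" and c assume p: "degree p \<le> 2"
      have "- ?D k (eigen_frame (coords z) t (\<chi> k. poly p (t k)) + c *s z) / ?r k = poly (smult (- 2) p) (t k)" for k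
        unfolding pairing_tangent_derivative[OF dp] using r by simp
      then show "E (\<chi> k. - ?D k (eigen_frame (coords z) t (\<chi> k. poly p (t k)) + c *s z) / ?r k) = 0"
        using E(2)[of "smult (- 2) p"] p degree_smult_le[of "- 2" p] by simp
    qed
  qed
qed

end

section \<open>The kernel of the differential of the moduli map\<close>

lemma quadratic_difference: "poly [:x, y, z:] u - poly [:x, y, z:] v = (u - v) * (y + z * (u + v))"
  for x :: "'a::comm_ring_1"
  by (simp add: algebra_simps)

text \<open>Interpolate \<open>a\<close> at three indices. The velocity of the cross ratio with a fourth one vanishes for
  \<open>a\<close> and for the interpolating polynomial, and it determines the fourth value.\<close>

lemma quadratic_velocity:
  fixes t a :: "'n::finite \<Rightarrow> complex"
  assumes t: "inj t" and n: "CARD('n) \<ge> 3"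
    and vel: "\<And>i j k l. distinct [i, j, k, l] \<Longrightarrow>
      ((a i - a k) * (t j - t l) + (t i - t k) * (a j - a l)) * ((t i - t l) * (t j - t k)) =
      ((t i - t k) * (t j - t l)) * ((a i - a l) * (t j - t k) + (t i - t l) * (a j - a k))"
  obtains p where "degree p \<le> 2" "\<And>k. a k = poly p (t k)"
proof -
  obtain i j k :: 'n where d: "distinct [i, j, k]" using three_indices[OF n] .
  have tn: "t x - t y \<noteq> 0" if "x \<noteq> y" for x y using that t by (auto simp: inj_eq)
  \<comment> \<open>Lagrange basis for the three indices.\<close>
  define L where "L x y z = smult (a x / ((t x - t y) * (t x - t z))) ([:- t y, 1:] * [:- t z, 1:])" for x y z
  define p where "p = L i j k + L j i k + L k i j"
  have dL: "degree (L x y z) \<le> 2" for x y z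
    unfolding L_def by (rule order_trans[OF degree_smult_le], rule order_trans[OF degree_mult_le]) simp
  have dp: "degree p \<le> 2" unfolding p_def by (intro degree_add_le dL)
  have pL: "poly (L x y z) s = a x / ((t x - t y) * (t x - t z)) * ((s - t y) * (s - t z))" for x y z s
    unfolding L_def poly_smult poly_mult by simp
  have p3: "poly p (t i) = a i" "poly p (t j) = a j" "poly p (t k) = a k"
    unfolding p_def poly_add pL using d tn[of i j] tn[of i k] tn[of j i] tn[of j k] tn[of k i] tn[of k j] by simp_all
  have "a l = poly p (t l)" for l
  proof (cases "l \<in> {i, j, k}")
    case True
    then show ?thesis using p3 by auto
  next
    case False
    then have d': "distinct [i, j, k, l]" using d by auto
    obtain x y z where xyz: "p = [:x, y, z:]" using quadratic_poly_cases[OF dp] .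
    define P where "P m = poly p (t m)" for m
    have P: "P m - P r = (t m - t r) * (y + z * (t m + t r))" for m r
      unfolding P_def xyz by (rule quadratic_difference)
    define A1 where "A1 = t i - t k"
    define A2 where "A2 = t j - t l"
    define A3 where "A3 = t i - t l"
    define A4 where "A4 = t j - t k"
    have velP: "((P i - P k) * A2 + A1 * (P j - P l)) * (A3 * A4) = (A1 * A2) * ((P i - P l) * A4 + A3 * (P j - P k))"
    proof -
      have "((P i - P k) * A2 + A1 * (P j - P l)) * (A3 * A4) = A1 * A2 * A3 * A4 * ((y + z * (t i + t k)) + (y + z * (t j + t l)))"
        unfolding P A1_def[symmetric] A2_def[symmetric] by (simp add: algebra_simps)
      also have "(y + z * (t i + t k)) + (y + z * (t j + t l)) = (y + z * (t i + t l)) + (y + z * (t j + t k))"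
        by (simp add: algebra_simps)
      also have "A1 * A2 * A3 * A4 * \<dots> = (A1 * A2) * ((P i - P l) * A4 + A3 * (P j - P k))"
        unfolding P A3_def[symmetric] A4_def[symmetric] by (simp add: algebra_simps)
      finally show ?thesis .
    qed
    have vela: "((a i - a k) * A2 + A1 * (a j - a l)) * (A3 * A4) = (A1 * A2) * ((a i - a l) * A4 + A3 * (a j - a k))"
      using vel[OF d'] unfolding A1_def A2_def A3_def A4_def .
    have eqs: "P i = a i" "P j = a j" "P k = a k" using p3 by (simp_all add: P_def)
    have "A1 * A4 * (A3 - A2) * (P l - a l) =
      (((a i - a k) * A2 + A1 * (a j - a l)) * (A3 * A4) - (A1 * A2) * ((a i - a l) * A4 + A3 * (a j - a k)))
      - (((P i - P k) * A2 + A1 * (P j - P l)) * (A3 * A4) - (A1 * A2) * ((P i - P l) * A4 + A3 * (P j - P k)))"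
      unfolding eqs by (simp add: algebra_simps)
    also have "\<dots> = 0" unfolding velP vela by simp
    finally have "A1 * A4 * (A3 - A2) * (P l - a l) = 0" .
    moreover have "A3 - A2 \<noteq> 0" using tn[of i j] d by (simp add: A3_def A2_def)
    moreover have "A1 \<noteq> 0" "A4 \<noteq> 0" using tn d by (simp_all add: A1_def A4_def)
    ultimately show ?thesis by (simp add: P_def)
  qed
  then show ?thesis using that dp by blast
qed

lemma cross_ratio_velocity:
  fixes t a :: "'n::finite \<Rightarrow> complex"
  assumes t: "inj t" and d: "distinct [i, j, k, l]"
    and der: "((\<lambda>r::real. cross_ratio (\<lambda>m. t m - 2 * of_real r * a m) i j k l) has_vector_derivative 0) (at 0)"
  shows "((a i - a k) * (t j - t l) + (t i - t k) * (a j - a l)) * ((t i - t l) * (t j - t k)) =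
      ((t i - t k) * (t j - t l)) * ((a i - a l) * (t j - t k) + (t i - t l) * (a j - a k))"
proof -
  let ?s = "\<lambda>z m. t m - 2 * z * a m"
  let ?N = "\<lambda>z. (?s z i - ?s z k) * (?s z j - ?s z l)"
  let ?M = "\<lambda>z. (?s z i - ?s z l) * (?s z j - ?s z k)"
  let ?N' = "(a i - a k) * (t j - t l) + (t i - t k) * (a j - a l)"
  let ?M' = "(a i - a l) * (t j - t k) + (t i - t l) * (a j - a k)"
  have N: "(?N has_field_derivative - 2 * ?N') (at 0)"
    by (rule DERIV_cong, (rule derivative_intros)+) (simp add: algebra_simps)
  have M: "(?M has_field_derivative - 2 * ?M') (at 0)"
    by (rule DERIV_cong, (rule derivative_intros)+) (simp add: algebra_simps)
  have M0: "?M 0 \<noteq> 0" using t d by (auto simp: inj_eq)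
  have "((\<lambda>z. cross_ratio (?s z) i j k l) has_field_derivative
      (- 2 * ?N' * ?M 0 - ?N 0 * (- 2 * ?M')) / (?M 0 * ?M 0)) (at (of_real 0))"
    unfolding cross_ratio_def using DERIV_divide[OF N M M0] by simp
  from has_vector_derivative_real_field[OF this]
  have "((\<lambda>r::real. cross_ratio (\<lambda>m. t m - 2 * of_real r * a m) i j k l) has_vector_derivative
      (- 2 * ?N' * ?M 0 - ?N 0 * (- 2 * ?M')) / (?M 0 * ?M 0)) (at 0)" .
  then have "(- 2 * ?N' * ?M 0 - ?N 0 * (- 2 * ?M')) / (?M 0 * ?M 0) = 0"
    using der by (rule vector_derivative_unique_at)
  then have "- 2 * ?N' * ?M 0 - ?N 0 * (- 2 * ?M') = 0" using M0 by simp
  moreover have "x * y = u * w" if "- 2 * x * y - u * (- 2 * w) = 0" for x y u w :: complex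
  proof -
    have "2 * (u * w - x * y) = 0" using that by (simp add: algebra_simps)
    then show ?thesis by simp
  qed
  ultimately have "?N' * ?M 0 = ?N 0 * ?M'" by blast
  then show ?thesis by simp
qed

lemma bounded_linear_matrix_complex: "bounded_linear ((*v) A)" for A :: "complex ^ 'n ^ 'm"
  by (rule linear_conv_bounded_linear[THEN iffD1], rule linearI)
     (simp_all add: matrix_vector_right_distrib scaleR_complex_vec vector_scalar_commute)

text \<open>A quadratic polynomial is determined by its values at three points.\<close>

lemma quadratic_curve_span_subspace:
  fixes t :: "'n::finite \<Rightarrow> complex"
  assumes t: "inj t" and n: "CARD('n) \<ge> 3" and E: "invertible E"
  shows "vec.subspace (quadratic_curve_span t E)" and "vec.dim (quadratic_curve_span t E) = 3"
proof -
  define M :: "complex ^ 3 ^ 'n" where "M = (\<chi> k j. if j = 1 then 1 else if j = 2 then t k else (t k)\<^sup>2)"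
  have M: "M *v y = (\<chi> k. poly [:y $ 1, y $ 2, y $ 3:] (t k))" for y
    by (simp add: M_def vec_eq_iff matrix_vector_mult_def sum_3 power2_eq_square algebra_simps)
  have range: "quadratic_curve_span t E = range ((*v) (E ** M))"
  proof (intro equalityI subsetI)
    fix v assume "v \<in> quadratic_curve_span t E"
    then obtain p where p: "v = E *v (\<chi> k. poly p (t k))" "degree p \<le> 2" unfolding quadratic_curve_span_def by blast
    obtain x y z where xyz: "p = [:x, y, z:]" using quadratic_poly_cases[OF p(2)] .
    have "v = (E ** M) *v (vector [x, y, z])"
      unfolding p(1) xyz matrix_vector_mul_assoc[symmetric] M by simp
    then show "v \<in> range ((*v) (E ** M))" by blast
  next
    fix v assume "v \<in> range ((*v) (E ** M))"
    then obtain y where "v = E *v (M *v y)" by (auto simp: matrix_vector_mul_assoc)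
    moreover have "degree [:y $ 1, y $ 2, y $ 3:] \<le> 2" by (simp add: degree_pCons_eq_if)
    ultimately show "v \<in> quadratic_curve_span t E" unfolding quadratic_curve_span_def M by blast
  qed
  have inj: "inj ((*v) (E ** M))"
  proof (rule injI)
    fix y y' assume "(E ** M) *v y = (E ** M) *v y'"
    then have "E *v (M *v (y - y')) = 0"
      by (simp add: matrix_vector_mult_diff_distrib matrix_vector_mul_assoc)
    then have z: "M *v (y - y') = 0" unfolding invertible_eq_0[OF E] .
    let ?y = "y - y'"
    have "[:?y $ 1, ?y $ 2, ?y $ 3:] = 0"
    proof (rule poly_eq_if_agree[OF t])
      show "degree [:?y $ 1, ?y $ 2, ?y $ 3:] < CARD('n)"
        using n by (simp add: degree_pCons_eq_if)
      show "poly [:?y $ 1, ?y $ 2, ?y $ 3:] (t k) = poly 0 (t k)" for k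
        using arg_cong[OF z, of "\<lambda>v. v $ k"] unfolding M by simp
    qed (use n in simp)
    then have "?y = 0" by (simp add: vec_eq_iff forall_3)
    then show "y = y'" by simp
  qed
  show "vec.subspace (quadratic_curve_span t E)"
  proof (rule vec.subspaceI)
    have "(E ** M) *v 0 \<in> quadratic_curve_span t E" unfolding range by blast
    then show "0 \<in> quadratic_curve_span t E" by simp
    show "v + w \<in> quadratic_curve_span t E" if "v \<in> quadratic_curve_span t E" "w \<in> quadratic_curve_span t E" for v w
      using that unfolding range by (auto simp: matrix_vector_right_distrib[symmetric])
    show "c *s v \<in> quadratic_curve_span t E" if "v \<in> quadratic_curve_span t E" for c v
      using that unfolding range by (auto simp: vector_scalar_commute[symmetric])
  qed
  show "vec.dim (quadratic_curve_span t E) = 3"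
    unfolding range using vec.dim_image_eq[OF matrix_vector_mul_linear_gen, of "E ** M" UNIV] inj
    by (simp add: vec_dim_card card_cart_basis)
qed

context diagonal_quadrics
begin

lemma eigen_frame_scale_point: "eigen_frame (b *s x) t a = b *s eigen_frame x t a"
proof -
  have "eigen_tangent lam (b *s x) s = b *s eigen_tangent lam x s" for s
    by (simp add: eigen_tangent_def vec_eq_iff)
  then show ?thesis
    by (simp add: eigen_frame_def vec.scale_sum_right vector_scalar_commute[symmetric] vector_smult_assoc mult.commute)
qed

text \<open>For the inclusion from left to right, a tangent vector is the velocity of a curve in the chart of the
  roots; along it each cross ratio, being a holomorphic function of the class, has derivative zero.\<close>

lemma moduli_kernel_eq:
  fixes t :: "'n \<Rightarrow> complex"
  assumes reg: "vec.span {z} \<in> regular_points X \<phi>\<^sub>1 \<phi>\<^sub>2 e" and z: "z \<noteq> 0"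
    and dp: "diagonal_point lam (coords z) t" and n: "CARD('n) \<ge> 3"
  shows "moduli_kernel X (vec.span {z}) =
     {eigen_frame (coords z) t (\<chi> k. poly p (t k)) + c *s z | p c. degree p \<le> 2}" (is "?K = ?Q")
proof (intro equalityI subsetI)
  have n2: "CARD('n) \<ge> 2" using n by simp
  have t: "inj t" using dp by (simp add: diagonal_point_def)
  note mz = moduli_map_diagonal_point[OF dp n2]
  have zX: "vec.span {z} \<in> X" using reg unfolding regular_points_def by blast
  {
    fix v assume "v \<in> ?Q"
    then obtain p c where v: "v = eigen_frame (coords z) t (\<chi> k. poly p (t k)) + c *s z" and p: "degree p \<le> 2" by blast
    have perp: "v \<in> perp X (vec.span {z})" unfolding perp_decomposition[OF dp] v by blast
    have "\<exists>D. ((\<lambda>u. G (moduli_map X (vec.span {u}))) has_derivative D) (at z' within {u. u \<noteq> 0 \<and> vec.span {u} \<in> X}) \<and> D v = 0"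
      if z': "z' \<in> vec.span {z} - {0}" and hol: "moduli_holomorphic_near G (moduli_map X (vec.span {z}))" for z' G
    proof -
      obtain b where b: "z' = b *s z" "b \<noteq> 0" using z' unfolding span_line by auto
      have sp: "vec.span {z} = vec.span {z'}" by (rule span_of_member[OF zX]) (use z' in auto)
      have dp': "diagonal_point lam (coords z') t" unfolding b(1) coords_scale by (rule diagonal_point_scale[OF dp b(2)])
      have v': "v = eigen_frame (coords z') t (\<chi> k. poly (smult (1 / b) p) (t k)) + (c / b) *s z'"
      proof -
        have "(\<chi> k. poly (smult (1 / b) p) (t k)) = (1 / b) *s (\<chi> k. poly p (t k))" by (simp add: vec_eq_iff)
        then show ?thesis unfolding v b(1) coords_scale eigen_frame_scale_point
          using b(2) by (simp add: eigen_frame_scale vector_smult_assoc)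
      qed
      show ?thesis
      proof (rule moduli_derivative[OF dp' n2 hol[unfolded sp]])
        fix D assume D: "((\<lambda>u. G (moduli_map X (vec.span {u}))) has_derivative D) (at z' within cone)"
          "\<And>p c. degree p \<le> 2 \<Longrightarrow> D (eigen_frame (coords z') t (\<chi> k. poly p (t k)) + c *s z') = 0"
        have "D v = 0" unfolding v' by (rule D(2)) (use p degree_smult_le[of "1 / b" p] in simp)
        then show ?thesis using D(1) unfolding cone_def by blast
      qed
    qed
    then show "v \<in> ?K" unfolding moduli_kernel_def using perp by blast
  }
  fix v assume vK: "v \<in> ?K"
  then have "v \<in> perp X (vec.span {z})" unfolding moduli_kernel_def by blast
  then obtain a c where v: "v = eigen_frame (coords z) t a + c *s z" unfolding perp_decomposition[OF dp] by blast
  have zz: "z \<in> vec.span {z} - {0}" using z span_line_mem by simp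
  \<comment> \<open>A curve in the cone with velocity \<open>v\<close> at \<open>z\<close>.\<close>
  define \<gamma> where "\<gamma> r = base_change *v ((1 + of_real r * c) *s root_chart lam (coords z) t (\<lambda>k. t k - 2 * of_real r * a $ k))" for r :: real
  have \<gamma>0: "\<gamma> 0 = z" using root_chart_base[OF dp] by (simp add: \<gamma>_def)
  have d\<gamma>: "(\<gamma> has_vector_derivative v) (at 0)"
  proof -
    have "v = base_change *v ((\<Sum>k\<in>UNIV. a $ k *s eigen_tangent lam (coords z) (t k)) + c *s coords z)"
      unfolding coords_eigen_frame[symmetric] v by simp
    then show ?thesis unfolding \<gamma>_def
      using bounded_linear.has_vector_derivative[OF bounded_linear_matrix_complex root_chart_derivative[OF dp]] by simp
  qed
  have tl: "\<And>k i. t k \<noteq> lam i" using dp by (simp add: diagonal_point_def)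
  have tend: "((\<lambda>r::real. t k - 2 * of_real r * a $ k) \<longlongrightarrow> t k) (nhds 0)" for k
    by (auto intro!: tendsto_eq_intros filterlim_ident)
  have vel: "((a $ i - a $ k) * (t j - t l) + (t i - t k) * (a $ j - a $ l)) * ((t i - t l) * (t j - t k)) =
      ((t i - t k) * (t j - t l)) * ((a $ i - a $ l) * (t j - t k) + (t i - t l) * (a $ j - a $ k))"
    if d: "distinct [i, j, k, l]" for i j k l
  proof (rule cross_ratio_coordinate[OF regular_point_rigid[OF reg dp n2] t n d])
    fix \<epsilon> G
    assume \<epsilon>: "\<epsilon> > 0" and hol: "moduli_holomorphic_near G (pencil_class (model_pencil t))"
      and G: "\<And>s. cross_ratios_near t \<epsilon> s \<Longrightarrow> G (pencil_class (model_pencil s)) = cross_ratio s i j k l"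
    obtain D where D: "((\<lambda>u. G (moduli_map X (vec.span {u}))) has_derivative D) (at z within cone)" "D v = 0"
      using vK zz hol unfolding moduli_kernel_def mz cone_def by blast
    have near: "\<forall>\<^sub>F r in nhds (0::real). cross_ratios_near t \<epsilon> (\<lambda>k. t k - 2 * of_real r * a $ k)"
      by (rule eventually_cross_ratios_near[OF _ tend]) (use t \<epsilon> in \<open>simp add: cross_ratios_near_def\<close>)
    have ne: "\<forall>\<^sub>F r in nhds (0::real). \<forall>k i. t k - 2 * of_real r * a $ k \<noteq> lam i"
      by (intro eventually_all_finite tendsto_imp_eventually_ne[OF tend tl])
    have nz: "\<forall>\<^sub>F r in nhds (0::real). 1 + of_real r * c \<noteq> 0"
      by (rule tendsto_imp_eventually_ne[of _ "1 + of_real 0 * c"]) (auto intro!: tendsto_eq_intros filterlim_ident)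
    have ev: "\<forall>\<^sub>F r in nhds (0::real). \<gamma> r \<in> cone \<and>
        cross_ratio (\<lambda>k. t k - 2 * of_real r * a $ k) i j k l = G (moduli_map X (vec.span {\<gamma> r}))"
      using near ne nz
    proof eventually_elim
      case (elim r)
      let ?s = "\<lambda>k. t k - 2 * of_real r * a $ k"
      have "inj ?s" using elim(1) by (simp add: cross_ratios_near_def)
      then have "diagonal_point lam (root_chart lam (coords z) t ?s) ?s"
        using elim(2) by (intro root_chart_diagonal_point[OF dp inj_lam card_ambient]) auto
      then have "diagonal_point lam ((1 + of_real r * c) *s root_chart lam (coords z) t ?s) ?s"
        using elim(3) by (rule diagonal_point_scale)
      then have dp': "diagonal_point lam (coords (\<gamma> r)) ?s" by (simp add: \<gamma>_def)
      show ?case using diagonal_point_cone[OF dp'] moduli_map_diagonal_point[OF dp' n2] G[OF elim(1)] by simp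
    qed
    then obtain S where S: "open S" "0 \<in> S" "\<And>r. r \<in> S \<Longrightarrow> \<gamma> r \<in> cone"
      "\<And>r. r \<in> S \<Longrightarrow> cross_ratio (\<lambda>k. t k - 2 * of_real r * a $ k) i j k l = G (moduli_map X (vec.span {\<gamma> r}))"
      unfolding eventually_nhds by blast
    have 1: "(\<gamma> has_derivative (\<lambda>r. r *\<^sub>R v)) (at 0 within S)"
      using d\<gamma> unfolding has_vector_derivative_def by (rule has_derivative_at_withinI)
    have 2: "((\<lambda>u. G (moduli_map X (vec.span {u}))) has_derivative D) (at (\<gamma> 0) within \<gamma> ` S)"
      unfolding \<gamma>0 by (rule has_derivative_subset[OF D(1)]) (use S(3) in auto)
    have 3: "((\<lambda>r. G (moduli_map X (vec.span {\<gamma> r}))) has_derivative (\<lambda>r. D (r *\<^sub>R v))) (at 0 within S)"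
      by (rule has_derivative_in_compose[OF 1 2])
    have "((\<lambda>r. cross_ratio (\<lambda>k. t k - 2 * of_real r * a $ k) i j k l) has_derivative (\<lambda>r. D (r *\<^sub>R v))) (at 0 within S)"
    proof (rule has_derivative_transform[OF S(2) _ 3])
      fix r assume "r \<in> S"
      then show "cross_ratio (\<lambda>k. t k - 2 * of_real r * a $ k) i j k l = G (moduli_map X (vec.span {\<gamma> r}))"
        by (rule S(4))
    qed
    moreover have "D (r *\<^sub>R v) = r *\<^sub>R 0" for r
      using linear_scale[OF has_derivative_linear[OF D(1)], of r v] D(2) by simp
    ultimately have "((\<lambda>r. cross_ratio (\<lambda>k. t k - 2 * of_real r * a $ k) i j k l) has_vector_derivative 0) (at 0)"
      unfolding has_vector_derivative_def at_within_open[OF S(2,1)] by simp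
    from cross_ratio_velocity[OF t d this] show ?thesis .
  qed
  obtain p where p: "degree p \<le> 2" "\<And>k. a $ k = poly p (t k)"
    using quadratic_velocity[OF t n vel] by blast
  then have "a = (\<chi> k. poly p (t k))" by (simp add: vec_eq_iff)
  then show "v \<in> ?Q" using v p(1) by blast
qed

lemma refined_data:
  fixes t :: "'n \<Rightarrow> complex"
  assumes reg: "vec.span {z} \<in> regular_points X \<phi>\<^sub>1 \<phi>\<^sub>2 e" and z: "z \<noteq> 0"
    and dp: "diagonal_point lam (coords z) t" and n: "CARD('n) \<ge> 3"
  obtains q1 q2 E where "second_fundamental_form X (vec.span {z}) = forms_span q1 q2"
    "diagonal_pair q1 q2 t E (\<lambda>k. resolvent_deriv lam (($) (coords z)) (t k))"
    "tangent_kernel X (vec.span {z}) = quadratic_curve_span t E"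
    "(second_fundamental_form X (vec.span {z}), tangent_kernel X (vec.span {z})) \<in> refined_pairs"
proof (rule second_fundamental_form_diagonal[OF dp])
  let ?F = "frame_at X (vec.span {z})"
  fix E
  assume E: "diagonal_pair (\<lambda>w. \<phi>\<^sub>1 (?F *v w)) (\<lambda>w. \<phi>\<^sub>2 (?F *v w)) t E (\<lambda>k. resolvent_deriv lam (($) (coords z)) (t k))"
    and FE: "\<And>a. \<exists>c. ?F *v (E *v a) = eigen_frame (coords z) t a + c *s z"
  have inv: "invertible E" and t: "inj t" using E by (auto simp: diagonal_pair_def)
  have ker: "tangent_kernel X (vec.span {z}) = quadratic_curve_span t E"
  proof (intro set_eqI)
    fix w
    obtain a where a: "w = E *v a" using invertible_surj[OF inv] by metis
    obtain c where c: "?F *v (E *v a) = eigen_frame (coords z) t a + c *s z" using FE by blast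
    have uniq: "a = b" if "eigen_frame (coords z) t a + c *s z = eigen_frame (coords z) t b + c' *s z" for b c'
    proof -
      have "eigen_frame (coords z) t a = eigen_frame (coords z) t (a - b) + eigen_frame (coords z) t b"
        unfolding eigen_frame_add[symmetric] by simp
      then have "eigen_frame (coords z) t (a - b) + (c - c') *s z = 0"
        using that by (simp add: vec.scale_left_diff_distrib algebra_simps)
      then have "coords (eigen_frame (coords z) t (a - b) + (c - c') *s z) = 0" by simp
      then have "a - b = 0" unfolding coords_eigen_frame by (rule eigen_sum_eq_0[OF dp])
      then show ?thesis by simp
    qed
    have "w \<in> tangent_kernel X (vec.span {z}) \<longleftrightarrow> eigen_frame (coords z) t a + c *s z \<in> moduli_kernel X (vec.span {z})"
      unfolding tangent_kernel_def a vimage_eq c ..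
    also have "\<dots> \<longleftrightarrow> (\<exists>p. degree p \<le> 2 \<and> a = (\<chi> k. poly p (t k)))"
      unfolding moduli_kernel_eq[OF reg z dp n] using uniq by blast
    also have "\<dots> \<longleftrightarrow> w \<in> quadratic_curve_span t E"
      unfolding quadratic_curve_span_def a using invertible_inj[OF inv] by auto
    finally show "w \<in> tangent_kernel X (vec.span {z}) \<longleftrightarrow> w \<in> quadratic_curve_span t E" .
  qed
  have "(second_fundamental_form X (vec.span {z}), tangent_kernel X (vec.span {z})) \<in> refined_pairs"
    unfolding refined_pairs_def ker using quadratic_curve_span_subspace[OF t n inv] reg
    unfolding regular_points_def by blast
  then show ?thesis using that second_fundamental_form_span E ker by blast
qed

end

text \<open>Equality of the refined classes becomes one relation on the roots and nodes, by
  \<open>refined_pencil_match\<close> and the expression of the derivative of the resolvent by products.\<close>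

lemma refined_match:
  fixes t t' :: "'n::finite \<Rightarrow> complex" and X X' :: "(complex ^ ('n + 3)) set set"
  assumes A: "diagonal_quadrics X \<phi>\<^sub>1 \<phi>\<^sub>2 lam e" and B: "diagonal_quadrics X' \<phi>\<^sub>1' \<phi>\<^sub>2' lam' e'"
    and reg: "vec.span {z} \<in> regular_points X \<phi>\<^sub>1 \<phi>\<^sub>2 e" and reg': "vec.span {z'} \<in> regular_points X' \<phi>\<^sub>1' \<phi>\<^sub>2' e'"
    and z: "z \<noteq> 0" "z' \<noteq> 0"
    and dp: "diagonal_point lam (diagonal_quadrics.coords e z) t"
    and dp': "diagonal_point lam' (diagonal_quadrics.coords e' z') t'"
    and n: "CARD('n) > 4"
    and eq: "refined_moduli_map X (vec.span {z}) = refined_moduli_map X' (vec.span {z'})"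
  obtains a b g d \<pi> K where "bij \<pi>" "a * d - b * g \<noteq> 0" "\<And>k. t' (\<pi> k) * (g * t k + d) = a * t k + b" "K \<noteq> 0"
    "\<And>k. (\<Prod>i\<in>UNIV. (lam i - t k)) = K * (\<Prod>i\<in>UNIV. (lam' i * (g * t k + d) - (a * t k + b)))"
proof -
  interpret A: diagonal_quadrics X \<phi>\<^sub>1 \<phi>\<^sub>2 lam e by (rule A)
  interpret B: diagonal_quadrics X' \<phi>\<^sub>1' \<phi>\<^sub>2' lam' e' by (rule B)
  have n3: "CARD('n) \<ge> 3" and n2: "CARD('n) \<ge> 2" using n by simp_all
  show ?thesis
  proof (rule A.refined_data[OF reg z(1) dp n3], rule B.refined_data[OF reg' z(2) dp' n3])
    fix q1 q2 E q1' q2' E'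
    assume 1: "second_fundamental_form X (vec.span {z}) = forms_span q1 q2"
      "diagonal_pair q1 q2 t E (\<lambda>k. resolvent_deriv lam (($) (A.coords z)) (t k))"
      "tangent_kernel X (vec.span {z}) = quadratic_curve_span t E"
      "(second_fundamental_form X (vec.span {z}), tangent_kernel X (vec.span {z})) \<in> refined_pairs"
    assume 2: "second_fundamental_form X' (vec.span {z'}) = forms_span q1' q2'"
      "diagonal_pair q1' q2' t' E' (\<lambda>k. resolvent_deriv lam' (($) (B.coords z')) (t' k))"
      "tangent_kernel X' (vec.span {z'}) = quadratic_curve_span t' E'"
      "(second_fundamental_form X' (vec.span {z'}), tangent_kernel X' (vec.span {z'})) \<in> refined_pairs"
    let ?P = "(second_fundamental_form X (vec.span {z}), tangent_kernel X (vec.span {z}))"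
    let ?P' = "(second_fundamental_form X' (vec.span {z'}), tangent_kernel X' (vec.span {z'}))"
    have "(?P', ?P') \<in> refined_rel"
      unfolding refined_rel_def using 2(4) by (auto intro!: exI[of _ "mat 1"] simp: invertible_mat_1 pullback_mat_1)
    then have "(?P, ?P') \<in> refined_rel" using eq unfolding refined_moduli_map_def by blast
    then obtain T where T: "invertible T" "forms_span q1' q2' = pullback T (forms_span q1 q2)"
      "quadratic_curve_span t' E' = (*v) T -` quadratic_curve_span t E"
      unfolding refined_rel_def 1(1,3) 2(1,3) by blast
    show ?thesis
    proof (rule refined_pencil_match[OF 1(2) 2(2) T n])
      fix a b g d \<pi> \<kappa>
      assume h: "bij \<pi>" "a * d - b * g \<noteq> 0" "\<kappa> \<noteq> 0" "\<And>k. t' (\<pi> k) * (g * t k + d) = a * t k + b"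
        "\<And>k. resolvent_deriv lam' (($) (B.coords z')) (t' (\<pi> k)) = \<kappa> * (g * t k + d) ^ 5 * resolvent_deriv lam (($) (A.coords z)) (t k)"
      obtain c where c: "c \<noteq> 0" "\<And>k. resolvent_deriv lam (($) (A.coords z)) (t k) * (\<Prod>i\<in>UNIV. (lam i - t k)) = - c * (\<Prod>j\<in>UNIV-{k}. (t j - t k))"
        by (rule diagonal_point_representation[OF dp A.inj_lam A.card_ambient]) (rule that; assumption)
      obtain c' where c': "c' \<noteq> 0" "\<And>k. resolvent_deriv lam' (($) (B.coords z')) (t' k) * (\<Prod>i\<in>UNIV. (lam' i - t' k)) = - c' * (\<Prod>j\<in>UNIV-{k}. (t' j - t' k))"
        by (rule diagonal_point_representation[OF dp' B.inj_lam B.card_ambient]) (rule that; assumption)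
      have t: "inj t" and tl: "\<And>k i. t k \<noteq> lam i" using dp by (auto simp: diagonal_point_def)
      obtain K where "K \<noteq> 0" "\<And>k. (\<Prod>i\<in>UNIV. (lam i - t k)) = K * (\<Prod>i\<in>UNIV. (lam' i * (g * t k + d) - (a * t k + b)))"
        by (rule discriminants_match[OF A.card_ambient n2 t tl h(1) h(4) h(2) c(2) c'(2) c(1) c'(1) h(3) h(5)]) (rule that; assumption)
      then show ?thesis using that[OF h(1,2,4)] by blast
    qed
  qed
qed

section \<open>Monomial maps matching the nodes\<close>

lemma moebius_compose_inverse:
  fixes a :: "'a::field"
  assumes "w * (g * u + d) = a * u + b" "w * (g' * s + d') = a' * s + b'"
  shows "u * ((a * g' - g * a') * s + (a * d' - g * b')) = (d * a' - b * g') * s + (d * b' - b * d')"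
proof -
  have "u * (a * (g' * s + d') - g * (a' * s + b')) = u * a * (g' * s + d') - u * g * (w * (g' * s + d'))"
    unfolding assms(2) by (simp add: algebra_simps)
  also have "\<dots> = (a * u + b - w * (g * u + d)) * (g' * s + d') + (d * w - b) * (g' * s + d')"
    by (simp add: algebra_simps)
  also have "\<dots> = d * (w * (g' * s + d')) - b * (g' * s + d')"
    unfolding assms(1) by (simp add: algebra_simps)
  finally show ?thesis unfolding assms(2) by (simp add: algebra_simps)
qed

text \<open>The composition of one map with the inverse of the other fixes three points. Its
  fixed points are the zeros of a quadratic polynomial, which therefore vanishes.\<close>

lemma moebius_unique:
  fixes u :: "'i::finite \<Rightarrow> 'a::field"
  assumes u: "inj u" "CARD('i) \<ge> 3"
    and h: "\<And>i. w i * (g * u i + d) = a * u i + b" and det: "a * d - b * g \<noteq> 0"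
    and h': "\<And>i. w i * (g' * u i + d') = a' * u i + b'" and det': "a' * d' - b' * g' \<noteq> 0"
  obtains c where "c \<noteq> 0" "a' = c * a" "b' = c * b" "g' = c * g" "d' = c * d"
proof -
  \<comment> \<open>The fixed points of the composition, as in \<open>moebius_compose_inverse\<close> with \<open>u = s\<close>.\<close>
  let ?p = "[:d * b' - b * d', (d * a' - b * g') - (a * d' - g * b'), - (a * g' - g * a'):]"
  have "?p = 0"
  proof (rule poly_eq_if_agree[of u UNIV])
    show "poly ?p (u k) = poly 0 (u k)" for k
      using moebius_compose_inverse[OF h h', of k] by (simp add: algebra_simps)
    show "degree ?p < card (UNIV :: 'i set)"
      using u(2) by (simp add: degree_pCons_eq_if)
  qed (use u in auto)
  then have 1: "d * b' = b * d'" "d * a' - b * g' = a * d' - g * b'" "a * g' = g * a'" by simp_all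
  define E where "E = a * d - b * g"
  define c where "c = (d * a' - b * g') / E"
  have E: "E \<noteq> 0" using det by (simp add: E_def)
  have "E * a' = (d * a' - b * g') * a" "E * b' = (d * a' - b * g') * b"
    "E * g' = (d * a' - b * g') * g" "E * d' = (d * a' - b * g') * d"
    using 1 unfolding E_def by algebra+
  then have "a' = c * a" "b' = c * b" "g' = c * g" "d' = c * d"
    using E by (simp_all add: c_def field_simps)
  moreover from this det' have "c \<noteq> 0" by auto
  ultimately show ?thesis using that by blast
qed

definition monomial_matrix :: "('k \<Rightarrow> 'k) \<Rightarrow> ('k \<Rightarrow> complex) \<Rightarrow> complex ^ 'k ^ 'k" where
  "monomial_matrix \<sigma> \<rho> = (\<chi> j i. if j = \<sigma> i then \<rho> i else 0)"

text \<open>Coordinate permutations \<open>\<sigma>\<close> that match the nodes \<open>lam\<close> and \<open>lam'\<close> through a Moebius map, with the multipliers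
  that carry points of one intersection of diagonal quadrics to points of the other.\<close>

definition node_maps :: "('k::finite \<Rightarrow> complex) \<Rightarrow> ('k \<Rightarrow> complex) \<Rightarrow> (complex ^ 'k ^ 'k) set" where
  "node_maps lam lam' = {monomial_matrix \<sigma> \<rho> | \<sigma> \<rho>. bij \<sigma> \<and> (\<exists>a b g d. a * d - b * g \<noteq> 0 \<and>
     (\<forall>i. lam' (\<sigma> i) * (g * lam i + d) = a * lam i + b \<and> (\<rho> i)\<^sup>2 = g * lam i + d))}"

lemma monomial_matrix_mult:
  assumes "bij \<sigma>" shows "(monomial_matrix \<sigma> \<rho> *v x) $ \<sigma> i = \<rho> i * x $ i"
proof -
  have "(monomial_matrix \<sigma> \<rho> *v x) $ \<sigma> i = (\<Sum>j\<in>UNIV. if j = i then \<rho> j * x $ j else 0)"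
    unfolding monomial_matrix_def matrix_vector_mult_def vec_lambda_beta
    by (intro sum.cong refl) (use assms in \<open>auto simp: bij_def inj_eq\<close>)
  then show ?thesis by simp
qed

lemma monomial_matrix_eqI:
  assumes "bij \<sigma>" "\<And>i. y $ \<sigma> i = \<rho> i * x $ i" shows "monomial_matrix \<sigma> \<rho> *v x = y"
proof (rule vec_eqI)
  fix j
  obtain i where "j = \<sigma> i" using assms(1) by (metis bij_pointE)
  then show "(monomial_matrix \<sigma> \<rho> *v x) $ j = y $ j" using assms by (simp add: monomial_matrix_mult)
qed

lemma node_maps_cases:
  assumes "A \<in> node_maps lam lam'"
  obtains \<sigma> \<rho> a b g d where "A = monomial_matrix \<sigma> \<rho>" "bij \<sigma>" "a * d - b * g \<noteq> 0"
    "\<And>i. lam' (\<sigma> i) * (g * lam i + d) = a * lam i + b" "\<And>i. (\<rho> i)\<^sup>2 = g * lam i + d" "\<And>i. \<rho> i \<noteq> 0"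
proof -
  obtain \<sigma> \<rho> a b g d where *: "A = monomial_matrix \<sigma> \<rho>" "bij \<sigma>" "a * d - b * g \<noteq> 0"
    "\<And>i. lam' (\<sigma> i) * (g * lam i + d) = a * lam i + b" "\<And>i. (\<rho> i)\<^sup>2 = g * lam i + d"
    using assms unfolding node_maps_def by blast
  moreover have "\<rho> i \<noteq> 0" for i
    using moebius_denominator_nz[OF *(4,3), of i] *(5)[of i] by auto
  ultimately show ?thesis by (rule that)
qed

lemma node_maps_invertible:
  assumes "A \<in> node_maps lam lam'" shows "invertible A"
proof (rule node_maps_cases[OF assms])
  fix \<sigma> \<rho> assume A: "A = monomial_matrix \<sigma> \<rho>" "bij \<sigma>" "\<And>i. \<rho> i \<noteq> 0"
  have "y = A *v (\<chi> i. y $ \<sigma> i / \<rho> i)" for y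
    unfolding A(1) by (rule monomial_matrix_eqI[OF A(2), symmetric]) (simp add: A(3))
  then have "surj ((*v) A)" unfolding surj_def by blast
  then show ?thesis unfolding invertible_right_inverse matrix_right_invertible_surjective .
qed

text \<open>The squares of the multipliers are the denominators of a Moebius map, which \<open>\<sigma>\<close> determines
  up to a factor. Normalizing one multiplier to \<open>1\<close> leaves finitely many signs.\<close>

lemma node_maps_finite:
  fixes lam lam' :: "'k::finite \<Rightarrow> complex"
  assumes lam: "inj lam" and card: "CARD('k) \<ge> 3"
  obtains F where "finite F" "F \<subseteq> node_maps lam lam'"
    "\<And>A. A \<in> node_maps lam lam' \<Longrightarrow> \<exists>B\<in>F. \<exists>c. c \<noteq> 0 \<and> (\<forall>x. A *v x = c *s (B *v x))"
proof -
  obtain i0 :: 'k where True by blast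
  define moeb where "moeb \<sigma> v \<longleftrightarrow> (\<exists>a b g d. a * d - b * g \<noteq> 0 \<and> v i0 = 1 \<and>
     (\<forall>i. lam' (\<sigma> i) * (g * lam i + d) = a * lam i + b \<and> v i = g * lam i + d))" for \<sigma> v
  have uniq: "v = v'" if v: "moeb \<sigma> v" "moeb \<sigma> v'" for \<sigma> v v'
  proof -
    obtain a b g d where 1: "a * d - b * g \<noteq> 0" "v i0 = 1" "\<And>i. lam' (\<sigma> i) * (g * lam i + d) = a * lam i + b"
      "\<And>i. v i = g * lam i + d" using v(1) unfolding moeb_def by blast
    obtain a' b' g' d' where 2: "a' * d' - b' * g' \<noteq> 0" "v' i0 = 1" "\<And>i. lam' (\<sigma> i) * (g' * lam i + d') = a' * lam i + b'"
      "\<And>i. v' i = g' * lam i + d'" using v(2) unfolding moeb_def by blast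
    show ?thesis
    proof (rule moebius_unique[OF lam card 1(3,1) 2(3,1)])
      fix c assume c: "g' = c * g" "d' = c * d"
      have eq: "v' i = c * v i" for i unfolding 1(4) 2(4) c by (simp add: algebra_simps)
      have "c = 1" using eq[of i0] 1(2) 2(2) by simp
      then show "v = v'" using eq by auto
    qed
  qed
  define F where "F = {A. \<exists>\<sigma> \<rho>. A = monomial_matrix \<sigma> \<rho> \<and> bij \<sigma> \<and> \<rho> i0 = 1 \<and> moeb \<sigma> (\<lambda>i. (\<rho> i)\<^sup>2)}"
  have "finite {\<rho>. moeb \<sigma> (\<lambda>i. (\<rho> i)\<^sup>2)}" for \<sigma>
  proof (cases "\<exists>\<rho>. moeb \<sigma> (\<lambda>i. (\<rho> i)\<^sup>2)")
    case True
    then obtain r where r: "moeb \<sigma> (\<lambda>i. (r i)\<^sup>2)" by blast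
    have "\<rho> i \<in> {r i, - r i}" if \<rho>: "moeb \<sigma> (\<lambda>i. (\<rho> i)\<^sup>2)" for \<rho> i
    proof -
      have "(\<rho> i)\<^sup>2 = (r i)\<^sup>2" using fun_cong[OF uniq[OF \<rho> r], of i] by simp
      then show ?thesis by (simp add: power2_eq_iff)
    qed
    then have "{\<rho>. moeb \<sigma> (\<lambda>i. (\<rho> i)\<^sup>2)} \<subseteq> Pi\<^sub>E UNIV (\<lambda>i. {r i, - r i})" by auto
    then show ?thesis by (rule finite_subset) (intro finite_PiE; simp)
  qed simp
  then have "finite (Sigma UNIV (\<lambda>\<sigma>. {\<rho>. moeb \<sigma> (\<lambda>i. (\<rho> i)\<^sup>2)}))" by (intro finite_SigmaI) simp_all
  moreover have "F \<subseteq> (\<lambda>(\<sigma>, \<rho>). monomial_matrix \<sigma> \<rho>) ` Sigma UNIV (\<lambda>\<sigma>. {\<rho>. moeb \<sigma> (\<lambda>i. (\<rho> i)\<^sup>2)})"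
    by (auto simp: F_def)
  ultimately have fin: "finite F" by (rule finite_surj)
  show ?thesis
  proof (rule that[OF fin])
    show "F \<subseteq> node_maps lam lam'" unfolding F_def moeb_def node_maps_def by blast
    fix A assume "A \<in> node_maps lam lam'"
    then show "\<exists>B\<in>F. \<exists>c. c \<noteq> 0 \<and> (\<forall>x. A *v x = c *s (B *v x))"
    proof (rule node_maps_cases)
      fix \<sigma> \<rho> a b g d
      assume A: "A = monomial_matrix \<sigma> \<rho>" "bij \<sigma>" "a * d - b * g \<noteq> 0"
        "\<And>i. lam' (\<sigma> i) * (g * lam i + d) = a * lam i + b" "\<And>i. (\<rho> i)\<^sup>2 = g * lam i + d" "\<And>i. \<rho> i \<noteq> 0"
      define c where "c = \<rho> i0"
      have c: "c \<noteq> 0" using A(6) by (simp add: c_def)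
      have "moeb \<sigma> (\<lambda>i. (\<rho> i / c)\<^sup>2)" unfolding moeb_def
      proof (intro exI conjI allI)
        show "(a / c\<^sup>2) * (d / c\<^sup>2) - (b / c\<^sup>2) * (g / c\<^sup>2) \<noteq> 0"
          using A(3) c by (simp add: diff_divide_distrib[symmetric])
        show "(\<rho> i0 / c)\<^sup>2 = 1" using c by (simp add: c_def)
        fix i
        show "lam' (\<sigma> i) * ((g / c\<^sup>2) * lam i + d / c\<^sup>2) = (a / c\<^sup>2) * lam i + b / c\<^sup>2"
          using A(4)[of i] c by (simp add: field_simps)
        show "(\<rho> i / c)\<^sup>2 = (g / c\<^sup>2) * lam i + d / c\<^sup>2"
          using A(5)[of i] by (simp add: power_divide add_divide_distrib)
      qed
      then have "monomial_matrix \<sigma> (\<lambda>i. \<rho> i / c) \<in> F" unfolding F_def mem_Collect_eq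
        using A(2) c by (intro exI[of _ \<sigma>] exI[of _ "\<lambda>i. \<rho> i / c"]) (simp add: c_def)
      moreover have "A *v x = c *s (monomial_matrix \<sigma> (\<lambda>i. \<rho> i / c) *v x)" for x
        unfolding A(1) by (rule monomial_matrix_eqI) (use A(2) c in \<open>simp_all add: monomial_matrix_mult\<close>)
      ultimately show ?thesis using c by blast
    qed
  qed
qed

text \<open>The exceptional tuples consist of common roots of a nonzero member of the family of differences of both sides.\<close>

definition generic_roots :: "('k::finite \<Rightarrow> complex) \<Rightarrow> ('k \<Rightarrow> complex) \<Rightarrow> ('n \<Rightarrow> complex) \<Rightarrow> bool" where
  "generic_roots lam lam' t \<longleftrightarrow> (\<forall>a b g d.
     (\<forall>k. (\<Prod>i\<in>UNIV. (lam i - t k)) = (\<Prod>i\<in>UNIV. (lam' i * (g * t k + d) - (a * t k + b)))) \<longrightarrow>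
     (\<forall>s. (\<Prod>i\<in>UNIV. (lam i - s)) = (\<Prod>i\<in>UNIV. (lam' i * (g * s + d) - (a * s + b)))))"

text \<open>The quadruples \<open>(a, b, g, d)\<close> form a space of real dimension \<open>8 < 2 * CARD('n)\<close>.\<close>

lemma generic_roots_negligible:
  fixes lam lam' :: "'k::finite \<Rightarrow> complex"
  assumes n: "CARD('n::finite) > 4"
  shows "negligible {t :: complex ^ 'n. \<not> generic_roots lam lam' (($) t)}"
proof -
  \<comment> \<open>The factor \<open>lam' i * (g * s + d) - (a * s + b)\<close> as a polynomial in \<open>s\<close>.\<close>
  define P where "P i h = (case h of (a, b, g, d) \<Rightarrow> [:lam' i * d - b, lam' i * g - a:])" for i and h :: "complex \<times> complex \<times> complex \<times> complex"
  define G where "G h = node_poly lam UNIV - (\<Prod>i\<in>UNIV. P i h)" for h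
  have bl: "bounded_linear (\<lambda>h :: complex \<times> complex \<times> complex \<times> complex. lam' i * snd (snd (snd h)) - fst (snd h))"
    "bounded_linear (\<lambda>h :: complex \<times> complex \<times> complex \<times> complex. lam' i * fst (snd (snd h)) - fst h)" for i
    by (intro bounded_linear_intros)+
  have "lipschitz_poly_family 1 (P i)" for i
    unfolding lipschitz_poly_family_def
  proof (intro conjI allI)
    show "degree (P i h) \<le> 1" for h by (simp add: P_def split: prod.split)
    fix j
    have "(\<lambda>h. coeff (P i h) j) = (if j = 0 then (\<lambda>h. lam' i * snd (snd (snd h)) - fst (snd h))
        else if j = 1 then (\<lambda>h. lam' i * fst (snd (snd h)) - fst h) else (\<lambda>h. 0))"
      by (auto simp: P_def fun_eq_iff coeff_pCons split: prod.split nat.split)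
    then show "locally_lipschitz (\<lambda>h. coeff (P i h) j)"
      by (simp add: locally_lipschitz_linear[OF bl(1)] locally_lipschitz_linear[OF bl(2)] locally_lipschitz_const)
  qed
  then have pr: "lipschitz_poly_family (card (UNIV :: 'k set)) (\<lambda>h. \<Prod>i\<in>UNIV. P i h)"
    by (intro lipschitz_poly_family_prod) simp_all
  have G: "lipschitz_poly_family (CARD('k)) G"
    unfolding lipschitz_poly_family_def
  proof (intro conjI allI)
    show "degree (G h) \<le> CARD('k)" for h
      unfolding G_def using pr degree_node_poly[of lam UNIV] by (intro degree_diff_le) (simp_all add: lipschitz_poly_family_def del: split_paired_All)
    fix j
    have "locally_lipschitz (\<lambda>h. coeff (node_poly lam UNIV) j + (- 1) * coeff (\<Prod>i\<in>UNIV. P i h) j)"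
      using pr unfolding lipschitz_poly_family_def
      by (intro locally_lipschitz_add locally_lipschitz_mult locally_lipschitz_const) auto
    then show "locally_lipschitz (\<lambda>h. coeff (G h) j)" by (simp add: G_def)
  qed
  have ev: "poly (G (a, b, g, d)) s = (\<Prod>i\<in>UNIV. (lam i - s)) - (\<Prod>i\<in>UNIV. (lam' i * (g * s + d) - (a * s + b)))" for a b g d s
    unfolding G_def P_def by (simp add: poly_node_poly poly_prod algebra_simps)
  have "DIM(complex \<times> complex \<times> complex \<times> complex) < 2 * CARD('n)" using n by simp
  from common_roots_negligible[OF G this]
  show ?thesis
  proof (rule negligible_subset)
    show "{t :: complex ^ 'n. \<not> generic_roots lam lam' (($) t)} \<subseteq> {t. \<exists>h. G h \<noteq> 0 \<and> (\<forall>k. poly (G h) (t $ k) = 0)}"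
    proof
      fix t :: "complex ^ 'n" assume "t \<in> {t. \<not> generic_roots lam lam' (($) t)}"
      then obtain a b g d s where h: "\<And>k. poly (G (a, b, g, d)) (t $ k) = 0" "poly (G (a, b, g, d)) s \<noteq> 0"
        unfolding generic_roots_def ev by auto
      from h(2) have "G (a, b, g, d) \<noteq> 0" by (intro notI) simp
      with h(1) have "\<exists>h. G h \<noteq> 0 \<and> (\<forall>k. poly (G h) (t $ k) = 0)" by (intro exI[of _ "(a, b, g, d)"]) simp
      then show "t \<in> {t. \<exists>h. G h \<noteq> 0 \<and> (\<forall>k. poly (G h) (t $ k) = 0)}" by (rule CollectI)
    qed
  qed
qed

text \<open>By genericity the Moebius map matches the nodes, and \<open>squares_match\<close> gives the squares of the
  multipliers.\<close>

lemma node_map_at_generic_point: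
  fixes lam lam' :: "'k::finite \<Rightarrow> complex" and t t' :: "'n::finite \<Rightarrow> complex"
  assumes card: "CARD('k) = CARD('n) + 3" and lam: "inj lam" "inj lam'"
    and dp: "diagonal_point lam x t" and dp': "diagonal_point lam' x' t'" and gen: "generic_roots lam lam' t"
    and pi: "bij \<pi>" and det: "a * d - b * g \<noteq> 0" and h: "\<And>k. t' (\<pi> k) * (g * t k + d) = a * t k + b"
    and K: "K \<noteq> 0" "\<And>k. (\<Prod>i\<in>UNIV. (lam i - t k)) = K * (\<Prod>i\<in>UNIV. (lam' i * (g * t k + d) - (a * t k + b)))"
  obtains A where "A \<in> node_maps lam lam'" "A *v x = x'"
proof -
  \<comment> \<open>The factor \<open>K\<close> is absorbed by a rescaling of the Moebius map.\<close>
  have "0 < CARD('k)" by simp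
  then obtain r where r: "r ^ CARD('k) = K" using exists_complex_root[of "CARD('k)" K] by auto
  have r0: "r \<noteq> 0" using r K(1) by (auto simp: power_0_left)
  define a' b' g' d' where abgd: "a' = r * a" "b' = r * b" "g' = r * g" "d' = r * d"
  have det': "a' * d' - b' * g' \<noteq> 0"
  proof -
    have "a' * d' - b' * g' = r\<^sup>2 * (a * d - b * g)" unfolding abgd by (simp add: power2_eq_square algebra_simps)
    then show ?thesis using det r0 by simp
  qed
  have h': "t' (\<pi> k) * (g' * t k + d') = a' * t k + b'" for k
    using arg_cong[OF h[of k], of "(*) r"] unfolding abgd by (simp add: algebra_simps)
  have "(\<Prod>i\<in>UNIV. (lam i - t k)) = (\<Prod>i\<in>UNIV. (lam' i * (g' * t k + d') - (a' * t k + b')))" for k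
  proof -
    have "(\<Prod>i\<in>UNIV. (lam i - t k)) = (\<Prod>i::'k\<in>UNIV. r) * (\<Prod>i\<in>UNIV. (lam' i * (g * t k + d) - (a * t k + b)))"
      unfolding K(2) by (simp add: r)
    also have "\<dots> = (\<Prod>i\<in>UNIV. (lam' i * (g' * t k + d') - (a' * t k + b')))"
      unfolding prod.distrib[symmetric] abgd by (simp add: algebra_simps)
    finally show ?thesis .
  qed
  then have id: "(\<Prod>i\<in>UNIV. (lam i - s)) = (\<Prod>i\<in>UNIV. (lam' i * (g' * s + d') - (a' * s + b')))" for s
    using gen unfolding generic_roots_def by blast
  show ?thesis
  proof (rule nodes_match[OF lam(1) det' id])
    fix \<sigma> assume \<sigma>: "bij \<sigma>" "\<And>i. lam' (\<sigma> i) * (g' * lam i + d') = a' * lam i + b'"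
    show ?thesis
    proof (rule diagonal_point_representation[OF dp lam(1) card], rule diagonal_point_representation[OF dp' lam(2) card])
      fix c c'
      assume c: "c \<noteq> 0" "\<And>i. (x $ i)\<^sup>2 * (\<Prod>j\<in>UNIV-{i}. (lam j - lam i)) = c * (\<Prod>k\<in>UNIV. (t k - lam i))"
        and c': "c' \<noteq> 0" "\<And>i. (x' $ i)\<^sup>2 * (\<Prod>j\<in>UNIV-{i}. (lam' j - lam' i)) = c' * (\<Prod>k\<in>UNIV. (t' k - lam' i))"
      show ?thesis
      proof (rule squares_match[OF card lam(1) pi h' \<sigma> det' c(2) c'(2) c(1) c'(1)])
        fix C assume C: "C \<noteq> 0" "\<And>i. (x' $ \<sigma> i)\<^sup>2 = C * (g' * lam i + d') * (x $ i)\<^sup>2"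
        have x: "x $ i \<noteq> 0" for i using dp by (simp add: diagonal_point_def)
        \<comment> \<open>With these multipliers \<open>x\<close> is mapped to \<open>x'\<close> exactly; the factor \<open>C\<close> goes into the Moebius map.\<close>
        define \<rho> where "\<rho> i = x' $ \<sigma> i / x $ i" for i
        have "(C * a') * (C * d') - (C * b') * (C * g') \<noteq> 0"
        proof -
          have "(C * a') * (C * d') - (C * b') * (C * g') = C\<^sup>2 * (a' * d' - b' * g')"
            by (simp add: power2_eq_square algebra_simps)
          then show ?thesis using det' C(1) by simp
        qed
        moreover have "lam' (\<sigma> i) * (C * g' * lam i + C * d') = C * a' * lam i + C * b'" for i
          using arg_cong[OF \<sigma>(2)[of i], of "(*) C"] by (simp add: algebra_simps)
        moreover have "(\<rho> i)\<^sup>2 = C * g' * lam i + C * d'" for i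
          unfolding \<rho>_def power_divide C(2) using x[of i] by (simp add: divide_simps) (simp add: algebra_simps)
        ultimately have "monomial_matrix \<sigma> \<rho> \<in> node_maps lam lam'"
          unfolding node_maps_def using \<sigma>(1) by blast
        moreover have "monomial_matrix \<sigma> \<rho> *v x = x'"
          by (rule monomial_matrix_eqI[OF \<sigma>(1)]) (simp add: \<rho>_def x)
        ultimately show ?thesis by (rule that)
      qed
    qed
  qed
qed

text \<open>Both maps induce Moebius maps from \<open>t\<close> to \<open>t'\<close>. They differ by a Moebius permutation of \<open>t\<close>, so by rigidity they
  agree on \<open>t\<close> and are proportional; hence the permutations \<open>\<sigma>\<close> agree as well.\<close>

lemma node_maps_rigid:
  fixes lam lam' :: "'k::finite \<Rightarrow> complex" and t t' :: "'n::finite \<Rightarrow> complex"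
  assumes card: "CARD('k) = CARD('n) + 3" and n: "CARD('n) \<ge> 3" and lam: "inj lam" "inj lam'"
    and A: "A \<in> node_maps lam lam'" and B: "B \<in> node_maps lam lam'"
    and dp: "diagonal_point lam x t" and dp': "diagonal_point lam' (A *v x) t'" and rig: "moebius_rigid t"
    and eq: "B *v x = c *s (A *v x)" and c: "c \<noteq> 0"
  shows "B *v y = c *s (A *v y)"
proof (rule node_maps_cases[OF A], rule node_maps_cases[OF B],
    rule diagonal_point_representation[OF dp lam(1) card], rule diagonal_point_representation[OF dp' lam(2) card])
  fix \<sigma> \<rho> a b g d \<sigma>' \<rho>' a' b' g' d' r r'
  assume A: "A = monomial_matrix \<sigma> \<rho>" "bij \<sigma>" "a * d - b * g \<noteq> 0"
      "\<And>i. lam' (\<sigma> i) * (g * lam i + d) = a * lam i + b" "\<And>i. (\<rho> i)\<^sup>2 = g * lam i + d"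
    and B: "B = monomial_matrix \<sigma>' \<rho>'" "bij \<sigma>'" "a' * d' - b' * g' \<noteq> 0"
      "\<And>i. lam' (\<sigma>' i) * (g' * lam i + d') = a' * lam i + b'" "\<And>i. (\<rho>' i)\<^sup>2 = g' * lam i + d'"
    and r: "r \<noteq> 0" "\<And>i. (x $ i)\<^sup>2 * (\<Prod>j\<in>UNIV-{i}. (lam j - lam i)) = r * (\<Prod>k\<in>UNIV. (t k - lam i))"
    and r': "r' \<noteq> 0" "\<And>i. ((A *v x) $ i)\<^sup>2 * (\<Prod>j\<in>UNIV-{i}. (lam' j - lam' i)) = r' * (\<Prod>k\<in>UNIV. (t' k - lam' i))"
  have t: "inj t" and x: "\<And>i. x $ i \<noteq> 0" using dp by (auto simp: diagonal_point_def)
  have CA: "((A *v x) $ \<sigma> i)\<^sup>2 = 1 * (g * lam i + d) * (x $ i)\<^sup>2" for i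
    unfolding A(1) monomial_matrix_mult[OF A(2)] by (simp add: power_mult_distrib A(5))
  \<comment> \<open>\<open>A *v x\<close> is \<open>B *v x\<close> divided by \<open>c\<close>, so \<open>B\<close> relates its squares to those of \<open>x\<close> too.\<close>
  have CB: "((A *v x) $ \<sigma>' i)\<^sup>2 = (1 / c\<^sup>2) * (g' * lam i + d') * (x $ i)\<^sup>2" for i
  proof -
    have "c * (A *v x) $ \<sigma>' i = (B *v x) $ \<sigma>' i" unfolding eq by simp
    also have "\<dots> = \<rho>' i * x $ i" unfolding B(1) monomial_matrix_mult[OF B(2)] ..
    finally have "(A *v x) $ \<sigma>' i = \<rho>' i * x $ i / c" using c by (simp add: field_simps)
    then show ?thesis by (simp add: power_divide power_mult_distrib B(5))
  qed
  show ?thesis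
  proof (rule roots_match[OF card lam(1) A(2,4,3) r(2) r'(2) r(1) r'(1) CA t],
      rule roots_match[OF card lam(1) B(2,4,3) r(2) r'(2) r(1) r'(1) CB t])
    fix \<pi> \<pi>'
    assume \<pi>: "bij \<pi>" "\<And>k. t' (\<pi> k) * (g * t k + d) = a * t k + b"
      and \<pi>': "bij \<pi>'" "\<And>k. t' (\<pi>' k) * (g' * t k + d') = a' * t k + b'"
    have inv: "\<pi> ((inv \<pi> \<circ> \<pi>') k) = \<pi>' k" for k
      using \<pi>(1) by (simp add: bij_is_surj surj_f_inv_f)
    have "inv \<pi> \<circ> \<pi>' = id"
    proof -
      have "bij (inv \<pi> \<circ> \<pi>')" using \<pi>(1) \<pi>'(1) by (simp add: bij_comp bij_imp_bij_inv)
      moreover have "(d * a' - b * g') * (a * d' - g * b') - (d * b' - b * d') * (a * g' - g * a') \<noteq> 0"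
      proof -
        have "(d * a' - b * g') * (a * d' - g * b') - (d * b' - b * d') * (a * g' - g * a')
            = (a * d - b * g) * (a' * d' - b' * g')" by (simp add: algebra_simps)
        then show ?thesis using A(3) B(3) by simp
      qed
      moreover have "t ((inv \<pi> \<circ> \<pi>') k) * ((a * g' - g * a') * t k + (a * d' - g * b'))
          = (d * a' - b * g') * t k + (d * b' - b * d')" for k
        by (rule moebius_compose_inverse[OF \<pi>(2)[of "(inv \<pi> \<circ> \<pi>') k", unfolded inv] \<pi>'(2)])
      ultimately show ?thesis using rig unfolding moebius_rigid_def by blast
    qed
    then have "\<pi>' k = \<pi> k" for k using inv[of k] by simp
    note \<pi>'' = \<pi>'(2)[unfolded this]
    show ?thesis
    proof (rule moebius_unique[OF t n \<pi>(2) A(3) \<pi>'' B(3)])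
      fix e assume e: "e \<noteq> 0" "a' = e * a" "b' = e * b" "g' = e * g" "d' = e * d"
      have "\<sigma>' i = \<sigma> i" for i
      proof -
        have "e * (lam' (\<sigma>' i) * (g * lam i + d)) = e * (a * lam i + b)"
          using B(4)[of i] unfolding e by (simp add: algebra_simps)
        then have "lam' (\<sigma>' i) * (g * lam i + d) = lam' (\<sigma> i) * (g * lam i + d)" using e(1) A(4)[of i] by simp
        then show ?thesis using moebius_denominator_nz[OF A(4,3), of i] lam(2) by (simp add: inj_eq)
      qed
      then have \<sigma>: "\<sigma>' = \<sigma>" by auto
      have "\<rho>' i = c * \<rho> i" for i
        using arg_cong[OF eq, of "\<lambda>v. v $ \<sigma> i"] x[of i]
        unfolding A(1) B(1) \<sigma> by (simp add: monomial_matrix_mult[OF A(2)])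
      then show ?thesis unfolding A(1) B(1) \<sigma>
        by (intro monomial_matrix_eqI[OF A(2)]) (simp add: monomial_matrix_mult[OF A(2)])
    qed
  qed
qed

section \<open>Gluing the local descriptions\<close>

lemma span_eq_iff_minors:
  fixes v w :: "complex ^ 'm"
  assumes "v \<noteq> 0" "w \<noteq> 0"
  shows "vec.span {v} = vec.span {w} \<longleftrightarrow> (\<forall>i j. v $ i * w $ j = v $ j * w $ i)"
proof
  assume "vec.span {v} = vec.span {w}"
  then have "v \<in> range (\<lambda>c. c *s w)" using span_line_mem[of v] unfolding span_line[of w] by simp
  then show "\<forall>i j. v $ i * w $ j = v $ j * w $ i" by auto
next
  assume m: "\<forall>i j. v $ i * w $ j = v $ j * w $ i"
  obtain j where j: "w $ j \<noteq> 0" using assms(2) by (auto simp: vec_eq_iff)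
  define c where "c = v $ j / w $ j"
  have v: "v = c *s w"
  proof (rule vec_eqI)
    fix i
    have "v $ i * w $ j = v $ j * w $ i" using m by blast
    then show "v $ i = (c *s w) $ i" using j by (simp add: c_def field_simps)
  qed
  then have "c \<noteq> 0" using assms(1) by auto
  then have "vec.span {c *s w} = vec.span {w}"
    unfolding span_line
  proof (intro equalityI subsetI)
    fix y assume "y \<in> range (\<lambda>b. b *s (c *s w))"
    then obtain b where "y = (b * c) *s w" by (auto simp: vector_smult_assoc)
    then show "y \<in> range (\<lambda>b. b *s w)" by blast
  next
    fix y assume "y \<in> range (\<lambda>b. b *s w)"
    then obtain b where "y = b *s w" by blast
    then have "y = (b / c) *s (c *s w)" using \<open>c \<noteq> 0\<close> by (simp add: vector_smult_assoc)
    then show "y \<in> range (\<lambda>b. b *s (c *s w))" by blast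
  qed
  then show "vec.span {v} = vec.span {w}" unfolding v .
qed

lemma span_scale:
  fixes w :: "complex ^ 'm"
  assumes "c \<noteq> 0" shows "vec.span {c *s w} = vec.span {w}"
proof (cases "w = 0")
  case False
  then have "c *s w \<noteq> 0" using assms by simp
  then show ?thesis using span_eq_iff_minors[of "c *s w" w] False by (simp add: mult_ac)
qed simp

lemma span_eqD:
  fixes v w :: "complex ^ 'm"
  assumes "vec.span {v} = vec.span {w}" "v \<noteq> 0" obtains c where "c \<noteq> 0" "v = c *s w"
proof -
  have "v \<in> range (\<lambda>c. c *s w)" using assms(1) span_line_mem[of v] unfolding span_line[of w] by simp
  then obtain c where "v = c *s w" by blast
  then show ?thesis using that[of c] assms(2) by auto
qed

lemma image_span_line: "(*v) A ` vec.span {u} = vec.span {A *v u}" for A :: "complex ^ 'k ^ 'm"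
  unfolding span_line by (auto simp: image_image vector_scalar_commute)

text \<open>The projection from nonzero vectors to projective space is open, since the preimage of the image of
  \<open>N\<close> is the union of the multiples of \<open>N\<close>.\<close>

lemma openin_proj_image:
  fixes N :: "(complex ^ 'k) set"
  assumes "open N" shows "openin proj_topology {vec.span {u} | u. u \<in> N \<and> u \<noteq> 0}"
  unfolding openin_proj_topology
proof
  show "{vec.span {u} | u. u \<in> N \<and> u \<noteq> 0} \<subseteq> proj_space" unfolding proj_space_def by blast
  have "{z. z \<noteq> 0 \<and> vec.span {z} \<in> {vec.span {u} | u. u \<in> N \<and> u \<noteq> 0}}
      = (\<Union>c\<in>-{0}. (\<lambda>z. c *s z) -` (N - {0}))" (is "?L = ?R")
  proof
    show "?L \<subseteq> ?R"
    proof
      fix z assume "z \<in> ?L"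
      then obtain u where u: "vec.span {u} = vec.span {z}" "u \<in> N" "u \<noteq> 0" by auto
      from u(1,3) show "z \<in> ?R" by (rule span_eqD) (use u in auto)
    qed
    show "?R \<subseteq> ?L"
    proof
      fix z assume "z \<in> ?R"
      then obtain c where c: "c \<noteq> 0" "c *s z \<in> N" "c *s z \<noteq> 0" by auto
      then have "vec.span {z} \<in> {vec.span {u} | u. u \<in> N \<and> u \<noteq> 0}"
        using span_scale[OF c(1), of z, symmetric] by blast
      moreover have "z \<noteq> 0" using c(3) by auto
      ultimately show "z \<in> ?L" by simp
    qed
  qed
  moreover have "open ((\<lambda>z. c *s z) -` (N - {0}))" for c
  proof (rule open_vimage)
    show "open (N - {0})" using assms by (simp add: open_Diff)
    have "bounded_linear (\<lambda>z :: complex ^ 'k. c *s z)"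
      by (rule linear_conv_bounded_linear[THEN iffD1], rule linearI)
         (simp_all add: vec.scale_right_distrib scaleR_complex_vec vector_smult_assoc mult.commute)
    then show "continuous_on UNIV (\<lambda>z :: complex ^ 'k. c *s z)"
      by (rule linear_continuous_on)
  qed
  ultimately show "open {z. z \<noteq> 0 \<and> vec.span {z} \<in> {vec.span {u} | u. u \<in> N \<and> u \<noteq> 0}}"
    by (simp only:) (intro open_UN ballI)
qed

lemma nhds_neighbourhood:
  assumes "\<forall>\<^sub>F u in nhds z. P u"
  obtains S where "open S" "z \<in> S" "\<And>u. u \<in> S \<Longrightarrow> P u"
  using assms unfolding eventually_nhds by blast

text \<open>Proportionality of two vectors is the vanishing of their minors, a closed condition.\<close>

lemma lifts_differ_nearby:
  fixes F G :: "complex ^ 'k \<Rightarrow> complex ^ 'm"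
  assumes "isCont F z" "isCont G z" and nz: "\<And>u. u \<noteq> 0 \<Longrightarrow> G u \<noteq> 0" and z: "z \<noteq> 0"
    and N: "open N" "z \<in> N" "\<And>u. u \<in> N \<Longrightarrow> F u \<noteq> 0"
    and ne: "vec.span {F z} \<noteq> vec.span {G z}"
  shows "\<forall>\<^sub>F u in nhds z. vec.span {F u} \<noteq> vec.span {G u}"
proof -
  obtain i j where ij: "F z $ i * G z $ j - F z $ j * G z $ i \<noteq> 0"
    using ne span_eq_iff_minors[OF N(3)[OF N(2)] nz[OF z]] by auto
  have "((\<lambda>u. F u $ i * G u $ j - F u $ j * G u $ i) \<longlongrightarrow> F z $ i * G z $ j - F z $ j * G z $ i) (nhds z)"
  proof -
    have "(F \<longlongrightarrow> F z) (nhds z)" "(G \<longlongrightarrow> G z) (nhds z)"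
      using assms(1,2) by (simp_all add: continuous_at tendsto_nhds_iff)
    then show ?thesis by (intro tendsto_intros)
  qed
  then have "\<forall>\<^sub>F u in nhds z. F u $ i * G u $ j - F u $ j * G u $ i \<noteq> 0"
    using ij by (rule tendsto_imp_eventually_ne)
  moreover have "\<forall>\<^sub>F u in nhds z. u \<noteq> 0" using z by (intro t1_space_nhds)
  moreover have "\<forall>\<^sub>F u in nhds z. u \<in> N" using N by (intro eventually_nhds_in_open)
  ultimately show ?thesis
  proof eventually_elim
    case (elim u)
    then show ?case using span_eq_iff_minors[OF N(3) nz, of u u] by auto
  qed
qed

locale matched_moduli_maps =
  A: diagonal_quadrics X \<phi>\<^sub>1 \<phi>\<^sub>2 lam e + B: diagonal_quadrics X' \<phi>\<^sub>1' \<phi>\<^sub>2' lam' e'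
  for X X' :: "(complex ^ ('n::finite + 3)) set set"
    and \<phi>\<^sub>1 \<phi>\<^sub>2 \<phi>\<^sub>1' \<phi>\<^sub>2' :: "complex ^ ('n + 3) \<Rightarrow> complex"
    and lam lam' :: "'n + 3 \<Rightarrow> complex"
    and e e' :: "'n + 3 \<Rightarrow> complex ^ ('n + 3)" +
  fixes M M' :: "(complex ^ ('n + 3)) set set"
    and f :: "(complex ^ ('n + 3)) set \<Rightarrow> (complex ^ ('n + 3)) set"
  assumes n: "CARD('n) > 4"
    and regular: "M \<subseteq> regular_points X \<phi>\<^sub>1 \<phi>\<^sub>2 e" "M' \<subseteq> regular_points X' \<phi>\<^sub>1' \<phi>\<^sub>2' e'"
    and open_M: "openin (subtopology proj_topology X) M"
    and maps: "\<And>p. p \<in> M \<Longrightarrow> f p \<in> M'" and hol: "proj_holomorphic_on f M"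
    and moduli: "\<And>p. p \<in> M \<Longrightarrow> refined_moduli_map X p = refined_moduli_map X' (f p)"
begin

definition ambient :: "complex ^ ('n + 3) ^ ('n + 3) \<Rightarrow> complex ^ ('n + 3) ^ ('n + 3)" where
  "ambient L = B.base_change ** L ** matrix_inv A.base_change"

lemma ambient_mult: "ambient L *v u = B.base_change *v (L *v A.coords u)"
  by (simp add: ambient_def A.coords_def matrix_vector_mul_assoc matrix_mul_assoc)

lemma coords_ambient: "B.coords (ambient L *v u) = L *v A.coords u"
  by (simp add: ambient_mult)

lemma ambient_scale: "(\<And>x. L' *v x = c *s (L *v x)) \<Longrightarrow> ambient L' *v u = c *s (ambient L *v u)"
  by (simp add: ambient_mult vector_scalar_commute)

lemma invertible_ambient: "invertible L \<Longrightarrow> invertible (ambient L)"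
  unfolding ambient_def
  by (intro invertible_mult A.invertible_base_change B.invertible_base_change invertible_matrix_inv)

lemma point_of_M:
  assumes "p \<in> M" obtains z where "z \<noteq> 0" "p = vec.span {z}"
proof -
  have "p \<in> topspace proj_topology" using assms openin_subset[OF open_M] by auto
  moreover have "openin proj_topology (topspace proj_topology :: (complex ^ ('n + 3)) set set)" by simp
  ultimately have "p \<in> proj_space" unfolding openin_proj_topology by blast
  then show ?thesis unfolding proj_space_def using that by blast
qed

lemma image_point:
  assumes "p \<in> M" obtains z' where "z' \<noteq> 0" "f p = vec.span {z'}" "vec.span {z'} \<in> M'"
proof -
  have fp: "f p \<in> M'" using maps assms .
  then have "f p \<in> X'" using regular(2) unfolding regular_points_def by blast
  then have "f p \<in> proj_space" using B.nonsing unfolding nonsingular_two_quadrics_def by blast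
  then obtain z' where "f p = vec.span {z'}" "z' \<noteq> 0" unfolding proj_space_def by blast
  then show ?thesis using fp that by simp
qed

text \<open>In the chart of the roots the generic tuples are dense, because their complement is
  negligible.\<close>

lemma dense_node_maps:
  assumes z: "z \<noteq> 0" "vec.span {z} \<in> M" and N: "open N" "z \<in> N"
  shows "\<exists>u\<in>N. u \<noteq> 0 \<and> vec.span {u} \<in> M \<and>
    (\<exists>L\<in>node_maps lam lam'. f (vec.span {u}) = vec.span {ambient L *v u})"
proof -
  have reg: "vec.span {z} \<in> regular_points X \<phi>\<^sub>1 \<phi>\<^sub>2 e" using z regular(1) by blast
  obtain U where U: "openin proj_topology U" "M = X \<inter> U"
    using open_M unfolding openin_subtopology by (auto simp: Int_commute)
  have oU: "open {u. u \<noteq> 0 \<and> vec.span {u} \<in> U}" using U(1) unfolding openin_proj_topology by blast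
  show ?thesis
  proof (rule A.regular_point_roots[OF reg z(1)])
    fix t :: "'n \<Rightarrow> complex" assume dp: "diagonal_point lam (A.coords z) t"
    have t: "inj t" and tl: "\<And>k i. t k \<noteq> lam i" using dp by (auto simp: diagonal_point_def)
    let ?u = "\<lambda>s :: complex ^ 'n. A.base_change *v root_chart lam (A.coords z) t (($) s)"
    let ?s0 = "(\<chi> k. t k) :: complex ^ 'n"
    have ident: "((\<lambda>s. s) \<longlongrightarrow> ?s0) (nhds ?s0)" by (rule filterlim_ident)
    have comp: "((\<lambda>s. s $ k) \<longlongrightarrow> t k) (nhds ?s0)" for k
      using tendsto_vec_nth[OF ident, of k] by simp
    \<comment> \<open>Moving the roots of \<open>z\<close> slightly gives points of \<open>M\<close> near \<open>z\<close>.\<close>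
    have "((\<lambda>s. root_chart lam (A.coords z) t (($) s)) \<longlongrightarrow> A.coords z) (nhds ?s0)"
      by (rule root_chart_continuous[OF dp comp])
    then have "(?u \<longlongrightarrow> A.base_change *v A.coords z) (nhds ?s0)"
      by (rule bounded_linear.tendsto[OF bounded_linear_matrix_complex])
    then have lim: "(?u \<longlongrightarrow> z) (nhds ?s0)" by simp
    have e1: "\<forall>\<^sub>F s in nhds ?s0. ?u s \<in> N" using topological_tendstoD[OF lim N] .
    have e2: "\<forall>\<^sub>F s in nhds ?s0. ?u s \<in> {u. u \<noteq> 0 \<and> vec.span {u} \<in> U}"
      using topological_tendstoD[OF lim oU] z U(2) by blast
    have e3: "\<forall>\<^sub>F s in nhds ?s0. \<forall>k i. s $ k \<noteq> lam i"
      by (intro eventually_all_finite tendsto_imp_eventually_ne[OF comp tl])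
    have e4: "\<forall>\<^sub>F s in nhds ?s0. \<forall>k l. k \<noteq> l \<longrightarrow> s $ k \<noteq> s $ l"
      by (rule eventually_distinct[OF comp t])
    obtain S where S: "open S" "?s0 \<in> S"
      "\<And>s. s \<in> S \<Longrightarrow> (?u s \<in> N \<and> ?u s \<in> {u. u \<noteq> 0 \<and> vec.span {u} \<in> U}) \<and>
         (\<forall>k i. s $ k \<noteq> lam i) \<and> (\<forall>k l. k \<noteq> l \<longrightarrow> s $ k \<noteq> s $ l)"
      using eventually_conj[OF eventually_conj[OF e1 e2] eventually_conj[OF e3 e4]]
      by (rule nhds_neighbourhood) (rule that; assumption)
    have "\<not> S \<subseteq> {s. \<not> generic_roots lam lam' (($) s)}"
    proof
      assume "S \<subseteq> {s. \<not> generic_roots lam lam' (($) s)}"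
      then have "negligible S" by (rule negligible_subset[OF generic_roots_negligible[OF n]])
      then show False using open_not_negligible[OF S(1)] S(2) by blast
    qed
    then obtain s where s: "s \<in> S" "generic_roots lam lam' (($) s)" by blast
    define u where "u = ?u s"
    have u: "u \<in> N" "u \<noteq> 0" "vec.span {u} \<in> U" using S(3)[OF s(1)] by (auto simp: u_def)
    have dpu: "diagonal_point lam (A.coords u) (($) s)"
      unfolding u_def A.coords_base_change
      by (rule root_chart_diagonal_point[OF dp A.inj_lam A.card_ambient])
         (use S(3)[OF s(1)] in \<open>auto intro!: injI\<close>)
    have "vec.span {u} \<in> X" using A.diagonal_point_cone[OF dpu] by (simp add: A.cone_def)
    then have uM: "vec.span {u} \<in> M" using u(3) U(2) by blast
    show ?thesis
    proof (rule image_point[OF uM])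
      fix z' assume z': "z' \<noteq> 0" "f (vec.span {u}) = vec.span {z'}" "vec.span {z'} \<in> M'"
      have regu: "vec.span {u} \<in> regular_points X \<phi>\<^sub>1 \<phi>\<^sub>2 e" and reg': "vec.span {z'} \<in> regular_points X' \<phi>\<^sub>1' \<phi>\<^sub>2' e'"
        using uM z'(3) regular by blast+
      show ?thesis
      proof (rule B.regular_point_roots[OF reg' z'(1)])
        fix t' :: "'n \<Rightarrow> complex" assume dp': "diagonal_point lam' (B.coords z') t'"
        show ?thesis
        proof (rule refined_match[OF A.diagonal_quadrics_axioms B.diagonal_quadrics_axioms regu reg' u(2) z'(1) dpu dp' n
              moduli[OF uM, unfolded z'(2)]])
          fix a b g d \<pi> K
          assume m: "bij \<pi>" "a * d - b * g \<noteq> 0" "\<And>k. t' (\<pi> k) * (g * s $ k + d) = a * s $ k + b" "K \<noteq> 0"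
            "\<And>k. (\<Prod>i\<in>UNIV. (lam i - s $ k)) = K * (\<Prod>i\<in>UNIV. (lam' i * (g * s $ k + d) - (a * s $ k + b)))"
          show ?thesis
          proof (rule node_map_at_generic_point[OF A.card_ambient A.inj_lam B.inj_lam dpu dp' s(2) m])
            fix L assume L: "L \<in> node_maps lam lam'" "L *v A.coords u = B.coords z'"
            have "ambient L *v u = z'" unfolding ambient_mult L(2) by simp
            then show ?thesis using L(1) u uM z'(2) by metis
          qed
        qed
      qed
    qed
  qed
qed

definition agreement :: "complex ^ ('n + 3) ^ ('n + 3) \<Rightarrow> (complex ^ ('n + 3)) set set" where
  "agreement L = {p \<in> M. f p = (*v) (ambient L) ` p}"

lemma lift_disagrees_nearby:
  assumes z: "z \<noteq> 0" "vec.span {z} \<in> M" and L: "invertible L" and out: "vec.span {z} \<notin> agreement L"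
  shows "\<forall>\<^sub>F u in nhds z. u \<noteq> 0 \<and> vec.span {u} \<in> M \<longrightarrow> vec.span {u} \<notin> agreement L"
proof -
  have "z \<in> vec.span {z} - {0}" using z(1) by (simp add: span_line_mem)
  then obtain N F where NF: "open N" "z \<in> N"
    "\<And>u. u \<in> N \<Longrightarrow> (\<exists>J. (F has_derivative (*v) J) (at u)) \<and> F u \<noteq> 0 \<and>
       (u \<noteq> 0 \<and> vec.span {u} \<in> M \<longrightarrow> f (vec.span {u}) = vec.span {F u})"
    using hol z(2) unfolding proj_holomorphic_on_def by meson
  have F: "isCont F z" using NF(3)[OF NF(2)] has_derivative_continuous by blast
  have G: "isCont (\<lambda>u. ambient L *v u) z" by (rule linear_continuous_at[OF bounded_linear_matrix_complex])
  have nz: "ambient L *v u \<noteq> 0" if "u \<noteq> 0" for u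
    using invertible_eq_0[OF invertible_ambient[OF L], of u] that by auto
  have ne: "vec.span {F z} \<noteq> vec.span {ambient L *v z}"
    using out z NF(3)[OF NF(2)] unfolding agreement_def by (simp add: image_span_line)
  have "\<forall>\<^sub>F u in nhds z. vec.span {F u} \<noteq> vec.span {ambient L *v u}"
    by (rule lifts_differ_nearby[OF F G nz z(1) NF(1,2) _ ne]) (simp_all add: NF(3))
  moreover have "\<forall>\<^sub>F u in nhds z. u \<in> N" using NF by (intro eventually_nhds_in_open)
  ultimately show ?thesis
  proof eventually_elim
    case (elim u)
    then show ?case using NF(3)[of u] unfolding agreement_def by (simp add: image_span_line)
  qed
qed

lemma closedin_agreement:
  assumes L: "invertible L" shows "closedin (subtopology proj_topology M) (agreement L)"
proof -
  have top: "topspace (subtopology proj_topology M) = M"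
    using openin_subset[OF open_M] by auto
  have "\<exists>T. openin (subtopology proj_topology M) T \<and> p \<in> T \<and> T \<subseteq> M - agreement L"
    if p: "p \<in> M - agreement L" for p
  proof -
    obtain z where z: "z \<noteq> 0" "p = vec.span {z}" using p by (auto elim: point_of_M)
    obtain N where N: "open N" "z \<in> N"
      "\<And>u. u \<in> N \<Longrightarrow> u \<noteq> 0 \<and> vec.span {u} \<in> M \<longrightarrow> vec.span {u} \<notin> agreement L"
      using lift_disagrees_nearby[OF z(1) _ L] p unfolding z(2) eventually_nhds by blast
    have "openin (subtopology proj_topology M) ({vec.span {u} | u. u \<in> N \<and> u \<noteq> 0} \<inter> M)"
      using openin_proj_image[OF N(1)] unfolding openin_subtopology by blast
    moreover have "p \<in> {vec.span {u} | u. u \<in> N \<and> u \<noteq> 0} \<inter> M" using z N(2) p by blast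
    moreover have "{vec.span {u} | u. u \<in> N \<and> u \<noteq> 0} \<inter> M \<subseteq> M - agreement L" using N(3) by auto
    ultimately show ?thesis by blast
  qed
  then have "openin (subtopology proj_topology M) (M - agreement L)" by (subst openin_subopen) blast
  then show ?thesis unfolding closedin_def top by (auto simp: agreement_def)
qed

text \<open>If \<open>f\<close> differed at \<open>p\<close> from each of the finitely many maps, it would differ from all of them on a neighbourhood,
  against \<open>dense_node_maps\<close>.\<close>

lemma agreement_cover:
  assumes F: "finite F" "F \<subseteq> node_maps lam lam'"
    "\<forall>L\<in>node_maps lam lam'. \<exists>L'\<in>F. \<exists>c. c \<noteq> 0 \<and> (\<forall>x. L *v x = c *s (L' *v x))"
    and p: "p \<in> M"
  shows "\<exists>L\<in>F. p \<in> agreement L"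
proof (rule ccontr)
  assume none: "\<not> (\<exists>L\<in>F. p \<in> agreement L)"
  obtain z where z: "z \<noteq> 0" "p = vec.span {z}" using p by (rule point_of_M)
  have "\<forall>\<^sub>F u in nhds z. \<forall>L\<in>F. u \<noteq> 0 \<and> vec.span {u} \<in> M \<longrightarrow> vec.span {u} \<notin> agreement L"
    unfolding eventually_ball_finite_distrib[OF F(1)]
    using lift_disagrees_nearby[OF z(1)] p none F(2) node_maps_invertible unfolding z(2) by blast
  then obtain N where N: "open N" "z \<in> N"
    "\<And>u L. u \<in> N \<Longrightarrow> L \<in> F \<Longrightarrow> u \<noteq> 0 \<Longrightarrow> vec.span {u} \<in> M \<Longrightarrow> vec.span {u} \<notin> agreement L"
    unfolding eventually_nhds by blast
  obtain u L where u: "u \<in> N" "u \<noteq> 0" "vec.span {u} \<in> M" "L \<in> node_maps lam lam'"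
    "f (vec.span {u}) = vec.span {ambient L *v u}"
    using dense_node_maps[OF z(1) _ N(1,2)] p unfolding z(2) by blast
  obtain L' c where L': "L' \<in> F" "c \<noteq> 0" "\<And>x. L *v x = c *s (L' *v x)" using bspec[OF F(3) u(4)] by blast
  have "f (vec.span {u}) = vec.span {ambient L' *v u}"
    unfolding u(5) ambient_scale[OF L'(3)] span_scale[OF L'(2)] ..
  then have "vec.span {u} \<in> agreement L'" using u(3) unfolding agreement_def by (simp add: image_span_line)
  then show False using N(3)[OF u(1) L'(1) u(2,3)] by blast
qed

lemma agreement_disjoint_or_equal:
  assumes L: "L \<in> node_maps lam lam'" and L': "L' \<in> node_maps lam lam'"
    and p: "p \<in> agreement L" "p \<in> agreement L'"
  shows "agreement L = agreement L'"
proof -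
  have pM: "p \<in> M" using p(1) by (simp add: agreement_def)
  obtain z where z: "z \<noteq> 0" "p = vec.span {z}" using pM by (rule point_of_M)
  have fp: "f p = vec.span {ambient L *v z}" "f p = vec.span {ambient L' *v z}"
    using p unfolding agreement_def z(2) by (simp_all add: image_span_line)
  have nz: "ambient L *v z \<noteq> 0" "ambient L' *v z \<noteq> 0"
    using invertible_eq_0[OF invertible_ambient[OF node_maps_invertible[OF L]], of z]
      invertible_eq_0[OF invertible_ambient[OF node_maps_invertible[OF L']], of z] z(1) by auto
  have "vec.span {ambient L' *v z} = vec.span {ambient L *v z}" using fp by simp
  then obtain c where c: "c \<noteq> 0" "ambient L' *v z = c *s (ambient L *v z)" using nz(2) by (rule span_eqD)
  have "B.coords (ambient L' *v z) = c *s B.coords (ambient L *v z)" unfolding c(2) by simp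
  then have eq: "L' *v A.coords z = c *s (L *v A.coords z)" unfolding coords_ambient .
  have reg: "vec.span {z} \<in> regular_points X \<phi>\<^sub>1 \<phi>\<^sub>2 e" using pM regular(1) z(2) by blast
  have reg': "vec.span {ambient L *v z} \<in> regular_points X' \<phi>\<^sub>1' \<phi>\<^sub>2' e'"
    using maps[OF pM] regular(2) fp(1) by auto
  have n23: "CARD('n) \<ge> 2" "CARD('n) \<ge> 3" using n by simp_all
  have "L' *v y = c *s (L *v y)" for y
  proof (rule A.regular_point_roots[OF reg z(1)], rule B.regular_point_roots[OF reg' nz(1)])
    fix t t' :: "'n \<Rightarrow> complex"
    assume dp: "diagonal_point lam (A.coords z) t" and dp': "diagonal_point lam' (B.coords (ambient L *v z)) t'"
    show ?thesis
      by (rule node_maps_rigid[OF A.card_ambient n23(2) A.inj_lam B.inj_lam L L' dp dp'[unfolded coords_ambient]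
            A.regular_point_rigid[OF reg dp n23(1)] eq c(1)])
  qed
  then have same: "vec.span {ambient L' *v u} = vec.span {ambient L *v u}" for u
    using ambient_scale[of L' c L u] span_scale[OF c(1)] by simp
  have "(*v) (ambient L') ` q = (*v) (ambient L) ` q" if q: "q \<in> M" for q
  proof -
    obtain u where "u \<noteq> 0" "q = vec.span {u}" using q by (rule point_of_M)
    then show ?thesis by (simp add: image_span_line same)
  qed
  then show ?thesis unfolding agreement_def by auto
qed

text \<open>The nonempty sets \<open>agreement L\<close> form a finite partition of \<open>M\<close> into closed sets, so each of them is also
  open.\<close>

theorem projective_automorphism:
  assumes conn: "connectedin proj_topology M"
  shows "\<exists>T :: complex ^ ('n + 3) ^ ('n + 3). invertible T \<and> (\<forall>p\<in>M. f p = (*v) T ` p)"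
proof (cases "M = {}")
  case True
  then show ?thesis using invertible_mat_1 by blast
next
  case False
  then obtain p where p: "p \<in> M" by blast
  let ?T = "subtopology proj_topology M"
  have top: "topspace ?T = M" using openin_subset[OF open_M] by auto
  have "CARD('n + 3) \<ge> 3" by simp
  then show ?thesis
  proof (rule node_maps_finite[OF A.inj_lam, of lam'])
    fix F
    assume F: "finite F" "F \<subseteq> node_maps lam lam'"
      "\<And>L. L \<in> node_maps lam lam' \<Longrightarrow> \<exists>L'\<in>F. \<exists>c. c \<noteq> 0 \<and> (\<forall>x. L *v x = c *s (L' *v x))"
    have "\<forall>L\<in>node_maps lam lam'. \<exists>L'\<in>F. \<exists>c. c \<noteq> 0 \<and> (\<forall>x. L *v x = c *s (L' *v x))" using F(3) by blast
    note cover = agreement_cover[OF F(1,2) this]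
    obtain L where L: "L \<in> F" "p \<in> agreement L" using cover[OF p] by blast
    have inv: "invertible L'" if "L' \<in> F" for L' using that F(2) node_maps_invertible by blast
    let ?R = "agreement ` {L' \<in> F. agreement L' \<inter> agreement L = {}}"
    have "M - agreement L = \<Union>?R"
    proof
      show "M - agreement L \<subseteq> \<Union>?R"
      proof
        fix q assume q: "q \<in> M - agreement L"
        then obtain L' where L': "L' \<in> F" "q \<in> agreement L'" using cover by blast
        have "agreement L' \<inter> agreement L = {}"
        proof (rule ccontr)
          assume "agreement L' \<inter> agreement L \<noteq> {}"
          then obtain r where "r \<in> agreement L'" "r \<in> agreement L" by blast
          then have "agreement L' = agreement L" using agreement_disjoint_or_equal L(1) L'(1) F(2) by blast
          then show False using q L'(2) by blast
        qed
        then show "q \<in> \<Union>?R" using L' by blast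
      qed
      show "\<Union>?R \<subseteq> M - agreement L" by (auto simp: agreement_def)
    qed
    moreover have "closedin ?T (\<Union>?R)"
      by (rule closedin_Union) (use F(1) closedin_agreement inv in auto)
    ultimately have "closedin ?T (M - agreement L)" by simp
    then have "openin ?T (agreement L)"
      unfolding closedin_def top by (simp add: Diff_Diff_Int Int_absorb1 agreement_def)
    moreover have "closedin ?T (agreement L)" using closedin_agreement[OF inv[OF L(1)]] .
    ultimately have "agreement L = {} \<or> agreement L = topspace ?T"
      using conn unfolding connectedin_def connected_space_clopen_in by blast
    then have "agreement L = M" using L(2) top by auto
    then have "f q = (*v) (ambient L) ` q" if "q \<in> M" for q using that unfolding agreement_def by blast
    then show ?thesis using invertible_ambient[OF inv[OF L(1)]] by blast
  qed
qed

end

theorem theorem1p4: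
  fixes X X' M M' :: "(complex ^ ('n::finite + 3)) set set"
    and \<phi>\<^sub>1 \<phi>\<^sub>2 \<phi>\<^sub>1' \<phi>\<^sub>2' :: "complex ^ ('n + 3) \<Rightarrow> complex"
    and lam lam' :: "'n + 3 \<Rightarrow> complex"
    and e e' :: "'n + 3 \<Rightarrow> complex ^ ('n + 3)"
    and f :: "(complex ^ ('n + 3)) set \<Rightarrow> (complex ^ ('n + 3)) set"
  assumes "CARD('n) > 4"
    and "nonsingular_two_quadrics X" and "nonsingular_two_quadrics X'"
    and "diagonalization X \<phi>\<^sub>1 \<phi>\<^sub>2 lam e" and "diagonalization X' \<phi>\<^sub>1' \<phi>\<^sub>2' lam' e'"
    and "M \<subseteq> regular_points X \<phi>\<^sub>1 \<phi>\<^sub>2 e" and "M' \<subseteq> regular_points X' \<phi>\<^sub>1' \<phi>\<^sub>2' e'"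
    and "openin (subtopology proj_topology X) M" and "openin (subtopology proj_topology X') M'"
    and "connectedin proj_topology M" and "connectedin proj_topology M'"
    and "biholomorphic f M M'"
    and "\<forall>p\<in>M. refined_moduli_map X p = refined_moduli_map X' (f p)"
  shows "\<exists>A :: complex ^ ('n + 3) ^ ('n + 3). invertible A \<and> (\<forall>p\<in>M. f p = (*v) A ` p)"
proof -
  interpret matched_moduli_maps X X' \<phi>\<^sub>1 \<phi>\<^sub>2 \<phi>\<^sub>1' \<phi>\<^sub>2' lam lam' e e' M M' f
  proof
    show "f p \<in> M'" if "p \<in> M" for p
      using that assms(12) unfolding biholomorphic_def bij_betw_def by blast
    show "proj_holomorphic_on f M" using assms(12) unfolding biholomorphic_def by blast
    show "refined_moduli_map X p = refined_moduli_map X' (f p)" if "p \<in> M" for p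
      using that assms(13) by blast
  qed (use assms in blast)+
  show ?thesis by (rule projective_automorphism[OF assms(10)])
qed

end
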